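(* Assume that $F$ is constant (the DC case). Then every $(\varphi,T)$-ergodic Borel probability measure on $\mathcal{X}$ is supported either on a set of equilibria, or on a single totally ordered periodic orbit.
   Context: Setting. $V:\mathbb{R}^2\to\mathbb{R}$ is $C^2$, satisfies $V(u+1,v+1)=V(u,v)$ and the twist condition $V_{12}(u,v)\le-\delta<0$ for some fixed $\delta$ (subscripts denote partial derivatives); $F\in\mathbb{R}$ is a constant. The system is $$\frac{d}{dt}u_j(t)=-V_2(u_{j-1}(t),u_j(t))-V_1(u_j(t),u_{j+1}(t))+F,\qquad j\in\mathbb{Z}.$$ State space. $K_n=\{u\in\mathbb{R}^{\mathbb{Z}}:\sup_i|u_{i+1}-u_i|\le n\}$, $X=\bigcup_{n\ge1}K_n$, with the induced product topology. $\mathcal{X}=X/R$ and $\mathcal{K}_n=K_n/R$ are the quotients obtained by identifying $u$ with $Ru=u+1$. $T$ is the shift $(Tu)_i=u_{i-1}$. For $u\in X$, $\varphi^t(u)=u(t)$ denotes the solution with $u(0)=u$; it exists for all $t\ge0$, leaves each $\mathcal{K}_n$ forward invariant, is continuous on $\mathcal{K}_n$, and commutes with $R$ and $T$. Invariance and ergodicity. A Borel probability measure is $(\varphi,T)$-invariant if it is invariant under $T$ and under all $\varphi^t$, $t\ge0$. A set $A$ is $(\varphi,T)$-invariant if $T(A)=A$ and $\varphi^t(A)\subseteq A$ for all $t\ge0$. A $(\varphi,T)$-invariant probability measure $\mu$ is $(\varphi,T)$-ergodic if $\mu(A)\in\{0,1\}$ for every Borel $(\varphi,T)$-invariant set $A$.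 Equilibria are configurations with $du/dt=0$. Periodic orbits are periodic orbits of $\varphi$ in the quotient $\mathcal{X}$ (so $u(t_0)=u(0)+m$ for some $t_0>0$ and $m\in\mathbb{Z}$). With the partial order $w\ge v$ iff $w_j\ge v_j$ for all $j$ on $\mathbb{R}^{\mathbb{Z}}$, the orbit of $u$ is totally ordered if the set $\Upsilon(u)=\{\varphi^tT^ku: t\in\mathbb{R},k\in\mathbb{Z}\}\subset\mathbb{R}^{\mathbb{Z}}$ is totally ordered, i.e. for all $v,w\in\Upsilon(u)$ either $v\ge w$ or $v\le w$. *)

theory Defs
  imports "HOL-Probability.Probability"
begin

definition D1 :: "(real \<Rightarrow> real \<Rightarrow> real) \<Rightarrow> real \<Rightarrow> real \<Rightarrow> real" where
  "D1 f u v = deriv (\<lambda>x. f x v) u"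

definition D2 :: "(real \<Rightarrow> real \<Rightarrow> real) \<Rightarrow> real \<Rightarrow> real \<Rightarrow> real" where
  "D2 f u v = deriv (\<lambda>y. f u y) v"

definition C1_plane :: "(real \<Rightarrow> real \<Rightarrow> real) \<Rightarrow> bool" where
  "C1_plane f \<longleftrightarrow>
     (\<forall>u v. (\<lambda>x. f x v) differentiable (at u) \<and> (\<lambda>y. f u y) differentiable (at v)) \<and>
     continuous_on UNIV (\<lambda>(u, v). D1 f u v) \<and> continuous_on UNIV (\<lambda>(u, v). D2 f u v)"

definition C2_plane :: "(real \<Rightarrow> real \<Rightarrow> real) \<Rightarrow> bool" where
  "C2_plane f \<longleftrightarrow> C1_plane f \<and> C1_plane (D1 f) \<and> C1_plane (D2 f)"

type_synonym config = "int \<Rightarrow> real"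

definition K :: "nat \<Rightarrow> config set" where
  "K n = {u. \<forall>i. \<bar>u (i + 1) - u i\<bar> \<le> real n}"

definition X :: "config set" where
  "X = (\<Union>n\<in>{1..}. K n)"

definition translate :: "int \<Rightarrow> config \<Rightarrow> config" where
  "translate m u = (\<lambda>i. u i + of_int m)"

definition Tshift :: "config \<Rightarrow> config" where
  "Tshift u = (\<lambda>i. u (i - 1))"

definition Tshift_power :: "int \<Rightarrow> config \<Rightarrow> config" where
  "Tshift_power k u = (\<lambda>i. u (i - k))"

lemma Tshift_power_of_nat: "Tshift_power (int k) u = (Tshift ^^ k) u"
proof (induction k)
  case 0
  show ?case by (simp add: Tshift_power_def)
next
  case (Suc k)
  have "(Tshift ^^ Suc k) u = Tshift (Tshift_power (int k) u)"
    using Suc.IH by simp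
  also have "\<dots> = Tshift_power (int (Suc k)) u"
    by (rule ext) (simp add: Tshift_power_def Tshift_def algebra_simps)
  finally show ?case by simp
qed

lemma Tshift_power_inverse: "Tshift_power k (Tshift_power (- k) u) = u"
  by (simp add: Tshift_power_def)

definition vfield :: "(real \<Rightarrow> real \<Rightarrow> real) \<Rightarrow> real \<Rightarrow> config \<Rightarrow> config" where
  "vfield V F u = (\<lambda>j. - D2 V (u (j - 1)) (u j) - D1 V (u j) (u (j + 1)) + F)"

text \<open>
  A solution is required to have spacings bounded uniformly in time (it stays in some
  \<open>K n\<close>, as solutions starting in \<open>K n\<close> do). On \<open>K n\<close> the field is Lipschitz in
  the supremum distance, so this is the class in which solutions of the infinite system are
  determined by their initial value.
\<close>

definition solution :: "(real \<Rightarrow> real \<Rightarrow> real) \<Rightarrow> real \<Rightarrow> (real \<Rightarrow> config) \<Rightarrow> bool" where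
  "solution V F x \<longleftrightarrow>
     (\<exists>n. \<forall>t\<ge>0. x t \<in> K n) \<and>
     (\<forall>t\<ge>0. \<forall>j. ((\<lambda>s. x s j) has_real_derivative vfield V F (x t) j) (at t within {0..}))"

definition flow :: "(real \<Rightarrow> real \<Rightarrow> real) \<Rightarrow> real \<Rightarrow> real \<Rightarrow> config \<Rightarrow> config" where
  "flow V F t u = (THE w. \<exists>x. solution V F x \<and> x 0 = u \<and> x t = w)"

definition Rrel :: "config rel" where
  "Rrel = {(u, v). u \<in> X \<and> v \<in> X \<and> (\<exists>m. v = translate m u)}"

definition QX :: "config set set" where
  "QX = X // Rrel"

definition cls :: "config \<Rightarrow> config set" where
  "cls u = Rrel `` {u}"

text \<open>\<open>config\<close> carries the product topology of the function type; \<open>X\<close> has the subspace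
  topology, and \<open>QX\<close> the quotient topology.\<close>

definition QX_topology :: "config set topology" where
  "QX_topology = topology (\<lambda>U. U \<subseteq> QX \<and> openin (top_of_set X) {u \<in> X. cls u \<in> U})"

definition QX_borel :: "config set measure" where
  "QX_borel = sigma QX {U. openin QX_topology U}"

lemma translate_in_X: "u \<in> X \<Longrightarrow> translate m u \<in> X"
  by (auto simp: X_def K_def translate_def)

lemma equiv_Rrel: "equiv X Rrel"
proof (rule equivI)
  show "Rrel \<subseteq> X \<times> X" by (auto simp: Rrel_def)
  show "refl_on X Rrel"
    by (auto simp: refl_on_def Rrel_def translate_def intro!: exI[of _ 0])
  show "sym Rrel"
  proof (rule symI)
    fix u v assume "(u, v) \<in> Rrel"
    then obtain m where "u \<in> X" "v \<in> X" "v = translate m u" by (auto simp: Rrel_def)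
    then have "u = translate (- m) v" by (auto simp: translate_def)
    then show "(v, u) \<in> Rrel" using \<open>u \<in> X\<close> \<open>v \<in> X\<close> by (auto simp: Rrel_def)
  qed
  show "trans Rrel"
  proof (rule transI)
    fix u v w assume "(u, v) \<in> Rrel" "(v, w) \<in> Rrel"
    then obtain m k where *: "u \<in> X" "w \<in> X" "v = translate m u" "w = translate k v"
      by (auto simp: Rrel_def)
    then have "w = translate (m + k) u" by (auto simp: translate_def)
    then show "(u, w) \<in> Rrel" using * by (auto simp: Rrel_def)
  qed
qed

lemma cls_in_QX: "u \<in> X \<Longrightarrow> cls u \<in> QX"
  by (simp add: QX_def cls_def quotientI)

lemma cls_eq: "u \<in> X \<Longrightarrow> cls u = range (\<lambda>m. translate m u)"
  by (auto simp: cls_def Rrel_def translate_in_X)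

lemma openin_QX_topology:
  "openin QX_topology U \<longleftrightarrow> U \<subseteq> QX \<and> openin (top_of_set X) {u \<in> X. cls u \<in> U}"
proof -
  have "istopology (\<lambda>U. U \<subseteq> QX \<and> openin (top_of_set X) {u \<in> X. cls u \<in> U})"
    unfolding istopology_def
  proof (intro conjI allI impI)
    fix S T
    assume S: "S \<subseteq> QX \<and> openin (top_of_set X) {u \<in> X. cls u \<in> S}"
      and T: "T \<subseteq> QX \<and> openin (top_of_set X) {u \<in> X. cls u \<in> T}"
    have eq: "{u \<in> X. cls u \<in> S \<inter> T} = {u \<in> X. cls u \<in> S} \<inter> {u \<in> X. cls u \<in> T}" by auto
    show "openin (top_of_set X) {u \<in> X. cls u \<in> S \<inter> T}"
      unfolding eq using S T by (intro openin_Int) simp_all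
    show "S \<inter> T \<subseteq> QX" using S by auto
  next
    fix \<K> assume H: "\<forall>U\<in>\<K>. U \<subseteq> QX \<and> openin (top_of_set X) {u \<in> X. cls u \<in> U}"
    have eq: "{u \<in> X. cls u \<in> \<Union>\<K>} = (\<Union>U\<in>\<K>. {u \<in> X. cls u \<in> U})" by auto
    show "openin (top_of_set X) {u \<in> X. cls u \<in> \<Union>\<K>}"
      unfolding eq using H by (intro openin_Union) auto
    show "\<Union>\<K> \<subseteq> QX" using H by auto
  qed
  then show ?thesis by (simp add: QX_topology_def topology_inverse')
qed

lemma topspace_QX_topology: "topspace QX_topology = QX"
proof
  show "topspace QX_topology \<subseteq> QX"
    using openin_topspace[of QX_topology] unfolding openin_QX_topology by (rule conjunct1)
  have eq: "{u \<in> X. cls u \<in> QX} = X" by (auto simp: cls_in_QX)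
  have "openin (top_of_set X) X" by (rule openin_subtopology_self)
  then have "openin QX_topology QX"
    unfolding openin_QX_topology eq by (simp only: order_refl)
  then show "QX \<subseteq> topspace QX_topology" by (rule openin_subset)
qed

lemma quotient_map_cls: "quotient_map (top_of_set X) QX_topology cls"
  unfolding quotient_map_def topspace_QX_topology
proof (intro conjI allI impI)
  show "cls ` topspace (top_of_set X) = QX"
    by (auto simp: QX_def cls_def quotient_def)
next
  fix U :: "config set set"
  assume "U \<subseteq> QX"
  then show "openin (top_of_set X) {x \<in> topspace (top_of_set X). cls x \<in> U} =
      openin QX_topology U"
    by (simp only: openin_QX_topology topspace_euclidean_subtopology simp_thms)
qed

text \<open>
  A map \<open>g\<close> of configurations that commutes with integer translations descends to the
  quotient as the image map \<open>(`) g\<close>: it sends the class of \<open>u\<close> to the class of \<open>g u\<close>.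
\<close>

definition invariant_set ::
  "(real \<Rightarrow> real \<Rightarrow> real) \<Rightarrow> real \<Rightarrow> config set set \<Rightarrow> bool" where
  "invariant_set V F A \<longleftrightarrow>
     (`) Tshift ` A = A \<and> (\<forall>t\<ge>0. (`) (flow V F t) ` A \<subseteq> A)"

definition preserves :: "'a measure \<Rightarrow> ('a \<Rightarrow> 'a) \<Rightarrow> bool" where
  "preserves \<mu> g \<longleftrightarrow> g \<in> measurable \<mu> \<mu> \<and> distr \<mu> \<mu> g = \<mu>"

definition invariant_measure ::
  "(real \<Rightarrow> real \<Rightarrow> real) \<Rightarrow> real \<Rightarrow> config set measure \<Rightarrow> bool" where
  "invariant_measure V F \<mu> \<longleftrightarrow>
     prob_space \<mu> \<and> sets \<mu> = sets QX_borel \<and>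
     preserves \<mu> ((`) Tshift) \<and> (\<forall>t\<ge>0. preserves \<mu> ((`) (flow V F t)))"

definition ergodic_measure ::
  "(real \<Rightarrow> real \<Rightarrow> real) \<Rightarrow> real \<Rightarrow> config set measure \<Rightarrow> bool" where
  "ergodic_measure V F \<mu> \<longleftrightarrow>
     invariant_measure V F \<mu> \<and>
     (\<forall>A\<in>sets \<mu>. invariant_set V F A \<longrightarrow> measure \<mu> A = 0 \<or> measure \<mu> A = 1)"

definition supported_on :: "'a measure \<Rightarrow> 'a set \<Rightarrow> bool" where
  "supported_on \<mu> S \<longleftrightarrow> S \<in> sets \<mu> \<and> measure \<mu> S = 1"

definition equilibria :: "(real \<Rightarrow> real \<Rightarrow> real) \<Rightarrow> real \<Rightarrow> config set" where
  "equilibria V F = {u \<in> X. \<forall>j. vfield V F u j = 0}"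

definition periodic :: "(real \<Rightarrow> real \<Rightarrow> real) \<Rightarrow> real \<Rightarrow> config \<Rightarrow> bool" where
  "periodic V F u \<longleftrightarrow> u \<in> X \<and> (\<exists>t0>0. \<exists>m. flow V F t0 u = translate m u)"

text \<open>For periodic \<open>u\<close> the forward orbit is the whole orbit in the quotient.\<close>

definition orbit :: "(real \<Rightarrow> real \<Rightarrow> real) \<Rightarrow> real \<Rightarrow> config \<Rightarrow> config set set" where
  "orbit V F u = {cls (flow V F t u) | t. t \<ge> 0}"

text \<open>
  The points \<open>\<phi>\<^sup>t T\<^sup>k u\<close> with \<open>t\<close> real and \<open>k\<close> an integer. For \<open>t \<ge> 0\<close> this is the
  flow; the value at time \<open>- t\<close> is the configuration that the flow takes to \<open>T\<^sup>k u\<close> in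
  time \<open>t\<close>, whenever it exists (as it does for periodic \<open>u\<close>).
\<close>

definition Upsilon :: "(real \<Rightarrow> real \<Rightarrow> real) \<Rightarrow> real \<Rightarrow> config \<Rightarrow> config set" where
  "Upsilon V F u =
     {w \<in> X. \<exists>k. \<exists>t\<ge>0. w = flow V F t (Tshift_power k u) \<or> flow V F t w = Tshift_power k u}"

definition totally_ordered :: "config set \<Rightarrow> bool" where
  "totally_ordered S \<longleftrightarrow> (\<forall>v\<in>S. \<forall>w\<in>S. v \<ge> w \<or> v \<le> w)"

end

theory Submission
  imports Defs
begin

text \<open>The shifts \<open>T\<^sup>k\<close>, the translations by integers \<open>m\<close> and the semiflow commute, so the crossings of
  \<open>u\<close> with \<open>\<phi>\<^sup>s T\<^sup>k u + m\<close> may be followed in time. The twist condition makes the difference of two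
  solutions obey a cooperative tridiagonal linear system; its number of sign changes does not increase
  in time, and drops strictly at a degenerate zero. For an invariant measure the density of crossings is
  constant in time, so almost surely no crossing is ever degenerate. Then crossings can neither be
  created nor destroyed when \<open>s\<close> grows, as long as \<open>u\<close> and \<open>\<phi>\<^sup>s T\<^sup>k u + m\<close> do not coincide.

  The energy balance reads \<open>E (f\<^sub>0\<^sup>2) = F E f\<^sub>0\<close> for the velocity \<open>f\<^sub>0\<close> of the site \<open>0\<close>. If the drift
  \<open>E f\<^sub>0\<close> vanishes, almost every configuration is an equilibrium. Otherwise, by a pointwise ergodic
  argument, \<open>\<phi>\<^sup>t u\<close> escapes to infinity, so that the density of crossings with \<open>\<phi>\<^sup>s T\<^sup>k u + m\<close> tends to
  \<open>0\<close> as \<open>s\<close> grows and is therefore \<open>0\<close>. Hence \<open>u\<close> is comparable with all these configurations. By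
  the drift, \<open>\<phi>\<^sup>t u\<close> and \<open>u + 1\<close> or \<open>u - 1\<close> agree at the site \<open>0\<close> for some \<open>t > 0\<close>; being comparable,
  they coincide by strong monotonicity. So the orbit is periodic, and by ergodicity it carries the measure.\<close>

section \<open>The vector field\<close>

text \<open>Two configurations of an infinite chain may cross infinitely often, so no integer count
  is a Lyapunov function. The mean number per site replaces it, and a loss inside a long window must
  be told apart from crossings that pass through its two ends. That exchange is bounded
  independently of the length of the window and disappears after division by the length.

  The second obstacle is that almost sure statements come for one parameter \<open>s\<close> at a
  time, while growing \<open>s\<close> needs all parameters at once. Rational times and parameters
  are treated by countability, the others by stability: a drop of the count at one parameter
  persists at nearby rational ones.

  The continuation in \<open>s\<close> is broken only by a coincidence of \<open>u\<close> with a
  moved configuration. For the pure time flow this would make the displacement bounded, which escape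
  forbids; for general \<open>k\<close> and \<open>m\<close> it already forces the comparability
  that is to be proved.

  Strict inequalities appear only after a positive time. Differences are therefore often inspected
  at time 1, and the periodic orbit found is that of the configuration at time 1.\<close>

lemma C1_plane_has_derivative:
  assumes "C1_plane f"
  shows "((\<lambda>(x, y). f x y) has_derivative (\<lambda>(h, k). D1 f x y * h + D2 f x y * k)) (at (x, y))"
proof -
  have d: "(\<lambda>x. f x y) differentiable (at x)" "(\<lambda>y. f x y) differentiable (at y)" for x y
    using assms by (auto simp: C1_plane_def)
  have 1: "((\<lambda>x. f x y) has_derivative (\<lambda>h. D1 f x y * h)) (at x within UNIV)"
    using d(1)[of y x] by (simp add: D1_def real_differentiable_def has_field_derivative_def)
      (metis DERIV_imp_deriv has_field_derivative_def)
  have 2: "((\<lambda>y. f x y) has_derivative blinfun_apply (D2 f x y *\<^sub>R id_blinfun)) (at y within UNIV)" for x y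
    using d(2)[of x y] by (simp add: D2_def real_differentiable_def has_field_derivative_def scaleR_blinfun.rep_eq)
      (metis DERIV_imp_deriv has_field_derivative_def)
  have c: "continuous_on UNIV (\<lambda>(x, y). D2 f x y)"
    using assms by (auto simp: C1_plane_def)
  have 3: "continuous (at (x, y) within UNIV \<times> UNIV) (\<lambda>(x, y). D2 f x y *\<^sub>R (id_blinfun :: real \<Rightarrow>\<^sub>L real))"
    using continuous_on_scaleR[OF c continuous_on_const[of _ "id_blinfun :: real \<Rightarrow>\<^sub>L real"]]
    by (simp add: continuous_on_eq_continuous_within case_prod_unfold)
  from has_derivative_partialsI[OF 1 2 3] show ?thesis
    by (simp add: scaleR_blinfun.rep_eq)
qed

lemma C1_plane_continuous:
  assumes "C1_plane f"
  shows "continuous_on UNIV (\<lambda>(x, y). f x y)"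
  using C1_plane_has_derivative[OF assms]
  by (auto simp: continuous_on_eq_continuous_at intro!: has_derivative_continuous)

lemma C1_plane_partials:
  assumes "C1_plane f"
  shows "((\<lambda>x. f x y) has_real_derivative D1 f x y) (at x)"
    "((\<lambda>y. f x y) has_real_derivative D2 f x y) (at y)"
  using assms by (auto simp: C1_plane_def D1_def D2_def real_differentiable_def dest: DERIV_imp_deriv)

text \<open>Restriction to the segment from \<open>(x', y')\<close> to \<open>(x, y)\<close> reduces
  this to the mean value theorem in one variable, with one intermediate point for both partial
  derivatives. Applied to \<open>D1 V\<close> and \<open>D2 V\<close> it produces the coefficients
  of the linear system for the difference of two solutions.\<close>

lemma C1_plane_mvt:
  assumes "C1_plane f"
  obtains \<theta> where "0 < \<theta>" "\<theta> < 1"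
    "f x y - f x' y' = D1 f (x' + \<theta> * (x - x')) (y' + \<theta> * (y - y')) * (x - x')
       + D2 f (x' + \<theta> * (x - x')) (y' + \<theta> * (y - y')) * (y - y')"
proof -
  define g where "g \<theta> = f (x' + \<theta> * (x - x')) (y' + \<theta> * (y - y'))" for \<theta>
  define g' where "g' \<theta> = D1 f (x' + \<theta> * (x - x')) (y' + \<theta> * (y - y')) * (x - x')
       + D2 f (x' + \<theta> * (x - x')) (y' + \<theta> * (y - y')) * (y - y')" for \<theta>
  have "(g has_real_derivative g' \<theta>) (at \<theta>)" for \<theta>
  proof -
    have "((\<lambda>\<theta>. (\<lambda>(x, y). f x y) (x' + \<theta> * (x - x'), y' + \<theta> * (y - y'))) has_derivative
       (\<lambda>h. (\<lambda>(h, k). D1 f (x' + \<theta> * (x - x')) (y' + \<theta> * (y - y')) * h + D2 f (x' + \<theta> * (x - x')) (y' + \<theta> * (y - y')) * k)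
          (h * (x - x'), h * (y - y')))) (at \<theta>)"
      by (rule has_derivative_compose[where g = "\<lambda>(x, y). f x y" and f = "\<lambda>\<theta>. (x' + \<theta> * (x - x'), y' + \<theta> * (y - y'))", OF _ C1_plane_has_derivative[OF assms]])
        (auto intro!: derivative_eq_intros)
    then show ?thesis
      unfolding has_field_derivative_def g_def[abs_def] g'_def prod.case
      by (rule has_derivative_eq_rhs) (auto simp: algebra_simps)
  qed
  then obtain \<theta> where "0 < \<theta>" "\<theta> < 1" "g 1 - g 0 = (1 - 0) * g' \<theta>"
    using MVT2[of 0 1 g g'] by auto
  then show ?thesis using that[of \<theta>] by (simp add: g_def g'_def)
qed

text \<open>The mean value theorem is applied in \<open>x\<close> to the difference of
  \<open>f\<close> along the two edges parallel to the first axis, and then in \<open>y\<close> to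
  \<open>D1 f\<close>. The left side of the identity is symmetric in the two variables, so the
  swapped function yields the other mixed derivative.\<close>

lemma mixed_difference:
  fixes f :: "real \<Rightarrow> real \<Rightarrow> real"
  assumes "h > 0" "C1_plane f" "C1_plane (D1 f)"
  obtains x y where "a < x" "x < a + h" "b < y" "y < b + h"
    "f (a + h) (b + h) - f (a + h) b - f a (b + h) + f a b = h * h * D2 (D1 f) x y"
proof -
  have "((\<lambda>x. f x (b + h) - f x b) has_real_derivative (D1 f x (b + h) - D1 f x b)) (at x)" for x
    by (intro derivative_intros C1_plane_partials assms)
  then obtain x where x: "a < x" "x < a + h"
    "(f (a + h) (b + h) - f (a + h) b) - (f a (b + h) - f a b) = (a + h - a) * (D1 f x (b + h) - D1 f x b)"
    using MVT2[of a "a + h" "\<lambda>x. f x (b + h) - f x b" "\<lambda>x. D1 f x (b + h) - D1 f x b"] assms(1) by auto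
  obtain y where y: "b < y" "y < b + h" "D1 f x (b + h) - D1 f x b = (b + h - b) * D2 (D1 f) x y"
    using MVT2[of b "b + h" "D1 f x" "D2 (D1 f) x"] C1_plane_partials(2)[OF assms(3)] assms(1) by auto
  show ?thesis using that[OF x(1,2) y(1,2)] x(3) y(3) by simp
qed

lemma D1_swap: "D1 (\<lambda>x y. f y x) u v = D2 f v u" and D2_swap: "D2 (\<lambda>x y. f y x) u v = D1 f v u"
  by (simp_all add: D1_def D2_def)

lemma C1_plane_swap: "C1_plane f \<Longrightarrow> C1_plane (\<lambda>x y. f y x)"
proof -
  assume f: "C1_plane f"
  have sw: "continuous_on UNIV (\<lambda>(u, v). g v u)" if "continuous_on UNIV (\<lambda>(u, v). g u v :: real)"
    for g :: "real \<Rightarrow> real \<Rightarrow> real"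
    using continuous_on_compose2[OF that continuous_on_swap, of UNIV] by (simp add: case_prod_unfold)
  show ?thesis
    using f sw[of "D1 f"] sw[of "D2 f"] by (auto simp: C1_plane_def D1_swap[of f] D2_swap[of f])
qed

text \<open>The second difference over a square of side \<open>h\<close> at \<open>(a, b)\<close>
  equals \<open>h * h\<close> times either mixed derivative at some point of the square, and both
  are continuous. The equality matters because the left neighbour enters the field through
  \<open>D1 (D2 V)\<close>, while the twist condition speaks of \<open>D2 (D1 V)\<close>.\<close>

lemma mixed_partials_commute:
  assumes "C2_plane f"
  shows "D1 (D2 f) a b = D2 (D1 f) a b"
proof -
  have C: "C1_plane f" "C1_plane (D1 f)" "C1_plane (D2 f)"
    using assms by (auto simp: C2_plane_def)
  have "C1_plane (D1 (\<lambda>x y. f y x))"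
    using C1_plane_swap[OF C(3)] by (simp add: D1_swap[of f, abs_def])
  note 2 = mixed_difference[OF _ C1_plane_swap[OF C(1)] this]
  note 1 = mixed_difference[OF _ C(1,2)]
  have c1: "continuous (at (a, b)) (\<lambda>(u, v). D2 (D1 f) u v)" "continuous (at (a, b)) (\<lambda>(u, v). D1 (D2 f) u v)"
    using C by (auto simp: C1_plane_def continuous_on_eq_continuous_at)
  show ?thesis
  proof (rule ccontr)
    assume ne: "D1 (D2 f) a b \<noteq> D2 (D1 f) a b"
    define e where "e = \<bar>D1 (D2 f) a b - D2 (D1 f) a b\<bar> / 2"
    have e: "e > 0" using ne by (simp add: e_def)
    obtain d1 where d1: "d1 > 0" "\<And>z. dist z (a, b) < d1 \<Longrightarrow> dist ((\<lambda>(u, v). D2 (D1 f) u v) z) (D2 (D1 f) a b) < e"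
      using c1(1) e unfolding continuous_at_eps_delta by force
    obtain d2 where d2: "d2 > 0" "\<And>z. dist z (a, b) < d2 \<Longrightarrow> dist ((\<lambda>(u, v). D1 (D2 f) u v) z) (D1 (D2 f) a b) < e"
      using c1(2) e unfolding continuous_at_eps_delta by force
    \<comment> \<open>Half of the radius, because the distance in the plane is estimated by the sum
      of the two coordinate distances.\<close>
    define h where "h = min d1 d2 / 2"
    have h: "h > 0" using d1 d2 by (simp add: h_def)
    have near: "dist (x, y) (a, b) < min d1 d2" if "a < x" "x < a + h" "b < y" "y < b + h" for x y
    proof -
      have "dist (x, y) (a, b) \<le> dist x a + dist y b"
        unfolding dist_prod_def by (simp add: sqrt_sum_squares_le_sum)
      also have "\<dots> < h + h" using that by (intro add_strict_mono) (auto simp: dist_real_def)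
      finally show ?thesis by (simp add: h_def)
    qed
    obtain x y where xy: "a < x" "x < a + h" "b < y" "y < b + h"
      "f (a + h) (b + h) - f (a + h) b - f a (b + h) + f a b = h * h * D2 (D1 f) x y"
      using 1[OF h, of a b] by metis
    obtain y' x' where xy': "b < y'" "y' < b + h" "a < x'" "x' < a + h"
      "f (a + h) (b + h) - f a (b + h) - f (a + h) b + f a b = h * h * D2 (D1 (\<lambda>x y. f y x)) y' x'"
      using 2[OF h, of b a] by metis
    have "h * h * D2 (D1 f) x y = h * h * D1 (D2 f) x' y'"
      using xy(5) xy'(5) unfolding D1_swap[of f, abs_def] D2_swap[of "D2 f"] by linarith
    then have "D2 (D1 f) x y = D1 (D2 f) x' y'" using h by simp
    moreover have "dist (D2 (D1 f) x y) (D2 (D1 f) a b) < e"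
      using d1(2)[of "(x, y)"] near[OF xy(1-4)] by simp
    moreover have "dist (D1 (D2 f) x' y') (D1 (D2 f) a b) < e"
      using d2(2)[of "(x', y')"] near[OF xy'(3,4,1,2)] by simp
    ultimately show False unfolding e_def dist_real_def by argo
  qed
qed

lemma D1_shift:
  assumes "\<And>u v. f (u + 1) (v + 1) = f u v"
  shows "D1 f (u + 1) (v + 1) = D1 f u v"
proof -
  have "((\<lambda>x. f x (v + 1)) has_real_derivative y) (at (u + 1)) \<longleftrightarrow> ((\<lambda>x. f x v) has_real_derivative y) (at u)" for y
    unfolding DERIV_shift[of "\<lambda>x. f x (v + 1)"] assms ..
  then show ?thesis unfolding D1_def deriv_def by presburger
qed

lemma D2_shift:
  assumes "\<And>u v. f (u + 1) (v + 1) = f u v"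
  shows "D2 f (u + 1) (v + 1) = D2 f u v"
proof -
  have "((\<lambda>y. f (u + 1) y) has_real_derivative z) (at (v + 1)) \<longleftrightarrow> ((\<lambda>y. f u y) has_real_derivative z) (at v)" for z
    unfolding DERIV_shift[of "\<lambda>y. f (u + 1) y"] assms ..
  then show ?thesis unfolding D2_def deriv_def by presburger
qed

lemma shift_of_int:
  fixes f :: "real \<Rightarrow> real \<Rightarrow> 'b"
  assumes "\<And>u v. f (u + 1) (v + 1) = f u v"
  shows "f (u + of_int m) (v + of_int m) = f u v"
proof (induction m rule: int_induct[where k = 0])
  case (step1 i)
  then show ?case using assms[of "u + of_int i" "v + of_int i"] by (simp add: add.assoc)
next
  case (step2 i)
  then show ?case using assms[of "u + of_int (i - 1)" "v + of_int (i - 1)"] by (simp add: algebra_simps)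
qed simp

text \<open>Subtracting the integer part of \<open>u\<close> from both arguments moves any point of
  the strip into the compact rectangle \<open>{0..1} \<times> {-c..c+1}\<close>.\<close>

lemma shift_invariant_bounded_on_strip:
  fixes f :: "real \<Rightarrow> real \<Rightarrow> real"
  assumes "\<And>u v. f (u + 1) (v + 1) = f u v" "continuous_on UNIV (\<lambda>(u, v). f u v)"
  shows "\<exists>B>0. \<forall>u v. \<bar>u - v\<bar> \<le> c \<longrightarrow> \<bar>f u v\<bar> \<le> B"
proof -
  have "compact ((\<lambda>(u, v). f u v) ` ({0..1} \<times> {-c..c+1}))"
    by (intro compact_continuous_image continuous_on_subset[OF assms(2)] compact_Times) auto
  then obtain B where B: "B > 0" "\<And>u v. u \<in> {0..1} \<Longrightarrow> v \<in> {-c..c+1} \<Longrightarrow> \<bar>f u v\<bar> \<le> B"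
    by (force dest!: compact_imp_bounded simp: bounded_pos)
  have "\<bar>f u v\<bar> \<le> B" if "\<bar>u - v\<bar> \<le> c" for u v
  proof -
    have "f (u + of_int (- \<lfloor>u\<rfloor>)) (v + of_int (- \<lfloor>u\<rfloor>)) = f u v"
      by (rule shift_of_int) fact
    moreover have "\<bar>f (u + of_int (- \<lfloor>u\<rfloor>)) (v + of_int (- \<lfloor>u\<rfloor>))\<bar> \<le> B"
    proof (rule B(2))
      have *: "0 \<le> u - of_int \<lfloor>u\<rfloor>" "u - of_int \<lfloor>u\<rfloor> \<le> 1" by linarith+
      then show "u + of_int (- \<lfloor>u\<rfloor>) \<in> {0..1}" by simp
      have "u - v \<le> c" "v - u \<le> c" using that by (auto simp: abs_le_iff)
      with * show "v + of_int (- \<lfloor>u\<rfloor>) \<in> {-c..c+1}"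
        unfolding atLeastAtMost_iff of_int_minus by linarith
    qed
    ultimately show ?thesis by simp
  qed
  then show ?thesis using B(1) by blast
qed

section \<open>Bounded spacing and estimates for the field\<close>

lemma K_D: "u \<in> K n \<Longrightarrow> \<bar>u (i + 1) - u i\<bar> \<le> real n"
  by (simp add: K_def)

lemma K_D': "u \<in> K n \<Longrightarrow> \<bar>u i - u (i - 1)\<bar> \<le> real n"
  using K_D[of u n "i - 1"] by simp

lemma K_mono: "m \<le> n \<Longrightarrow> K m \<subseteq> K n"
proof -
  assume mn: "m \<le> n"
  show ?thesis
  proof
    fix u assume "u \<in> K m"
    then have "\<bar>u (i + 1) - u i\<bar> \<le> real m" for i by (simp add: K_def)
    moreover have "real m \<le> real n" using mn by simp
    ultimately show "u \<in> K n" unfolding K_def by (blast intro: order_trans)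
  qed
qed

lemma K_imp_X: "u \<in> K n \<Longrightarrow> u \<in> X"
  using K_mono[of n "Suc n"] by (auto simp: X_def intro!: bexI[of _ "Suc n"])

lemma K_diff: "u \<in> K n \<Longrightarrow> \<bar>u (i + k) - u i\<bar> \<le> real n * real_of_int \<bar>k\<bar>"
proof -
  assume u: "u \<in> K n"
  have *: "\<bar>u (i + int m) - u i\<bar> \<le> real n * real m" for i m
  proof (induction m)
    case (Suc m)
    have "\<bar>u (i + int m + 1) - u (i + int m)\<bar> \<le> real n" by (rule K_D[OF u])
    moreover have eq: "i + int (Suc m) = i + int m + 1" "real n * real (Suc m) = real n * real m + real n"
      by (simp_all add: algebra_simps)
    ultimately show ?case using Suc unfolding eq by linarith
  qed simp
  show ?thesis
  proof (cases "k \<ge> 0")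
    case True
    then show ?thesis using *[of i "nat k"] by simp
  next
    case False
    then show ?thesis using *[of "i + k" "nat (- k)"] by (simp add: abs_minus_commute)
  qed
qed

text \<open>The prefix stands for Frenkel-Kontorova: an overdamped chain of particles with nearest
  neighbour interaction \<open>V\<close>, driven by the constant force \<open>F\<close>.\<close>

locale fk_chain =
  fixes V :: "real \<Rightarrow> real \<Rightarrow> real" and F \<delta> :: real
  assumes C2: "C2_plane V"
    and periodic_V: "\<And>u v. V (u + 1) (v + 1) = V u v"
    and delta_pos: "\<delta> > 0"
    and twist: "\<And>u v. D2 (D1 V) u v \<le> - \<delta>"
begin

lemma C1s: "C1_plane V" "C1_plane (D1 V)" "C1_plane (D2 V)"
  using C2 by (auto simp: C2_plane_def)

abbreviation "f \<equiv> vfield V F"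

lemma f_translate: "f (translate m u) = f u"
  using shift_of_int[of "D1 V", OF D1_shift[of V, OF periodic_V]]
    shift_of_int[of "D2 V", OF D2_shift[of V, OF periodic_V]]
  by (simp add: vfield_def translate_def fun_eq_iff)

lemma f_shift: "f (Tshift_power k u) = Tshift_power k (f u)"
  by (auto simp: vfield_def Tshift_power_def algebra_simps)

lemma second_derivatives_bounded:
  "\<exists>L>0. \<forall>u v. \<bar>u - v\<bar> \<le> c \<longrightarrow> \<bar>D1 (D1 V) u v\<bar> \<le> L \<and> \<bar>D2 (D1 V) u v\<bar> \<le> L \<and>
     \<bar>D1 (D2 V) u v\<bar> \<le> L \<and> \<bar>D2 (D2 V) u v\<bar> \<le> L"
proof -
  have *: "\<exists>B>0. \<forall>u v. \<bar>u - v\<bar> \<le> c \<longrightarrow> \<bar>g u v\<bar> \<le> B"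
    if "g \<in> {D1 (D1 V), D2 (D1 V), D1 (D2 V), D2 (D2 V)}" for g
  proof (rule shift_invariant_bounded_on_strip)
    note * = D1_shift[of V, OF periodic_V] D2_shift[of V, OF periodic_V]
    show "g (u + 1) (v + 1) = g u v" for u v
      using that D1_shift[of "D1 V", OF *(1)] D1_shift[of "D2 V", OF *(2)]
        D2_shift[of "D1 V", OF *(1)] D2_shift[of "D2 V", OF *(2)] by blast
    show "continuous_on UNIV (\<lambda>(u, v). g u v)"
      using that C1s(2,3) by (auto simp: C1_plane_def)
  qed
  obtain B1 B2 B3 B4 where B: "B1 > 0" "\<forall>u v. \<bar>u - v\<bar> \<le> c \<longrightarrow> \<bar>D1 (D1 V) u v\<bar> \<le> B1"
     "B2 > 0" "\<forall>u v. \<bar>u - v\<bar> \<le> c \<longrightarrow> \<bar>D2 (D1 V) u v\<bar> \<le> B2"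
     "B3 > 0" "\<forall>u v. \<bar>u - v\<bar> \<le> c \<longrightarrow> \<bar>D1 (D2 V) u v\<bar> \<le> B3"
     "B4 > 0" "\<forall>u v. \<bar>u - v\<bar> \<le> c \<longrightarrow> \<bar>D2 (D2 V) u v\<bar> \<le> B4"
    using *[of "D1 (D1 V)"] *[of "D2 (D1 V)"] *[of "D1 (D2 V)"] *[of "D2 (D2 V)"] by auto
  then show ?thesis
    by (intro exI[of _ "B1 + B2 + B3 + B4"]) (auto, smt+)
qed

text \<open>The field differs along two configurations by a cooperative tridiagonal form, because the
  straight segment between them stays in the strip where the second derivatives are bounded.\<close>

lemma field_difference_ex:
  "\<exists>L>0. \<forall>u\<in>K n. \<forall>v\<in>K n. \<forall>j. \<exists>\<alpha> \<beta> \<gamma>. \<delta> \<le> \<alpha> \<and> \<alpha> \<le> L \<and> \<bar>\<beta>\<bar> \<le> L \<and> \<delta> \<le> \<gamma> \<and> \<gamma> \<le> L \<and>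
     f u j - f v j = \<alpha> * (u (j - 1) - v (j - 1)) + \<beta> * (u j - v j) + \<gamma> * (u (j + 1) - v (j + 1))"
proof -
  obtain L where L: "L > 0" "\<And>u v. \<bar>u - v\<bar> \<le> real n \<Longrightarrow> \<bar>D1 (D1 V) u v\<bar> \<le> L \<and> \<bar>D2 (D1 V) u v\<bar> \<le> L \<and>
     \<bar>D1 (D2 V) u v\<bar> \<le> L \<and> \<bar>D2 (D2 V) u v\<bar> \<le> L"
    using second_derivatives_bounded by blast
  have "\<exists>\<alpha> \<beta> \<gamma>. \<delta> \<le> \<alpha> \<and> \<alpha> \<le> 2 * L \<and> \<bar>\<beta>\<bar> \<le> 2 * L \<and> \<delta> \<le> \<gamma> \<and> \<gamma> \<le> 2 * L \<and>
     f u j - f v j = \<alpha> * (u (j - 1) - v (j - 1)) + \<beta> * (u j - v j) + \<gamma> * (u (j + 1) - v (j + 1))"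
    if u: "u \<in> K n" and v: "v \<in> K n" for u v j
  proof -
    have seg: "\<bar>(y' + \<theta> * (y - y')) - (x' + \<theta> * (x - x'))\<bar> \<le> real n"
      if "\<bar>y - x\<bar> \<le> real n" "\<bar>y' - x'\<bar> \<le> real n" "0 < \<theta>" "\<theta> < 1" for x y x' y' \<theta> :: real
    proof -
      have "(y' + \<theta> * (y - y')) - (x' + \<theta> * (x - x')) = (1 - \<theta>) * (y' - x') + \<theta> * (y - x)"
        by (simp add: algebra_simps)
      also have "\<bar>\<dots>\<bar> \<le> (1 - \<theta>) * \<bar>y' - x'\<bar> + \<theta> * \<bar>y - x\<bar>"
        using that(3,4) abs_triangle_ineq[of "(1 - \<theta>) * (y' - x')" "\<theta> * (y - x)"] by (simp add: abs_mult)
      also have "\<dots> \<le> (1 - \<theta>) * real n + \<theta> * real n"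
        using that by (intro add_mono mult_left_mono) auto
      finally show ?thesis by (simp add: algebra_simps)
    qed
    obtain \<theta> where \<theta>: "0 < \<theta>" "\<theta> < 1"
      "D2 V (u (j - 1)) (u j) - D2 V (v (j - 1)) (v j) =
        D1 (D2 V) (v (j - 1) + \<theta> * (u (j - 1) - v (j - 1))) (v j + \<theta> * (u j - v j)) * (u (j - 1) - v (j - 1))
       + D2 (D2 V) (v (j - 1) + \<theta> * (u (j - 1) - v (j - 1))) (v j + \<theta> * (u j - v j)) * (u j - v j)"
      using C1_plane_mvt[OF C1s(3)] by blast
    obtain \<eta> where \<eta>: "0 < \<eta>" "\<eta> < 1"
      "D1 V (u j) (u (j + 1)) - D1 V (v j) (v (j + 1)) =
        D1 (D1 V) (v j + \<eta> * (u j - v j)) (v (j + 1) + \<eta> * (u (j + 1) - v (j + 1))) * (u j - v j)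
       + D2 (D1 V) (v j + \<eta> * (u j - v j)) (v (j + 1) + \<eta> * (u (j + 1) - v (j + 1))) * (u (j + 1) - v (j + 1))"
      using C1_plane_mvt[OF C1s(2)] by blast
    define p q where "p = v (j - 1) + \<theta> * (u (j - 1) - v (j - 1))" and "q = v j + \<theta> * (u j - v j)"
    define p' q' where "p' = v j + \<eta> * (u j - v j)" and "q' = v (j + 1) + \<eta> * (u (j + 1) - v (j + 1))"
    have "\<bar>q - p\<bar> \<le> real n" "\<bar>q' - p'\<bar> \<le> real n"
      using seg[OF K_D'[OF u] K_D'[OF v] \<theta>(1,2)] seg[OF K_D[OF u] K_D[OF v] \<eta>(1,2)]
      by (simp_all add: p_def q_def p'_def q'_def)
    then have b: "\<bar>D1 (D2 V) p q\<bar> \<le> L" "\<bar>D2 (D2 V) p q\<bar> \<le> L" "\<bar>D1 (D1 V) p' q'\<bar> \<le> L" "\<bar>D2 (D1 V) p' q'\<bar> \<le> L"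
      using L(2)[of p q] L(2)[of p' q'] by (auto simp: abs_minus_commute)
    have t: "D1 (D2 V) p q \<le> - \<delta>" "D2 (D1 V) p' q' \<le> - \<delta>"
      using twist by (simp_all add: mixed_partials_commute[OF C2])
    have "f u j - f v j = - D1 (D2 V) p q * (u (j - 1) - v (j - 1)) + (- D2 (D2 V) p q - D1 (D1 V) p' q') * (u j - v j)
      + - D2 (D1 V) p' q' * (u (j + 1) - v (j + 1))"
      using \<theta>(3) \<eta>(3) unfolding p_def[symmetric] q_def[symmetric] p'_def[symmetric] q'_def[symmetric]
      by (simp add: vfield_def algebra_simps)
    moreover have "\<bar>- D2 (D2 V) p q - D1 (D1 V) p' q'\<bar> \<le> 2 * L" using b by argo
    ultimately show ?thesis using b t L(1)
      by (intro exI[of _ "- D1 (D2 V) p q"] exI[of _ "- D2 (D2 V) p q - D1 (D1 V) p' q'"] exI[of _ "- D2 (D1 V) p' q'"])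
        auto
  qed
  \<comment> \<open>The coefficient of \<open>u j\<close> is a sum of two second derivatives, one
    from each bond, whence the factor 2.\<close>
  then show ?thesis using L(1) by (intro exI[of _ "2 * L"]) auto
qed

text \<open>Choosing one bound per \<open>n\<close> once and for all lets every later rate refer to
  the same constant. The triple of coefficients stays existential because it depends on the two
  configurations and on the site.\<close>

definition field_lip :: "nat \<Rightarrow> real" where
  "field_lip n = (SOME L. L > 0 \<and> (\<forall>u\<in>K n. \<forall>v\<in>K n. \<forall>j. \<exists>\<alpha> \<beta> \<gamma>. \<delta> \<le> \<alpha> \<and> \<alpha> \<le> L \<and> \<bar>\<beta>\<bar> \<le> L \<and> \<delta> \<le> \<gamma> \<and> \<gamma> \<le> L \<and>
     f u j - f v j = \<alpha> * (u (j - 1) - v (j - 1)) + \<beta> * (u j - v j) + \<gamma> * (u (j + 1) - v (j + 1))))"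

lemma field_lip_pos: "field_lip n > 0" and field_difference:
  "u \<in> K n \<Longrightarrow> v \<in> K n \<Longrightarrow> \<exists>\<alpha> \<beta> \<gamma>. \<delta> \<le> \<alpha> \<and> \<alpha> \<le> field_lip n \<and> \<bar>\<beta>\<bar> \<le> field_lip n \<and> \<delta> \<le> \<gamma> \<and> \<gamma> \<le> field_lip n \<and>
     f u j - f v j = \<alpha> * (u (j - 1) - v (j - 1)) + \<beta> * (u j - v j) + \<gamma> * (u (j + 1) - v (j + 1))"
  using someI_ex[OF field_difference_ex[of n]] unfolding field_lip_def[symmetric] by blast+

lemma field_bounded_ex: "\<exists>B>0. \<forall>u\<in>K n. \<forall>j. \<bar>f u j\<bar> \<le> B"
proof -
  obtain B1 where B1: "B1 > 0" "\<And>u v. \<bar>u - v\<bar> \<le> real n \<Longrightarrow> \<bar>D1 V u v\<bar> \<le> B1"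
    using shift_invariant_bounded_on_strip[OF D1_shift[of V, OF periodic_V] C1_plane_continuous[OF C1s(2)]] by blast
  obtain B2 where B2: "B2 > 0" "\<And>u v. \<bar>u - v\<bar> \<le> real n \<Longrightarrow> \<bar>D2 V u v\<bar> \<le> B2"
    using shift_invariant_bounded_on_strip[OF D2_shift[of V, OF periodic_V] C1_plane_continuous[OF C1s(3)]] by blast
  have "\<bar>f u j\<bar> \<le> B1 + B2 + \<bar>F\<bar>" if "u \<in> K n" for u j
  proof -
    have "\<bar>D1 V (u j) (u (j + 1))\<bar> \<le> B1" "\<bar>D2 V (u (j - 1)) (u j)\<bar> \<le> B2"
      using K_D[OF that, of j] K_D'[OF that, of j] by (auto intro!: B1(2) B2(2) simp only: abs_minus_commute)
    then show ?thesis unfolding vfield_def by linarith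
  qed
  then show ?thesis using B1(1) B2(1) by (intro exI[of _ "B1 + B2 + \<bar>F\<bar>"]) auto
qed

definition field_bound :: "nat \<Rightarrow> real" where
  "field_bound n = (SOME B. B > 0 \<and> (\<forall>u\<in>K n. \<forall>j. \<bar>f u j\<bar> \<le> B))"

lemma field_bound_pos: "field_bound n > 0" and field_bounded: "u \<in> K n \<Longrightarrow> \<bar>f u j\<bar> \<le> field_bound n"
  using someI_ex[OF field_bounded_ex[of n]] unfolding field_bound_def[symmetric] by blast+

end

section \<open>The monotone semiflow\<close>

text \<open>Solutions have only a one-sided derivative at time 0. Derivatives relative to the closed
  interval give continuity up to its ends, and the sign is asked for in its interior.\<close>

lemma nonneg_deriv_imp_le:
  fixes g :: "real \<Rightarrow> real"
  assumes "\<And>t. a \<le> t \<Longrightarrow> t \<le> b \<Longrightarrow> (g has_real_derivative g' t) (at t within {a..b})"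
    and "\<And>t. a < t \<Longrightarrow> t < b \<Longrightarrow> 0 \<le> g' t" and "a \<le> b"
  shows "g a \<le> g b"
proof (cases "a = b")
  case False
  have c: "continuous_on {a..b} g"
    using assms(1) by (auto simp: continuous_on_eq_continuous_within intro!: DERIV_continuous)
  show ?thesis
  proof (rule DERIV_nonneg_imp_increasing_open[OF \<open>a \<le> b\<close> _ c])
    fix t assume "a < t" "t < b"
    then show "\<exists>y. DERIV g t :> y \<and> y \<ge> 0"
      using assms(1)[of t] assms(2)[of t] by (auto simp: at_within_Icc_at)
  qed
qed simp

lemma pos_deriv_imp_less:
  fixes g :: "real \<Rightarrow> real"
  assumes "\<And>t. a \<le> t \<Longrightarrow> t \<le> b \<Longrightarrow> (g has_real_derivative g' t) (at t within {a..b})"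
    and "\<And>t. a < t \<Longrightarrow> t < b \<Longrightarrow> 0 < g' t" and "a < b"
  shows "g a < g b"
proof -
  have c: "continuous_on {a..b} g"
    using assms(1) by (auto simp: continuous_on_eq_continuous_within intro!: DERIV_continuous)
  show ?thesis
  proof (rule DERIV_pos_imp_increasing_open[OF \<open>a < b\<close> _ c])
    fix t assume "a < t" "t < b"
    then show "\<exists>y. DERIV g t :> y \<and> y > 0"
      using assms(1)[of t] assms(2)[of t] by (auto simp: at_within_Icc_at)
  qed
qed

text \<open>Differentiation leads from one term of the exponential series to the one before it.
  Integral inequalities that are iterated from a constant bound therefore run through these terms:
  in the comparison principle, in backward uniqueness and in the Picard iteration.\<close>

lemma has_real_derivative_power_over_fact:
  "((\<lambda>t. C * (c * t) ^ Suc k / fact (Suc k)) has_real_derivative c * (C * (c * t) ^ k / fact k)) (at t within S)"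
proof -
  have "((\<lambda>t. C * (c * t) ^ Suc k / fact (Suc k)) has_real_derivative
     C * (real (Suc k) * (c * t) ^ k * c) / fact (Suc k)) (at t within S)"
    by (auto intro!: derivative_eq_intros simp del: power_Suc)
  also have "C * (real (Suc k) * (c * t) ^ k * c) / fact (Suc k) = c * (C * (c * t) ^ k / fact k)"
    by (simp add: field_simps del: of_nat_Suc)
  finally show ?thesis .
qed

lemma power_over_fact_tendsto_0: "(\<lambda>k. C * (x :: real) ^ k / fact k) \<longlonglongrightarrow> 0"
  using tendsto_mult_right_zero[OF summable_LIMSEQ_zero[OF summable_exp[of x]], of C]
  by (simp add: field_simps)

text \<open>Iterating the integrated inequality gives \<open>exp (L t) * w \<ge> - C * (4 L t)\<^sup>k / k!\<close> for every \<open>k\<close>.\<close>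

lemma comparison_principle:
  fixes w w' :: "real \<Rightarrow> int \<Rightarrow> real"
  assumes der: "\<And>t j. 0 \<le> t \<Longrightarrow> t \<le> \<tau> \<Longrightarrow> ((\<lambda>s. w s j) has_real_derivative w' t j) (at t within {0..\<tau>})"
    and ineq: "\<And>t j. 0 \<le> t \<Longrightarrow> t \<le> \<tau> \<Longrightarrow> \<exists>\<alpha> \<beta> \<gamma>. 0 \<le> \<alpha> \<and> \<alpha> \<le> L \<and> \<bar>\<beta>\<bar> \<le> L \<and> 0 \<le> \<gamma> \<and> \<gamma> \<le> L \<and>
        \<alpha> * w t (j - 1) + \<beta> * w t j + \<gamma> * w t (j + 1) \<le> w' t j"
    and init: "\<And>j. 0 \<le> w 0 j"
    and bdd: "\<And>t j. 0 \<le> t \<Longrightarrow> t \<le> \<tau> \<Longrightarrow> - C \<le> w t j"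
    and t: "0 \<le> t" "t \<le> \<tau>"
  shows "0 \<le> w t j"
proof -
  have L: "0 \<le> L" using ineq[of t j] t by force
  \<comment> \<open>The weight \<open>exp (L * t)\<close> changes the diagonal coefficient
    \<open>\<beta>\<close> into \<open>L + \<beta>\<close>, so that all three coefficients are
    nonnegative with sum at most \<open>4 * L\<close>, the rate of the iteration. \<open>C'\<close>
    bounds the weighted function from below by \<open>- C'\<close>.\<close>
  define C' where "C' = \<bar>C\<bar> * exp (L * \<tau>)"
  have C': "0 \<le> C'" by (simp add: C'_def)
  have *: "- (C' * (4 * L * t) ^ k / fact k) \<le> exp (L * t) * w t j" if "0 \<le> t" "t \<le> \<tau>" for k t j
    using that
  proof (induction k arbitrary: t j)
    case 0
    have "exp (L * t) * (- w t j) \<le> exp (L * t) * \<bar>C\<bar>"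
      using bdd[of t j] 0 by (intro mult_left_mono) auto
    also have "\<dots> \<le> exp (L * \<tau>) * \<bar>C\<bar>" using 0 L by (intro mult_right_mono) (auto simp: mult_left_mono)
    finally show ?case by (simp add: C'_def mult.commute)
  next
    case (Suc k)
    define g where "g s = exp (L * s) * w s j + C' * (4 * L * s) ^ Suc k / fact (Suc k)" for s
    define g' where "g' s = (exp (L * s) * w' s j + L * exp (L * s) * w s j) + 4 * L * (C' * (4 * L * s) ^ k / fact k)" for s
    have "g 0 \<le> g t"
    proof (rule nonneg_deriv_imp_le[where g = g and g' = g'])
      fix s assume s: "0 \<le> s" "s \<le> t"
      have d: "((\<lambda>s. w s j) has_real_derivative w' s j) (at s within {0..t})"
        using der[of s j] s Suc.prems by (auto intro: DERIV_subset)
      have e: "((\<lambda>s. exp (L * s)) has_real_derivative L * exp (L * s)) (at s within {0..t})"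
        by (auto intro!: derivative_eq_intros)
      show "(g has_real_derivative g' s) (at s within {0..t})"
        unfolding g_def g'_def
        by (rule DERIV_add[OF _ has_real_derivative_power_over_fact])
          (use DERIV_mult[OF e d] in \<open>simp add: algebra_simps\<close>)
    next
      fix s assume s: "0 < s" "s < t"
      have s': "0 \<le> s" "s \<le> \<tau>" using s Suc.prems by auto
      define M where "M = C' * (4 * L * s) ^ k / fact k"
      have M: "0 \<le> M" using C' L s by (simp add: M_def)
      have lb: "- M \<le> exp (L * s) * w s i" for i
        using Suc.IH[OF s', of i] by (simp add: M_def)
      obtain \<alpha> \<beta> \<gamma> where c: "0 \<le> \<alpha>" "\<alpha> \<le> L" "\<bar>\<beta>\<bar> \<le> L" "0 \<le> \<gamma>" "\<gamma> \<le> L"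
        "\<alpha> * w s (j - 1) + \<beta> * w s j + \<gamma> * w s (j + 1) \<le> w' s j"
        using ineq[OF s'] by blast
      have trm: "- (a * M) \<le> a * (exp (L * s) * w s i)" if "0 \<le> a" for a i
        using mult_left_mono[OF lb that, of i] by simp
      have "- (4 * L * M) \<le> - (\<alpha> * M) + - ((L + \<beta>) * M) + - (\<gamma> * M)"
      proof -
        have "(\<alpha> + (L + \<beta>) + \<gamma>) * M \<le> (4 * L) * M" using c by (intro mult_right_mono M) linarith
        then show ?thesis by (simp add: algebra_simps)
      qed
      also have "\<dots> \<le> \<alpha> * (exp (L * s) * w s (j - 1)) + (L + \<beta>) * (exp (L * s) * w s j) + \<gamma> * (exp (L * s) * w s (j + 1))"
        using c by (intro add_mono trm) auto
      also have "\<dots> = exp (L * s) * (\<alpha> * w s (j - 1) + \<beta> * w s j + \<gamma> * w s (j + 1)) + L * exp (L * s) * w s j"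
        by (simp add: algebra_simps)
      also have "\<dots> \<le> exp (L * s) * w' s j + L * exp (L * s) * w s j"
        using c(6) by simp
      finally show "0 \<le> g' s" by (simp add: g'_def M_def)
    qed (use Suc.prems in auto)
    moreover have "0 \<le> g 0" using init[of j] by (simp add: g_def)
    ultimately show ?case by (simp add: g_def)
  qed
  have "(\<lambda>k. - (C' * (4 * L * t) ^ k / fact k)) \<longlonglongrightarrow> - 0"
    by (intro tendsto_minus power_over_fact_tendsto_0)
  then have "- 0 \<le> exp (L * t) * w t j"
    by (rule LIMSEQ_le_const2) (use *[OF t] in auto)
  then show ?thesis by (simp add: zero_le_mult_iff)
qed

section \<open>Order, uniqueness and backward uniqueness of solutions\<close>

context fk_chain
begin

definition solK :: "nat \<Rightarrow> (real \<Rightarrow> config) \<Rightarrow> bool" where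
  "solK n x \<longleftrightarrow> (\<forall>t\<ge>0. x t \<in> K n) \<and>
     (\<forall>t\<ge>0. \<forall>j. ((\<lambda>s. x s j) has_real_derivative f (x t) j) (at t within {0..}))"

lemma solution_iff_solK: "solution V F x \<longleftrightarrow> (\<exists>n. solK n x)"
  by (auto simp: solution_def solK_def)

lemma solK_mono: "m \<le> n \<Longrightarrow> solK m x \<Longrightarrow> solK n x"
  using K_mono[of m n] by (auto simp: solK_def)

lemma solK_K: "solK n x \<Longrightarrow> 0 \<le> t \<Longrightarrow> x t \<in> K n"
  by (simp add: solK_def)

lemma solK_deriv: "solK n x \<Longrightarrow> 0 \<le> t \<Longrightarrow> S \<subseteq> {0..} \<Longrightarrow> ((\<lambda>s. x s j) has_real_derivative f (x t) j) (at t within S)"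
  unfolding solK_def using DERIV_subset by blast

lemma solK_lipschitz:
  assumes "solK n x" "0 \<le> s" "s \<le> t"
  shows "\<bar>x t j - x s j\<bar> \<le> field_bound n * (t - s)"
proof -
  have b: "\<bar>f (x r) j\<bar> \<le> field_bound n" if "s \<le> r" for r
    using field_bounded[OF solK_K[OF assms(1)]] assms(2) that by auto
  have d: "((\<lambda>s. x s j) has_real_derivative f (x r) j) (at r within {s..t})" if "s \<le> r" for r
    by (rule solK_deriv[OF assms(1)]) (use that assms in auto)
  have "field_bound n * s - x s j \<le> field_bound n * t - x t j"
    by (rule nonneg_deriv_imp_le[where g = "\<lambda>s. field_bound n * s - x s j" and g' = "\<lambda>r. field_bound n - f (x r) j"])
      (use d b assms in \<open>auto intro!: derivative_eq_intros simp: abs_le_iff\<close>)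
  moreover have "field_bound n * s + x s j \<le> field_bound n * t + x t j"
  proof (rule nonneg_deriv_imp_le[where g = "\<lambda>s. field_bound n * s + x s j" and g' = "\<lambda>r. field_bound n + f (x r) j"])
    show "0 \<le> field_bound n + f (x r) j" if "s < r" "r < t" for r using b[of r] that by linarith
  qed (use d assms in \<open>auto intro!: derivative_eq_intros\<close>)
  ultimately show ?thesis by (simp add: abs_le_iff algebra_simps)
qed

lemma solK_difference:
  assumes "solK n x" "solK n y" "0 \<le> t"
  shows "\<exists>\<alpha> \<beta> \<gamma>. \<delta> \<le> \<alpha> \<and> \<alpha> \<le> field_lip n \<and> \<bar>\<beta>\<bar> \<le> field_lip n \<and> \<delta> \<le> \<gamma> \<and> \<gamma> \<le> field_lip n \<and>
     f (x t) j - f (y t) j = \<alpha> * (x t (j - 1) - y t (j - 1)) + \<beta> * (x t j - y t j) + \<gamma> * (x t (j + 1) - y t (j + 1))"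
  using field_difference solK_K assms by blast

text \<open>The function \<open>\<psi> j * exp (5 * field_lip n * t)\<close> is a supersolution: the
  two neighbours contribute at most \<open>2 * \<psi> j\<close> each and the site itself
  \<open>\<psi> j\<close>, which makes 5. The zero weight gives monotonicity, constant weights a
  bound in the supremum distance, and geometrically growing weights the dependence on a finite
  window.\<close>

lemma solK_weighted_bound:
  assumes x: "solK n x" and y: "solK n y"
    and \<psi>: "\<And>j. 0 \<le> \<psi> j" "\<And>j. \<psi> (j - 1) \<le> 2 * \<psi> j" "\<And>j. \<psi> (j + 1) \<le> 2 * \<psi> j"
    and init: "\<And>j. x 0 j - y 0 j \<le> \<psi> j"
    and t: "0 \<le> t"
  shows "x t j - y t j \<le> \<psi> j * exp (5 * field_lip n * t)"
proof -
  let ?e = "\<lambda>t. exp (5 * field_lip n * t)"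
  have "0 \<le> \<psi> j * ?e t - (x t j - y t j)"
  proof (rule comparison_principle[where \<tau> = t and w = "\<lambda>t j. \<psi> j * ?e t - (x t j - y t j)"
        and w' = "\<lambda>t j. \<psi> j * (5 * field_lip n * ?e t) - (f (x t) j - f (y t) j)" and L = "field_lip n" and C = "2 * field_bound n * t"])
    fix s j assume s: "0 \<le> s" "s \<le> t"
    have "((\<lambda>s. x s j) has_real_derivative f (x s) j) (at s within {0..t})"
      "((\<lambda>s. y s j) has_real_derivative f (y s) j) (at s within {0..t})"
      by (rule solK_deriv[OF x] solK_deriv[OF y]; use s in auto)+
    then show "((\<lambda>s. \<psi> j * ?e s - (x s j - y s j)) has_real_derivative
        \<psi> j * (5 * field_lip n * ?e s) - (f (x s) j - f (y s) j)) (at s within {0..t})"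
      by (auto intro!: derivative_eq_intros)
    obtain \<alpha> \<beta> \<gamma> where c: "\<delta> \<le> \<alpha>" "\<alpha> \<le> field_lip n" "\<bar>\<beta>\<bar> \<le> field_lip n" "\<delta> \<le> \<gamma>" "\<gamma> \<le> field_lip n"
      "f (x s) j - f (y s) j = \<alpha> * (x s (j - 1) - y s (j - 1)) + \<beta> * (x s j - y s j) + \<gamma> * (x s (j + 1) - y s (j + 1))"
      using solK_difference[OF x y s(1)] by blast
    have "\<alpha> * \<psi> (j - 1) + \<beta> * \<psi> j + \<gamma> * \<psi> (j + 1) \<le> field_lip n * (2 * \<psi> j) + field_lip n * \<psi> j + field_lip n * (2 * \<psi> j)"
      using c delta_pos \<psi> field_lip_pos[of n] by (intro add_mono mult_mono mult_right_mono) auto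
    also have "\<dots> = 5 * field_lip n * \<psi> j" by simp
    finally have "(\<alpha> * \<psi> (j - 1) + \<beta> * \<psi> j + \<gamma> * \<psi> (j + 1)) * ?e s \<le> (5 * field_lip n * \<psi> j) * ?e s"
      by (rule mult_right_mono) simp
    then show "\<exists>\<alpha> \<beta> \<gamma>. 0 \<le> \<alpha> \<and> \<alpha> \<le> field_lip n \<and> \<bar>\<beta>\<bar> \<le> field_lip n \<and> 0 \<le> \<gamma> \<and> \<gamma> \<le> field_lip n \<and>
      \<alpha> * (\<psi> (j - 1) * ?e s - (x s (j - 1) - y s (j - 1))) + \<beta> * (\<psi> j * ?e s - (x s j - y s j)) +
      \<gamma> * (\<psi> (j + 1) * ?e s - (x s (j + 1) - y s (j + 1))) \<le> \<psi> j * (5 * field_lip n * ?e s) - (f (x s) j - f (y s) j)"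
      using c delta_pos by (intro exI[of _ \<alpha>] exI[of _ \<beta>] exI[of _ \<gamma>]) (auto simp: algebra_simps)
    have "\<bar>x s j - x 0 j\<bar> \<le> field_bound n * s" "\<bar>y s j - y 0 j\<bar> \<le> field_bound n * s"
      using solK_lipschitz[OF x, of 0 s j] solK_lipschitz[OF y, of 0 s j] s by auto
    moreover have "field_bound n * s \<le> field_bound n * t" using s field_bound_pos[of n] by simp
    moreover have "\<psi> j \<le> \<psi> j * ?e s"
      using \<psi>(1)[of j] s field_lip_pos[of n] by (simp add: mult_le_cancel_left1)
    ultimately show "- (2 * field_bound n * t) \<le> \<psi> j * ?e s - (x s j - y s j)"
      using init[of j] by linarith
  next
    show "0 \<le> \<psi> j * ?e 0 - (x 0 j - y 0 j)" for j using init[of j] by simp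
  qed (use t in auto)
  then show ?thesis by simp
qed

lemma solK_mono_init:
  assumes "solK n x" "solK n y" "x 0 \<le> y 0" "0 \<le> t"
  shows "x t \<le> y t"
proof (rule le_funI)
  fix j show "x t j \<le> y t j"
    using solK_weighted_bound[OF assms(1,2), of "\<lambda>_. 0" t j] assms(3,4) by (simp add: le_fun_def)
qed

lemma solK_unique:
  assumes "solK n x" "solK m y" "x 0 = y 0" "0 \<le> t"
  shows "x t = y t"
proof -
  have s: "solK (max n m) x" "solK (max n m) y"
    using solK_mono[OF _ assms(1), of "max n m"] solK_mono[OF _ assms(2), of "max n m"] by auto
  show ?thesis
    by (rule antisym) (use solK_mono_init[OF s] solK_mono_init[OF s(2,1)] assms(3,4) in auto)
qed

text \<open>At a site \<open>p\<close> where the difference is positive initially it stays positive.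
  The twist transmits positivity at rate at least \<open>\<delta>\<close> to the neighbouring sites
  at every positive time, and induction on the distance from \<open>p\<close> reaches every
  \<open>j\<close>.\<close>

lemma solK_strict_mono:
  assumes x: "solK n x" and y: "solK n y" and le: "x 0 \<le> y 0" and ne: "x 0 \<noteq> y 0" and t: "0 < t"
  shows "x t j < y t j"
proof -
  let ?L = "field_lip n"
  define w where "w t j = y t j - x t j" for t j
  have w0: "0 \<le> w t j" if "0 \<le> t" for t j
    using solK_mono_init[OF x y le that] by (simp add: w_def le_fun_def)
  have dw: "((\<lambda>s. exp (?L * s) * w s j) has_real_derivative
     exp (?L * s) * (f (y s) j - f (x s) j) + ?L * exp (?L * s) * w s j) (at s within S)" if "0 \<le> s" "S \<subseteq> {0..}" for s j S
    unfolding w_def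
    by (auto intro!: derivative_eq_intros solK_deriv[OF x that] solK_deriv[OF y that] simp: algebra_simps)
  have lb: "exp (?L * s) * (\<delta> * w s (j - 1) + \<delta> * w s (j + 1)) \<le> exp (?L * s) * (f (y s) j - f (x s) j) + ?L * exp (?L * s) * w s j"
    if s: "0 \<le> s" for s j
  proof -
    obtain \<alpha> \<beta> \<gamma> where c: "\<delta> \<le> \<alpha>" "\<alpha> \<le> ?L" "\<bar>\<beta>\<bar> \<le> ?L" "\<delta> \<le> \<gamma>" "\<gamma> \<le> ?L"
      "f (y s) j - f (x s) j = \<alpha> * w s (j - 1) + \<beta> * w s j + \<gamma> * w s (j + 1)"
      using solK_difference[OF y x s] unfolding w_def by blast
    have "\<delta> * w s (j - 1) + 0 * w s j + \<delta> * w s (j + 1) \<le> \<alpha> * w s (j - 1) + (?L + \<beta>) * w s j + \<gamma> * w s (j + 1)"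
      using c w0[OF s] by (intro add_mono mult_right_mono) auto
    then have "exp (?L * s) * (\<delta> * w s (j - 1) + \<delta> * w s (j + 1)) \<le> exp (?L * s) * (\<alpha> * w s (j - 1) + (?L + \<beta>) * w s j + \<gamma> * w s (j + 1))"
      by (intro mult_left_mono) auto
    then show ?thesis unfolding c(6) by (simp add: algebra_simps)
  qed
  have step: "0 < w t j" if t: "0 < t" and pos: "\<And>s. 0 < s \<Longrightarrow> 0 < w s (j - 1) \<or> 0 < w s (j + 1)" for t j
  proof -
    have "exp (?L * 0) * w 0 j < exp (?L * t) * w t j"
    proof (rule pos_deriv_imp_less[OF dw])
      fix s assume s: "0 < s" "s < t"
      have "0 < \<delta> * w s (j - 1) + \<delta> * w s (j + 1)"
        using pos[OF s(1)] w0[of s "j - 1"] w0[of s "j + 1"] s delta_pos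
        by (auto intro: add_pos_nonneg add_nonneg_pos)
      then have "0 < exp (?L * s) * (\<delta> * w s (j - 1) + \<delta> * w s (j + 1))" by simp
      also note lb[of s j]
      finally show "0 < exp (?L * s) * (f (y s) j - f (x s) j) + ?L * exp (?L * s) * w s j" using s by simp
    qed (use t in auto)
    then have "0 < exp (?L * t) * w t j" using w0[of 0 j] by simp
    then show ?thesis by (simp add: zero_less_mult_iff)
  qed
  obtain p where p: "0 < w 0 p"
    using ne le unfolding w_def by (metis diff_gt_0_iff_gt ext le_fun_def order_le_less)
  have "0 < w t (p + int i) \<and> 0 < w t (p - int i)" if "0 < t" for i t
    using that
  proof (induction i arbitrary: t)
    case 0
    have "exp (?L * 0) * w 0 p \<le> exp (?L * t) * w t p"
    proof (rule nonneg_deriv_imp_le[OF dw])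
      fix s assume s: "0 < s" "s < t"
      have "0 \<le> exp (?L * s) * (\<delta> * w s (p - 1) + \<delta> * w s (p + 1))"
        using w0[of s] s delta_pos by simp
      also note lb[of s p]
      finally show "0 \<le> exp (?L * s) * (f (y s) p - f (x s) p) + ?L * exp (?L * s) * w s p" using s by simp
    qed (use 0 in auto)
    then have "0 < exp (?L * t) * w t p" using p by simp
    then show ?case by (simp add: zero_less_mult_iff)
  next
    case (Suc i)
    have "0 < w t (p + int (Suc i))"
      by (rule step[OF Suc.prems]) (use Suc.IH in auto)
    moreover have "0 < w t (p - int (Suc i))"
    proof (rule step[OF Suc.prems])
      fix s :: real assume "0 < s"
      moreover have "p - int (Suc i) + 1 = p - int i" by simp
      ultimately show "0 < w s (p - int (Suc i) - 1) \<or> 0 < w s (p - int (Suc i) + 1)" using Suc.IH[of s] by simp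
    qed
    ultimately show ?case by simp
  qed
  from this[OF t, of "nat \<bar>j - p\<bar>"] have "0 < w t j"
    by (cases "p \<le> j") auto
  then show ?thesis by (simp add: w_def)
qed

text \<open>The field is bounded on \<open>K n\<close>, so two solutions that agree at time
  \<open>T\<close> differ by at most \<open>2 * field_bound n * T\<close> before. Integrating back
  from \<open>T\<close> with the Lipschitz constant \<open>3 * field_lip n\<close> improves a bound
  of order \<open>k\<close> in \<open>T - t\<close> to one of order \<open>k + 1\<close>, with the
  factorials that make it tend to 0.\<close>

lemma solK_backward_unique:
  assumes x: "solK n x" and y: "solK n y" and T: "0 \<le> T" and eq: "x T = y T" and t: "0 \<le> t" "t \<le> T"
  shows "x t = y t"
proof -
  let ?L = "field_lip n"
  define C where "C = 2 * field_bound n * T"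
  have *: "\<bar>x t j - y t j\<bar> \<le> C * (3 * ?L * (T - t)) ^ k / fact k" if "0 \<le> t" "t \<le> T" for t j k
    using that
  proof (induction k arbitrary: t j)
    case 0
    have "\<bar>x T j - x t j\<bar> \<le> field_bound n * (T - t)" "\<bar>y T j - y t j\<bar> \<le> field_bound n * (T - t)"
      using solK_lipschitz[OF x, of t T j] solK_lipschitz[OF y, of t T j] 0 by auto
    moreover have "field_bound n * (T - t) \<le> field_bound n * T" using 0 field_bound_pos[of n] by simp
    ultimately show ?case using eq by (simp add: C_def)
  next
    case (Suc k)
    have bnd: "\<bar>f (x s) j - f (y s) j\<bar> \<le> 3 * ?L * (C * (3 * ?L * (T - s)) ^ k / fact k)" if s: "t \<le> s" "s \<le> T" for s
    proof -
      have s': "0 \<le> s" using s Suc.prems by simp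
      define M where "M = C * (3 * ?L * (T - s)) ^ k / fact k"
      have IH: "\<bar>x s i - y s i\<bar> \<le> M" for i using Suc.IH[OF s' s(2)] by (simp add: M_def)
      obtain \<alpha> \<beta> \<gamma> where c: "\<delta> \<le> \<alpha>" "\<alpha> \<le> ?L" "\<bar>\<beta>\<bar> \<le> ?L" "\<delta> \<le> \<gamma>" "\<gamma> \<le> ?L"
        "f (x s) j - f (y s) j = \<alpha> * (x s (j - 1) - y s (j - 1)) + \<beta> * (x s j - y s j) + \<gamma> * (x s (j + 1) - y s (j + 1))"
        using solK_difference[OF x y s'] by blast
      have "\<bar>f (x s) j - f (y s) j\<bar> \<le> \<bar>\<alpha>\<bar> * \<bar>x s (j - 1) - y s (j - 1)\<bar> + \<bar>\<beta>\<bar> * \<bar>x s j - y s j\<bar> + \<bar>\<gamma>\<bar> * \<bar>x s (j + 1) - y s (j + 1)\<bar>"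
        unfolding c(6) abs_mult[symmetric] by linarith
      also have "\<dots> \<le> ?L * M + ?L * M + ?L * M"
        using c delta_pos IH field_lip_pos[of n] by (intro add_mono mult_mono) auto
      also have "\<dots> = 3 * ?L * M" by simp
      finally show ?thesis unfolding M_def .
    qed
    define G where "G s = C * (3 * ?L * (T - s)) ^ Suc k / fact (Suc k)" for s
    have dG: "(G has_real_derivative - (3 * ?L * (C * (3 * ?L * (T - s)) ^ k / fact k))) (at s within S)" for s S
    proof -
      have "((\<lambda>s. T - s) has_real_derivative - 1) (at s within S)"
        by (auto intro!: derivative_eq_intros)
      from DERIV_chain2[OF has_real_derivative_power_over_fact[of C "3 * ?L" k] this]
      show ?thesis by (simp only: G_def[abs_def] mult_minus_right mult_1_right)
    qed
    have d: "((\<lambda>s. x s j) has_real_derivative f (x s) j) (at s within {t..T})"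
      "((\<lambda>s. y s j) has_real_derivative f (y s) j) (at s within {t..T})" if "t \<le> s" for s
      by (rule solK_deriv[OF x] solK_deriv[OF y]; use that Suc.prems in auto)+
    have "(x t j - y t j) - G t \<le> (x T j - y T j) - G T"
    proof (rule nonneg_deriv_imp_le[where g = "\<lambda>s. (x s j - y s j) - G s"])
      show "((\<lambda>s. (x s j - y s j) - G s) has_real_derivative (f (x s) j - f (y s) j) - - (3 * ?L * (C * (3 * ?L * (T - s)) ^ k / fact k))) (at s within {t..T})"
        if "t \<le> s" "s \<le> T" for s using that by (intro DERIV_diff d dG)
      show "0 \<le> (f (x s) j - f (y s) j) - - (3 * ?L * (C * (3 * ?L * (T - s)) ^ k / fact k))" if "t < s" "s < T" for s
        using bnd[of s] that by linarith
    qed (use Suc.prems in auto)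
    moreover have "- (x t j - y t j) - G t \<le> - (x T j - y T j) - G T"
    proof (rule nonneg_deriv_imp_le[where g = "\<lambda>s. - (x s j - y s j) - G s"])
      show "((\<lambda>s. - (x s j - y s j) - G s) has_real_derivative - (f (x s) j - f (y s) j) - - (3 * ?L * (C * (3 * ?L * (T - s)) ^ k / fact k))) (at s within {t..T})"
        if "t \<le> s" "s \<le> T" for s using that by (intro DERIV_diff DERIV_minus d dG)
      show "0 \<le> - (f (x s) j - f (y s) j) - - (3 * ?L * (C * (3 * ?L * (T - s)) ^ k / fact k))" if "t < s" "s < T" for s
        using bnd[of s] that by linarith
    qed (use Suc.prems in auto)
    moreover have "G T = 0" by (simp add: G_def)
    ultimately show ?case using eq unfolding G_def[symmetric] by simp
  qed
  show ?thesis
  proof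
    fix j
    have "\<bar>x t j - y t j\<bar> \<le> 0"
      by (rule LIMSEQ_le_const[OF power_over_fact_tendsto_0]) (use *[OF t] in auto)
    then show "x t j = y t j" by simp
  qed
qed

end

section \<open>Translations and shifts\<close>

lemma K_translate: "translate m u \<in> K n \<longleftrightarrow> u \<in> K n"
  by (simp add: K_def translate_def)

lemma K_shift: "u \<in> K n \<Longrightarrow> Tshift_power k u \<in> K n"
  by (simp add: K_def Tshift_power_def) (metis add_diff_eq diff_add_eq)

lemma Tshift_eq_power: "Tshift = Tshift_power 1"
  by (simp add: Tshift_def Tshift_power_def fun_eq_iff)

lemma Tshift_power_add: "Tshift_power k (Tshift_power l u) = Tshift_power (k + l) u"
  by (simp add: Tshift_power_def algebra_simps)

lemma translate_add: "translate k (translate l u) = translate (k + l) u"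
  by (simp add: translate_def algebra_simps)

lemma translate_0 [simp]: "translate 0 u = u" and Tshift_power_0 [simp]: "Tshift_power 0 u = u"
  by (simp_all add: translate_def Tshift_power_def)

lemma translate_shift: "translate m (Tshift_power k u) = Tshift_power k (translate m u)"
  by (simp add: translate_def Tshift_power_def)

lemma translate_mono_iff [simp]: "translate m u \<le> translate m v \<longleftrightarrow> u \<le> v"
  by (simp add: translate_def le_fun_def)

lemma shift_mono_iff [simp]: "Tshift_power k u \<le> Tshift_power k v \<longleftrightarrow> u \<le> v"
proof
  show "Tshift_power k u \<le> Tshift_power k v \<Longrightarrow> u \<le> v"
    unfolding le_fun_def Tshift_power_def by (metis add_diff_cancel_right')
qed (simp add: Tshift_power_def le_fun_def)

section \<open>Existence of solutions\<close>

lemma integral_power_over_fact: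
  fixes c C t :: real
  assumes "0 \<le> t"
  shows "((\<lambda>s. c * (C * (c * s) ^ k / fact k)) has_integral C * (c * t) ^ Suc k / fact (Suc k)) {0..t}"
proof -
  have "((\<lambda>s. c * (C * (c * s) ^ k / fact k)) has_integral
     C * (c * t) ^ Suc k / fact (Suc k) - C * (c * 0) ^ Suc k / fact (Suc k)) {0..t}"
    by (rule fundamental_theorem_of_calculus[OF assms])
      (simp only: has_real_derivative_power_over_fact has_real_derivative_iff_has_vector_derivative[symmetric])
  then show ?thesis by simp
qed

context fk_chain
begin

lemma f_continuous_on:
  assumes "\<And>i. continuous_on S (\<lambda>s. x s i)"
  shows "continuous_on S (\<lambda>s. f (x s) j)"
proof -
  have c: "continuous_on S (\<lambda>s. g (x s a) (x s b))" if "C1_plane g" for g a b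
    using continuous_on_compose2[OF C1_plane_continuous[OF that] continuous_on_Pair[OF assms assms], of a b]
    by simp
  show ?thesis
    unfolding vfield_def by (intro continuous_intros c C1s)
qed

text \<open>The added multiple of \<open>u j\<close> makes the field nondecreasing in each of its
  three arguments. A solution satisfies
  \<open>(exp (L * t) * x t j)' = exp (L * t) * damped n (x t) j\<close> with
  \<open>L = field_lip n\<close>, which is the integral equation iterated below.\<close>

definition damped :: "nat \<Rightarrow> config \<Rightarrow> config" where
  "damped n u = (\<lambda>j. field_lip n * u j + f u j)"

lemma damped_difference:
  assumes "u \<in> K n" "v \<in> K n"
  shows "\<exists>a b c. 0 \<le> a \<and> 0 \<le> b \<and> 0 \<le> c \<and> a + b + c \<le> 4 * field_lip n \<and>
    damped n u j - damped n v j = a * (u (j - 1) - v (j - 1)) + b * (u j - v j) + c * (u (j + 1) - v (j + 1))"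
proof -
  obtain \<alpha> \<beta> \<gamma> where c: "\<delta> \<le> \<alpha>" "\<alpha> \<le> field_lip n" "\<bar>\<beta>\<bar> \<le> field_lip n" "\<delta> \<le> \<gamma>" "\<gamma> \<le> field_lip n"
     "f u j - f v j = \<alpha> * (u (j - 1) - v (j - 1)) + \<beta> * (u j - v j) + \<gamma> * (u (j + 1) - v (j + 1))"
    using field_difference[OF assms] by blast
  have "damped n u j - damped n v j = (f u j - f v j) + field_lip n * (u j - v j)"
    by (simp add: damped_def algebra_simps)
  then have "damped n u j - damped n v j = \<alpha> * (u (j - 1) - v (j - 1)) + (field_lip n + \<beta>) * (u j - v j) + \<gamma> * (u (j + 1) - v (j + 1))"
    unfolding c(6) by (simp add: algebra_simps)
  then show ?thesis using c delta_pos
    by (intro exI[of _ \<alpha>] exI[of _ "field_lip n + \<beta>"] exI[of _ \<gamma>]) auto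
qed

lemma damped_abs_le:
  assumes "u \<in> K n" "v \<in> K n" "\<And>i. \<bar>u i - v i\<bar> \<le> M"
  shows "\<bar>damped n u j - damped n v j\<bar> \<le> 4 * field_lip n * M"
proof -
  obtain a b c where *: "0 \<le> a" "0 \<le> b" "0 \<le> c" "a + b + c \<le> 4 * field_lip n"
    "damped n u j - damped n v j = a * (u (j - 1) - v (j - 1)) + b * (u j - v j) + c * (u (j + 1) - v (j + 1))"
    using damped_difference[OF assms(1,2)] by blast
  have M: "0 \<le> M" using assms(3)[of 0] by linarith
  have "\<bar>damped n u j - damped n v j\<bar> \<le> \<bar>a\<bar> * \<bar>u (j - 1) - v (j - 1)\<bar> + \<bar>b\<bar> * \<bar>u j - v j\<bar> + \<bar>c\<bar> * \<bar>u (j + 1) - v (j + 1)\<bar>"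
    unfolding *(5) abs_mult[symmetric] by linarith
  also have "\<dots> \<le> a * M + b * M + c * M"
    using * assms(3) by (intro add_mono mult_mono) auto
  also have "\<dots> = (a + b + c) * M" by (simp add: algebra_simps)
  also have "\<dots> \<le> 4 * field_lip n * M" using * M by (intro mult_right_mono) auto
  finally show ?thesis .
qed

lemma damped_mono:
  assumes "u \<in> K n" "v \<in> K n" "u \<le> v"
  shows "damped n u j \<le> damped n v j"
proof -
  obtain a b c where *: "0 \<le> a" "0 \<le> b" "0 \<le> c"
    "damped n v j - damped n u j = a * (v (j - 1) - u (j - 1)) + b * (v j - u j) + c * (v (j + 1) - u (j + 1))"
    using damped_difference[OF assms(2,1)] by blast
  have "0 \<le> damped n v j - damped n u j" unfolding *(4) using * assms(3) by (simp add: le_fun_def)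
  then show ?thesis by simp
qed

text \<open>Membership in \<open>K n\<close> means that the shifted configuration lies between the
  translates of \<open>u\<close> by \<open>- n\<close> and by \<open>n\<close>. The damped field
  preserves this order, and a translation by \<open>m\<close> adds exactly
  \<open>field_lip n * m\<close> to it.\<close>

lemma damped_spacing:
  assumes u: "u \<in> K n"
  shows "\<bar>damped n u (j + 1) - damped n u j\<bar> \<le> field_lip n * real n"
proof -
  let ?v = "Tshift_power (-1) u"
  have v: "?v \<in> K n" by (rule K_shift[OF u])
  have tr: "damped n (translate m w) j = damped n w j + field_lip n * real_of_int m" for m w
    by (simp add: damped_def f_translate) (simp add: translate_def algebra_simps)
  have "damped n ?v j = damped n u (j + 1)"
    by (simp add: damped_def f_shift) (simp add: Tshift_power_def)
  moreover have "damped n ?v j \<le> damped n (translate (int n) u) j"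
  proof (rule damped_mono[OF v])
    show "?v \<le> translate (int n) u"
      unfolding le_fun_def translate_def Tshift_power_def using K_D[OF u] by (auto simp: abs_le_iff algebra_simps)
  qed (use u in \<open>simp add: K_translate\<close>)
  moreover have "damped n (translate (- int n) u) j \<le> damped n ?v j"
  proof (rule damped_mono[OF _ v])
    show "translate (- int n) u \<le> ?v"
      unfolding le_fun_def translate_def Tshift_power_def using K_D[OF u] by (auto simp: abs_le_iff algebra_simps)
  qed (use u in \<open>simp add: K_translate\<close>)
  ultimately show ?thesis by (simp add: tr abs_le_iff)
qed

text \<open>Picard iteration in variation-of-constants form: every iterate is a convex average of
  configurations of \<open>K n\<close>, so no cut-off of the field outside \<open>K n\<close> is needed.\<close>

primrec picard :: "nat \<Rightarrow> config \<Rightarrow> nat \<Rightarrow> real \<Rightarrow> config" where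
  "picard n u 0 = (\<lambda>t. u)"
| "picard n u (Suc k) = (\<lambda>t j. exp (- (field_lip n * t)) * (u j + integral {0..t} (\<lambda>s. exp (field_lip n * s) * damped n (picard n u k s) j)))"

lemma damped_continuous_on:
  assumes "\<And>i. continuous_on S (\<lambda>s. x s i)"
  shows "continuous_on S (\<lambda>s. damped n (x s) j)"
  unfolding damped_def by (intro continuous_intros f_continuous_on assms)

lemma continuous_on_atLeastI:
  fixes g :: "real \<Rightarrow> real"
  assumes "\<And>T. continuous_on {a..T} g"
  shows "continuous_on {a..} g"
  unfolding continuous_on_eq_continuous_within
proof
  fix t assume t: "t \<in> {a..}"
  have "continuous (at t within {a..t + 1}) g"
    using assms[of "t + 1"] t by (simp add: continuous_on_eq_continuous_within)
  moreover have "at t within {a..t + 1} = at t within {a..}"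
    by (rule at_within_nhd[of t "{..<t + 1}"]) auto
  ultimately show "continuous (at t within {a..}) g" by simp
qed

lemma picard_continuous: "continuous_on {0..} (\<lambda>t. picard n u k t j)"
proof (induction k arbitrary: j)
  case (Suc k)
  have c: "continuous_on {0..T} (\<lambda>s. exp (field_lip n * s) * damped n (picard n u k s) j)" for T
    by (intro continuous_intros damped_continuous_on continuous_on_subset[OF Suc]) auto
  show ?case
    by (rule continuous_on_atLeastI)
      (auto intro!: continuous_intros indefinite_integral_continuous_1 integrable_continuous_real c)
qed auto

lemma picard_integrand:
  "(\<lambda>s. exp (field_lip n * s) * damped n (picard n u k s) j) integrable_on {0..T}"
  by (intro integrable_continuous_real continuous_intros damped_continuous_on continuous_on_subset[OF picard_continuous]) auto

lemma exp_weight_integral: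
  fixes M :: real
  assumes "0 \<le> t"
  shows "((\<lambda>s. exp (L * s) * (L * M)) has_integral exp (L * t) * M - M) {0..t}"
proof -
  have "((\<lambda>s. exp (L * s) * M) has_real_derivative exp (L * s) * (L * M)) (at s within {0..t})" for s
    by (auto intro!: derivative_eq_intros)
  then have "((\<lambda>s. exp (L * s) * (L * M)) has_integral exp (L * t) * M - exp (L * 0) * M) {0..t}"
    by (intro fundamental_theorem_of_calculus[OF assms]) (simp only: has_real_derivative_iff_has_vector_derivative[symmetric])
  then show ?thesis by simp
qed

text \<open>The spacing of the integrand is at most \<open>exp (L * s) * L * n\<close> with
  \<open>L = field_lip n\<close>. Together with the initial spacing \<open>n\<close> it integrates
  to \<open>exp (L * t) * n\<close>, and the prefactor cancels the exponential exactly, so the bound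
  does not deteriorate from one iterate to the next.\<close>

lemma picard_K:
  assumes "u \<in> K n" "0 \<le> t"
  shows "picard n u k t \<in> K n"
  using assms(2)
proof (induction k arbitrary: t)
  case 0
  show ?case using assms by simp
next
  case (Suc k)
  have "\<bar>picard n u (Suc k) t (j + 1) - picard n u (Suc k) t j\<bar> \<le> real n" for j
  proof -
    let ?I = "\<lambda>j. integral {0..t} (\<lambda>s. exp (field_lip n * s) * damped n (picard n u k s) j)"
    let ?D = "integral {0..t} (\<lambda>s. exp (field_lip n * s) * (damped n (picard n u k s) (j + 1) - damped n (picard n u k s) j))"
    have D: "?I (j + 1) - ?I j = ?D"
      by (subst integral_diff[symmetric]) (simp_all only: picard_integrand right_diff_distrib)
    have "norm ?D \<le> integral {0..t} (\<lambda>s. exp (field_lip n * s) * (field_lip n * real n))"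
    proof (rule integral_norm_bound_integral)
      show "(\<lambda>s. exp (field_lip n * s) * (damped n (picard n u k s) (j + 1) - damped n (picard n u k s) j)) integrable_on {0..t}"
        using integrable_diff[OF picard_integrand[where j = "j + 1" and T = t] picard_integrand[where j = j and T = t]]
        by (simp only: right_diff_distrib)
      show "(\<lambda>s. exp (field_lip n * s) * (field_lip n * real n)) integrable_on {0..t}"
        using exp_weight_integral[OF Suc.prems] by (rule has_integral_integrable)
      fix s assume "s \<in> {0..t}"
      then show "norm (exp (field_lip n * s) * (damped n (picard n u k s) (j + 1) - damped n (picard n u k s) j)) \<le> exp (field_lip n * s) * (field_lip n * real n)"
        using damped_spacing[OF Suc.IH[of s], of j] by (simp add: abs_mult)
    qed
    then have "\<bar>?D\<bar> \<le> exp (field_lip n * t) * real n - real n"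
      by (simp only: real_norm_def integral_unique[OF exp_weight_integral[OF Suc.prems]])
    then have "\<bar>(u (j + 1) - u j) + (?I (j + 1) - ?I j)\<bar> \<le> exp (field_lip n * t) * real n"
      unfolding D using K_D[OF assms(1), of j] by linarith
    then have "exp (- (field_lip n * t)) * \<bar>(u (j + 1) - u j) + (?I (j + 1) - ?I j)\<bar> \<le> exp (- (field_lip n * t)) * (exp (field_lip n * t) * real n)"
      by (rule mult_left_mono) simp
    also have "\<dots> = real n" by (simp add: mult.assoc[symmetric] exp_add[symmetric])
    finally have "\<bar>exp (- (field_lip n * t)) * ((u (j + 1) - u j) + (?I (j + 1) - ?I j))\<bar> \<le> real n"
      by (simp add: abs_mult)
    moreover have "picard n u (Suc k) t (j + 1) - picard n u (Suc k) t j = exp (- (field_lip n * t)) * ((u (j + 1) - u j) + (?I (j + 1) - ?I j))"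
      unfolding picard.simps by (simp only: right_diff_distrib distrib_left)
    ultimately show ?thesis by (simp only:)
  qed
  then show ?case by (simp add: K_def)
qed

lemma weighted_integral_le:
  fixes h :: "real \<Rightarrow> real"
  assumes "0 \<le> t" "continuous_on {0..t} h" "(g has_integral G) {0..t}" "\<And>s. 0 \<le> s \<Longrightarrow> s \<le> t \<Longrightarrow> \<bar>h s\<bar> \<le> g s"
  shows "\<bar>exp (- (field_lip n * t)) * integral {0..t} (\<lambda>s. exp (field_lip n * s) * h s)\<bar> \<le> G"
proof -
  have "norm (integral {0..t} (\<lambda>s. exp (- (field_lip n * t)) * (exp (field_lip n * s) * h s))) \<le> integral {0..t} g"
  proof (rule integral_norm_bound_integral)
    show "(\<lambda>s. exp (- (field_lip n * t)) * (exp (field_lip n * s) * h s)) integrable_on {0..t}"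
      by (intro integrable_continuous_real continuous_intros assms)
    show "g integrable_on {0..t}" using assms(3) by (rule has_integral_integrable)
    fix s assume s: "s \<in> {0..t}"
    have "exp (- (field_lip n * t)) * exp (field_lip n * s) = exp (field_lip n * (s - t))"
      unfolding exp_add[symmetric] by (simp add: algebra_simps)
    then have "exp (- (field_lip n * t)) * (exp (field_lip n * s) * \<bar>h s\<bar>) = exp (field_lip n * (s - t)) * \<bar>h s\<bar>"
      by (simp add: mult.assoc[symmetric])
    also have "\<dots> \<le> 1 * \<bar>h s\<bar>"
      using s field_lip_pos[of n] by (intro mult_right_mono) (auto simp: mult_nonneg_nonpos)
    finally show "norm (exp (- (field_lip n * t)) * (exp (field_lip n * s) * h s)) \<le> g s"
      using assms(4)[of s] s by (simp add: abs_mult)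
  qed
  then show ?thesis using integral_unique[OF assms(3)] by simp
qed

text \<open>The factor \<open>field_bound n / (4 * field_lip n)\<close> normalises the bound for
  \<open>k = 0\<close> to \<open>field_bound n * t\<close>, the distance that can be covered at
  maximal speed. Each further iterate integrates once more with the Lipschitz constant
  \<open>4 * field_lip n\<close> of the damped field.\<close>

definition picard_bound :: "nat \<Rightarrow> real \<Rightarrow> nat \<Rightarrow> real" where
  "picard_bound n t k = field_bound n / (4 * field_lip n) * (4 * field_lip n * t) ^ Suc k / fact (Suc k)"

lemma picard_step:
  assumes u: "u \<in> K n" and t: "0 \<le> t"
  shows "\<bar>picard n u (Suc k) t j - picard n u k t j\<bar> \<le> picard_bound n t k"
  using t
proof (induction k arbitrary: t j)
  case 0
  \<comment> \<open>The damping part of the integrand is integrated in closed form. After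
    multiplication with the prefactor it restores \<open>u j\<close> up to the term already present,
    so that only the true field contributes to the first increment.\<close>
  have I: "integral {0..t} (\<lambda>s. exp (field_lip n * s) * damped n u j) = integral {0..t} (\<lambda>s. exp (field_lip n * s) * f u j) + (exp (field_lip n * t) * u j - u j)"
  proof -
    have "integral {0..t} (\<lambda>s. exp (field_lip n * s) * damped n u j) = integral {0..t} (\<lambda>s. exp (field_lip n * s) * f u j + exp (field_lip n * s) * (field_lip n * u j))"
      by (simp add: damped_def algebra_simps)
    also have "\<dots> = integral {0..t} (\<lambda>s. exp (field_lip n * s) * f u j) + integral {0..t} (\<lambda>s. exp (field_lip n * s) * (field_lip n * u j))"
      by (intro Henstock_Kurzweil_Integration.integral_add integrable_continuous_real continuous_intros)
    also have "integral {0..t} (\<lambda>s. exp (field_lip n * s) * (field_lip n * u j)) = exp (field_lip n * t) * u j - u j"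
      by (rule integral_unique[OF exp_weight_integral[OF 0]])
    finally show ?thesis .
  qed
  have "exp (- (field_lip n * t)) * (exp (field_lip n * t) * u j) = u j" by (simp add: mult.assoc[symmetric] exp_add[symmetric])
  then have eq: "picard n u (Suc 0) t j - picard n u 0 t j = exp (- (field_lip n * t)) * integral {0..t} (\<lambda>s. exp (field_lip n * s) * f u j)"
    unfolding picard.simps I by (simp add: algebra_simps)
  have "\<bar>exp (- (field_lip n * t)) * integral {0..t} (\<lambda>s. exp (field_lip n * s) * f u j)\<bar> \<le> picard_bound n t 0"
  proof (rule weighted_integral_le[OF 0])
    show "((\<lambda>s. 4 * field_lip n * (field_bound n / (4 * field_lip n) * (4 * field_lip n * s) ^ 0 / fact 0)) has_integral picard_bound n t 0) {0..t}"
      unfolding picard_bound_def by (rule integral_power_over_fact[OF 0])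
    show "\<bar>f u j\<bar> \<le> 4 * field_lip n * (field_bound n / (4 * field_lip n) * (4 * field_lip n * s) ^ 0 / fact 0)" for s
      using field_bounded[OF u] field_lip_pos[of n] by simp
  qed auto
  then show ?case unfolding eq .
next
  case (Suc k)
  let ?h = "\<lambda>s. damped n (picard n u (Suc k) s) j - damped n (picard n u k s) j"
  have S: "picard n u (Suc i) t j = exp (- (field_lip n * t)) * (u j + integral {0..t} (\<lambda>s. exp (field_lip n * s) * damped n (picard n u i s) j))" for i
    by simp
  have D: "integral {0..t} (\<lambda>s. exp (field_lip n * s) * ?h s) = integral {0..t} (\<lambda>s. exp (field_lip n * s) * damped n (picard n u (Suc k) s) j)
      - integral {0..t} (\<lambda>s. exp (field_lip n * s) * damped n (picard n u k s) j)"
    unfolding right_diff_distrib by (rule integral_diff[OF picard_integrand picard_integrand])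
  have eq: "picard n u (Suc (Suc k)) t j - picard n u (Suc k) t j = exp (- (field_lip n * t)) * integral {0..t} (\<lambda>s. exp (field_lip n * s) * ?h s)"
    unfolding S[of "Suc k"] S[of k] D by (simp only: right_diff_distrib distrib_left)
  have "\<bar>exp (- (field_lip n * t)) * integral {0..t} (\<lambda>s. exp (field_lip n * s) * ?h s)\<bar> \<le> picard_bound n t (Suc k)"
  proof (rule weighted_integral_le[OF Suc.prems])
    show "continuous_on {0..t} ?h"
      by (intro continuous_intros damped_continuous_on continuous_on_subset[OF picard_continuous]) auto
    show "((\<lambda>s. 4 * field_lip n * (field_bound n / (4 * field_lip n) * (4 * field_lip n * s) ^ Suc k / fact (Suc k))) has_integral picard_bound n t (Suc k)) {0..t}"
      unfolding picard_bound_def by (rule integral_power_over_fact[OF Suc.prems])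
    show "\<bar>?h s\<bar> \<le> 4 * field_lip n * (field_bound n / (4 * field_lip n) * (4 * field_lip n * s) ^ Suc k / fact (Suc k))" if "0 \<le> s" "s \<le> t" for s
      using damped_abs_le[OF picard_K[OF u that(1)] picard_K[OF u that(1)] Suc.IH[OF that(1)]] unfolding picard_bound_def .
  qed
  then show ?case unfolding eq .
qed

lemma picard_bound_mono: "0 \<le> s \<Longrightarrow> s \<le> t \<Longrightarrow> picard_bound n s k \<le> picard_bound n t k"
  using field_lip_pos[of n] field_bound_pos[of n] unfolding picard_bound_def
  by (intro divide_right_mono mult_left_mono power_mono) auto

lemma picard_bound_summable: "summable (picard_bound n t)"
proof -
  have "summable (\<lambda>k. field_bound n / (4 * field_lip n) * (inverse (fact (Suc k)) * (4 * field_lip n * t) ^ Suc k))"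
    by (intro summable_mult) (rule summable_Suc_iff[THEN iffD2, OF summable_exp[of "4 * field_lip n * t"]])
  then show ?thesis unfolding picard_bound_def by (simp only: divide_inverse mult_ac)
qed

lemma picard_limit_ex:
  assumes u: "u \<in> K n"
  shows "\<exists>x. \<forall>T j. uniform_limit {0..T} (\<lambda>k t. picard n u k t j) (\<lambda>t. x t j) sequentially"
proof -
  define x where "x t j = u j + (\<Sum>k. picard n u (Suc k) t j - picard n u k t j)" for t j
  have b: "norm (picard n u (Suc k) t j - picard n u k t j) \<le> picard_bound n T k" if "t \<in> {0..T}" for k t T j
    using picard_step[OF u, of t k j] picard_bound_mono[of t T n k] that unfolding real_norm_def atLeastAtMost_iff by linarith
  have "uniform_limit {0..T} (\<lambda>k t. \<Sum>i<k. picard n u (Suc i) t j - picard n u i t j) (\<lambda>t. \<Sum>i. picard n u (Suc i) t j - picard n u i t j) sequentially" for T j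
    by (rule Weierstrass_m_test[OF b picard_bound_summable[of n T]])
  moreover have "(\<Sum>i<k. picard n u (Suc i) t j - picard n u i t j) = picard n u k t j - u j" for k t j
    by (induction k) auto
  ultimately have "uniform_limit {0..T} (\<lambda>k t. u j + (picard n u k t j - u j)) (\<lambda>t. x t j) sequentially" for T j
    unfolding x_def by (intro uniform_limit_intros) (simp_all only:)
  then show ?thesis by (intro exI[of _ x]) simp
qed

text \<open>The iterates converge locally uniformly in time at each site. Since the field at
  \<open>j\<close> sees only three sites, the integrands converge uniformly as well, and the limit
  satisfies the integral equation, which is then differentiated. Uniformity in \<open>j\<close> is
  not involved.\<close>

lemma solK_exists:
  assumes u: "u \<in> K n"
  shows "\<exists>x. solK n x \<and> x 0 = u"
proof -
  obtain x where lim: "\<And>T j. uniform_limit {0..T} (\<lambda>k t. picard n u k t j) (\<lambda>t. x t j) sequentially"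
    using picard_limit_ex[OF u] by blast
  have plim: "(\<lambda>k. picard n u k t j) \<longlonglongrightarrow> x t j" if "0 \<le> t" for t j
    by (rule tendsto_uniform_limitI[OF lim[where T = t and j = j]]) (use that in auto)
  have cont: "continuous_on {0..T} (\<lambda>t. x t j)" for T j
    by (rule uniform_limit_theorem[OF _ lim]) (auto intro!: always_eventually continuous_on_subset[OF picard_continuous])
  have xK: "x t \<in> K n" if t: "0 \<le> t" for t
    unfolding K_def
  proof (intro CollectI allI)
    fix i
    have "(\<lambda>k. \<bar>picard n u k t (i + 1) - picard n u k t i\<bar>) \<longlonglongrightarrow> \<bar>x t (i + 1) - x t i\<bar>"
      by (intro tendsto_intros plim t)
    then show "\<bar>x t (i + 1) - x t i\<bar> \<le> real n"
      by (rule LIMSEQ_le_const2) (use K_D[OF picard_K[OF u t]] in auto)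
  qed
  have Hc: "continuous_on {0..T} (\<lambda>s. exp (field_lip n * s) * damped n (x s) j)" for T j
    by (intro continuous_intros damped_continuous_on cont)
  have eq: "x t j = exp (- (field_lip n * t)) * (u j + integral {0..t} (\<lambda>s. exp (field_lip n * s) * damped n (x s) j))"
    if t: "0 \<le> t" for t j
  proof -
    have "uniform_limit {0..t} (\<lambda>k s. damped n (picard n u k s) j) (\<lambda>s. damped n (x s) j) sequentially"
    proof (rule uniform_limitI)
      fix e :: real assume e: "0 < e"
      have "\<forall>\<^sub>F k in sequentially. \<forall>i\<in>{j-1..j+1}. \<forall>s\<in>{0..t}. dist (picard n u k s i) (x s i) < e / (12 * field_lip n + 1)"
        using field_lip_pos[of n] e by (intro eventually_ball_finite ballI uniform_limitD[OF lim]) auto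
      then show "\<forall>\<^sub>F k in sequentially. \<forall>s\<in>{0..t}. dist (damped n (picard n u k s) j) (damped n (x s) j) < e"
      proof eventually_elim
        case (elim k)
        show ?case
        proof
          fix s assume s: "s \<in> {0..t}"
          \<comment> \<open>Any positive \<open>d\<close> with
            \<open>4 * field_lip n * d < e\<close> works, because the three coefficients of the
            damped field sum to at most \<open>4 * field_lip n\<close>.\<close>
          define d where "d = e / (12 * field_lip n + 1)"
          have d: "d > 0" using e field_lip_pos[of n] by (simp add: d_def)
          have near: "\<bar>picard n u k s (j - 1) - x s (j - 1)\<bar> \<le> d" "\<bar>picard n u k s j - x s j\<bar> \<le> d" "\<bar>picard n u k s (j + 1) - x s (j + 1)\<bar> \<le> d"
            using elim[rule_format, OF _ s, of "j - 1"] elim[rule_format, OF _ s, of j] elim[rule_format, OF _ s, of "j + 1"]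
            by (auto simp: dist_real_def d_def)
          obtain a b c where *: "0 \<le> a" "0 \<le> b" "0 \<le> c" "a + b + c \<le> 4 * field_lip n"
            "damped n (picard n u k s) j - damped n (x s) j = a * (picard n u k s (j - 1) - x s (j - 1)) + b * (picard n u k s j - x s j) + c * (picard n u k s (j + 1) - x s (j + 1))"
            using damped_difference[OF picard_K[OF u] xK, of s s k j] s by auto
          have "\<bar>damped n (picard n u k s) j - damped n (x s) j\<bar> \<le> \<bar>a\<bar> * \<bar>picard n u k s (j - 1) - x s (j - 1)\<bar> + \<bar>b\<bar> * \<bar>picard n u k s j - x s j\<bar> + \<bar>c\<bar> * \<bar>picard n u k s (j + 1) - x s (j + 1)\<bar>"
            unfolding *(5) abs_mult[symmetric] by linarith
          also have "\<dots> \<le> a * d + b * d + c * d" using * near by (intro add_mono mult_mono) auto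
          also have "\<dots> = (a + b + c) * d" by (simp add: algebra_simps)
          also have "\<dots> \<le> (4 * field_lip n) * d" using * d by (intro mult_right_mono) auto
          also have "\<dots> < (12 * field_lip n + 1) * d" using d field_lip_pos[of n] by (intro mult_strict_right_mono) auto
          also have "\<dots> = e" using field_lip_pos[of n] by (simp add: d_def)
          finally show "dist (damped n (picard n u k s) j) (damped n (x s) j) < e" by (simp add: dist_real_def)
        qed
      qed
    qed
    note ulim = this
    have "uniform_limit {0..t} (\<lambda>k s. exp (field_lip n * s) * damped n (picard n u k s) j) (\<lambda>s. exp (field_lip n * s) * damped n (x s) j) sequentially"
      by (rule uniform_lim_mult[OF uniform_limit_const ulim])
        (auto intro!: compact_imp_bounded compact_continuous_image continuous_intros damped_continuous_on cont)
    from uniform_limit_integral[OF this]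
    obtain I J where I: "\<And>k. ((\<lambda>s. exp (field_lip n * s) * damped n (picard n u k s) j) has_integral I k) {0..t}"
      and J: "((\<lambda>s. exp (field_lip n * s) * damped n (x s) j) has_integral J) {0..t}" and "I \<longlonglongrightarrow> J"
      using damped_continuous_on[OF continuous_on_subset[OF picard_continuous]] by (force intro!: continuous_intros)
    have "(\<lambda>k. exp (- (field_lip n * t)) * (u j + I k)) \<longlonglongrightarrow> exp (- (field_lip n * t)) * (u j + J)"
      by (intro tendsto_intros \<open>I \<longlonglongrightarrow> J\<close>)
    moreover have "exp (- (field_lip n * t)) * (u j + I k) = picard n u (Suc k) t j" for k
      using integral_unique[OF I[of k]] by simp
    ultimately have "(\<lambda>k. picard n u (Suc k) t j) \<longlonglongrightarrow> exp (- (field_lip n * t)) * (u j + J)" by simp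
    moreover have "(\<lambda>k. picard n u (Suc k) t j) \<longlonglongrightarrow> x t j"
      by (rule LIMSEQ_Suc[OF plim[OF t]])
    ultimately show ?thesis using integral_unique[OF J] LIMSEQ_unique by metis
  qed
  have der: "((\<lambda>s. x s j) has_real_derivative f (x t) j) (at t within {0..})" if t: "0 \<le> t" for t j
  proof -
    let ?G = "\<lambda>t. integral {0..t} (\<lambda>s. exp (field_lip n * s) * damped n (x s) j)"
    have "((\<lambda>t. integral {0..t} (\<lambda>s. exp (field_lip n * s) * damped n (x s) j)) has_real_derivative exp (field_lip n * t) * damped n (x t) j) (at t within {0..t+1})"
      by (rule integral_has_real_derivative[OF Hc]) (use t in auto)
    then have "((\<lambda>t. exp (- (field_lip n * t)) * (u j + ?G t)) has_real_derivative
        exp (- (field_lip n * t)) * (exp (field_lip n * t) * damped n (x t) j) + - field_lip n * (exp (- (field_lip n * t)) * (u j + ?G t))) (at t within {0..t+1})"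
      by (auto intro!: derivative_eq_intros)
    also have "exp (- (field_lip n * t)) * (exp (field_lip n * t) * damped n (x t) j) + - field_lip n * (exp (- (field_lip n * t)) * (u j + ?G t)) = f (x t) j"
      unfolding eq[OF t, symmetric] by (simp add: mult.assoc[symmetric] exp_add[symmetric] damped_def)
    finally have "((\<lambda>t. x t j) has_real_derivative f (x t) j) (at t within {0..t+1})"
      by (rule has_field_derivative_transform_within[where d = 1]) (use t eq in auto)
    moreover have "at t within {0..t + 1} = at t within {0..}"
      by (rule at_within_nhd[of t "{..<t + 1}"]) auto
    ultimately show ?thesis by simp
  qed
  have "x 0 = u" using eq[of 0] by auto
  then show ?thesis using xK der by (auto simp: solK_def)
qed

section \<open>The semiflow, its symmetries and its continuity\<close>

abbreviation "\<phi> \<equiv> flow V F"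

lemma flow_solK_eq:
  assumes "solK n x" "0 \<le> t"
  shows "\<phi> t (x 0) = x t"
  unfolding flow_def
proof (rule the_equality)
  show "\<exists>y. solution V F y \<and> y 0 = x 0 \<and> y t = x t"
    using assms by (auto simp: solution_iff_solK)
  show "w = x t" if "\<exists>y. solution V F y \<and> y 0 = x 0 \<and> y t = w" for w
    using that solK_unique[OF _ assms(1)] assms(2) by (auto simp: solution_iff_solK)
qed

lemma flow_solK:
  assumes "u \<in> K n"
  shows "solK n (\<lambda>t. \<phi> t u)"
proof -
  obtain x where x: "solK n x" "x 0 = u" using solK_exists[OF assms] by blast
  have eq: "\<phi> t u = x t" if "0 \<le> t" for t using flow_solK_eq[OF x(1) that] x(2) by simp
  have "((\<lambda>s. \<phi> s u j) has_real_derivative f (\<phi> t u) j) (at t within {0..})" if "0 \<le> t" for t j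
  proof -
    have "((\<lambda>s. x s j) has_real_derivative f (\<phi> t u) j) (at t within {0..})"
      using solK_deriv[OF x(1) that order_refl] eq[OF that] by simp
    then show ?thesis
      by (rule has_field_derivative_transform_within[where d = 1]) (use that eq in auto)
  qed
  then show ?thesis using solK_K[OF x(1)] eq by (auto simp: solK_def)
qed

lemma flow_K: "u \<in> K n \<Longrightarrow> 0 \<le> t \<Longrightarrow> \<phi> t u \<in> K n"
  using solK_K[OF flow_solK] .

lemma flow_0: "u \<in> K n \<Longrightarrow> \<phi> 0 u = u"
  using solK_exists[of u n] flow_solK_eq[of n _ 0] by auto

lemma flow_unique:
  assumes "solK n x" "x 0 = u" "0 \<le> t"
  shows "\<phi> t u = x t"
  using flow_solK_eq[OF assms(1,3)] assms(2) by simp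

lemma solK_time_shift:
  assumes x: "solK n x" and s: "0 \<le> s"
  shows "solK n (\<lambda>t. x (s + t))"
proof -
  have "((\<lambda>r. x (s + r) j) has_real_derivative f (x (s + t)) j) (at t within {0..})" if t: "0 \<le> t" for t j
  proof -
    have "((\<lambda>s. x s j) has_real_derivative f (x (s + t)) j) (at (s + t) within (\<lambda>r. s + r) ` {0..})"
      by (rule solK_deriv[OF x]) (use s t in auto)
    moreover have "((\<lambda>r. s + r) has_real_derivative 1) (at t within {0..})"
      by (auto intro!: derivative_eq_intros)
    ultimately show ?thesis
      using DERIV_image_chain[of "\<lambda>s. x s j" "f (x (s + t)) j" "\<lambda>r. s + r" t "{0..}" 1] by (simp add: comp_def)
  qed
  then show ?thesis using solK_K[OF x] s by (auto simp: solK_def)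
qed

lemma flow_add:
  assumes "u \<in> K n" "0 \<le> s" "0 \<le> t"
  shows "\<phi> (s + t) u = \<phi> t (\<phi> s u)"
  using flow_unique[OF solK_time_shift[OF flow_solK[OF assms(1)] assms(2)] _ assms(3)] by simp

lemma flow_translate:
  assumes u: "u \<in> K n" and t: "0 \<le> t"
  shows "\<phi> t (translate m u) = translate m (\<phi> t u)"
proof (rule flow_unique[where n = n])
  show "solK n (\<lambda>t. translate m (\<phi> t u))"
    using flow_solK[OF u]
    unfolding solK_def f_translate
    by (auto simp: K_translate) (auto simp: translate_def intro!: derivative_eq_intros)
qed (use t flow_0[OF u] in auto)

lemma flow_shift:
  assumes u: "u \<in> K n" and t: "0 \<le> t"
  shows "\<phi> t (Tshift_power k u) = Tshift_power k (\<phi> t u)"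
proof (rule flow_unique[where n = n])
  show "solK n (\<lambda>t. Tshift_power k (\<phi> t u))"
    using flow_solK[OF u]
    unfolding solK_def f_shift
    by (auto intro: K_shift) (auto simp: Tshift_power_def)
qed (use t flow_0[OF u] in auto)

lemma flow_mono: "u \<in> K n \<Longrightarrow> v \<in> K n \<Longrightarrow> u \<le> v \<Longrightarrow> 0 \<le> t \<Longrightarrow> \<phi> t u \<le> \<phi> t v"
  using solK_mono_init[OF flow_solK flow_solK] by (simp add: flow_0)

lemma flow_strict_mono: "u \<in> K n \<Longrightarrow> v \<in> K n \<Longrightarrow> u \<le> v \<Longrightarrow> u \<noteq> v \<Longrightarrow> 0 < t \<Longrightarrow> \<phi> t u j < \<phi> t v j"
  using solK_strict_mono[OF flow_solK flow_solK] by (simp add: flow_0)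

lemma flow_inj: "u \<in> K n \<Longrightarrow> v \<in> K n \<Longrightarrow> 0 \<le> t \<Longrightarrow> \<phi> t u = \<phi> t v \<Longrightarrow> u = v"
  using solK_backward_unique[OF flow_solK flow_solK, of u n v t 0] by (simp add: flow_0)

lemma flow_lipschitz: "u \<in> K n \<Longrightarrow> 0 \<le> s \<Longrightarrow> 0 \<le> t \<Longrightarrow> \<bar>\<phi> t u j - \<phi> s u j\<bar> \<le> field_bound n * \<bar>t - s\<bar>"
  using solK_lipschitz[OF flow_solK, of u n s t j] solK_lipschitz[OF flow_solK, of u n t s j]
  by (cases "s \<le> t") (auto simp: abs_minus_commute)

lemma flow_continuous_time: "u \<in> K n \<Longrightarrow> continuous_on {0..} (\<lambda>t. \<phi> t u j)"
  unfolding continuous_on_eq_continuous_within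
  by (intro ballI DERIV_continuous[OF solK_deriv[OF flow_solK]]) auto

lemma flow_weighted_bound:
  assumes u: "u \<in> K n" and v: "v \<in> K n"
    and \<psi>: "\<And>j. 0 \<le> \<psi> j" "\<And>j. \<psi> (j - 1) \<le> 2 * \<psi> j" "\<And>j. \<psi> (j + 1) \<le> 2 * \<psi> j"
    and init: "\<And>j. \<bar>u j - v j\<bar> \<le> \<psi> j"
    and t: "0 \<le> t"
  shows "\<bar>\<phi> t u j - \<phi> t v j\<bar> \<le> \<psi> j * exp (5 * field_lip n * t)"
proof -
  have "u j - v j \<le> \<psi> j" "v j - u j \<le> \<psi> j" for j using init[of j] by linarith+
  then show ?thesis
    using solK_weighted_bound[OF flow_solK[OF u] flow_solK[OF v] \<psi> _ t, of j]
      solK_weighted_bound[OF flow_solK[OF v] flow_solK[OF u] \<psi> _ t, of j]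
    by (simp add: flow_0[OF u] flow_0[OF v] abs_le_iff)
qed

lemma flow_sup_bound:
  assumes "u \<in> K n" "v \<in> K n" "\<And>j. \<bar>u j - v j\<bar> \<le> c" "0 \<le> t"
  shows "\<bar>\<phi> t u j - \<phi> t v j\<bar> \<le> c * exp (5 * field_lip n * t)"
proof -
  have "0 \<le> c" using assms(3)[of 0] by linarith
  then show ?thesis using flow_weighted_bound[OF assms(1,2) _ _ _ assms(3,4), of j] by simp
qed

lemma isCont_coordinate: "isCont (\<lambda>u :: config. u i) u"
  by (rule continuous_on_interior[OF continuous_on_product_coordinates]) simp

text \<open>Finite propagation up to exponentially small errors: the weight \<open>\<eta> * 2\<^bsup>|i - j|\<^esup>\<close> dominates
  the difference of two configurations of \<open>K n\<close> that are close on a long window around \<open>j\<close>.\<close>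

lemma flow_continuous:
  assumes t: "0 \<le> t"
  shows "continuous_on (K n) (\<lambda>u. \<phi> t u j)"
  unfolding continuous_on
proof
  fix u assume u: "u \<in> K n"
  show "((\<lambda>v. \<phi> t v j) \<longlongrightarrow> \<phi> t u j) (at u within K n)"
  proof (rule tendstoI)
    fix e :: real assume e: "0 < e"
    \<comment> \<open>The value of the weight at \<open>j\<close> itself, chosen such that its
      growth up to time \<open>t\<close> leaves at most \<open>e / 2\<close>.\<close>
    define \<eta> where "\<eta> = min 1 (e / (2 * exp (5 * field_lip n * t)))"
    have \<eta>: "0 < \<eta>" "\<eta> \<le> 1" using e by (auto simp: \<eta>_def)
    \<comment> \<open>Configurations of \<open>K n\<close> that differ by at most 1 at
      \<open>j\<close> differ by at most \<open>1 + 2 * n * m\<close> at distance \<open>m\<close>.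
      Beyond some \<open>N\<close> the weight exceeds this linear growth without further assumptions
      on the configurations.\<close>
    have "(\<lambda>m. (1 + 2 * real n * real m) / 2 ^ m) \<longlonglongrightarrow> 0" by real_asymp
    then have "\<forall>\<^sub>F m in sequentially. (1 + 2 * real n * real m) / 2 ^ m < \<eta>"
      by (rule order_tendstoD) (rule \<eta>)
    then obtain N where "\<And>m. m \<ge> N \<Longrightarrow> (1 + 2 * real n * real m) / 2 ^ m < \<eta>"
      unfolding eventually_sequentially by blast
    then have N: "1 + 2 * real n * real m \<le> \<eta> * 2 ^ m" if "m \<ge> N" for m
      using that by (simp add: pos_divide_less_eq less_imp_le)
    have "\<forall>\<^sub>F v in at u within K n. \<forall>i\<in>{j - int N..j + int N}. dist (v i) (u i) < \<eta>"
    proof (intro eventually_ball_finite ballI)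
      fix i
      have "((\<lambda>v. v i) \<longlongrightarrow> u i) (at u within K n)"
        using isCont_coordinate[where i = i and u = u] unfolding isCont_def by (rule tendsto_within_subset) simp
      then show "\<forall>\<^sub>F v in at u within K n. dist (v i) (u i) < \<eta>"
        by (rule tendstoD) (rule \<eta>)
    qed simp
    moreover have "\<forall>\<^sub>F v in at u within K n. v \<in> K n"
      by (simp add: eventually_at_filter)
    ultimately show "\<forall>\<^sub>F v in at u within K n. dist (\<phi> t v j) (\<phi> t u j) < e"
    proof eventually_elim
      case (elim v)
      define \<psi> where "\<psi> i = \<eta> * 2 ^ nat \<bar>i - j\<bar>" for i
      have w: "\<psi> a \<le> 2 * \<psi> b" if "\<bar>a - b\<bar> = 1" for a b
      proof -
        have "(2::real) ^ nat \<bar>a - j\<bar> \<le> 2 ^ Suc (nat \<bar>b - j\<bar>)"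
          using that by (intro power_increasing) auto
        then have "\<eta> * 2 ^ nat \<bar>a - j\<bar> \<le> \<eta> * 2 ^ Suc (nat \<bar>b - j\<bar>)"
          using \<eta> by (intro mult_left_mono) auto
        then show ?thesis by (simp add: \<psi>_def)
      qed
      have b: "\<bar>v i - u i\<bar> \<le> \<psi> i" for i
      proof (cases "i \<in> {j - int N..j + int N}")
        case True
        then have "\<bar>v i - u i\<bar> < \<eta>" using elim(1) by (auto simp: dist_real_def)
        moreover have "\<eta> * 1 \<le> \<psi> i" unfolding \<psi>_def using \<eta> by (intro mult_left_mono) auto
        ultimately show ?thesis by simp
      next
        case False
        define m where "m = nat \<bar>i - j\<bar>"
        have m: "m \<ge> N" "real_of_int \<bar>i - j\<bar> = real m" using False by (auto simp: m_def)
        have "\<bar>v i - v j\<bar> \<le> real n * real m" "\<bar>u i - u j\<bar> \<le> real n * real m"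
          using K_diff[OF elim(2), of j "i - j"] K_diff[OF u, of j "i - j"] m by auto
        moreover have "\<bar>v j - u j\<bar> < \<eta>" using elim(1) by (auto simp: dist_real_def)
        ultimately have "\<bar>v i - u i\<bar> \<le> 1 + 2 * real n * real m" using \<eta> by linarith
        also note N[OF m(1)]
        finally show ?thesis by (simp add: \<psi>_def m_def)
      qed
      have "\<bar>\<phi> t v j - \<phi> t u j\<bar> \<le> \<psi> j * exp (5 * field_lip n * t)"
        by (rule flow_weighted_bound[OF elim(2) u _ _ _ b t]) (use \<eta> w in \<open>auto simp: \<psi>_def\<close>)
      also have "\<dots> \<le> (e / (2 * exp (5 * field_lip n * t))) * exp (5 * field_lip n * t)"
        by (intro mult_right_mono) (auto simp: \<psi>_def \<eta>_def)
      also have "\<dots> < e" using e by simp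
      finally show ?case by (simp add: dist_real_def)
    qed
  qed
qed

lemma flow_cls:
  assumes "u \<in> K n" "0 \<le> t"
  shows "\<phi> t ` cls u = cls (\<phi> t u)"
proof -
  have "\<phi> t ` cls u = range (\<lambda>m. \<phi> t (translate m u))"
    using cls_eq[OF K_imp_X[OF assms(1)]] by (auto simp: image_image)
  also have "\<dots> = range (\<lambda>m. translate m (\<phi> t u))"
    by (simp add: flow_translate[OF assms])
  also have "\<dots> = cls (\<phi> t u)"
    using cls_eq[OF K_imp_X[OF flow_K[OF assms]]] by simp
  finally show ?thesis .
qed

end

lemma shift_cls:
  assumes "u \<in> X"
  shows "Tshift_power k ` cls u = cls (Tshift_power k u)"
proof -
  obtain n where "u \<in> K n" using assms by (auto simp: X_def)
  then have "Tshift_power k u \<in> X" by (intro K_imp_X K_shift)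
  then show ?thesis
    using cls_eq[OF assms] cls_eq[of "Tshift_power k u"] by (auto simp: image_image translate_shift)
qed

lemma K_Tshift_iff: "Tshift u \<in> K n \<longleftrightarrow> u \<in> K n"
  using K_shift[of u n 1] K_shift[of "Tshift u" n "-1"] by (auto simp: Tshift_eq_power Tshift_power_def)

lemma continuous_coordinate: "continuous_on S (\<lambda>u :: config. u j)"
  by (rule continuous_on_subset[OF continuous_on_product_coordinates subset_UNIV])

section \<open>Sign changes\<close>

text \<open>A change is recorded at its left end, the last site before the intermediate zeros, even
  if the right end \<open>k\<close> lies outside the window under consideration. This makes the
  counts over adjacent half-open windows add up exactly.\<close>

definition sign_change_at :: "config \<Rightarrow> int \<Rightarrow> bool" where
  "sign_change_at w j \<longleftrightarrow> (\<exists>k>j. w j * w k < 0 \<and> (\<forall>i. j < i \<and> i < k \<longrightarrow> w i = 0))"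

definition sign_changes :: "config \<Rightarrow> int \<Rightarrow> int \<Rightarrow> nat" where
  "sign_changes w a b = card {j \<in> {a..<b}. sign_change_at w j}"

definition gap :: "config \<Rightarrow> int \<Rightarrow> int \<Rightarrow> bool" where
  "gap w p q \<longleftrightarrow> p < q \<and> w p \<noteq> 0 \<and> w q \<noteq> 0 \<and> (\<forall>i. p < i \<and> i < q \<longrightarrow> w i = 0)"

text \<open>A zero whose neighbours have strictly opposite signs is the discrete form of a
  transversal crossing. Every other zero, in particular one next to another zero, plays the part of
  a multiple root.\<close>

definition degenerate :: "config \<Rightarrow> int \<Rightarrow> int \<Rightarrow> bool" where
  "degenerate w a b \<longleftrightarrow> (\<exists>j. a < j \<and> j < b \<and> w j = 0 \<and> \<not> w (j - 1) * w (j + 1) < 0)"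

text \<open>Models a small perturbation of \<open>w\<close> on a finite window: strict signs
  persist, and zeros may become anything.\<close>

definition sign_extends :: "config \<Rightarrow> config \<Rightarrow> int \<Rightarrow> int \<Rightarrow> bool" where
  "sign_extends w w' a b \<longleftrightarrow> (\<forall>j. a \<le> j \<and> j \<le> b \<and> w j \<noteq> 0 \<longrightarrow> 0 < w j * w' j)"

section \<open>Combinatorics of sign changes in a finite window\<close>

lemma finite_int_between [simp]:
  "finite {j :: int. a \<le> j \<and> j < b \<and> P j}" "finite {j :: int. a < j \<and> j \<le> b \<and> P j}"
  by (rule finite_subset[of _ "{a..b}"]; auto)+

lemma sign_changes_split:
  assumes "a \<le> b" "b \<le> c"
  shows "sign_changes w a c = sign_changes w a b + sign_changes w b c"
proof -
  have "{j \<in> {a..<c}. sign_change_at w j} = {j \<in> {a..<b}. sign_change_at w j} \<union> {j \<in> {b..<c}. sign_change_at w j}"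
    using assms by auto
  moreover have "finite {j \<in> {x..<y}. sign_change_at w j}" for x y by (rule finite_subset[of _ "{x..<y}"]) auto
  moreover have "{j \<in> {a..<b}. sign_change_at w j} \<inter> {j \<in> {b..<c}. sign_change_at w j} = {}" by auto
  ultimately show ?thesis unfolding sign_changes_def by (simp only: card_Un_disjoint)
qed

lemma sign_changes_le: "sign_changes w a b \<le> nat (b - a)"
  unfolding sign_changes_def by (rule order_trans[OF card_mono[of "{a..<b}"]]) auto

lemma sign_changes_refl [simp]: "sign_changes w a a = 0"
  by (simp add: sign_changes_def)

lemma sign_change_at_next: "sign_change_at w j \<Longrightarrow> w (j + 1) \<noteq> 0 \<Longrightarrow> w j * w (j + 1) < 0"
proof -
  assume "sign_change_at w j" and nz: "w (j + 1) \<noteq> 0"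
  then obtain k where k: "j < k" "w j * w k < 0" "\<And>i. j < i \<Longrightarrow> i < k \<Longrightarrow> w i = 0"
    by (auto simp: sign_change_at_def)
  have "k = j + 1" using k(1) k(3)[of "j + 1"] nz by (cases "j + 1 < k") auto
  then show ?thesis using k by simp
qed

lemma last_gap:
  assumes "w a \<noteq> 0" "w b \<noteq> 0" "a < b"
  obtains p where "a \<le> p" "gap w p b"
proof -
  define A where "A = {i. a \<le> i \<and> i < b \<and> w i \<noteq> 0}"
  have A: "finite A" "A \<noteq> {}" using assms by (auto simp: A_def)
  define p where "p = Max A"
  have "p \<in> A" unfolding p_def using A by (rule Max_in)
  then have p: "a \<le> p" "p < b" "w p \<noteq> 0" by (auto simp: A_def)
  have "w i = 0" if "p < i" "i < b" for i
  proof (rule ccontr)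
    assume "w i \<noteq> 0"
    then have "i \<in> A" using that p by (simp add: A_def)
    then show False using Max_ge[OF A(1), of i] that by (simp add: p_def)
  qed
  then have "gap w p b" using p assms by (simp add: gap_def)
  with p(1) show ?thesis by (rule that)
qed

lemma first_gap:
  assumes "w a \<noteq> 0" "w b \<noteq> 0" "a < b"
  obtains q where "q \<le> b" "gap w a q"
proof -
  obtain p where "- b \<le> p" "gap (\<lambda>i. w (- i)) p (- a)"
    by (rule last_gap[of "\<lambda>i. w (- i)" "- b" "- a"]) (use assms in auto)
  then have "a < - p" "w a \<noteq> 0" "w (- p) \<noteq> 0" and z: "\<And>i. p < i \<Longrightarrow> i < - a \<Longrightarrow> w (- i) = 0"
    by (auto simp: gap_def)
  moreover have "w i = 0" if "a < i" "i < - p" for i using z[of "- i"] that by simp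
  ultimately have "gap w a (- p)" by (simp add: gap_def)
  then show ?thesis using that[of "- p"] \<open>- b \<le> p\<close> by simp
qed

lemma gap_around:
  assumes "w a \<noteq> 0" "w b \<noteq> 0" "a < j" "j < b" "w j = 0"
  obtains p q where "a \<le> p" "p < j" "j < q" "q \<le> b" "gap w p q"
proof -
  \<comment> \<open>Setting the value at \<open>j\<close> to 1 makes \<open>j\<close> an admissible
    end, so that the gaps on its two sides can be found separately and then joined.\<close>
  define w1 where "w1 = w(j := 1)"
  obtain p where p: "a \<le> p" "gap w1 p j" by (rule last_gap[of w1 a j]) (use assms in \<open>auto simp: w1_def\<close>)
  obtain q where q: "q \<le> b" "gap w1 j q" by (rule first_gap[of w1 j b]) (use assms in \<open>auto simp: w1_def\<close>)
  have "w i = 0" if "p < i" "i < q" for i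
    using p q that assms(5) by (cases i j rule: linorder_cases) (auto simp: gap_def w1_def)
  then have "gap w p q" using p q by (auto simp: gap_def w1_def)
  then show ?thesis using that[of p q] p q by (auto simp: gap_def)
qed

lemma sign_changes_gap:
  assumes g: "gap w p q"
  shows "sign_changes w p q = (if w p * w q < 0 then 1 else 0)"
proof -
  have "sign_change_at w j \<longleftrightarrow> j = p \<and> w p * w q < 0" if "p \<le> j" "j < q" for j
  proof
    assume "sign_change_at w j"
    then obtain k where k: "j < k" "w j * w k < 0" "\<And>i. j < i \<Longrightarrow> i < k \<Longrightarrow> w i = 0"
      by (auto simp: sign_change_at_def)
    have "w j \<noteq> 0" "w k \<noteq> 0" using k(2) by auto
    then have j: "j = p" using g that by (force simp: gap_def)
    have "k = q"
    proof (cases k q rule: linorder_cases)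
      case less
      then show ?thesis using g k j \<open>w k \<noteq> 0\<close> by (auto simp: gap_def)
    next
      case greater
      then show ?thesis using g k(3)[of q] that by (auto simp: gap_def)
    qed
    then show "j = p \<and> w p * w q < 0" using j k by simp
  next
    assume "j = p \<and> w p * w q < 0"
    then show "sign_change_at w j"
      using g by (auto simp: sign_change_at_def gap_def intro!: exI[of _ q])
  qed
  then have "{j \<in> {p..<q}. sign_change_at w j} = (if w p * w q < 0 then {p} else {})"
    using g by (auto simp: gap_def)
  then show ?thesis by (simp add: sign_changes_def)
qed

text \<open>A discrete intermediate value property: on the way back from \<open>j\<close> to
  \<open>i\<close> through successive gaps, some gap must have ends of opposite sign.\<close>

lemma sign_changes_pos:
  assumes "i < j" "w i * w j < 0"
  shows "1 \<le> sign_changes w i j"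
proof -
  have "\<exists>k. i \<le> k \<and> k < j \<and> sign_change_at w k"
    using assms
  proof (induction "nat (j - i)" arbitrary: j rule: less_induct)
    case less
    have nz: "w i \<noteq> 0" "w j \<noteq> 0" using less.prems by auto
    obtain p where p: "i \<le> p" "gap w p j" by (rule last_gap[OF nz less.prems(1)])
    show ?case
    proof (cases "w i * w p < 0")
      case True
      then have "i \<noteq> p" using p by (auto simp: mult_less_0_iff)
      then have "i < p" "nat (p - i) < nat (j - i)" using p less.prems(1) by (auto simp: gap_def)
      then obtain k where "i \<le> k" "k < p" "sign_change_at w k" using less.hyps True by blast
      then show ?thesis using p by (auto simp: gap_def intro!: exI[of _ k])
    next
      case False
      then have "w p * w j < 0"
        using less.prems(2) p by (auto simp: gap_def mult_less_0_iff)
      moreover from this have "sign_change_at w p"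
        unfolding sign_change_at_def using p(2) by (intro exI[of _ j]) (auto simp: gap_def)
      ultimately show ?thesis using p by (auto simp: gap_def)
    qed
  qed
  then have "{k \<in> {i..<j}. sign_change_at w k} \<noteq> {}" by auto
  then show ?thesis unfolding sign_changes_def by (simp add: Suc_le_eq card_gt_0_iff)
qed

lemma sign_extends_mono: "sign_extends w w' a b \<Longrightarrow> a \<le> c \<Longrightarrow> d \<le> b \<Longrightarrow> sign_extends w w' c d"
  by (auto simp: sign_extends_def)

lemma sign_extends_opposite:
  assumes "sign_extends w w' a b" "a \<le> i" "i \<le> b" "a \<le> j" "j \<le> b" "w i * w j < 0"
  shows "w' i * w' j < 0"
proof -
  have "w i \<noteq> 0" "w j \<noteq> 0" using assms(6) by auto
  then have "0 < w i * w' i" "0 < w j * w' j" using assms by (auto simp: sign_extends_def)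
  then show ?thesis using assms(6) by (auto simp: mult_less_0_iff zero_less_mult_iff)
qed

text \<open>The window is cut at the nonzero sites of \<open>w\<close>. A gap of \<open>w\<close>
  contributes at most one change, and if it does, its ends keep their opposite signs in
  \<open>w'\<close>, which forces a change of \<open>w'\<close> between them.\<close>

lemma sign_changes_lower_semicontinuous:
  assumes "w a \<noteq> 0" "w b \<noteq> 0" "a \<le> b" "sign_extends w w' a b"
  shows "sign_changes w a b \<le> sign_changes w' a b"
  using assms(2-4)
proof (induction "nat (b - a)" arbitrary: b rule: less_induct)
  case less
  show ?case
  proof (cases "a = b")
    case False
    then have "a < b" using less.prems by simp
    obtain p where p: "a \<le> p" "gap w p b" by (rule last_gap[OF assms(1) less.prems(1) \<open>a < b\<close>])
    have pb: "p < b" "w p \<noteq> 0" using p by (auto simp: gap_def)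
    have "sign_changes w a p \<le> sign_changes w' a p"
      by (rule less.hyps) (use p pb less.prems in \<open>auto elim: sign_extends_mono\<close>)
    moreover have "sign_changes w p b \<le> sign_changes w' p b"
    proof (cases "w p * w b < 0")
      case True
      then have "w' p * w' b < 0"
        using sign_extends_opposite[OF less.prems(3) p(1) _ _ _ True] pb less.prems by auto
      then show ?thesis using sign_changes_pos[OF pb(1)] by (simp add: sign_changes_gap[OF p(2)])
    qed (simp add: sign_changes_gap[OF p(2)])
    ultimately show ?thesis
      using sign_changes_split[of a p b] p(1) pb(1) by simp
  qed simp
qed

lemma sign_changes_drop:
  assumes "w a \<noteq> 0" "w b \<noteq> 0" "sign_extends w w' a b"
    and pq: "a \<le> p" "q \<le> b" "gap w p q" "sign_changes w p q < sign_changes w' p q"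
  shows "sign_changes w a b < sign_changes w' a b"
proof -
  have g: "p < q" "w p \<noteq> 0" "w q \<noteq> 0" using pq by (auto simp: gap_def)
  have "sign_changes w a p \<le> sign_changes w' a p" "sign_changes w q b \<le> sign_changes w' q b"
    using assms g by (auto intro!: sign_changes_lower_semicontinuous elim: sign_extends_mono)
  moreover have "sign_changes u a b = sign_changes u a p + sign_changes u p q + sign_changes u q b" for u
    using sign_changes_split[of a p b] sign_changes_split[of p q b] pq g by simp
  ultimately show ?thesis using pq(4) by simp
qed

text \<open>The pattern into which a gap \<open>(p, q)\<close> of zeros is filled by the evolution immediately afterwards:
  every site takes the sign of the nearer end; only a middle site between opposite ends is undetermined.\<close>

definition filled :: "config \<Rightarrow> config \<Rightarrow> int \<Rightarrow> int \<Rightarrow> bool" where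
  "filled w w' p q \<longleftrightarrow> (\<forall>j. p < j \<and> j < q \<longrightarrow>
     (2 * j < p + q \<longrightarrow> 0 < w p * w' j) \<and> (p + q < 2 * j \<longrightarrow> 0 < w q * w' j) \<and>
     (2 * j = p + q \<and> 0 < w p * w q \<longrightarrow> 0 < w p * w' j))"

text \<open>Between ends of equal sign every site acquires that sign. Between opposite ends the left
  half follows \<open>p\<close> and the right half follows \<open>q\<close>; whatever the middle
  site does, zero included, there is only one change.\<close>

lemma sign_changes_filled_gap:
  assumes g: "gap w p q" and f: "filled w w' p q" and e: "0 < w p * w' p" "0 < w q * w' q"
  shows "sign_changes w' p q \<le> sign_changes w p q"
proof (cases "w p * w q < 0")
  case False
  then have pq: "0 < w p * w q" using g by (auto simp: gap_def not_less less_le)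
  have pos: "0 < w p * w' j" if "p \<le> j" "j \<le> q" for j
  proof -
    have q': "0 < w p * w' j" if "0 < w q * w' j" for j
      using that pq by (auto simp: zero_less_mult_iff)
    consider "j = p" | "j = q" | "p < j" "j < q" using \<open>p \<le> j\<close> \<open>j \<le> q\<close> by linarith
    then show ?thesis
    proof cases
      case 3
      then show ?thesis using f pq q'[of j] unfolding filled_def by (cases "2 * j" "p + q" rule: linorder_cases) auto
    qed (use e q' in auto)
  qed
  have "\<not> sign_change_at w' j" if "p \<le> j" "j < q" for j
    using sign_change_at_next[of w' j] pos[of j] pos[of "j + 1"] that
    by (auto simp: zero_less_mult_iff mult_less_0_iff)
  then have "{j \<in> {p..<q}. sign_change_at w' j} = {}" by auto
  then show ?thesis by (simp only: sign_changes_def card.empty)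
next
  case True
  have lo: "0 < w p * w' j" if "p \<le> j" "2 * j < p + q" for j
    using f e that unfolding filled_def by (cases "j = p") auto
  have hi: "w p * w' j < 0" if "j \<le> q" "p + q < 2 * j" for j
  proof -
    have "0 < w q * w' j" using f e that unfolding filled_def by (cases "j = q") auto
    then show ?thesis using True by (auto simp: zero_less_mult_iff mult_less_0_iff)
  qed
  have pos: "0 < w p * w' j" if j: "p \<le> j" "j < q" "sign_change_at w' j" for j
  proof (rule ccontr)
    assume n: "\<not> 0 < w p * w' j"
    then have "p + q \<le> 2 * j" using lo[of j] j by linarith
    then have h: "w p * w' (j + 1) < 0" using hi[of "j + 1"] j by simp
    then have "w' (j + 1) \<noteq> 0" by auto
    from sign_change_at_next[OF j(3) this] n h show False
      by (auto simp: zero_less_mult_iff mult_less_0_iff)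
  qed
  have "j = k" if j: "p \<le> j" "j < q" "sign_change_at w' j" and k: "p \<le> k" "k < q" "sign_change_at w' k" for j k
  proof -
    have F: False if "j < k" "p \<le> j" "k < q" "sign_change_at w' j" "sign_change_at w' k" for j k
    proof -
      have k': "0 < w p * w' k" using pos[of k] that by simp
      then have "2 * k \<le> p + q" using hi[of k] that by fastforce
      then have n: "0 < w p * w' (j + 1)" using lo[of "j + 1"] k' that by (cases "j + 1 = k") auto
      then have "w' (j + 1) \<noteq> 0" by auto
      from sign_change_at_next[OF that(4) this] n pos[of j] that show False
        by (auto simp: zero_less_mult_iff mult_less_0_iff)
    qed
    show ?thesis using F[of j k] F[of k j] j k by (cases j k rule: linorder_cases) auto
  qed
  then have "card {j \<in> {p..<q}. sign_change_at w' j} \<le> 1"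
    using card_le_Suc0_iff_eq[of "{j \<in> {p..<q}. sign_change_at w' j}"] by auto
  then show ?thesis using True by (simp add: sign_changes_gap[OF g]) (simp add: sign_changes_def)
qed

lemma sign_changes_filled:
  assumes "w a \<noteq> 0" "w b \<noteq> 0" "a \<le> b" "sign_extends w w' a b"
    and "\<And>p q. a \<le> p \<Longrightarrow> q \<le> b \<Longrightarrow> gap w p q \<Longrightarrow> filled w w' p q"
  shows "sign_changes w' a b \<le> sign_changes w a b"
  using assms(2-5)
proof (induction "nat (b - a)" arbitrary: b rule: less_induct)
  case less
  show ?case
  proof (cases "a = b")
    case False
    then have "a < b" using less.prems by simp
    obtain p where p: "a \<le> p" "gap w p b" by (rule last_gap[OF assms(1) less.prems(1) \<open>a < b\<close>])
    have pb: "p < b" "w p \<noteq> 0" using p by (auto simp: gap_def)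
    have "sign_changes w' a p \<le> sign_changes w a p"
      by (rule less.hyps) (use p pb less.prems in \<open>auto elim: sign_extends_mono\<close>)
    moreover have "sign_changes w' p b \<le> sign_changes w p b"
      by (rule sign_changes_filled_gap[OF p(2)]) (use p pb less.prems in \<open>auto simp: sign_extends_def\<close>)
    ultimately show ?thesis
      using sign_changes_split[of a p b] p(1) pb(1) by simp
  qed simp
qed

text \<open>A filled gap can vanish only at the middle site between opposite ends, and there the two
  neighbours already carry the opposite signs of the ends.\<close>

lemma filled_nondegenerate:
  assumes "w a \<noteq> 0" "w b \<noteq> 0" "sign_extends w w' a b"
    and "\<And>p q. a \<le> p \<Longrightarrow> q \<le> b \<Longrightarrow> gap w p q \<Longrightarrow> filled w w' p q"
  shows "\<not> degenerate w' a b"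
proof
  assume "degenerate w' a b"
  then obtain j where j: "a < j" "j < b" "w' j = 0" "\<not> w' (j - 1) * w' (j + 1) < 0"
    by (auto simp: degenerate_def)
  have "w j = 0" using assms(3)[unfolded sign_extends_def, rule_format, of j] j by auto
  from gap_around[OF assms(1,2) j(1,2) this]
  obtain p q where pq: "a \<le> p" "p < j" "j < q" "q \<le> b" "gap w p q" .
  have f: "filled w w' p q" by (rule assms(4)) fact+
  then have m: "2 * j = p + q" "\<not> 0 < w p * w q"
    using pq j(3) unfolding filled_def by (metis less_irrefl mult_zero_right not_less_iff_gr_or_eq)+
  have e: "0 < w p * w' p" "0 < w q * w' q"
    using assms(3) pq by (auto simp: sign_extends_def gap_def)
  have "0 < w p * w' (j - 1)" using f m pq e unfolding filled_def by (cases "j - 1 = p") auto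
  moreover have "0 < w q * w' (j + 1)" using f m pq e unfolding filled_def by (cases "j + 1 = q") auto
  moreover have "w p * w q < 0" using m(2) pq(5) by (auto simp: gap_def not_less less_le)
  ultimately show False using j(4) by (auto simp: zero_less_mult_iff mult_less_0_iff)
qed

text \<open>Without degenerate zeros a gap contains at most one zero, and that one lies midway
  between opposite ends, where the filling pattern prescribes nothing. Hence any sign-preserving
  perturbation fills it, and the count is stable from both sides.\<close>

lemma nondegenerate_filled:
  assumes "\<not> degenerate w a b" "a \<le> p" "q \<le> b" "gap w p q"
  shows "filled w w' p q"
proof (cases "q = p + 1")
  case True
  then show ?thesis by (auto simp: filled_def)
next
  case False
  then have "p + 1 < q" using assms(4) by (auto simp: gap_def)
  then have z: "w (p + 1) = 0" using assms(4) by (auto simp: gap_def)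
  then have "w (p + 1 - 1) * w (p + 1 + 1) < 0"
    using assms \<open>p + 1 < q\<close> unfolding degenerate_def by force
  then have n: "w p * w (p + 2) < 0" by (simp add: add.commute)
  have "q = p + 2"
  proof (rule ccontr)
    assume "q \<noteq> p + 2"
    then have "w (p + 2) = 0" using assms(4) \<open>p + 1 < q\<close> by (auto simp: gap_def)
    then show False using n by simp
  qed
  then show ?thesis using n by (auto simp: filled_def)
qed

lemma sign_changes_nondegenerate:
  assumes "w a \<noteq> 0" "w b \<noteq> 0" "a \<le> b" "sign_extends w w' a b" "\<not> degenerate w a b"
  shows "sign_changes w' a b = sign_changes w a b"
  using sign_changes_lower_semicontinuous[OF assms(1-4)]
    sign_changes_filled[OF assms(1-4) nondegenerate_filled[OF assms(5)]] by simp

lemma degenerate_gap: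
  assumes "w a \<noteq> 0" "w b \<noteq> 0" "degenerate w a b"
  obtains p q where "a \<le> p" "q \<le> b" "gap w p q" "p + 3 \<le> q \<or> q = p + 2 \<and> 0 < w p * w q"
proof -
  obtain j where j: "a < j" "j < b" "w j = 0" "\<not> w (j - 1) * w (j + 1) < 0"
    using assms by (auto simp: degenerate_def)
  from gap_around[OF assms(1,2) j(1-3)]
  obtain p q where pq: "a \<le> p" "p < j" "j < q" "q \<le> b" "gap w p q" .
  have "0 < w p * w q" if "q = p + 2"
  proof -
    have "p = j - 1" "q = j + 1" using pq that by auto
    then have "\<not> w p * w q < 0" using j(4) by simp
    then show ?thesis using pq(5) by (auto simp: gap_def not_less less_le)
  qed
  moreover have "p + 3 \<le> q \<or> q = p + 2" using pq by auto
  ultimately have "p + 3 \<le> q \<or> q = p + 2 \<and> 0 < w p * w q" by auto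
  then show ?thesis using that pq by blast
qed

text \<open>Next to each end the perturbed values have the sign opposite to that end. With at least
  two zeros this yields two disjoint changes, while the gap itself counts at most one. With a single
  zero between equal ends the gap counts none, and one change suffices.\<close>

lemma sign_changes_degenerate_gap:
  assumes g: "gap w p q" "p + 3 \<le> q \<or> q = p + 2 \<and> 0 < w p * w q"
    and e: "0 < w p * w' p" "0 < w q * w' q" and n: "w p * w' (p + 1) < 0" "w q * w' (q - 1) < 0"
  shows "sign_changes w p q < sign_changes w' p q"
proof -
  have "w' p * w' (p + 1) < 0" "w' (q - 1) * w' q < 0"
    using e n by (auto simp: zero_less_mult_iff mult_less_0_iff)
  then have s: "1 \<le> sign_changes w' p (p + 1)" "1 \<le> sign_changes w' (q - 1) q"
    using sign_changes_pos[of p "p + 1" w'] sign_changes_pos[of "q - 1" q w'] by auto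
  show ?thesis
  proof (cases "p + 3 \<le> q")
    case True
    have "sign_changes w' p q = sign_changes w' p (p + 1) + sign_changes w' (p + 1) (q - 1) + sign_changes w' (q - 1) q"
      using sign_changes_split[of p "p + 1" q w'] sign_changes_split[of "p + 1" "q - 1" q w'] True by simp
    then show ?thesis using s by (simp add: sign_changes_gap[OF g(1)])
  next
    case False
    then have "q = p + 2" "0 < w p * w q" using g(2) by auto
    then have "\<not> w p * w q < 0" by linarith
    then have "sign_changes w p q = 0" unfolding sign_changes_gap[OF g(1)] by (rule if_not_P)
    moreover have "sign_changes w' p q = sign_changes w' p (p + 1) + sign_changes w' (p + 1) q"
      using sign_changes_split[of p "p + 1" q w'] \<open>q = p + 2\<close> by simp
    ultimately show ?thesis using s by simp
  qed
qed

section \<open>Cooperative tridiagonal systems near a gap of zeros\<close>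

definition cooperative :: "real \<Rightarrow> real \<Rightarrow> (real \<Rightarrow> config) \<Rightarrow> bool" where
  "cooperative \<delta> L w \<longleftrightarrow> (\<forall>t\<ge>0. \<forall>j. \<exists>\<alpha> \<beta> \<gamma>. \<delta> \<le> \<alpha> \<and> \<alpha> \<le> L \<and> \<bar>\<beta>\<bar> \<le> L \<and> \<delta> \<le> \<gamma> \<and> \<gamma> \<le> L \<and>
     ((\<lambda>s. w s j) has_real_derivative \<alpha> * w t (j - 1) + \<beta> * w t j + \<gamma> * w t (j + 1)) (at t within {0..}))"

lemma cooperativeE:
  assumes "cooperative \<delta> L w" "0 \<le> t"
  obtains \<alpha> \<beta> \<gamma> where "\<delta> \<le> \<alpha>" "\<alpha> \<le> L" "\<bar>\<beta>\<bar> \<le> L" "\<delta> \<le> \<gamma>" "\<gamma> \<le> L"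
    "((\<lambda>s. w s j) has_real_derivative \<alpha> * w t (j - 1) + \<beta> * w t j + \<gamma> * w t (j + 1)) (at t within {0..})"
proof -
  have "\<exists>\<alpha> \<beta> \<gamma>. \<delta> \<le> \<alpha> \<and> \<alpha> \<le> L \<and> \<bar>\<beta>\<bar> \<le> L \<and> \<delta> \<le> \<gamma> \<and> \<gamma> \<le> L \<and>
     ((\<lambda>s. w s j) has_real_derivative \<alpha> * w t (j - 1) + \<beta> * w t j + \<gamma> * w t (j + 1)) (at t within {0..})"
    using assms unfolding cooperative_def by blast
  then show ?thesis using that by blast
qed

lemma cooperative_continuous_on:
  assumes "cooperative \<delta> L w"
  shows "continuous_on {0..} (\<lambda>t. w t j)"
  unfolding continuous_on_eq_continuous_within
proof
  fix t :: real assume "t \<in> {0..}"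
  then have "0 \<le> t" by simp
  then obtain D where "((\<lambda>s. w s j) has_real_derivative D) (at t within {0..})"
    using cooperativeE[OF assms, of t j] by metis
  then show "continuous (at t within {0..}) (\<lambda>t. w t j)" by (rule DERIV_continuous)
qed

lemma cooperative_reflect:
  assumes "cooperative \<delta> L w"
  shows "cooperative \<delta> L (\<lambda>t j. w t (- j))"
  unfolding cooperative_def
proof (intro allI impI)
  fix t :: real and j :: int assume "0 \<le> t"
  from cooperativeE[OF assms this, of "- j"]
  obtain \<alpha> \<beta> \<gamma> where c: "\<delta> \<le> \<alpha>" "\<alpha> \<le> L" "\<bar>\<beta>\<bar> \<le> L" "\<delta> \<le> \<gamma>" "\<gamma> \<le> L"
    "((\<lambda>s. w s (- j)) has_real_derivative \<alpha> * w t (- j - 1) + \<beta> * w t (- j) + \<gamma> * w t (- j + 1)) (at t within {0..})" .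
  have e: "- (j - 1) = - j + 1" "- (j + 1) = - j - 1" by simp_all
  have "((\<lambda>s. w s (- j)) has_real_derivative \<gamma> * w t (- (j - 1)) + \<beta> * w t (- j) + \<alpha> * w t (- (j + 1))) (at t within {0..})"
    unfolding e using c(6) by (simp add: add.commute add.left_commute)
  then show "\<exists>\<alpha> \<beta> \<gamma>. \<delta> \<le> \<alpha> \<and> \<alpha> \<le> L \<and> \<bar>\<beta>\<bar> \<le> L \<and> \<delta> \<le> \<gamma> \<and> \<gamma> \<le> L \<and>
      ((\<lambda>s. w s (- j)) has_real_derivative \<alpha> * w t (- (j - 1)) + \<beta> * w t (- j) + \<gamma> * w t (- (j + 1))) (at t within {0..})"
    using c(1-5) by blast
qed

lemma cooperative_time_shift:
  assumes "cooperative \<delta> L w" "0 \<le> s"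
  shows "cooperative \<delta> L (\<lambda>t. w (s + t))"
  unfolding cooperative_def
proof (intro allI impI)
  fix t :: real and j :: int assume t: "0 \<le> t"
  then have "0 \<le> s + t" using assms by simp
  from cooperativeE[OF assms(1) this, of j]
  obtain \<alpha> \<beta> \<gamma> where c: "\<delta> \<le> \<alpha>" "\<alpha> \<le> L" "\<bar>\<beta>\<bar> \<le> L" "\<delta> \<le> \<gamma>" "\<gamma> \<le> L"
    "((\<lambda>s. w s j) has_real_derivative \<alpha> * w (s + t) (j - 1) + \<beta> * w (s + t) j + \<gamma> * w (s + t) (j + 1)) (at (s + t) within {0..})" .
  have "((\<lambda>r. s + r) has_real_derivative 1) (at t within {0..})"
    by (auto intro!: derivative_eq_intros)
  then have "((\<lambda>r. w (s + r) j) has_real_derivative \<alpha> * w (s + t) (j - 1) + \<beta> * w (s + t) j + \<gamma> * w (s + t) (j + 1)) (at t within {0..})"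
    using DERIV_image_chain[of "\<lambda>s. w s j" _ "\<lambda>r. s + r" t "{0..}" 1] DERIV_subset[OF c(6), of "(+) s ` {0..}"] assms(2)
    by (force simp: comp_def)
  then show "\<exists>\<alpha> \<beta> \<gamma>. \<delta> \<le> \<alpha> \<and> \<alpha> \<le> L \<and> \<bar>\<beta>\<bar> \<le> L \<and> \<delta> \<le> \<gamma> \<and> \<gamma> \<le> L \<and>
      ((\<lambda>r. w (s + r) j) has_real_derivative \<alpha> * w (s + t) (j - 1) + \<beta> * w (s + t) j + \<gamma> * w (s + t) (j + 1)) (at t within {0..})"
    using c(1-5) by blast
qed

text \<open>For \<open>\<tau> \<le> A / (2 * B + 1)\<close> the term of order \<open>Suc i\<close>
  takes away at most half of the leading one. Integrating \<open>(A / 2) * \<tau> ^ i\<close> gives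
  the constant \<open>A / (2 * real (Suc i))\<close>.\<close>

lemma power_lower_bound:
  fixes g g' :: "real \<Rightarrow> real"
  assumes "0 < \<epsilon>" and d: "\<And>\<tau>. 0 \<le> \<tau> \<Longrightarrow> \<tau> \<le> \<epsilon> \<Longrightarrow> (g has_real_derivative g' \<tau>) (at \<tau> within {0..\<epsilon>})"
    and "g 0 = 0" "0 < A" "0 \<le> B" and lb: "\<And>\<tau>. 0 \<le> \<tau> \<Longrightarrow> \<tau> \<le> \<epsilon> \<Longrightarrow> A * \<tau> ^ i - B * \<tau> ^ Suc i \<le> g' \<tau>"
  shows "\<exists>c>0. \<exists>e>0. e \<le> \<epsilon> \<and> (\<forall>\<tau>. 0 \<le> \<tau> \<and> \<tau> \<le> e \<longrightarrow> c * \<tau> ^ Suc i \<le> g \<tau>)"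
proof -
  define e where "e = min \<epsilon> (A / (2 * B + 1))"
  define c where "c = A / (2 * real (Suc i))"
  have "c * \<tau> ^ Suc i \<le> g \<tau>" if \<tau>: "0 \<le> \<tau>" "\<tau> \<le> e" for \<tau>
  proof -
    have "g 0 - c * 0 ^ Suc i \<le> g \<tau> - c * \<tau> ^ Suc i"
    proof (rule nonneg_deriv_imp_le[where g = "\<lambda>s. g s - c * s ^ Suc i" and g' = "\<lambda>s. g' s - c * (real (Suc i) * s ^ i)"])
      fix s assume s: "0 \<le> s" "s \<le> \<tau>"
      have "(g has_real_derivative g' s) (at s within {0..\<tau>})"
        by (rule DERIV_subset[OF d]) (use s \<tau> in \<open>auto simp: e_def\<close>)
      moreover have "((\<lambda>s. c * s ^ Suc i) has_real_derivative c * (real (Suc i) * s ^ i)) (at s within {0..\<tau>})"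
        using DERIV_cmult[OF DERIV_power[OF DERIV_ident, of "Suc i" s "{0..\<tau>}"], of c] by (simp del: power_Suc of_nat_Suc)
      ultimately show "((\<lambda>s. g s - c * s ^ Suc i) has_real_derivative g' s - c * (real (Suc i) * s ^ i)) (at s within {0..\<tau>})"
        by (rule DERIV_diff)
    next
      fix s assume s: "0 < s" "s < \<tau>"
      have "s \<le> A / (2 * B + 1)" using s \<tau> by (simp add: e_def)
      then have "s * (2 * B + 1) \<le> A" using assms(5) by (simp add: field_simps)
      then have "2 * (B * s) \<le> A" using s by (simp add: algebra_simps)
      then have "B * s \<le> A / 2" by simp
      then have "(B * s) * s ^ i \<le> (A / 2) * s ^ i" using s by (intro mult_right_mono) auto
      then have "A * s ^ i - B * s ^ Suc i \<ge> (A / 2) * s ^ i" by (simp add: algebra_simps)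
      moreover have "c * (real (Suc i) * s ^ i) = (A / 2) * s ^ i"
        by (simp add: c_def del: of_nat_Suc)
      moreover have "A * s ^ i - B * s ^ Suc i \<le> g' s" using lb[of s] s \<tau> by (simp add: e_def)
      ultimately show "0 \<le> g' s - c * (real (Suc i) * s ^ i)" by linarith
    qed (use \<tau> in auto)
    then show ?thesis using assms(3) by simp
  qed
  moreover have "0 < c" "0 < e" "e \<le> \<epsilon>" using assms by (auto simp: c_def e_def)
  ultimately show ?thesis by blast
qed

text \<open>A site at distance at least \<open>k + 1\<close> from both ends is driven only by sites
  at distance at least \<open>k\<close>, which are of order \<open>\<tau> ^ k\<close>. It starts
  from zero, so integration gains one order.\<close>

lemma gap_upper_bound:
  assumes w: "cooperative \<delta> L w" and \<delta>: "0 < \<delta>" and g: "gap (w 0) p q"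
  shows "\<exists>C\<ge>0. \<forall>\<tau> j. 0 \<le> \<tau> \<and> \<tau> \<le> 1 \<and> p + int k \<le> j \<and> j \<le> q - int k \<longrightarrow> \<bar>w \<tau> j\<bar> \<le> C * \<tau> ^ k"
proof (induction k)
  case 0
  have "\<exists>C\<ge>0. \<forall>\<tau>. 0 \<le> \<tau> \<and> \<tau> \<le> 1 \<longrightarrow> \<bar>w \<tau> j\<bar> \<le> C" for j
  proof -
    have "compact ((\<lambda>t. w t j) ` {0..1})"
      by (intro compact_continuous_image continuous_on_subset[OF cooperative_continuous_on[OF w]]) auto
    then obtain C where "C > 0" "\<And>\<tau>. \<tau> \<in> {0..1} \<Longrightarrow> \<bar>w \<tau> j\<bar> \<le> C"
      by (force dest!: compact_imp_bounded simp: bounded_pos)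
    then show ?thesis by (intro exI[of _ C]) auto
  qed
  then obtain C where C: "\<And>j. 0 \<le> C j" "\<And>j \<tau>. 0 \<le> \<tau> \<Longrightarrow> \<tau> \<le> 1 \<Longrightarrow> \<bar>w \<tau> j\<bar> \<le> C j" by metis
  have "\<bar>w \<tau> j\<bar> \<le> (\<Sum>j\<in>{p..q}. C j)" if "0 \<le> \<tau>" "\<tau> \<le> 1" "p \<le> j" "j \<le> q" for \<tau> j
    using C(2)[of \<tau> j] member_le_sum[of j "{p..q}" C] that C(1) by (auto intro: order_trans)
  then show ?case using C by (intro exI[of _ "\<Sum>j\<in>{p..q}. C j"]) (auto intro: sum_nonneg)
next
  case (Suc k)
  then obtain C where C: "0 \<le> C" "\<And>\<tau> j. 0 \<le> \<tau> \<Longrightarrow> \<tau> \<le> 1 \<Longrightarrow> p + int k \<le> j \<Longrightarrow> j \<le> q - int k \<Longrightarrow> \<bar>w \<tau> j\<bar> \<le> C * \<tau> ^ k"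
    by blast
  obtain \<alpha>0 where "\<delta> \<le> \<alpha>0" "\<alpha>0 \<le> L" using cooperativeE[OF w order_refl, of 0] by metis
  then have L: "0 \<le> L" using \<delta> by linarith
  define M where "M = 3 * L * C"
  have M: "0 \<le> M" using L C by (simp add: M_def)
  have "\<bar>w \<tau> j\<bar> \<le> M * \<tau> ^ Suc k" if \<tau>: "0 \<le> \<tau>" "\<tau> \<le> 1" and j: "p + int (Suc k) \<le> j" "j \<le> q - int (Suc k)" for \<tau> j
  proof -
    have "\<exists>D. ((\<lambda>s. w s j) has_real_derivative D) (at s within {0..}) \<and> \<bar>D\<bar> \<le> M * s ^ k" if s: "0 \<le> s" "s \<le> 1" for s
    proof -
      from cooperativeE[OF w s(1), of j]
      obtain \<alpha> \<beta> \<gamma> where c: "\<delta> \<le> \<alpha>" "\<alpha> \<le> L" "\<bar>\<beta>\<bar> \<le> L" "\<delta> \<le> \<gamma>" "\<gamma> \<le> L"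
        "((\<lambda>s. w s j) has_real_derivative \<alpha> * w s (j - 1) + \<beta> * w s j + \<gamma> * w s (j + 1)) (at s within {0..})" .
      have "\<bar>\<alpha> * w s (j - 1) + \<beta> * w s j + \<gamma> * w s (j + 1)\<bar> \<le> \<bar>\<alpha>\<bar> * \<bar>w s (j - 1)\<bar> + \<bar>\<beta>\<bar> * \<bar>w s j\<bar> + \<bar>\<gamma>\<bar> * \<bar>w s (j + 1)\<bar>"
        unfolding abs_mult[symmetric] by linarith
      also have "\<dots> \<le> L * (C * s ^ k) + L * (C * s ^ k) + L * (C * s ^ k)"
      proof -
        have m: "\<bar>x\<bar> * \<bar>w s i\<bar> \<le> L * (C * s ^ k)" if "\<bar>x\<bar> \<le> L" "p + int k \<le> i" "i \<le> q - int k" for x i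
          by (rule mult_mono[OF that(1) C(2)[OF s that(2,3)] L]) simp
        show ?thesis by (rule add_mono[OF add_mono[OF m m] m]) (use c \<delta> j in auto)
      qed
      also have "\<dots> = M * s ^ k" by (simp add: M_def)
      finally show ?thesis using c(6) by blast
    qed
    then obtain D where D: "\<And>s. 0 \<le> s \<Longrightarrow> s \<le> 1 \<Longrightarrow> ((\<lambda>s. w s j) has_real_derivative D s) (at s within {0..})"
      "\<And>s. 0 \<le> s \<Longrightarrow> s \<le> 1 \<Longrightarrow> \<bar>D s\<bar> \<le> M * s ^ k" by metis
    have D': "((\<lambda>s. w s j) has_real_derivative D s) (at s within {0..\<tau>})" if "0 \<le> s" "s \<le> \<tau>" for s
      by (rule DERIV_subset[OF D(1)]) (use that \<tau> in auto)
    have P: "((\<lambda>s. M * s ^ Suc k) has_real_derivative M * (real (Suc k) * s ^ k)) (at s within {0..\<tau>})" for s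
      using DERIV_cmult[OF DERIV_power[OF DERIV_ident, of "Suc k" s "{0..\<tau>}"], of M] by (simp del: power_Suc of_nat_Suc)
    have b: "\<bar>D s\<bar> \<le> M * (real (Suc k) * s ^ k)" if "0 \<le> s" "s \<le> \<tau>" for s
    proof -
      have "1 * s ^ k \<le> real (Suc k) * s ^ k" using that by (intro mult_right_mono) auto
      then have "M * s ^ k \<le> M * (real (Suc k) * s ^ k)" using M by (intro mult_left_mono) auto
      then show ?thesis using D(2)[of s] that \<tau> by linarith
    qed
    have "j > p" "j < q" using j by auto
    then have z: "w 0 j = 0" using g by (auto simp: gap_def)
    have "M * 0 ^ Suc k - w 0 j \<le> M * \<tau> ^ Suc k - w \<tau> j"
    proof (rule nonneg_deriv_imp_le[where g = "\<lambda>s. M * s ^ Suc k - w s j"])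
      show "((\<lambda>s. M * s ^ Suc k - w s j) has_real_derivative M * (real (Suc k) * s ^ k) - D s) (at s within {0..\<tau>})" if "0 \<le> s" "s \<le> \<tau>" for s
        by (rule DERIV_diff[OF P D'[OF that]])
      show "0 \<le> M * (real (Suc k) * s ^ k) - D s" if "0 < s" "s < \<tau>" for s using b[of s] that by linarith
    qed (use \<tau> in auto)
    moreover have "M * 0 ^ Suc k + w 0 j \<le> M * \<tau> ^ Suc k + w \<tau> j"
    proof (rule nonneg_deriv_imp_le[where g = "\<lambda>s. M * s ^ Suc k + w s j"])
      show "((\<lambda>s. M * s ^ Suc k + w s j) has_real_derivative M * (real (Suc k) * s ^ k) + D s) (at s within {0..\<tau>})" if "0 \<le> s" "s \<le> \<tau>" for s
        by (rule DERIV_add[OF P D'[OF that]])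
      show "0 \<le> M * (real (Suc k) * s ^ k) + D s" if "0 < s" "s < \<tau>" for s using b[of s] that by linarith
    qed (use \<tau> in auto)
    ultimately show ?thesis using z by (simp add: abs_le_iff)
  qed
  then show ?case using M by blast
qed

text \<open>Inside a gap, the forcing from the nearer end has the lower order in \<open>\<tau>\<close> and decides the sign.\<close>

lemma gap_step:
  assumes w: "cooperative \<delta> L w" and \<delta>: "0 < \<delta>" and z: "w 0 j = 0"
    and c: "0 < c" and e: "0 < e" "e \<le> 1" and C: "0 \<le> C"
    and lo: "\<And>\<tau>. 0 \<le> \<tau> \<Longrightarrow> \<tau> \<le> e \<Longrightarrow> c * \<tau> ^ i \<le> \<sigma> * w \<tau> (j - 1)"
    and mid: "\<And>\<tau>. 0 \<le> \<tau> \<Longrightarrow> \<tau> \<le> e \<Longrightarrow> \<bar>\<sigma> * w \<tau> j\<bar> \<le> C * \<tau> ^ Suc i"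
    and hi: "\<And>\<tau>. 0 \<le> \<tau> \<Longrightarrow> \<tau> \<le> e \<Longrightarrow> - (C * \<tau> ^ Suc i) \<le> \<sigma> * w \<tau> (j + 1)"
  shows "\<exists>c>0. \<exists>e'>0. e' \<le> e \<and> (\<forall>\<tau>. 0 \<le> \<tau> \<and> \<tau> \<le> e' \<longrightarrow> c * \<tau> ^ Suc i \<le> \<sigma> * w \<tau> j)"
proof -
  have L: "0 \<le> L" using cooperativeE[OF w order_refl, of 0] \<delta> by (metis order_trans less_imp_le)
  have "\<exists>D. ((\<lambda>s. w s j) has_real_derivative D) (at s within {0..}) \<and> (\<delta> * c) * s ^ i - (2 * L * C) * s ^ Suc i \<le> \<sigma> * D"
    if s: "0 \<le> s" "s \<le> e" for s
  proof -
    from cooperativeE[OF w s(1), of j]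
    obtain \<alpha> \<beta> \<gamma> where k: "\<delta> \<le> \<alpha>" "\<alpha> \<le> L" "\<bar>\<beta>\<bar> \<le> L" "\<delta> \<le> \<gamma>" "\<gamma> \<le> L"
      "((\<lambda>s. w s j) has_real_derivative \<alpha> * w s (j - 1) + \<beta> * w s j + \<gamma> * w s (j + 1)) (at s within {0..})" .
    have P: "0 \<le> C * s ^ Suc i" "0 \<le> c * s ^ i" using C c s by auto
    have "\<delta> * (c * s ^ i) \<le> \<alpha> * (\<sigma> * w s (j - 1))"
      by (rule mult_mono[OF k(1) lo[OF s]]) (use k \<delta> P in linarith)+
    moreover have "\<bar>\<beta>\<bar> * \<bar>\<sigma> * w s j\<bar> \<le> L * (C * s ^ Suc i)"
      by (rule mult_mono[OF k(3) mid[OF s] L]) simp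
    then have "- (L * (C * s ^ Suc i)) \<le> \<beta> * (\<sigma> * w s j)" unfolding abs_mult[symmetric] by linarith
    moreover have "- (L * (C * s ^ Suc i)) \<le> \<gamma> * (\<sigma> * w s (j + 1))"
    proof -
      have "\<gamma> * - (C * s ^ Suc i) \<le> \<gamma> * (\<sigma> * w s (j + 1))" using k \<delta> hi[OF s] by (intro mult_left_mono) auto
      moreover have "\<gamma> * (C * s ^ Suc i) \<le> L * (C * s ^ Suc i)" using k P by (intro mult_right_mono) auto
      ultimately show ?thesis by simp
    qed
    ultimately have "(\<delta> * c) * s ^ i - (2 * L * C) * s ^ Suc i \<le> \<sigma> * (\<alpha> * w s (j - 1) + \<beta> * w s j + \<gamma> * w s (j + 1))"
      by (simp add: algebra_simps)
    then show ?thesis using k(6) by blast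
  qed
  then obtain D where D: "\<And>s. 0 \<le> s \<Longrightarrow> s \<le> e \<Longrightarrow> ((\<lambda>s. w s j) has_real_derivative D s) (at s within {0..})"
    "\<And>s. 0 \<le> s \<Longrightarrow> s \<le> e \<Longrightarrow> (\<delta> * c) * s ^ i - (2 * L * C) * s ^ Suc i \<le> \<sigma> * D s" by metis
  show ?thesis
  proof (rule power_lower_bound[OF e(1) _ _ _ _ D(2)])
    fix \<tau> assume "0 \<le> \<tau>" "\<tau> \<le> e"
    then show "((\<lambda>s. \<sigma> * w s j) has_real_derivative \<sigma> * D \<tau>) (at \<tau> within {0..e})"
      by (intro DERIV_cmult DERIV_subset[OF D(1)]) auto
  qed (use \<delta> c C L z in auto)
qed

text \<open>Induction on the distance \<open>i\<close> from the left end: the previous site drives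
  with order one lower than everything else. The condition \<open>2 * int i < q - p\<close> keeps
  the next site \<open>p + i + 1\<close> at distance at least \<open>i\<close> from the far end, so
  that its influence has order at least \<open>i\<close>.\<close>

lemma gap_lower_bound:
  assumes w: "cooperative \<delta> L w" and \<delta>: "0 < \<delta>" and g: "gap (w 0) p q" and i: "2 * int i < q - p"
  shows "\<exists>c>0. \<exists>e>0. e \<le> 1 \<and> (\<forall>\<tau>. 0 \<le> \<tau> \<and> \<tau> \<le> e \<longrightarrow> c * \<tau> ^ i \<le> w 0 p * w \<tau> (p + int i))"
  using i
proof (induction i)
  case 0
  define c where "c = w 0 p * w 0 p / 2"
  have c: "0 < c" "c < w 0 p * w 0 p" using g by (auto simp: c_def gap_def zero_less_mult_iff)
  have "continuous (at 0 within {0..}) (\<lambda>t. w t p)"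
    using cooperative_continuous_on[OF w] by (auto simp: continuous_on_eq_continuous_within)
  then have "((\<lambda>t. w 0 p * w t p) \<longlongrightarrow> w 0 p * w 0 p) (at 0 within {0..})"
    unfolding continuous_within by (intro tendsto_intros)
  then have "\<forall>\<^sub>F t in at 0 within {0..}. c < w 0 p * w t p" using c by (auto dest: order_tendstoD)
  then obtain d where d: "0 < d" "\<And>t. 0 \<le> t \<Longrightarrow> t < d \<Longrightarrow> t \<noteq> 0 \<Longrightarrow> c < w 0 p * w t p"
    unfolding eventually_at by (auto simp: dist_real_def)
  have "c \<le> w 0 p * w \<tau> p" if "0 \<le> \<tau>" "\<tau> \<le> min 1 (d / 2)" for \<tau>
    using d(2)[of \<tau>] that c d(1) by (cases "\<tau> = 0") auto
  then show ?case using c(1) d(1) by (intro exI[of _ c] conjI exI[of _ "min 1 (d / 2)"]) auto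
next
  case (Suc i)
  then obtain c e where ce: "0 < c" "0 < e" "e \<le> 1" "\<And>\<tau>. 0 \<le> \<tau> \<Longrightarrow> \<tau> \<le> e \<Longrightarrow> c * \<tau> ^ i \<le> w 0 p * w \<tau> (p + int i)"
    by fastforce
  obtain C where C: "0 \<le> C" "\<And>\<tau> j. 0 \<le> \<tau> \<Longrightarrow> \<tau> \<le> 1 \<Longrightarrow> p + int (Suc i) \<le> j \<Longrightarrow> j \<le> q - int (Suc i) \<Longrightarrow> \<bar>w \<tau> j\<bar> \<le> C * \<tau> ^ Suc i"
    using gap_upper_bound[OF w \<delta> g, of "Suc i"] by blast
  define C' where "C' = \<bar>w 0 p\<bar> * C"
  have C': "\<bar>w 0 p * w \<tau> j\<bar> \<le> C' * \<tau> ^ Suc i" if "0 \<le> \<tau>" "\<tau> \<le> e" "p + int (Suc i) \<le> j" "j \<le> q - int (Suc i)" for \<tau> j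
    using mult_left_mono[OF C(2)[of \<tau> j], of "\<bar>w 0 p\<bar>"] that ce(3) by (simp add: C'_def abs_mult mult.assoc)
  have "\<exists>c>0. \<exists>e'>0. e' \<le> e \<and> (\<forall>\<tau>. 0 \<le> \<tau> \<and> \<tau> \<le> e' \<longrightarrow> c * \<tau> ^ Suc i \<le> w 0 p * w \<tau> (p + int (Suc i)))"
  proof (rule gap_step[OF w \<delta> _ ce(1,2,3), where C = C'])
    have "p < p + int (Suc i)" "p + int (Suc i) < q" using Suc.prems by auto
    then show "w 0 (p + int (Suc i)) = 0" using g by (auto simp: gap_def)
    show "0 \<le> C'" using C by (simp add: C'_def)
    show "c * \<tau> ^ i \<le> w 0 p * w \<tau> (p + int (Suc i) - 1)" if "0 \<le> \<tau>" "\<tau> \<le> e" for \<tau>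
      using ce(4)[OF that] by simp
    show "\<bar>w 0 p * w \<tau> (p + int (Suc i))\<bar> \<le> C' * \<tau> ^ Suc i" if "0 \<le> \<tau>" "\<tau> \<le> e" for \<tau>
      by (rule C'[OF that]) (use Suc.prems in auto)
    show "- (C' * \<tau> ^ Suc i) \<le> w 0 p * w \<tau> (p + int (Suc i) + 1)" if "0 \<le> \<tau>" "\<tau> \<le> e" for \<tau>
      using C'[OF that, of "p + int (Suc i) + 1"] Suc.prems by (simp add: abs_le_iff)
  qed
  then show ?case using ce(3) by (meson order_trans)
qed

lemma eventually_at_right_0I:
  fixes P :: "real \<Rightarrow> bool"
  assumes "0 < e" "\<And>\<tau>. 0 < \<tau> \<Longrightarrow> \<tau> < e \<Longrightarrow> P \<tau>"
  shows "\<forall>\<^sub>F \<tau> in at_right 0. P \<tau>"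
  using assms by (auto simp: eventually_at_right_field)

lemma power_lower_bound_pos: "0 < c \<Longrightarrow> 0 < \<tau> \<Longrightarrow> c * \<tau> ^ i \<le> x \<Longrightarrow> 0 < (x :: real)"
  by (meson less_le_trans mult_pos_pos zero_less_power)

lemma gap_reflect: "gap w p q \<Longrightarrow> gap (\<lambda>j. w (- j)) (- q) (- p)"
  by (auto simp: gap_def)

lemma eventually_filled:
  assumes w: "cooperative \<delta> L w" and \<delta>: "0 < \<delta>" and g: "gap (w 0) p q"
  shows "\<forall>\<^sub>F \<tau> in at_right 0. filled (w 0) (w \<tau>) p q"
proof -
  have pq: "p < q" using g by (simp add: gap_def)
  note w' = cooperative_reflect[OF w] and g' = gap_reflect[OF g]
  have lo: "\<exists>c>0. \<exists>e>0. e \<le> 1 \<and> (\<forall>\<tau>. 0 \<le> \<tau> \<and> \<tau> \<le> e \<longrightarrow> c * \<tau> ^ i \<le> w 0 p * w \<tau> (p + int i))"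
    if "2 * int i < q - p" for i
    by (rule gap_lower_bound[OF w \<delta> g that])
  have hi: "\<exists>c>0. \<exists>e>0. e \<le> 1 \<and> (\<forall>\<tau>. 0 \<le> \<tau> \<and> \<tau> \<le> e \<longrightarrow> c * \<tau> ^ i \<le> w 0 q * w \<tau> (q - int i))"
    if "2 * int i < q - p" for i
    using gap_lower_bound[OF w' \<delta>, of "- q" "- p" i] g' that by simp
  have 1: "\<forall>\<^sub>F \<tau> in at_right 0. 0 < w 0 p * w \<tau> j" if j: "p < j" "j < q" "2 * j < p + q" for j
  proof -
    obtain c e where ce: "0 < c" "0 < e" "\<And>\<tau>. 0 \<le> \<tau> \<Longrightarrow> \<tau> \<le> e \<Longrightarrow> c * \<tau> ^ nat (j - p) \<le> w 0 p * w \<tau> j"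
      using lo[of "nat (j - p)"] j by auto
    have "0 < w 0 p * w \<tau> j" if "0 < \<tau>" "\<tau> < e" for \<tau>
      by (rule power_lower_bound_pos[OF ce(1) that(1) ce(3)]) (use that in auto)
    with ce(2) show ?thesis by (rule eventually_at_right_0I)
  qed
  have 2: "\<forall>\<^sub>F \<tau> in at_right 0. 0 < w 0 q * w \<tau> j" if j: "p < j" "j < q" "p + q < 2 * j" for j
  proof -
    obtain c e where ce: "0 < c" "0 < e" "\<And>\<tau>. 0 \<le> \<tau> \<Longrightarrow> \<tau> \<le> e \<Longrightarrow> c * \<tau> ^ nat (q - j) \<le> w 0 q * w \<tau> j"
      using hi[of "nat (q - j)"] j by auto
    have "0 < w 0 q * w \<tau> j" if "0 < \<tau>" "\<tau> < e" for \<tau>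
      by (rule power_lower_bound_pos[OF ce(1) that(1) ce(3)]) (use that in auto)
    with ce(2) show ?thesis by (rule eventually_at_right_0I)
  qed
  \<comment> \<open>At the exact middle both neighbours are of the same order. Equality of the signs
    at the two ends makes their contributions reinforce each other; with opposite ends they could
    cancel.\<close>
  have 3: "\<forall>\<^sub>F \<tau> in at_right 0. 0 < w 0 p * w \<tau> j" if j: "p < j" "j < q" "2 * j = p + q" and s: "0 < w 0 p * w 0 q" for j
  proof -
    define i where "i = nat (j - p) - 1"
    have i: "j = p + int (Suc i)" "j = q - int (Suc i)" "2 * int i < q - p" using j by (auto simp: i_def)
    obtain c e where ce: "0 < c" "0 < e" "e \<le> 1" "\<And>\<tau>. 0 \<le> \<tau> \<Longrightarrow> \<tau> \<le> e \<Longrightarrow> c * \<tau> ^ i \<le> w 0 p * w \<tau> (j - 1)"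
      using lo[OF i(3)] i(1) by auto
    obtain c' e' where ce': "0 < c'" "0 < e'" "\<And>\<tau>. 0 \<le> \<tau> \<Longrightarrow> \<tau> \<le> e' \<Longrightarrow> c' * \<tau> ^ i \<le> w 0 q * w \<tau> (j + 1)"
      using hi[OF i(3)] i(2) by auto
    obtain C where C: "0 \<le> C" "\<And>\<tau>. 0 \<le> \<tau> \<Longrightarrow> \<tau> \<le> 1 \<Longrightarrow> \<bar>w \<tau> j\<bar> \<le> C * \<tau> ^ Suc i"
      using gap_upper_bound[OF w \<delta> g, of "Suc i"] i by auto
    have "\<exists>c>0. \<exists>e''>0. e'' \<le> min e e' \<and> (\<forall>\<tau>. 0 \<le> \<tau> \<and> \<tau> \<le> e'' \<longrightarrow> c * \<tau> ^ Suc i \<le> w 0 p * w \<tau> j)"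
    proof (rule gap_step[OF w \<delta> _ ce(1), where C = "\<bar>w 0 p\<bar> * C"])
      show "w 0 j = 0" using g j by (auto simp: gap_def)
      show "\<bar>w 0 p * w \<tau> j\<bar> \<le> \<bar>w 0 p\<bar> * C * \<tau> ^ Suc i" if "0 \<le> \<tau>" "\<tau> \<le> min e e'" for \<tau>
        using mult_left_mono[OF C(2)[of \<tau>], of "\<bar>w 0 p\<bar>"] that ce(3) by (simp add: abs_mult mult.assoc)
      show "- (\<bar>w 0 p\<bar> * C * \<tau> ^ Suc i) \<le> w 0 p * w \<tau> (j + 1)" if "0 \<le> \<tau>" "\<tau> \<le> min e e'" for \<tau>
      proof -
        have "0 \<le> w 0 q * w \<tau> (j + 1)" using ce'(3)[of \<tau>] ce'(1) that by (auto intro: order_trans[rotated])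
        then have "0 \<le> w 0 p * w \<tau> (j + 1)" using s by (auto simp: zero_less_mult_iff zero_le_mult_iff)
        moreover have "0 \<le> \<bar>w 0 p\<bar> * C * \<tau> ^ Suc i" using C that by simp
        ultimately show ?thesis by linarith
      qed
    qed (use ce ce' C in auto)
    then obtain c2 e2 where ce2: "0 < c2" "0 < e2" "\<And>\<tau>. 0 \<le> \<tau> \<Longrightarrow> \<tau> \<le> e2 \<Longrightarrow> c2 * \<tau> ^ Suc i \<le> w 0 p * w \<tau> j" by blast
    have "0 < w 0 p * w \<tau> j" if "0 < \<tau>" "\<tau> < e2" for \<tau>
      by (rule power_lower_bound_pos[OF ce2(1) that(1) ce2(3)]) (use that in auto)
    with ce2(2) show ?thesis by (rule eventually_at_right_0I)
  qed
  have "\<forall>\<^sub>F \<tau> in at_right 0. \<forall>j\<in>{p<..<q}.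
     (2 * j < p + q \<longrightarrow> 0 < w 0 p * w \<tau> j) \<and> (p + q < 2 * j \<longrightarrow> 0 < w 0 q * w \<tau> j) \<and>
     (2 * j = p + q \<and> 0 < w 0 p * w 0 q \<longrightarrow> 0 < w 0 p * w \<tau> j)"
  proof (intro eventually_ball_finite ballI eventually_conj)
    fix j assume j: "j \<in> {p<..<q}"
    show "\<forall>\<^sub>F \<tau> in at_right 0. 2 * j < p + q \<longrightarrow> 0 < w 0 p * w \<tau> j"
      using 1[of j] j by (cases "2 * j < p + q") auto
    show "\<forall>\<^sub>F \<tau> in at_right 0. p + q < 2 * j \<longrightarrow> 0 < w 0 q * w \<tau> j"
      using 2[of j] j by (cases "p + q < 2 * j") auto
    show "\<forall>\<^sub>F \<tau> in at_right 0. 2 * j = p + q \<and> 0 < w 0 p * w 0 q \<longrightarrow> 0 < w 0 p * w \<tau> j"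
      using 3[of j] j by (cases "2 * j = p + q \<and> 0 < w 0 p * w 0 q") auto
  qed simp
  then show ?thesis by (rule eventually_mono) (auto simp: filled_def)
qed

lemma eventually_sign_extends:
  assumes "\<And>j. ((\<lambda>\<tau>. w' \<tau> j) \<longlongrightarrow> (w :: config) j) G"
  shows "\<forall>\<^sub>F \<tau> in G. sign_extends w (w' \<tau>) a b"
proof -
  have "\<forall>\<^sub>F \<tau> in G. w j \<noteq> 0 \<longrightarrow> 0 < w j * w' \<tau> j" for j
  proof (cases "w j = 0")
    case False
    then have "0 < w j * w j" by (auto simp: zero_less_mult_iff)
    moreover have "((\<lambda>\<tau>. w j * w' \<tau> j) \<longlongrightarrow> w j * w j) G" by (intro tendsto_intros assms)
    ultimately have "\<forall>\<^sub>F \<tau> in G. 0 < w j * w' \<tau> j" by (auto dest: order_tendstoD)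
    then show ?thesis by (rule eventually_mono) simp
  qed simp
  then have "\<forall>\<^sub>F \<tau> in G. \<forall>j\<in>{a..b}. w j \<noteq> 0 \<longrightarrow> 0 < w j * w' \<tau> j"
    by (intro eventually_ball_finite) auto
  then show ?thesis by (rule eventually_mono) (auto simp: sign_extends_def)
qed

section \<open>The number of sign changes along the evolution\<close>

lemma cooperative_tendsto_right:
  assumes "cooperative \<delta> L w" "0 \<le> t"
  shows "((\<lambda>\<tau>. w (t + \<tau>) j) \<longlongrightarrow> w t j) (at_right 0)"
proof -
  have "continuous (at 0 within {0..}) (\<lambda>\<tau>. w (t + \<tau>) j)"
    using cooperative_continuous_on[OF cooperative_time_shift[OF assms]] by (auto simp: continuous_on_eq_continuous_within)
  then have "((\<lambda>\<tau>. w (t + \<tau>) j) \<longlongrightarrow> w (t + 0) j) (at 0 within {0..})" by (simp only: continuous_within)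
  then have "((\<lambda>\<tau>. w (t + \<tau>) j) \<longlongrightarrow> w (t + 0) j) (at_right 0)" by (rule tendsto_within_subset) auto
  then show ?thesis by simp
qed

lemma cooperative_isCont:
  assumes "cooperative \<delta> L w" "0 < t"
  shows "isCont (\<lambda>t. w t j) t"
  using continuous_on_interior[OF cooperative_continuous_on[OF assms(1)], of t j] assms(2) by (simp add: interior_real_atLeast)

lemma cooperative_tendsto_left:
  assumes "cooperative \<delta> L w" "0 < t"
  shows "((\<lambda>\<tau>. w (t - \<tau>) j) \<longlongrightarrow> w t j) (at_right 0)"
proof -
  have "((\<lambda>\<tau>. t - \<tau>) \<longlongrightarrow> t - 0) (at_right 0)" by (intro tendsto_intros)
  then show ?thesis using isCont_tendsto_compose[OF cooperative_isCont[OF assms]] by simp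
qed

lemma sign_changes_right:
  assumes w: "cooperative \<delta> L w" and \<delta>: "0 < \<delta>" and t: "0 \<le> t" and ends: "w t a \<noteq> 0" "w t b \<noteq> 0" "a \<le> b"
  shows "\<forall>\<^sub>F \<tau> in at_right 0. sign_changes (w (t + \<tau>)) a b \<le> sign_changes (w t) a b \<and> \<not> degenerate (w (t + \<tau>)) a b"
proof -
  note w' = cooperative_time_shift[OF w t]
  have "\<forall>\<^sub>F \<tau> in at_right 0. \<forall>p\<in>{a..b}. \<forall>q\<in>{a..b}. gap (w t) p q \<longrightarrow> filled (w t) (w (t + \<tau>)) p q"
  proof (intro eventually_ball_finite ballI finite_atLeastAtMost_int)
    fix p q
    show "\<forall>\<^sub>F \<tau> in at_right 0. gap (w t) p q \<longrightarrow> filled (w t) (w (t + \<tau>)) p q"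
      using eventually_filled[OF w' \<delta>, of p q] by (cases "gap (w t) p q") simp_all
  qed
  moreover have "\<forall>\<^sub>F \<tau> in at_right 0. sign_extends (w t) (w (t + \<tau>)) a b"
    by (intro eventually_sign_extends cooperative_tendsto_right[OF w t])
  ultimately show ?thesis
  proof eventually_elim
    case (elim \<tau>)
    have "filled (w t) (w (t + \<tau>)) p q" if "a \<le> p" "q \<le> b" "gap (w t) p q" for p q
    proof -
      have "p \<in> {a..b}" "q \<in> {a..b}" using that by (auto simp: gap_def)
      then show ?thesis using elim(1) that(3) by simp
    qed
    then show ?case
      using sign_changes_filled[OF ends elim(2)] filled_nondegenerate[OF ends(1,2) elim(2)] by blast
  qed
qed

text \<open>At time \<open>t\<close> the derivative at the vanishing site \<open>p + 1\<close> has
  the sign of \<open>w t p\<close>, since the other neighbour is zero or pushes the same way. Hence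
  just before \<open>t\<close> the value there had the opposite sign.\<close>

lemma first_order_sign:
  assumes w: "cooperative \<delta> L w" and \<delta>: "0 < \<delta>" and t: "0 < t"
    and p: "w t p \<noteq> 0" "w t (p + 1) = 0" "0 \<le> w t p * w t (p + 2)"
  shows "\<forall>\<^sub>F \<tau> in at_right 0. w t p * w (t - \<tau>) (p + 1) < 0"
proof -
  from cooperativeE[OF w less_imp_le[OF t], of "p + 1"]
  obtain \<alpha> \<beta> \<gamma> where "\<delta> \<le> \<alpha>" "\<alpha> \<le> L" "\<bar>\<beta>\<bar> \<le> L" "\<delta> \<le> \<gamma>" "\<gamma> \<le> L"
    and D: "((\<lambda>s. w s (p + 1)) has_real_derivative \<alpha> * w t (p + 1 - 1) + \<beta> * w t (p + 1) + \<gamma> * w t (p + 1 + 1)) (at t within {0..})" .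
  then have c: "\<delta> \<le> \<alpha>" "\<delta> \<le> \<gamma>" by simp_all
  have at: "at t within {0..} = at t" using t by (intro at_within_interior) (simp add: interior_real_atLeast)
  have "((\<lambda>s. w t p * w s (p + 1)) has_real_derivative w t p * (\<alpha> * w t p + \<gamma> * w t (p + 2))) (at t)"
    using DERIV_cmult[OF D[unfolded at], of "w t p"] p(2) by (simp add: add.assoc)
  moreover have "0 < w t p * (\<alpha> * w t p + \<gamma> * w t (p + 2))"
  proof -
    have "0 < \<alpha> * (w t p * w t p)" using c \<delta> p(1) by (auto simp: zero_less_mult_iff)
    moreover have "0 \<le> \<gamma> * (w t p * w t (p + 2))" using c \<delta> p(3) by simp
    ultimately show ?thesis by (simp add: algebra_simps)
  qed
  ultimately obtain d where "0 < d" "\<And>h. 0 < h \<Longrightarrow> h < d \<Longrightarrow> w t p * w (t - h) (p + 1) < w t p * w t (p + 1)"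
    using DERIV_pos_inc_left by blast
  then show ?thesis by (intro eventually_at_right_0I[of d]) (auto simp: p(2))
qed

text \<open>Looking back from \<open>t\<close>, the zeros adjacent to the two ends of a degenerate
  gap are left with nonzero speed towards the sign opposite to the end. The gap thus contained more
  changes before \<open>t\<close>, and semicontinuity prevents a compensation in the rest of the
  window.\<close>

lemma sign_changes_left:
  assumes w: "cooperative \<delta> L w" and \<delta>: "0 < \<delta>" and t: "0 < t" and ends: "w t a \<noteq> 0" "w t b \<noteq> 0" "a \<le> b"
  shows "\<forall>\<^sub>F \<tau> in at_right 0. sign_changes (w t) a b \<le> sign_changes (w (t - \<tau>)) a b"
    and "degenerate (w t) a b \<Longrightarrow> \<forall>\<^sub>F \<tau> in at_right 0. sign_changes (w t) a b < sign_changes (w (t - \<tau>)) a b"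
proof -
  have ext: "\<forall>\<^sub>F \<tau> in at_right 0. sign_extends (w t) (w (t - \<tau>)) a b"
    by (intro eventually_sign_extends cooperative_tendsto_left[OF w t])
  then show "\<forall>\<^sub>F \<tau> in at_right 0. sign_changes (w t) a b \<le> sign_changes (w (t - \<tau>)) a b"
    by (rule eventually_mono) (rule sign_changes_lower_semicontinuous[OF ends])
  assume "degenerate (w t) a b"
  from degenerate_gap[OF ends(1,2) this]
  obtain p q where pq: "a \<le> p" "q \<le> b" "gap (w t) p q" "p + 3 \<le> q \<or> q = p + 2 \<and> 0 < w t p * w t q" .
  have g: "w t p \<noteq> 0" "w t q \<noteq> 0" "p < q" and z: "\<And>i. p < i \<Longrightarrow> i < q \<Longrightarrow> w t i = 0"
    using pq(3) by (auto simp: gap_def)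
  have "\<forall>\<^sub>F \<tau> in at_right 0. w t p * w (t - \<tau>) (p + 1) < 0"
  proof (rule first_order_sign[OF w \<delta> t g(1)])
    show "w t (p + 1) = 0" using z pq(4) by auto
    show "0 \<le> w t p * w t (p + 2)" using z[of "p + 2"] pq(4) by auto
  qed
  \<comment> \<open>The right end is the left end of the reflected system.\<close>
  moreover have "\<forall>\<^sub>F \<tau> in at_right 0. w t (- (- q)) * w (t - \<tau>) (- (- q + 1)) < 0"
  proof (rule first_order_sign[OF cooperative_reflect[OF w] \<delta> t])
    have e: "- (- q + 1) = q - 1" "- (- q + 2) = q - 2" by simp_all
    show "w t (- (- q + 1)) = 0" unfolding e using z pq(4) by auto
    show "0 \<le> w t (- (- q)) * w t (- (- q + 2))" unfolding e using z[of "q - 2"] pq(4) by (auto simp: mult.commute)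
  qed (use g in simp)
  ultimately show "\<forall>\<^sub>F \<tau> in at_right 0. sign_changes (w t) a b < sign_changes (w (t - \<tau>)) a b"
    using ext
  proof eventually_elim
    case (elim \<tau>)
    have "0 < w t p * w (t - \<tau>) p" "0 < w t q * w (t - \<tau>) q"
      using elim(3) pq g by (auto simp: sign_extends_def)
    moreover have "w t q * w (t - \<tau>) (q - 1) < 0" using elim(2) by (simp add: minus_diff_commute)
    ultimately have "sign_changes (w t) p q < sign_changes (w (t - \<tau>)) p q"
      using elim(1) by (intro sign_changes_degenerate_gap[OF pq(3,4)])
    then show ?case by (rule sign_changes_drop[OF ends(1,2) elim(3) pq(1-3)])
  qed
qed

text \<open>Bisection of the interval: an integer-valued count has no continuity to rely on, but
  around each time a comparison across that time holds at sufficiently short range, and such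
  comparisons compose.\<close>

lemma locally_nonincreasing_imp:
  fixes g :: "real \<Rightarrow> nat"
  assumes "a \<le> b"
    and r: "\<And>t. a \<le> t \<Longrightarrow> t < b \<Longrightarrow> \<forall>\<^sub>F \<tau> in at_right 0. g (t + \<tau>) \<le> g t"
    and l: "\<And>t. a < t \<Longrightarrow> t \<le> b \<Longrightarrow> \<forall>\<^sub>F \<tau> in at_right 0. g t \<le> g (t - \<tau>)"
  shows "g b \<le> g a"
proof -
  have "a \<le> a \<and> b \<le> b \<longrightarrow> g b \<le> g a"
  proof (rule Bolzano[OF assms(1), where P = "\<lambda>x y. a \<le> x \<and> y \<le> b \<longrightarrow> g y \<le> g x"])
    fix x y z assume "a \<le> x \<and> y \<le> b \<longrightarrow> g y \<le> g x" "a \<le> y \<and> z \<le> b \<longrightarrow> g z \<le> g y" "x \<le> y" "y \<le> z"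
    then show "a \<le> x \<and> z \<le> b \<longrightarrow> g z \<le> g x" by fastforce
  next
    fix t assume t: "a \<le> t" "t \<le> b"
    obtain d1 where d1: "0 < d1" "\<And>\<tau>. 0 < \<tau> \<Longrightarrow> \<tau> < d1 \<Longrightarrow> t + \<tau> \<le> b \<Longrightarrow> g (t + \<tau>) \<le> g t"
    proof (cases "t < b")
      case True
      then show ?thesis using r[OF t(1) True] that by (auto simp: eventually_at_right_field)
    next
      case False
      then show ?thesis using that[of 1] t by auto
    qed
    obtain d2 where d2: "0 < d2" "\<And>\<tau>. 0 < \<tau> \<Longrightarrow> \<tau> < d2 \<Longrightarrow> a \<le> t - \<tau> \<Longrightarrow> g t \<le> g (t - \<tau>)"
    proof (cases "a < t")
      case True
      then show ?thesis using l[OF True t(2)] that by (auto simp: eventually_at_right_field)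
    next
      case False
      then show ?thesis using that[of 1] t by auto
    qed
    have "g y \<le> g x" if "x \<le> t" "t \<le> y" "y - x < min d1 d2" "a \<le> x" "y \<le> b" for x y
    proof -
      have "g y \<le> g t" using d1(2)[of "y - t"] that by (cases "y = t") auto
      also have "g t \<le> g x" using d2(2)[of "t - x"] that by (cases "x = t") auto
      finally show ?thesis .
    qed
    then show "\<exists>d>0. \<forall>x y. x \<le> t \<and> t \<le> y \<and> y - x < d \<longrightarrow> a \<le> x \<and> y \<le> b \<longrightarrow> g y \<le> g x"
      using d1(1) d2(1) by (intro exI[of _ "min d1 d2"]) auto
  qed
  then show ?thesis by simp
qed

text \<open>The discrete Sturm property. Ends that never vanish close the window, so changes cannot
  enter; inside, gaps fill without new changes just after each time, and the count just before is at
  least as large.\<close>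

theorem sign_changes_nonincreasing:
  assumes w: "cooperative \<delta> L w" and \<delta>: "0 < \<delta>" and t: "0 \<le> t0" "t0 \<le> t1" and "a \<le> b"
    and ends: "\<And>t. t0 \<le> t \<Longrightarrow> t \<le> t1 \<Longrightarrow> w t a \<noteq> 0 \<and> w t b \<noteq> 0"
  shows "sign_changes (w t1) a b \<le> sign_changes (w t0) a b"
proof (rule locally_nonincreasing_imp[OF t(2)])
  fix t assume "t0 \<le> t" "t < t1"
  then show "\<forall>\<^sub>F \<tau> in at_right 0. sign_changes (w (t + \<tau>)) a b \<le> sign_changes (w t) a b"
    using sign_changes_right[OF w \<delta>, of t a b] ends[of t] t \<open>a \<le> b\<close> by (auto elim: eventually_mono)
next
  fix t assume "t0 < t" "t \<le> t1"
  then show "\<forall>\<^sub>F \<tau> in at_right 0. sign_changes (w t) a b \<le> sign_changes (w (t - \<tau>)) a b"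
    using sign_changes_left(1)[OF w \<delta>, of t a b] ends[of t] t \<open>a \<le> b\<close> by auto
qed

text \<open>The loss takes place before \<open>t\<close> and is not made up for afterwards.
  Nondegeneracy at \<open>t + \<tau>\<close> is recorded too, because it makes the later, smaller
  count stable under perturbation, while the earlier count can only rise; thus the drop is an open
  property.\<close>

lemma degenerate_imp_drop:
  assumes w: "cooperative \<delta> L w" and \<delta>: "0 < \<delta>" and t: "0 < t" and ends: "w t a \<noteq> 0" "w t b \<noteq> 0" "a \<le> b"
    and deg: "degenerate (w t) a b"
  shows "\<forall>\<^sub>F \<tau> in at_right 0. \<tau> < t \<and> (\<forall>s. \<bar>s - t\<bar> \<le> \<tau> \<longrightarrow> w s a \<noteq> 0 \<and> w s b \<noteq> 0) \<and>
     \<not> degenerate (w (t + \<tau>)) a b \<and> sign_changes (w (t + \<tau>)) a b < sign_changes (w (t - \<tau>)) a b"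
proof -
  have nz: "\<forall>\<^sub>F \<tau> in at_right 0. \<forall>s. \<bar>s - t\<bar> \<le> \<tau> \<longrightarrow> w s i \<noteq> 0" if nz: "w t i \<noteq> 0" for i
  proof -
    obtain e where "0 < e" "\<And>s. dist t s < e \<Longrightarrow> w s i \<noteq> 0"
      using continuous_at_avoid[OF cooperative_isCont[OF w t] nz] by metis
    then show ?thesis by (intro eventually_at_right_0I[of e]) (auto simp: dist_real_def abs_minus_commute)
  qed
  have "\<forall>\<^sub>F \<tau> in at_right 0. \<tau> < t" using t by (intro eventually_at_right_0I[of t]) auto
  then show ?thesis
    using nz[OF ends(1)] nz[OF ends(2)] sign_changes_right[OF w \<delta> less_imp_le[OF t] ends]
      sign_changes_left(2)[OF w \<delta> t ends deg]
    by eventually_elim simp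
qed

text \<open>The mean value theorem supplies new coefficients at each time and site without control
  of their variation; this is why \<open>cooperative\<close> quantifies them inside \<open>t\<close>
  and \<open>j\<close> and only bounds them.\<close>

lemma (in fk_chain) cooperative_flow_diff:
  assumes "x \<in> K n" "y \<in> K n"
  shows "cooperative \<delta> (field_lip n) (\<lambda>t j. \<phi> t x j - \<phi> t y j)"
  unfolding cooperative_def
proof (intro allI impI)
  fix t :: real and j assume t: "0 \<le> t"
  note s = flow_solK[OF assms(1)] flow_solK[OF assms(2)]
  obtain \<alpha> \<beta> \<gamma> where c: "\<delta> \<le> \<alpha>" "\<alpha> \<le> field_lip n" "\<bar>\<beta>\<bar> \<le> field_lip n" "\<delta> \<le> \<gamma>" "\<gamma> \<le> field_lip n"
     "f (\<phi> t x) j - f (\<phi> t y) j = \<alpha> * (\<phi> t x (j - 1) - \<phi> t y (j - 1)) + \<beta> * (\<phi> t x j - \<phi> t y j) + \<gamma> * (\<phi> t x (j + 1) - \<phi> t y (j + 1))"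
    using solK_difference[OF s t] by metis
  have "((\<lambda>s. \<phi> s x j - \<phi> s y j) has_real_derivative f (\<phi> t x) j - f (\<phi> t y) j) (at t within {0..})"
    by (rule DERIV_diff[OF solK_deriv[OF s(1) t order_refl] solK_deriv[OF s(2) t order_refl]])
  then show "\<exists>\<alpha> \<beta> \<gamma>. \<delta> \<le> \<alpha> \<and> \<alpha> \<le> field_lip n \<and> \<bar>\<beta>\<bar> \<le> field_lip n \<and> \<delta> \<le> \<gamma> \<and> \<gamma> \<le> field_lip n \<and>
     ((\<lambda>s. \<phi> s x j - \<phi> s y j) has_real_derivative \<alpha> * (\<phi> t x (j - 1) - \<phi> t y (j - 1)) + \<beta> * (\<phi> t x j - \<phi> t y j) + \<gamma> * (\<phi> t x (j + 1) - \<phi> t y (j + 1))) (at t within {0..})"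
    using c(1-5) unfolding c(6) by blast
qed

section \<open>Sign changes summed over consecutive blocks\<close>

lemma sign_changes_blocks:
  fixes l m :: nat
  shows "sign_changes w 0 (int (m * l)) = (\<Sum>k<m. sign_changes w (int (k * l)) (int (k * l) + int l))"
proof (induction m)
  case (Suc m)
  have "sign_changes w 0 (int (Suc m * l)) = sign_changes w 0 (int (m * l)) + sign_changes w (int (m * l)) (int (Suc m * l))"
    by (rule sign_changes_split) auto
  moreover have "int (Suc m * l) = int (m * l) + int l" by simp
  ultimately show ?case using Suc by (simp only: sum.lessThan_Suc)
qed simp

text \<open>The intervals between the chosen blocks also have their ends in \<open>S\<close>, so
  their contributions are nonnegative and may be dropped. In the application \<open>h\<close> is the
  loss of sign changes during a short time step, and \<open>S\<close> consists of the sites at which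
  the field does not vanish during that step.\<close>

lemma superadditive_disjoint_blocks:
  fixes h :: "int \<Rightarrow> int \<Rightarrow> int" and l :: nat and D :: "nat set"
  assumes add: "\<And>a b c. a \<le> b \<Longrightarrow> b \<le> c \<Longrightarrow> h a c = h a b + h b c"
    and nn: "\<And>a b. a \<le> b \<Longrightarrow> a \<in> S \<Longrightarrow> b \<in> S \<Longrightarrow> 0 \<le> h a b"
    and D: "finite D" "\<And>k. k \<in> D \<Longrightarrow> int (k * l) \<in> S \<and> int (k * l) + int l \<in> S \<and> r \<le> int (k * l) \<and> int (k * l) + int l \<le> R"
    and r: "r \<in> S" "R \<in> S" "r \<le> R"
  shows "(\<Sum>k\<in>D. h (int (k * l)) (int (k * l) + int l)) \<le> h r R"
  using D r(2,3)
proof (induction D arbitrary: R rule: finite_linorder_max_induct)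
  case empty
  then show ?case using nn r(1) by simp
next
  case (insert k D)
  have k: "int (k * l) \<in> S" "int (k * l) + int l \<in> S" "r \<le> int (k * l)" "int (k * l) + int l \<le> R"
    using insert.prems(1)[of k] by auto
  have "(\<Sum>k\<in>D. h (int (k * l)) (int (k * l) + int l)) \<le> h r (int (k * l))"
  proof (rule insert.IH)
    fix i assume i: "i \<in> D"
    then have "i < k" using insert.hyps by blast
    then have "Suc i * l \<le> k * l" by (intro mult_le_mono1) simp
    then have "int (Suc i * l) \<le> int (k * l)" by (simp only: of_nat_le_iff)
    moreover have "int (Suc i * l) = int (i * l) + int l" by simp
    ultimately show "int (i * l) \<in> S \<and> int (i * l) + int l \<in> S \<and> r \<le> int (i * l) \<and> int (i * l) + int l \<le> int (k * l)"
      using insert.prems(1)[of i] i by simp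
  qed (use k in auto)
  moreover have "0 \<le> h (int (k * l) + int l) R" using nn k insert.prems by blast
  moreover have "h r R = h r (int (k * l)) + h (int (k * l)) (int (k * l) + int l) + h (int (k * l) + int l) R"
    using add[of r "int (k * l)" R] add[of "int (k * l)" "int (k * l) + int l" R] k by simp
  moreover have "k \<notin> D" using insert.hyps by blast
  ultimately show ?case using insert.hyps(1) by simp
qed

text \<open>Sign changes enter or leave a long window only through its two ends; at each of the finitely
  many time steps the end is moved by at most \<open>q\<close> sites to a place where \<open>y\<close> does not vanish.\<close>

lemma sign_changes_block_sum_bound:
  fixes y :: "real \<Rightarrow> config" and C :: real and l q m :: nat and dr :: "nat \<Rightarrow> bool"
  assumes C: "0 \<le> C" "\<And>\<tau> \<tau>' j. \<tau> \<in> {0..1} \<Longrightarrow> \<tau>' \<in> {0..1} \<Longrightarrow> \<bar>y \<tau> j - y \<tau>' j\<bar> \<le> C * \<bar>\<tau> - \<tau>'\<bar>"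
    and mono: "\<And>a b \<tau>0 \<tau>1. 0 \<le> \<tau>0 \<Longrightarrow> \<tau>0 \<le> \<tau>1 \<Longrightarrow> \<tau>1 \<le> 1 \<Longrightarrow> a \<le> b \<Longrightarrow>
       (\<And>\<tau>. \<tau>0 \<le> \<tau> \<Longrightarrow> \<tau> \<le> \<tau>1 \<Longrightarrow> y \<tau> a \<noteq> 0 \<and> y \<tau> b \<noteq> 0) \<Longrightarrow>
       sign_changes (y \<tau>1) a b \<le> sign_changes (y \<tau>0) a b"
    and l: "1 \<le> l"
    and left: "\<And>\<tau>. \<tau> \<in> {0..1} \<inter> \<rat> \<Longrightarrow> \<exists>r\<le>q. 1 / real (Suc q) \<le> \<bar>y \<tau> (int r)\<bar>"
    and right: "\<And>\<tau>. \<tau> \<in> {0..1} \<inter> \<rat> \<Longrightarrow> \<exists>r\<le>q. 1 / real (Suc q) \<le> \<bar>y \<tau> (int (m * l) + int r)\<bar>"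
    and dr: "\<And>k. dr k \<Longrightarrow> (\<forall>\<tau>\<in>{0..1}. y \<tau> (int (k * l)) \<noteq> 0 \<and> y \<tau> (int (k * l) + int l) \<noteq> 0) \<and>
       sign_changes (y 1) (int (k * l)) (int (k * l) + int l) < sign_changes (y 0) (int (k * l)) (int (k * l) + int l)"
  shows "(\<Sum>k<m. int (sign_changes (y 1) (int (k * l)) (int (k * l) + int l)) -
      int (sign_changes (y 0) (int (k * l)) (int (k * l) + int l)) + of_bool (dr k))
     \<le> 2 * int q * int (nat \<lceil>C * real (Suc q)\<rceil> + 1) + 2 * int q"
proof -
  let ?N = "int (m * l)"
  let ?s = "\<lambda>\<tau> a b. int (sign_changes (y \<tau>) a b)"
  let ?k = "\<lambda>k. int (k * l)"
  let ?k' = "\<lambda>k. int (k * l) + int l"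
  have s_le: "?s \<tau> a b \<le> b - a" if "a \<le> b" for \<tau> a b
    using sign_changes_le[of "y \<tau>" a b] that by linarith
  have split: "?s \<tau> a c = ?s \<tau> a b + ?s \<tau> b c" if "a \<le> b" "b \<le> c" for \<tau> a b c
    using sign_changes_split[OF that, of "y \<tau>"] by simp
  show ?thesis
  proof (cases "?N < int q")
    case True
    have "(\<Sum>k<m. ?s 1 (?k k) (?k' k) - ?s 0 (?k k) (?k' k) + of_bool (dr k)) \<le> (\<Sum>k<m. 2 * int l)"
    proof (rule sum_mono)
      fix k
      have "?s 1 (?k k) (?k' k) \<le> int l" using s_le[of "?k k" "?k' k" 1] by simp
      moreover have "of_bool (dr k) \<le> int l" using l by simp
      ultimately show "?s 1 (?k k) (?k' k) - ?s 0 (?k k) (?k' k) + of_bool (dr k) \<le> 2 * int l" by linarith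
    qed
    also have "\<dots> = 2 * ?N" by simp
    finally have "(\<Sum>k<m. ?s 1 (?k k) (?k' k) - ?s 0 (?k k) (?k' k) + of_bool (dr k)) \<le> 2 * ?N" .
    moreover have "0 \<le> 2 * int q * int (nat \<lceil>C * real (Suc q)\<rceil> + 1)" by (intro mult_nonneg_nonneg) auto
    ultimately show ?thesis using True by linarith
  next
    case False
    \<comment> \<open>The number of time steps: during a step of length \<open>1 / P\<close> the
      field moves by less than \<open>1 / real (Suc q)\<close>, so a site where it has at least this
      size at the beginning of the step stays nonzero throughout.\<close>
    define P where "P = nat \<lceil>C * real (Suc q)\<rceil> + 1"
    have "C * real (Suc q) < real P" unfolding P_def using C(1) by (simp add: of_nat_nat) linarith
    then have CP: "C / real P < 1 / real (Suc q)" "0 < real P"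
      by (auto simp: P_def field_simps)
    define \<tau> where "\<tau> i = real i / real P" for i
    have \<tau>: "\<tau> i \<in> {0..1}" "\<tau> i \<in> \<rat>" if "i \<le> P" for i using that CP(2) by (auto simp: \<tau>_def)
    have \<tau>S: "\<tau> (Suc i) = \<tau> i + 1 / real P" for i by (simp add: \<tau>_def add_divide_distrib)
    have piece: "y t j \<noteq> 0" if "i < P" "1 / real (Suc q) \<le> \<bar>y (\<tau> i) j\<bar>" "\<tau> i \<le> t" "t \<le> \<tau> (Suc i)" for i t j
    proof -
      have "t \<in> {0..1}" using \<tau>(1)[of i] \<tau>(1)[of "Suc i"] that by auto
      then have "\<bar>y t j - y (\<tau> i) j\<bar> \<le> C * \<bar>t - \<tau> i\<bar>" using \<tau>(1)[of i] that by (intro C) auto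
      also have "\<dots> \<le> C * (1 / real P)" using that \<tau>S[of i] C(1) by (intro mult_left_mono) auto
      finally show ?thesis using CP that(2) by auto
    qed
    have "\<exists>r\<le>q. 1 / real (Suc q) \<le> \<bar>y (\<tau> i) (int r)\<bar>" if "i < P" for i using left \<tau>[of i] that by auto
    then obtain r where r: "\<And>i. i < P \<Longrightarrow> r i \<le> q" "\<And>i. i < P \<Longrightarrow> 1 / real (Suc q) \<le> \<bar>y (\<tau> i) (int (r i))\<bar>" by metis
    have "\<exists>r\<le>q. 1 / real (Suc q) \<le> \<bar>y (\<tau> i) (?N + int r)\<bar>" if "i < P" for i using right \<tau>[of i] that by auto
    then obtain R where R: "\<And>i. i < P \<Longrightarrow> R i \<le> q" "\<And>i. i < P \<Longrightarrow> 1 / real (Suc q) \<le> \<bar>y (\<tau> i) (?N + int (R i))\<bar>" by metis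
    define h where "h i a b = ?s (\<tau> i) a b - ?s (\<tau> (Suc i)) a b" for i a b
    have h_add: "h i a c = h i a b + h i b c" if "a \<le> b" "b \<le> c" for i a b c
      using split[OF that] by (simp add: h_def)
    have h_abs: "\<bar>h i a b\<bar> \<le> b - a" if "a \<le> b" for i a b
      using s_le[OF that, of "\<tau> i"] s_le[OF that, of "\<tau> (Suc i)"] by (simp add: h_def)
    \<comment> \<open>The left end of the window moves to the right by at most \<open>q\<close>
      sites, so only blocks starting at \<open>q\<close> or later are sure to lie inside. At most
      \<open>q\<close> blocks are given up, since each has length at least 1; they appear in the
      final bound.\<close>
    define D where "D = {k. k < m \<and> dr k \<and> int q \<le> ?k k}"
    have "finite D" by (auto simp: D_def)
    have hD: "(\<Sum>k\<in>D. h i (?k k) (?k' k)) \<le> h i 0 ?N + 2 * int q" if i: "i < P" for i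
    proof -
      define S where "S = {j. \<forall>t. \<tau> i \<le> t \<and> t \<le> \<tau> (Suc i) \<longrightarrow> y t j \<noteq> 0}"
      have rS: "int (r i) \<in> S" "?N + int (R i) \<in> S"
        unfolding S_def using piece[OF i r(2)[OF i]] piece[OF i R(2)[OF i]] by auto
      have le: "int (r i) \<le> int q" "int (R i) \<le> int q" "int q \<le> ?N" using r(1)[OF i] R(1)[OF i] False by auto
      have "(\<Sum>k\<in>D. h i (?k k) (?k' k)) \<le> h i (int (r i)) (?N + int (R i))"
      proof (rule superadditive_disjoint_blocks[where S = S, OF h_add _ \<open>finite D\<close> _ rS])
        fix a b assume ab: "a \<le> b" "a \<in> S" "b \<in> S"
        have "sign_changes (y (\<tau> (Suc i))) a b \<le> sign_changes (y (\<tau> i)) a b"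
          by (rule mono) (use ab \<tau>(1)[of i] \<tau>(1)[of "Suc i"] \<tau>S[of i] i in \<open>auto simp: S_def\<close>)
        then show "0 \<le> h i a b" by (simp add: h_def)
      next
        fix k assume k: "k \<in> D"
        have "?k k \<in> S \<and> ?k' k \<in> S"
          using dr[of k] k \<tau>(1)[of i] \<tau>(1)[of "Suc i"] i by (auto simp: S_def D_def)
        moreover have "Suc k * l \<le> m * l" using k by (intro mult_le_mono1) (auto simp: D_def)
        then have "int (Suc k * l) \<le> ?N" by (simp only: of_nat_le_iff)
        then have "?k' k \<le> ?N" by simp
        ultimately show "?k k \<in> S \<and> ?k' k \<in> S \<and> int (r i) \<le> ?k k \<and> ?k' k \<le> ?N + int (R i)"
          using k le by (auto simp: D_def)
      qed (use le in auto)
      also have "h i (int (r i)) (?N + int (R i)) = h i 0 ?N - h i 0 (int (r i)) + h i ?N (?N + int (R i))"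
        using h_add[of 0 "int (r i)" ?N i] h_add[of "int (r i)" ?N "?N + int (R i)" i] le by simp
      also have "\<dots> \<le> h i 0 ?N + 2 * int q"
        using h_abs[of 0 "int (r i)" i] h_abs[of ?N "?N + int (R i)" i] le by linarith
      finally show ?thesis .
    qed
    have tele: "(\<Sum>i<P. h i a b) = ?s 0 a b - ?s 1 a b" for a b
    proof -
      have "(\<Sum>i<P. h i a b) = ?s (\<tau> 0) a b - ?s (\<tau> P) a b"
        unfolding h_def by (rule sum_lessThan_telescope')
      then show ?thesis using CP(2) by (simp add: \<tau>_def)
    qed
    \<comment> \<open>Each block of \<open>D\<close> loses at least one change between the times 0
      and 1. Telescoping distributes this loss over the \<open>P\<close> steps, and after exchanging
      the sums the bound for a single step applies.\<close>
    have "int (card D) = (\<Sum>k\<in>D. 1)" by simp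
    also have "\<dots> \<le> (\<Sum>k\<in>D. ?s 0 (?k k) (?k' k) - ?s 1 (?k k) (?k' k))"
      using dr by (intro sum_mono) (force simp: D_def)
    also have "\<dots> = (\<Sum>k\<in>D. \<Sum>i<P. h i (?k k) (?k' k))" by (simp only: tele)
    also have "\<dots> = (\<Sum>i<P. \<Sum>k\<in>D. h i (?k k) (?k' k))" by (rule sum.swap)
    also have "\<dots> \<le> (\<Sum>i<P. h i 0 ?N + 2 * int q)" using hD by (intro sum_mono) auto
    also have "\<dots> = ?s 0 0 ?N - ?s 1 0 ?N + 2 * int q * int P" by (simp add: sum.distrib tele)
    finally have main: "?s 1 0 ?N - ?s 0 0 ?N + int (card D) \<le> 2 * int q * int P" by simp
    have "(\<Sum>k<m. of_bool (dr k)) \<le> int (card D) + int q"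
    proof -
      have "(\<Sum>k<m. of_bool (dr k) :: int) = int (card ({..<m} \<inter> {k. dr k}))" by simp
      also have "card ({..<m} \<inter> {k. dr k}) \<le> card (D \<union> {..<q})"
      proof (rule card_mono)
        show "{..<m} \<inter> {k. dr k} \<subseteq> D \<union> {..<q}"
        proof
          fix k assume k: "k \<in> {..<m} \<inter> {k. dr k}"
          show "k \<in> D \<union> {..<q}"
          proof (cases "q \<le> k * l")
            case True
            then show ?thesis using k by (simp add: D_def del: of_nat_mult)
          next
            case False
            moreover have "k * 1 \<le> k * l" by (rule mult_le_mono2[OF l])
            ultimately have "k < q" by linarith
            then show ?thesis by simp
          qed
        qed
      qed (use \<open>finite D\<close> in auto)
      also have "card (D \<union> {..<q}) \<le> card D + q" using card_Un_le[of D "{..<q}"] by simp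
      finally show ?thesis by simp
    qed
    moreover have "(\<Sum>k<m. ?s 1 (?k k) (?k' k) - ?s 0 (?k k) (?k' k) + of_bool (dr k)) = ?s 1 0 ?N - ?s 0 0 ?N + (\<Sum>k<m. of_bool (dr k))"
      by (simp only: sum.distrib sum_subtractf sign_changes_blocks of_nat_sum)
    ultimately show ?thesis using main unfolding P_def by linarith
  qed
qed

section \<open>Stationary measures\<close>

text \<open>The law of a representative of a random class is invariant only when tested against
  functions that do not see the integer translations.\<close>

locale fk_ergodic = fk_chain V F \<delta> + prob_space M
  for V F \<delta> and M :: "config measure" +
  fixes n :: nat
  assumes sets_M: "sets M = sets (restrict_space borel (K n))"
    and shift_integral: "\<And>h :: config \<Rightarrow> real. h \<in> borel_measurable M \<Longrightarrow> (\<And>u m. u \<in> K n \<Longrightarrow> h (translate m u) = h u) \<Longrightarrow>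
      (\<integral>u. h (Tshift u) \<partial>M) = (\<integral>u. h u \<partial>M)"
    and flow_integral: "\<And>(h :: config \<Rightarrow> real) t. 0 \<le> t \<Longrightarrow> h \<in> borel_measurable M \<Longrightarrow> (\<And>u m. u \<in> K n \<Longrightarrow> h (translate m u) = h u) \<Longrightarrow>
      (\<integral>u. h (\<phi> t u) \<partial>M) = (\<integral>u. h u \<partial>M)"
    and ergodic: "\<And>Q. {u \<in> K n. Q u} \<in> sets M \<Longrightarrow> (\<And>u m. u \<in> K n \<Longrightarrow> Q (translate m u) = Q u) \<Longrightarrow>
      (\<And>u. u \<in> K n \<Longrightarrow> Q (Tshift u) = Q u) \<Longrightarrow> (\<And>u t. u \<in> K n \<Longrightarrow> 0 \<le> t \<Longrightarrow> Q u \<Longrightarrow> Q (\<phi> t u)) \<Longrightarrow>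
      prob {u \<in> K n. Q u} = 0 \<or> prob {u \<in> K n. Q u} = 1"
begin

lemma space_M [simp]: "space M = K n"
  using sets_eq_imp_space_eq[OF sets_M] by (simp add: space_restrict_space)

lemma prob_K [simp]: "prob (K n) = 1"
  using prob_space by simp

lemma measurable_continuous: "continuous_on (K n) h \<Longrightarrow> h \<in> borel_measurable M"
  for h :: "config \<Rightarrow> 'b :: topological_space"
  using borel_measurable_continuous_on_restrict[of "K n" h] measurable_cong_sets[OF sets_M refl] by blast

lemma coordinate_measurable [measurable]: "(\<lambda>u. u j) \<in> borel_measurable M"
  by (rule measurable_continuous[OF continuous_coordinate])

lemma measurable_into_M:
  assumes "continuous_on (K n) h" "h \<in> K n \<rightarrow> K n"
  shows "h \<in> measurable M M"
proof -
  have "h \<in> measurable M (restrict_space borel (K n))"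
    by (rule measurable_restrict_space2) (use assms measurable_continuous in auto)
  then show ?thesis using measurable_cong_sets[OF refl sets_M] by blast
qed

lemma flow_measurable: "0 \<le> t \<Longrightarrow> \<phi> t \<in> measurable M M"
  by (intro measurable_into_M continuous_on_coordinatewise_then_product flow_continuous) (auto intro: flow_K)

lemma shift_measurable: "Tshift_power k \<in> measurable M M"
  unfolding Tshift_power_def[abs_def]
  by (intro measurable_into_M continuous_on_coordinatewise_then_product continuous_coordinate)
    (use K_shift[of _ n k] in \<open>auto simp: Tshift_power_def\<close>)

definition inv_fun :: "(config \<Rightarrow> real) \<Rightarrow> bool" where
  "inv_fun h \<longleftrightarrow> h \<in> borel_measurable M \<and> (\<forall>u\<in>K n. \<forall>m. h (translate m u) = h u)"

definition inv_event :: "(config \<Rightarrow> bool) \<Rightarrow> bool" where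
  "inv_event Q \<longleftrightarrow> Measurable.pred M Q \<and> (\<forall>u\<in>K n. \<forall>m. Q (translate m u) = Q u)"

lemma inv_event_sets: "inv_event Q \<Longrightarrow> {u \<in> K n. Q u} \<in> sets M"
proof -
  assume "inv_event Q"
  then have "Measurable.pred M Q" by (simp only: inv_event_def)
  then have "{u \<in> space M. Q u} \<in> sets M" by (rule predE)
  then show ?thesis by (simp only: space_M)
qed

lemma inv_event_indicator: "inv_event Q \<Longrightarrow> inv_fun (\<lambda>u. indicator {u \<in> K n. Q u} u)"
  unfolding inv_fun_def
  by (intro conjI borel_measurable_indicator inv_event_sets) (auto simp: inv_event_def indicator_def K_translate)

lemma inv_fun_shift: "inv_fun h \<Longrightarrow> inv_fun (\<lambda>u. h (Tshift_power k u))"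
  unfolding inv_fun_def using measurable_compose[OF shift_measurable] by (auto simp: translate_shift[symmetric] K_shift)

lemma inv_fun_flow: "inv_fun h \<Longrightarrow> 0 \<le> t \<Longrightarrow> inv_fun (\<lambda>u. h (\<phi> t u))"
  unfolding inv_fun_def using measurable_compose[OF flow_measurable] by (auto simp: flow_translate flow_K)

lemma inv_event_shift: "inv_event Q \<Longrightarrow> inv_event (\<lambda>u. Q (Tshift_power k u))"
  unfolding inv_event_def using measurable_compose[OF shift_measurable] by (auto simp: translate_shift[symmetric] K_shift)

lemma inv_event_flow: "inv_event Q \<Longrightarrow> 0 \<le> t \<Longrightarrow> inv_event (\<lambda>u. Q (\<phi> t u))"
  unfolding inv_event_def using measurable_compose[OF flow_measurable] by (auto simp: flow_translate flow_K)

lemma integral_shift: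
  assumes "inv_fun h"
  shows "(\<integral>u. h (Tshift_power k u) \<partial>M) = (\<integral>u. h u \<partial>M)"
proof -
  have 1: "(\<integral>u. h (Tshift_power 1 u) \<partial>M) = (\<integral>u. h u \<partial>M)" if "inv_fun h" for h
    using shift_integral[of h] that by (auto simp: inv_fun_def Tshift_eq_power)
  show ?thesis
  proof (induction k rule: int_induct[where k = 0])
    case (step1 i)
    then show ?case using 1[OF inv_fun_shift[OF assms, of i]] by (simp add: Tshift_power_add)
  next
    case (step2 i)
    then show ?case using 1[OF inv_fun_shift[OF assms, of "i - 1"]] by (simp add: Tshift_power_add)
  qed simp
qed

lemma integral_flow: "inv_fun h \<Longrightarrow> 0 \<le> t \<Longrightarrow> (\<integral>u. h (\<phi> t u) \<partial>M) = (\<integral>u. h u \<partial>M)"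
  using flow_integral by (auto simp: inv_fun_def)

lemma prob_eq_integral: "inv_event Q \<Longrightarrow> prob {u \<in> K n. Q u} = (\<integral>u. indicator {u \<in> K n. Q u} u \<partial>M)"
  by (subst Bochner_Integration.integral_indicator) (auto intro: arg_cong[where f = prob])

lemma prob_shift: "inv_event Q \<Longrightarrow> prob {u \<in> K n. Q (Tshift_power k u)} = prob {u \<in> K n. Q u}"
proof -
  assume Q: "inv_event Q"
  have "(\<integral>u. indicator {u \<in> K n. Q (Tshift_power k u)} u \<partial>M) = (\<integral>u. indicator {u \<in> K n. Q u} (Tshift_power k u) \<partial>M :: real)"
    by (rule Bochner_Integration.integral_cong) (auto simp: indicator_def K_shift)
  then show ?thesis
    using integral_shift[OF inv_event_indicator[OF Q], of k] prob_eq_integral[OF Q] prob_eq_integral[OF inv_event_shift[OF Q]]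
    by simp
qed

lemma prob_flow: "inv_event Q \<Longrightarrow> 0 \<le> t \<Longrightarrow> prob {u \<in> K n. Q (\<phi> t u)} = prob {u \<in> K n. Q u}"
proof -
  assume Q: "inv_event Q" and t: "0 \<le> t"
  have "(\<integral>u. indicator {u \<in> K n. Q (\<phi> t u)} u \<partial>M) = (\<integral>u. indicator {u \<in> K n. Q u} (\<phi> t u) \<partial>M :: real)"
    by (rule Bochner_Integration.integral_cong) (auto simp: indicator_def flow_K t)
  then show ?thesis
    using integral_flow[OF inv_event_indicator[OF Q] t] prob_eq_integral[OF Q] prob_eq_integral[OF inv_event_flow[OF Q t]]
    by simp
qed

lemma AE_iff_prob: "inv_event Q \<Longrightarrow> (AE u in M. Q u) \<longleftrightarrow> prob {u \<in> K n. Q u} = 1"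
  using prob_Collect_eq_1[of Q] inv_event_sets[of Q] by simp

lemma AE_shift: "inv_event Q \<Longrightarrow> (AE u in M. Q (Tshift_power k u)) \<longleftrightarrow> (AE u in M. Q u)"
  by (simp add: AE_iff_prob inv_event_shift prob_shift)

lemma AE_flow: "inv_event Q \<Longrightarrow> 0 \<le> t \<Longrightarrow> (AE u in M. Q (\<phi> t u)) \<longleftrightarrow> (AE u in M. Q u)"
  by (simp add: AE_iff_prob inv_event_flow prob_flow)

lemma zero_one:
  assumes "inv_event Q" "\<And>u. u \<in> K n \<Longrightarrow> Q (Tshift u) = Q u" "\<And>u t. u \<in> K n \<Longrightarrow> 0 \<le> t \<Longrightarrow> Q u \<Longrightarrow> Q (\<phi> t u)"
  shows "(AE u in M. Q u) \<or> (AE u in M. \<not> Q u)"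
proof -
  have "prob {u \<in> K n. Q u} = 0 \<or> prob {u \<in> K n. Q u} = 1"
    using ergodic[OF inv_event_sets[OF assms(1)] _ assms(2,3)] assms(1) by (auto simp: inv_event_def)
  then show ?thesis
    using prob_Collect_eq_0[of Q] prob_Collect_eq_1[of Q] inv_event_sets[OF assms(1)] by auto
qed

text \<open>If both ends of a stretch of \<open>m\<close> blocks are good, the sum of
  \<open>h\<close> over it is bounded independently of \<open>m\<close>. Dividing the expected sum
  by \<open>m\<close> and letting \<open>m\<close> grow leaves only the probability of a bad end,
  which vanishes as \<open>q\<close> grows. The bounds \<open>b q\<close> may increase with
  \<open>q\<close> at any rate.\<close>

lemma coboundary_nonpos:
  fixes h :: "config \<Rightarrow> real" and G :: "nat \<Rightarrow> config \<Rightarrow> bool" and b :: "nat \<Rightarrow> real" and l :: nat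
  assumes h: "inv_fun h" and B: "\<And>u. u \<in> K n \<Longrightarrow> \<bar>h u\<bar> \<le> B"
    and G: "\<And>q. inv_event (G q)" "\<And>q u. G q u \<Longrightarrow> G (Suc q) u" "AE u in M. \<exists>q. G q u"
    and bound: "AE u in M. \<forall>q m. G q u \<longrightarrow> G q (Tshift_power (- int (m * l)) u) \<longrightarrow>
      (\<Sum>k<m. h (Tshift_power (- int (k * l)) u)) \<le> b q"
  shows "(\<integral>u. h u \<partial>M) \<le> 0"
proof -
  define A where "A q = {u \<in> K n. G q u}" for q
  have A: "A q \<in> sets M" for q using inv_event_sets[OF G(1)] by (simp add: A_def)
  have int_shift: "integrable M (\<lambda>u. h (Tshift_power k u))" for k
    using inv_fun_shift[OF h, of k] B K_shift
    by (intro integrable_const_bound[of _ B]) (auto simp: inv_fun_def)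
  have B0: "0 \<le> B"
  proof -
    obtain u where "u \<in> K n" using not_empty by auto
    then show ?thesis using B[of u] by linarith
  qed
  \<comment> \<open>On the bad set the sum is estimated by \<open>m * B\<close>. By stationarity the
    right end is bad with the same probability as the left one, which explains the factor 2.\<close>
  have le: "(\<integral>u. h u \<partial>M) \<le> \<bar>b q\<bar> / real m + 2 * B * (1 - prob (A q))" if m: "0 < m" for q m
  proof -
    let ?T = "Tshift_power (- int (m * l))"
    define A' where "A' = {u \<in> K n. G q (?T u)}"
    have A': "A' \<in> sets M" "prob A' = prob (A q)"
      using inv_event_sets[OF inv_event_shift[OF G(1)]] prob_shift[OF G(1)] by (auto simp: A'_def A_def)
    have "real m * (\<integral>u. h u \<partial>M) = (\<Sum>k<m. \<integral>u. h (Tshift_power (- int (k * l)) u) \<partial>M)"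
      by (simp only: integral_shift[OF h]) simp
    also have "\<dots> = (\<integral>u. (\<Sum>k<m. h (Tshift_power (- int (k * l)) u)) \<partial>M)"
      by (rule Bochner_Integration.integral_sum[symmetric]) (rule int_shift)
    also have "\<dots> \<le> (\<integral>u. \<bar>b q\<bar> + real m * B * (indicator (space M - A q) u + indicator (space M - A') u) \<partial>M)"
    proof (rule integral_mono_AE)
      show "integrable M (\<lambda>u. \<Sum>k<m. h (Tshift_power (- int (k * l)) u))"
        by (intro Bochner_Integration.integrable_sum int_shift)
      show "integrable M (\<lambda>u. \<bar>b q\<bar> + real m * B * (indicator (space M - A q) u + indicator (space M - A') u))"
        using A A' by (intro Bochner_Integration.integrable_add integrable_mult_right integrable_const integrable_real_indicator) (auto simp: emeasure_eq_measure simp del: space_M)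
      show "AE u in M. (\<Sum>k<m. h (Tshift_power (- int (k * l)) u)) \<le> \<bar>b q\<bar> + real m * B * (indicator (space M - A q) u + indicator (space M - A') u)"
        using bound AE_space
      proof eventually_elim
        case (elim u)
        have sum: "(\<Sum>k<m. h (Tshift_power (- int (k * l)) u)) \<le> real m * B"
          using sum_bounded_above[of "{..<m}" "\<lambda>k. h (Tshift_power (- int (k * l)) u)" B] B K_shift elim(2)
          by (force simp: abs_le_iff)
        have nn: "0 \<le> real m * B" using B0 by simp
        show ?case
        proof (cases "G q u \<and> G q (?T u)")
          case True
          then have "(\<Sum>k<m. h (Tshift_power (- int (k * l)) u)) \<le> b q" using elim(1) by blast
          then show ?thesis using nn by (simp add: add_increasing2 abs_le_iff order_trans[OF _ abs_ge_self])
        next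
          case False
          then have "1 \<le> indicator (space M - A q) u + (indicator (space M - A') u :: real)"
            using elim(2) by (auto simp: A_def A'_def indicator_def)
          then have "real m * B * 1 \<le> real m * B * (indicator (space M - A q) u + indicator (space M - A') u)"
            using nn by (intro mult_left_mono)
          then show ?thesis using sum by linarith
        qed
      qed
    qed
    also have "\<dots> = \<bar>b q\<bar> + real m * B * ((1 - prob (A q)) + (1 - prob A'))"
    proof -
      have i: "integrable M (indicator (space M - S) :: config \<Rightarrow> real)" "(\<integral>u. indicator (space M - S) u \<partial>M) = 1 - prob S"
        if "S \<in> sets M" for S
        using prob_compl[OF that] sets.compl_sets[OF that] by (auto simp: emeasure_eq_measure intro!: integrable_real_indicator arg_cong[where f = prob] simp del: space_M)
      show ?thesis using i[OF A] i[OF A'(1)]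
        by (simp add: Bochner_Integration.integral_add Bochner_Integration.integrable_add integrable_mult_right)
    qed
    finally have "real m * (\<integral>u. h u \<partial>M) \<le> \<bar>b q\<bar> + real m * (2 * B * (1 - prob (A q)))"
      by (simp add: A'(2) algebra_simps)
    then show ?thesis using m by (simp add: field_simps)
  qed
  have "(\<integral>u. h u \<partial>M) \<le> 2 * B * (1 - prob (A q))" for q
  proof -
    have "(\<lambda>m. \<bar>b q\<bar> / real m) \<longlonglongrightarrow> 0" by real_asymp
    then have "(\<lambda>m. \<bar>b q\<bar> / real m + 2 * B * (1 - prob (A q))) \<longlonglongrightarrow> 0 + 2 * B * (1 - prob (A q))"
      by (intro tendsto_intros)
    then have "(\<integral>u. h u \<partial>M) \<le> 0 + 2 * B * (1 - prob (A q))"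
      by (rule LIMSEQ_le_const) (use le in \<open>auto intro!: exI[of _ 1]\<close>)
    then show ?thesis by simp
  qed
  moreover have "(\<lambda>q. 2 * B * (1 - prob (A q))) \<longlonglongrightarrow> 2 * B * (1 - 1)"
  proof -
    have inc: "incseq A" using G(2) by (auto simp: incseq_Suc_iff A_def)
    have "(\<lambda>q. prob (A q)) \<longlonglongrightarrow> prob (\<Union>q. A q)"
      by (rule finite_Lim_measure_incseq[OF _ inc]) (use A in auto)
    moreover have "prob (\<Union>q. A q) = 1"
      by (rule prob_eq_1[THEN iffD2]) (use A G(3) in \<open>auto simp: A_def elim!: AE_mp\<close>)
    ultimately have "(\<lambda>q. prob (A q)) \<longlonglongrightarrow> 1" by simp
    then show ?thesis by (intro tendsto_intros)
  qed
  ultimately show ?thesis using LIMSEQ_le_const[of "\<lambda>q. 2 * B * (1 - prob (A q))" 0 "\<integral>u. h u \<partial>M"] by auto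
qed

end

section \<open>Stationary fields with a parameter in the unit interval\<close>

lemma rat_near:
  fixes \<tau> e :: real
  assumes "\<tau> \<in> {0..1}" "0 < e"
  obtains r :: rat where "real_of_rat r \<in> {0..1}" "\<bar>\<tau> - real_of_rat r\<bar> < e"
proof (cases "\<tau> = 0")
  case True
  then show ?thesis using that[of 0] assms by auto
next
  case False
  then have "max 0 (\<tau> - e) < \<tau>" using assms by auto
  then obtain r where "max 0 (\<tau> - e) < real_of_rat r" "real_of_rat r < \<tau>"
    using of_rat_dense by blast
  then have r: "0 < real_of_rat r" "\<tau> - e < real_of_rat r" "real_of_rat r < \<tau>" by linarith+
  show ?thesis
  proof (rule that[of r])
    show "real_of_rat r \<in> {0..1}" using r assms unfolding atLeastAtMost_iff by linarith
    show "\<bar>\<tau> - real_of_rat r\<bar> < e" using r by linarith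
  qed
qed

text \<open>The parameters of near-zeros on growing windows accumulate at some \<open>l\<close>. A
  Lipschitz constant common to all sites turns the smallness near \<open>l\<close> into exact
  vanishing at \<open>l\<close>.\<close>

lemma lipschitz_common_zero:
  fixes y :: "real \<Rightarrow> config" and C :: real and J :: "nat \<Rightarrow> int set"
  assumes C: "\<And>\<tau> \<tau>' j. \<tau> \<in> {0..1} \<Longrightarrow> \<tau>' \<in> {0..1} \<Longrightarrow> \<bar>y \<tau> j - y \<tau>' j\<bar> \<le> C * \<bar>\<tau> - \<tau>'\<bar>"
    and J: "incseq J"
    and z: "\<And>N. \<exists>\<tau>\<in>{0..1}. \<forall>j\<in>J N. \<bar>y \<tau> j\<bar> \<le> 1 / real (Suc N)"
  shows "\<exists>\<tau>\<in>{0..1}. \<forall>N. \<forall>j\<in>J N. y \<tau> j = 0"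
proof -
  obtain \<sigma> where \<sigma>: "\<And>N. \<sigma> N \<in> {0..1}" "\<And>N j. j \<in> J N \<Longrightarrow> \<bar>y (\<sigma> N) j\<bar> \<le> 1 / real (Suc N)"
    using z by metis
  obtain l r where l: "l \<in> {0..1}" "strict_mono r" "(\<sigma> \<circ> r) \<longlonglongrightarrow> l"
    using compact_Icc[of "0::real" 1, unfolded compact_def] \<sigma>(1) by metis
  have "y l j = 0" if j: "j \<in> J N" for j N
  proof -
    have "(\<lambda>k. C * \<bar>l - (\<sigma> \<circ> r) k\<bar> + 1 / real (Suc k)) \<longlonglongrightarrow> C * \<bar>l - l\<bar> + 0"
      by (intro tendsto_intros l(3) LIMSEQ_inverse_real_of_nat[unfolded inverse_eq_divide])
    moreover have "\<bar>y l j\<bar> \<le> C * \<bar>l - (\<sigma> \<circ> r) k\<bar> + 1 / real (Suc k)" if "N \<le> k" for k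
    proof -
      have "k \<le> r k" using l(2) by (rule seq_suble)
      then have "j \<in> J (r k)" using incseqD[OF J, of N "r k"] j that by auto
      then have "\<bar>y (\<sigma> (r k)) j\<bar> \<le> 1 / real (Suc (r k))" by (rule \<sigma>(2))
      also have "\<dots> \<le> 1 / real (Suc k)" using \<open>k \<le> r k\<close> by (intro divide_left_mono) auto
      finally show ?thesis using C[OF l(1) \<sigma>(1)[of "r k"], of j] by (simp add: comp_def)
    qed
    ultimately have "\<bar>y l j\<bar> \<le> C * \<bar>l - l\<bar> + 0"
      by (intro LIMSEQ_le_const) auto
    then show ?thesis by simp
  qed
  then show ?thesis using l(1) by blast
qed

lemma sign_change_at_shift: "sign_change_at (\<lambda>i. w (i + c)) j = sign_change_at w (j + c)"
proof
  assume "sign_change_at (\<lambda>i. w (i + c)) j"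
  then obtain k where k: "j < k" "w (j + c) * w (k + c) < 0" "\<And>i. j < i \<Longrightarrow> i < k \<Longrightarrow> w (i + c) = 0"
    by (auto simp: sign_change_at_def)
  have "w i = 0" if "j + c < i" "i < k + c" for i using k(3)[of "i - c"] that by simp
  then show "sign_change_at w (j + c)" using k by (auto simp: sign_change_at_def intro!: exI[of _ "k + c"])
next
  assume "sign_change_at w (j + c)"
  then obtain k where k: "j + c < k" "w (j + c) * w k < 0" "\<And>i. j + c < i \<Longrightarrow> i < k \<Longrightarrow> w i = 0"
    by (auto simp: sign_change_at_def)
  then show "sign_change_at (\<lambda>i. w (i + c)) j" by (auto simp: sign_change_at_def intro!: exI[of _ "k - c"])
qed

lemma sign_changes_shift: "sign_changes (\<lambda>i. w (i + c)) a b = sign_changes w (a + c) (b + c)"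
  unfolding sign_changes_def
  by (rule bij_betw_same_card[of "\<lambda>j. j + c"], rule bij_betwI[of _ _ _ "\<lambda>j. j - c"])
    (auto simp: sign_change_at_shift)

lemma sign_changes_eq_sum: "real (sign_changes w a b) = (\<Sum>j\<in>{a..<b}. of_bool (sign_change_at w j))"
  unfolding sign_changes_def by (simp add: Int_def conj_commute)

context fk_ergodic
begin

text \<open>Isolates what the counting argument uses, because it is run twice: with the evolution
  time as the parameter \<open>\<tau>\<close>, to show that crossings are not lost, and with the
  amount \<open>s\<close> of the motion as the parameter, to compare crossing densities.\<close>

definition stationary_field :: "(real \<Rightarrow> int \<Rightarrow> config \<Rightarrow> real) \<Rightarrow> bool" where
  "stationary_field Y \<longleftrightarrow> (\<forall>\<tau>\<in>{0..1}. \<forall>j. inv_fun (Y \<tau> j)) \<and>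
     (\<forall>\<tau>\<in>{0..1}. \<forall>j k. \<forall>u\<in>K n. Y \<tau> j (Tshift_power k u) = Y \<tau> (j - k) u) \<and>
     (\<exists>C\<ge>0. \<forall>\<tau>\<in>{0..1}. \<forall>\<tau>'\<in>{0..1}. \<forall>j. \<forall>u\<in>K n. \<bar>Y \<tau> j u - Y \<tau>' j u\<bar> \<le> C * \<bar>\<tau> - \<tau>'\<bar>)"

text \<open>A countable, hence measurable, form of the condition that the field vanishes at neither
  \<open>a\<close> nor \<open>b\<close> for any \<open>\<tau>\<close> in the unit interval.\<close>

definition lower_event :: "(real \<Rightarrow> int \<Rightarrow> config \<Rightarrow> real) \<Rightarrow> int \<Rightarrow> int \<Rightarrow> config \<Rightarrow> bool" where
  "lower_event Y a b u \<longleftrightarrow> (\<exists>i :: nat. \<forall>r :: rat. real_of_rat r \<in> {0..1} \<longrightarrow>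
     1 / real (Suc i) \<le> \<bar>Y (real_of_rat r) a u\<bar> \<and> 1 / real (Suc i) \<le> \<bar>Y (real_of_rat r) b u\<bar>)"

definition drop_event :: "(real \<Rightarrow> int \<Rightarrow> config \<Rightarrow> real) \<Rightarrow> int \<Rightarrow> int \<Rightarrow> config \<Rightarrow> bool" where
  "drop_event Y a b u \<longleftrightarrow> lower_event Y a b u \<and>
     sign_changes (\<lambda>j. Y 1 j u) a b < sign_changes (\<lambda>j. Y 0 j u) a b"

text \<open>By stationarity this is also the expected number of sign changes per site of any
  window.\<close>

definition density :: "(real \<Rightarrow> int \<Rightarrow> config \<Rightarrow> real) \<Rightarrow> real \<Rightarrow> real" where
  "density Y \<tau> = prob {u \<in> K n. sign_change_at (\<lambda>j. Y \<tau> j u) 0}"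

lemma shift_coordinates: "u \<in> K n \<Longrightarrow> stationary_field Y \<Longrightarrow> \<tau> \<in> {0..1} \<Longrightarrow>
   (\<lambda>j. Y \<tau> j (Tshift_power k u)) = (\<lambda>j. Y \<tau> (j + - k) u)"
  by (auto simp: stationary_field_def)

lemma inv_event_sign_change:
  assumes Y: "stationary_field Y" "\<tau> \<in> {0..1}"
  shows "inv_event (\<lambda>u. sign_change_at (\<lambda>j. Y \<tau> j u) j)"
proof -
  have [measurable]: "Y \<tau> j \<in> borel_measurable M" for j using Y by (auto simp: stationary_field_def inv_fun_def)
  have "Measurable.pred M (\<lambda>u. sign_change_at (\<lambda>j. Y \<tau> j u) j)"
    unfolding sign_change_at_def by measurable
  then show ?thesis using Y by (auto simp: stationary_field_def inv_fun_def inv_event_def)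
qed

lemma sign_changes_measurable:
  assumes Y: "stationary_field Y" "\<tau> \<in> {0..1}"
  shows "inv_fun (\<lambda>u. real (sign_changes (\<lambda>j. Y \<tau> j u) a b))"
proof -
  have [measurable]: "Measurable.pred M (\<lambda>u. sign_change_at (\<lambda>j. Y \<tau> j u) j)" for j
    using inv_event_sign_change[OF Y] by (simp add: inv_event_def)
  have "(\<lambda>u. real (sign_changes (\<lambda>j. Y \<tau> j u) a b)) \<in> borel_measurable M"
    unfolding sign_changes_eq_sum by measurable
  then show ?thesis using Y by (auto simp: stationary_field_def inv_fun_def)
qed

lemma expectation_sign_changes:
  assumes Y: "stationary_field Y" "\<tau> \<in> {0..1}"
  shows "(\<integral>u. real (sign_changes (\<lambda>j. Y \<tau> j u) 0 (int l)) \<partial>M) = real l * density Y \<tau>"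
proof -
  note e = inv_event_sign_change[OF Y]
  have p: "prob {u \<in> K n. sign_change_at (\<lambda>j. Y \<tau> j u) j} = density Y \<tau>" for j
  proof -
    have "prob {u \<in> K n. sign_change_at (\<lambda>i. Y \<tau> i (Tshift_power (- j) u)) 0} = density Y \<tau>"
      unfolding density_def by (rule prob_shift[OF e])
    moreover have "sign_change_at (\<lambda>i. Y \<tau> i (Tshift_power (- j) u)) 0 = sign_change_at (\<lambda>i. Y \<tau> i u) j" if "u \<in> K n" for u
      unfolding shift_coordinates[OF that Y] by (simp add: sign_change_at_shift[of "\<lambda>i. Y \<tau> i u" j 0, simplified])
    ultimately show ?thesis by (metis (mono_tags, lifting) Collect_cong)
  qed
  have i: "integrable M (indicator {u \<in> K n. sign_change_at (\<lambda>j. Y \<tau> j u) j} :: config \<Rightarrow> real)" for j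
    using inv_event_sets[OF e] by (intro integrable_real_indicator) (auto simp: emeasure_eq_measure)
  have "(\<integral>u. real (sign_changes (\<lambda>j. Y \<tau> j u) 0 (int l)) \<partial>M) =
      (\<integral>u. (\<Sum>j\<in>{0..<int l}. indicator {u \<in> K n. sign_change_at (\<lambda>j. Y \<tau> j u) j} u) \<partial>M)"
    by (rule Bochner_Integration.integral_cong) (auto simp: sign_changes_eq_sum indicator_def intro!: sum.cong)
  also have "\<dots> = (\<Sum>j\<in>{0..<int l}. (\<integral>u. indicator {u \<in> K n. sign_change_at (\<lambda>j. Y \<tau> j u) j} u \<partial>M))"
    by (rule Bochner_Integration.integral_sum) (rule i)
  also have "\<dots> = (\<Sum>j\<in>{0..<int l}. density Y \<tau>)"
    by (intro sum.cong refl) (simp only: prob_eq_integral[OF e, symmetric] p)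
  finally show ?thesis by simp
qed

lemma field_measurable_real_pred:
  assumes "stationary_field Y" "\<tau> \<in> {0..1}"
  shows "Measurable.pred M (\<lambda>u. c \<le> \<bar>Y \<tau> j u\<bar>)" "Measurable.pred M (\<lambda>u. \<bar>Y \<tau> j u\<bar> \<le> c)"
proof -
  have [measurable]: "Y \<tau> j \<in> borel_measurable M" using assms by (auto simp: stationary_field_def inv_fun_def)
  show "Measurable.pred M (\<lambda>u. c \<le> \<bar>Y \<tau> j u\<bar>)" "Measurable.pred M (\<lambda>u. \<bar>Y \<tau> j u\<bar> \<le> c)" by measurable
qed

lemma field_translate:
  "stationary_field Y \<Longrightarrow> \<tau> \<in> {0..1} \<Longrightarrow> u \<in> K n \<Longrightarrow> Y \<tau> j (translate m u) = Y \<tau> j u"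
  by (auto simp: stationary_field_def inv_fun_def)

lemma inv_event_drop:
  assumes Y: "stationary_field Y"
  shows "inv_event (drop_event Y a b)"
proof -
  have [measurable]: "Measurable.pred M (\<lambda>u. real_of_rat r \<in> {0..1} \<longrightarrow> 1 / real (Suc i) \<le> \<bar>Y (real_of_rat r) a u\<bar> \<and> 1 / real (Suc i) \<le> \<bar>Y (real_of_rat r) b u\<bar>)"
    for r i a b
    using field_measurable_real_pred(1)[OF Y] by (cases "real_of_rat r \<in> {0..1}") (simp_all del: atLeastAtMost_iff add: pred_intros_logic)
  have [measurable]: "(\<lambda>u. real (sign_changes (\<lambda>j. Y 1 j u) a b)) \<in> borel_measurable M" "(\<lambda>u. real (sign_changes (\<lambda>j. Y 0 j u) a b)) \<in> borel_measurable M"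
    using sign_changes_measurable[OF Y] by (auto simp: inv_fun_def)
  have eq: "sign_changes (\<lambda>j. Y 1 j u) a b < sign_changes (\<lambda>j. Y 0 j u) a b \<longleftrightarrow> real (sign_changes (\<lambda>j. Y 1 j u) a b) < real (sign_changes (\<lambda>j. Y 0 j u) a b)" for u
    by simp
  have "Measurable.pred M (drop_event Y a b)"
    unfolding drop_event_def[abs_def] lower_event_def eq by measurable
  moreover have "drop_event Y a b (translate m u) = drop_event Y a b u" if "u \<in> K n" for u m
    using field_translate[OF Y _ that] by (simp add: drop_event_def lower_event_def)
  ultimately show ?thesis by (simp add: inv_event_def)
qed

text \<open>If \<open>Y\<close> vanishes on a half line with positive probability, stationarity lets the half line
  recede to infinity, and compactness in \<open>\<tau>\<close> produces a common zero on all of the lattice.\<close>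

lemma field_nonzero_half_line:
  assumes Y: "stationary_field Y" and NZ: "AE u in M. \<forall>\<tau>\<in>{0..1}. \<exists>j. Y \<tau> j u \<noteq> 0" and e: "e = 1 \<or> e = (-1 :: int)"
  shows "AE u in M. \<forall>\<tau>\<in>{0..1}. \<forall>a. \<exists>i :: nat. Y \<tau> (a + e * int i) u \<noteq> 0"
proof -
  obtain C where C: "0 \<le> C" "\<And>\<tau> \<tau>' j u. \<tau> \<in> {0..1} \<Longrightarrow> \<tau>' \<in> {0..1} \<Longrightarrow> u \<in> K n \<Longrightarrow> \<bar>Y \<tau> j u - Y \<tau>' j u\<bar> \<le> C * \<bar>\<tau> - \<tau>'\<bar>"
    using Y unfolding stationary_field_def by blast
  \<comment> \<open>A countable substitute for the vanishing of the field, at one parameter, on the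
    half line from \<open>a\<close> in the direction \<open>e\<close>: near-zeros at rational
    parameters on growing windows, from which compactness recovers an exact zero.\<close>
  define H where "H a u \<longleftrightarrow> (\<forall>N :: nat. \<exists>r :: rat. real_of_rat r \<in> {0..1} \<and> (\<forall>i\<in>{..N}. \<bar>Y (real_of_rat r) (a + e * int i) u\<bar> \<le> 1 / real (Suc N)))" for a u
  have H_inv: "inv_event (H a)" for a
  proof -
    have [measurable]: "Measurable.pred M (\<lambda>u. real_of_rat r \<in> {0..1} \<and> (\<forall>i\<in>{..N}. \<bar>Y (real_of_rat r) (a + e * int i) u\<bar> \<le> 1 / real (Suc N)))" for r N
    proof (cases "real_of_rat r \<in> {0..1}")
      case True
      have [measurable]: "Measurable.pred M (\<lambda>u. \<bar>Y (real_of_rat r) (a + e * int i) u\<bar> \<le> 1 / real (Suc N))" for i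
        by (rule field_measurable_real_pred(2)[OF Y True])
      have "Measurable.pred M (\<lambda>u. \<forall>i\<in>{..N}. \<bar>Y (real_of_rat r) (a + e * int i) u\<bar> \<le> 1 / real (Suc N))" by measurable
      then show ?thesis using True by (simp del: atLeastAtMost_iff)
    next
      case False
      then show ?thesis by (simp del: atLeastAtMost_iff)
    qed
    have "Measurable.pred M (H a)" unfolding H_def[abs_def] by measurable
    moreover have "H a (translate m u) = H a u" if "u \<in> K n" for u m
      using field_translate[OF Y _ that] unfolding H_def by (simp cong: conj_cong)
    ultimately show ?thesis by (simp add: inv_event_def)
  qed
  have H_shift: "H a (Tshift_power k u) = H (a - k) u" if "u \<in> K n" for a k u
  proof -
    have "Y \<tau> (a + e * int i) (Tshift_power k u) = Y \<tau> (a - k + e * int i) u" if "\<tau> \<in> {0..1}" for \<tau> i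
    proof -
      have "a - k + e * int i = a + e * int i - k" by simp
      then show ?thesis using Y that \<open>u \<in> K n\<close> by (simp only: stationary_field_def)
    qed
    then show ?thesis unfolding H_def by (simp cong: conj_cong)
  qed
  have H_Suc: "H (a + e) u" if Ha: "H a u" for a u
    unfolding H_def
  proof
    fix N
    obtain r where r: "real_of_rat r \<in> {0..1}" "\<And>i. i \<le> Suc N \<Longrightarrow> \<bar>Y (real_of_rat r) (a + e * int i) u\<bar> \<le> 1 / real (Suc (Suc N))"
      using Ha unfolding H_def by (metis atMost_iff)
    have "\<bar>Y (real_of_rat r) (a + e + e * int i) u\<bar> \<le> 1 / real (Suc N)" if "i \<le> N" for i
    proof -
      have eq: "a + e * int (Suc i) = a + e + e * int i" by (simp add: algebra_simps)
      have "\<bar>Y (real_of_rat r) (a + e * int (Suc i)) u\<bar> \<le> 1 / real (Suc (Suc N))"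
        by (rule r(2)) (use that in simp)
      then have "\<bar>Y (real_of_rat r) (a + e + e * int i) u\<bar> \<le> 1 / real (Suc (Suc N))"
        unfolding eq .
      also have "\<dots> \<le> 1 / real (Suc N)" by (intro divide_left_mono) auto
      finally show ?thesis .
    qed
    then show "\<exists>r. real_of_rat r \<in> {0..1} \<and> (\<forall>i\<in>{..N}. \<bar>Y (real_of_rat r) (a + e + e * int i) u\<bar> \<le> 1 / real (Suc N))"
      using r(1) by (intro exI[of _ r]) simp
  qed
  have H_sub: "H 0 u" if "H (- (e * int N)) u" for N u
    using that
  proof (induction N)
    case (Suc N)
    have "- (e * int (Suc N)) + e = - (e * int N)" by (simp add: algebra_simps)
    then show ?case using Suc H_Suc[OF Suc.prems] by simp
  qed simp
  \<comment> \<open>The events for half lines with receding origin are contained in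
    \<open>H 0\<close> and have the same probability, so they differ from it by null sets.\<close>
  have recede: "AE u in M. H 0 u \<longrightarrow> H (- (e * int N)) u" for N
  proof -
    have sets: "{u \<in> K n. H a u} \<in> sets M" for a by (rule inv_event_sets[OF H_inv])
    have "prob {u \<in> K n. H (- (e * int N)) u} = prob {u \<in> K n. H 0 u}"
      using prob_shift[OF H_inv, of 0 "e * int N"] H_shift[of _ 0 "e * int N"] by (simp cong: conj_cong)
    moreover have "{u \<in> K n. H (- (e * int N)) u} \<subseteq> {u \<in> K n. H 0 u}" using H_sub by blast
    ultimately have "prob ({u \<in> K n. H 0 u} - {u \<in> K n. H (- (e * int N)) u}) = 0"
      using finite_measure_Diff[OF sets sets] by simp
    then have "{u \<in> K n. H 0 u} - {u \<in> K n. H (- (e * int N)) u} \<in> null_sets M"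
      using sets by (auto simp: emeasure_eq_measure)
    then show ?thesis by (rule AE_I') auto
  qed
  have "AE u in M. \<forall>N. H 0 u \<longrightarrow> H (- (e * int N)) u" unfolding AE_all_countable using recede by blast
  then have "AE u in M. \<not> H 0 u"
    using NZ AE_space
  proof eventually_elim
    case (elim u)
    then have u: "u \<in> K n" by simp
    show ?case
    proof
      assume "H 0 u"
      then have HN: "H (- (e * int N)) u" for N using elim(1) by blast
      have "\<exists>\<tau>\<in>{0..1}. \<forall>N. \<forall>j\<in>{- int N..int N}. Y \<tau> j u = 0"
      proof (rule lipschitz_common_zero[where y = "\<lambda>\<tau> j. Y \<tau> j u"])
        show "\<bar>Y \<tau> j u - Y \<tau>' j u\<bar> \<le> C * \<bar>\<tau> - \<tau>'\<bar>" if "\<tau> \<in> {0..1}" "\<tau>' \<in> {0..1}" for \<tau> \<tau>' j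
          by (rule C(2)[OF that u])
        show "incseq (\<lambda>N. {- int N..int N})" by (auto simp: incseq_def)
        fix N :: nat
        obtain r where r: "real_of_rat r \<in> {0..1}" "\<And>i. i \<le> 2 * N \<Longrightarrow> \<bar>Y (real_of_rat r) (- (e * int N) + e * int i) u\<bar> \<le> 1 / real (Suc (2 * N))"
          using HN[of N] unfolding H_def by (metis atMost_iff)
        have "\<bar>Y (real_of_rat r) j u\<bar> \<le> 1 / real (Suc N)" if "j \<in> {- int N..int N}" for j
        proof -
          have "j = - (e * int N) + e * int (nat (e * j + int N))" "nat (e * j + int N) \<le> 2 * N"
            using e that by auto
          then have "\<bar>Y (real_of_rat r) j u\<bar> \<le> 1 / real (Suc (2 * N))" using r(2) by metis
          also have "\<dots> \<le> 1 / real (Suc N)" by (intro divide_left_mono) auto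
          finally show ?thesis .
        qed
        then show "\<exists>\<tau>\<in>{0..1}. \<forall>j\<in>{- int N..int N}. \<bar>Y \<tau> j u\<bar> \<le> 1 / real (Suc N)" using r(1) by blast
      qed
      then obtain \<tau> where \<tau>: "\<tau> \<in> {0..1}" "\<And>N j. j \<in> {- int N..int N} \<Longrightarrow> Y \<tau> j u = 0" by blast
      have "Y \<tau> j u = 0" for j by (rule \<tau>(2)[of j "nat \<bar>j\<bar>"]) auto
      then show False using elim(2) \<tau>(1) by blast
    qed
  qed
  moreover have "inv_event (\<lambda>u. \<not> H 0 u)" using H_inv[of 0] by (auto simp: inv_event_def)
  ultimately have "AE u in M. \<not> H 0 (Tshift_power k u)" for k by (subst AE_shift)
  then have "AE u in M. \<forall>k. \<not> H 0 (Tshift_power k u)" by (simp add: AE_all_countable)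
  then show ?thesis
    using AE_space
  proof eventually_elim
    case (elim u)
    then have u: "u \<in> K n" by simp
    have nH: "\<not> H a u" for a using elim(1) H_shift[OF u, of 0 "- a"] by (metis diff_0 minus_minus)
    show ?case
    proof (intro ballI allI)
      fix \<tau> :: real and a assume \<tau>: "\<tau> \<in> {0..1}"
      show "\<exists>i :: nat. Y \<tau> (a + e * int i) u \<noteq> 0"
      proof (rule ccontr)
        assume "\<not> ?thesis"
        then have z: "Y \<tau> (a + e * int i) u = 0" for i by blast
        have "H a u" unfolding H_def
        proof
          fix N
          \<comment> \<open>At this distance the Lipschitz bound keeps the values below
            \<open>1 / real (Suc N)\<close>; \<open>C + 1\<close> in place of \<open>C\<close>
            avoids dividing by zero.\<close>
          have "0 < 1 / (real (Suc N) * (C + 1))" using C(1) by simp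
          from rat_near[OF \<tau> this] obtain r where r: "real_of_rat r \<in> {0..1}" "\<bar>\<tau> - real_of_rat r\<bar> < 1 / (real (Suc N) * (C + 1))" .
          have "C * \<bar>real_of_rat r - \<tau>\<bar> \<le> 1 / real (Suc N)"
          proof -
            have "C * \<bar>real_of_rat r - \<tau>\<bar> \<le> (C + 1) * (1 / (real (Suc N) * (C + 1)))"
              using C(1) r(2) by (intro mult_mono) auto
            also have "\<dots> = 1 / real (Suc N)"
            proof -
              have "C + 1 \<noteq> 0" using C(1) by linarith
              then show ?thesis by (simp del: of_nat_Suc)
            qed
            finally show ?thesis .
          qed
          then have "\<bar>Y (real_of_rat r) (a + e * int i) u\<bar> \<le> 1 / real (Suc N)" for i
            using C(2)[OF r(1) \<tau> u, of "a + e * int i"] z[of i] by simp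
          then show "\<exists>r. real_of_rat r \<in> {0..1} \<and> (\<forall>i\<in>{..N}. \<bar>Y (real_of_rat r) (a + e * int i) u\<bar> \<le> 1 / real (Suc N))"
            using r(1) by blast
        qed
        then show False using nH by blast
      qed
    qed
  qed
qed

lemma lower_event_iff:
  assumes Y: "stationary_field Y" and u: "u \<in> K n"
  shows "lower_event Y a b u \<longleftrightarrow> (\<forall>\<tau>\<in>{0..1}. Y \<tau> a u \<noteq> 0 \<and> Y \<tau> b u \<noteq> 0)"
proof -
  obtain C where C: "0 \<le> C" "\<And>\<tau> \<tau>' j u. \<tau> \<in> {0..1} \<Longrightarrow> \<tau>' \<in> {0..1} \<Longrightarrow> u \<in> K n \<Longrightarrow> \<bar>Y \<tau> j u - Y \<tau>' j u\<bar> \<le> C * \<bar>\<tau> - \<tau>'\<bar>"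
    using Y unfolding stationary_field_def by blast
  show ?thesis
  proof
    assume "lower_event Y a b u"
    then obtain i :: nat where i: "\<And>r. real_of_rat r \<in> {0..1} \<Longrightarrow> 1 / real (Suc i) \<le> \<bar>Y (real_of_rat r) a u\<bar> \<and> 1 / real (Suc i) \<le> \<bar>Y (real_of_rat r) b u\<bar>"
      unfolding lower_event_def by blast
    show "\<forall>\<tau>\<in>{0..1}. Y \<tau> a u \<noteq> 0 \<and> Y \<tau> b u \<noteq> 0"
    proof
      fix \<tau> :: real assume \<tau>: "\<tau> \<in> {0..1}"
      have "0 < 1 / (real (Suc i) * (C + 1))" using C(1) by simp
      from rat_near[OF \<tau> this] obtain r where r: "real_of_rat r \<in> {0..1}" "\<bar>\<tau> - real_of_rat r\<bar> < 1 / (real (Suc i) * (C + 1))" .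
      have "C * \<bar>real_of_rat r - \<tau>\<bar> < 1 / real (Suc i)"
      proof -
        have "C * \<bar>real_of_rat r - \<tau>\<bar> \<le> (C + 1) * \<bar>real_of_rat r - \<tau>\<bar>" by (intro mult_right_mono) auto
        also have "\<dots> < (C + 1) * (1 / (real (Suc i) * (C + 1)))"
          using C(1) r(2) by (intro mult_strict_left_mono) auto
        also have "\<dots> = 1 / real (Suc i)"
        proof -
          have "C + 1 \<noteq> 0" using C(1) by linarith
          then show ?thesis by (simp del: of_nat_Suc)
        qed
        finally show ?thesis .
      qed
      then show "Y \<tau> a u \<noteq> 0 \<and> Y \<tau> b u \<noteq> 0"
        using C(2)[OF r(1) \<tau> u, of a] C(2)[OF r(1) \<tau> u, of b] i[OF r(1)] by auto
    qed
  next
    assume nz: "\<forall>\<tau>\<in>{0..1}. Y \<tau> a u \<noteq> 0 \<and> Y \<tau> b u \<noteq> 0"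
    show "lower_event Y a b u"
    proof (rule ccontr)
      assume "\<not> ?thesis"
      then have bad: "\<exists>r. real_of_rat r \<in> {0..1} \<and> (\<bar>Y (real_of_rat r) a u\<bar> < 1 / real (Suc i) \<or> \<bar>Y (real_of_rat r) b u\<bar> < 1 / real (Suc i))" for i
        unfolding lower_event_def by (metis not_le)
      \<comment> \<open>The smaller of the two moduli, written as a field that is constant in
        \<open>j\<close>, so that the compactness lemma applies with the one-site window.\<close>
      define y :: "real \<Rightarrow> config" where "y \<tau> = (\<lambda>j. min \<bar>Y \<tau> a u\<bar> \<bar>Y \<tau> b u\<bar>)" for \<tau>
      have "\<exists>\<tau>\<in>{0..1}. \<forall>N :: nat. \<forall>j\<in>{0}. y \<tau> j = 0"
      proof (rule lipschitz_common_zero[where y = y and J = "\<lambda>_ :: nat. {0}"])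
        fix \<tau> \<tau>' :: real and j assume "\<tau> \<in> {0..1}" "\<tau>' \<in> {0..1}"
        then show "\<bar>y \<tau> j - y \<tau>' j\<bar> \<le> C * \<bar>\<tau> - \<tau>'\<bar>"
          using C(2)[of \<tau> \<tau>' u a] C(2)[of \<tau> \<tau>' u b] u unfolding y_def by linarith
      next
        fix N show "\<exists>\<tau>\<in>{0..1}. \<forall>j\<in>{0}. \<bar>y \<tau> j\<bar> \<le> 1 / real (Suc N)"
        proof -
          obtain r where r: "real_of_rat r \<in> {0..1}" "\<bar>Y (real_of_rat r) a u\<bar> < 1 / real (Suc N) \<or> \<bar>Y (real_of_rat r) b u\<bar> < 1 / real (Suc N)"
            using bad[of N] by blast
          have "\<bar>y (real_of_rat r) 0\<bar> \<le> 1 / real (Suc N)" using r(2) unfolding y_def by linarith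
          then show ?thesis using r(1) by blast
        qed
      qed (simp add: incseq_def)
      then obtain \<tau> where "\<tau> \<in> {0..1}" "min \<bar>Y \<tau> a u\<bar> \<bar>Y \<tau> b u\<bar> = 0" by (auto simp: y_def)
      then show False using nz by (auto simp: min_def split: if_splits)
    qed
  qed
qed

text \<open>The function \<open>h\<close> below is the net gain of sign changes in a block of length
  \<open>l\<close>, plus 1 if the block has a drop while its ends stay nonzero. Over many blocks its
  sum is bounded by what can enter through the two ends, so its mean is at most 0. By stationarity
  that mean is the difference of the two sides.\<close>

theorem density_drop:
  fixes l :: nat
  assumes Y: "stationary_field Y" and l: "1 \<le> l"
    and NZ: "AE u in M. \<forall>\<tau>\<in>{0..1}. \<exists>j. Y \<tau> j u \<noteq> 0"
    and mono: "AE u in M. \<forall>a b \<tau>0 \<tau>1. 0 \<le> \<tau>0 \<longrightarrow> \<tau>0 \<le> \<tau>1 \<longrightarrow> \<tau>1 \<le> 1 \<longrightarrow> a \<le> b \<longrightarrow>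
       (\<forall>\<tau>\<in>{\<tau>0..\<tau>1}. Y \<tau> a u \<noteq> 0 \<and> Y \<tau> b u \<noteq> 0) \<longrightarrow>
       sign_changes (\<lambda>j. Y \<tau>1 j u) a b \<le> sign_changes (\<lambda>j. Y \<tau>0 j u) a b"
  shows "real l * density Y 1 + prob {u \<in> K n. drop_event Y 0 (int l) u} \<le> real l * density Y 0"
proof -
  obtain C where C: "0 \<le> C" "\<And>\<tau> \<tau>' j u. \<tau> \<in> {0..1} \<Longrightarrow> \<tau>' \<in> {0..1} \<Longrightarrow> u \<in> K n \<Longrightarrow> \<bar>Y \<tau> j u - Y \<tau>' j u\<bar> \<le> C * \<bar>\<tau> - \<tau>'\<bar>"
    using Y unfolding stationary_field_def by blast
  have 01: "0 \<in> {0..1::real}" "1 \<in> {0..1::real}" by simp_all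
  let ?s = "\<lambda>\<tau> a b u. real (sign_changes (\<lambda>j. Y \<tau> j u) a b)"
  define h where "h u = ?s 1 0 (int l) u - ?s 0 0 (int l) u + indicator {u \<in> K n. drop_event Y 0 (int l) u} u" for u
  \<comment> \<open>For every rational parameter some site among 0 to \<open>q\<close> carries a
    value of size at least \<open>1 / real (Suc q)\<close>. The index \<open>q\<close> serves as
    search distance and as inverse size at once, so the events increase; compactness and the absence
    of vanishing half lines make them exhaust almost everything.\<close>
  define G where "G q u \<longleftrightarrow> (\<forall>r :: rat. real_of_rat r \<in> {0..1} \<longrightarrow> (\<exists>i\<in>{..q}. 1 / real (Suc q) \<le> \<bar>Y (real_of_rat r) (int i) u\<bar>))" for q u
  note m = sign_changes_measurable[OF Y 01(1), of 0 "int l"] sign_changes_measurable[OF Y 01(2), of 0 "int l"]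
    inv_event_indicator[OF inv_event_drop[OF Y, of 0 "int l"]]
  have h_inv: "inv_fun h" using m unfolding inv_fun_def h_def by auto
  have h_shift: "h (Tshift_power (- c) u) = ?s 1 c (c + int l) u - ?s 0 c (c + int l) u + of_bool (drop_event Y c (c + int l) u)"
    if u: "u \<in> K n" for u c
  proof -
    have "drop_event Y 0 (int l) (Tshift_power (- c) u) = drop_event Y c (c + int l) u"
      using sign_changes_shift[of "\<lambda>j. Y 1 j u" c 0 "int l"] sign_changes_shift[of "\<lambda>j. Y 0 j u" c 0 "int l"]
        shift_coordinates[OF u Y 01(1), of "- c"] shift_coordinates[OF u Y 01(2), of "- c"] Y u
      by (simp add: drop_event_def lower_event_def stationary_field_def add.commute)
    then show ?thesis
      using shift_coordinates[OF u Y 01(1), of "- c"] shift_coordinates[OF u Y 01(2), of "- c"] K_shift[OF u, of "- c"]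
        sign_changes_shift[of "\<lambda>j. Y 1 j u" c 0 "int l"] sign_changes_shift[of "\<lambda>j. Y 0 j u" c 0 "int l"]
      by (simp add: h_def add.commute)
  qed
  have "(\<integral>u. h u \<partial>M) \<le> 0"
  proof (rule coboundary_nonpos[where h = h and B = "2 * real l + 1" and G = G and l = l
        and b = "\<lambda>q. real_of_int (2 * int q * int (nat \<lceil>C * real (Suc q)\<rceil> + 1) + 2 * int q)"])
    show "inv_fun h" by (rule h_inv)
    show "\<bar>h u\<bar> \<le> 2 * real l + 1" for u
      using sign_changes_le[of "\<lambda>j. Y 1 j u" 0 "int l"] sign_changes_le[of "\<lambda>j. Y 0 j u" 0 "int l"]
      by (auto simp: h_def indicator_def)
    show "inv_event (G q)" for q
    proof -
      have [measurable]: "Measurable.pred M (\<lambda>u. real_of_rat r \<in> {0..1} \<longrightarrow> (\<exists>i\<in>{..q}. 1 / real (Suc q) \<le> \<bar>Y (real_of_rat r) (int i) u\<bar>))" for r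
      proof (cases "real_of_rat r \<in> {0..1}")
        case True
        have [measurable]: "Measurable.pred M (\<lambda>u. 1 / real (Suc q) \<le> \<bar>Y (real_of_rat r) (int i) u\<bar>)" for i
          by (rule field_measurable_real_pred(1)[OF Y True])
        have "Measurable.pred M (\<lambda>u. \<exists>i\<in>{..q}. 1 / real (Suc q) \<le> \<bar>Y (real_of_rat r) (int i) u\<bar>)" by measurable
        then show ?thesis using True by (simp del: atLeastAtMost_iff)
      next
        case False
        then show ?thesis by (simp del: atLeastAtMost_iff)
      qed
      have "Measurable.pred M (G q)" unfolding G_def[abs_def] by measurable
      moreover have "G q (translate m u) = G q u" if "u \<in> K n" for u m
        using field_translate[OF Y _ that] unfolding G_def by simp
      ultimately show ?thesis by (simp add: inv_event_def)
    qed
    show "G (Suc q) u" if Gq: "G q u" for q u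
      unfolding G_def
    proof (intro allI impI)
      fix r :: rat assume "real_of_rat r \<in> {0..1}"
      then obtain i where "i \<le> q" "1 / real (Suc q) \<le> \<bar>Y (real_of_rat r) (int i) u\<bar>" using Gq unfolding G_def by auto
      moreover have "1 / real (Suc (Suc q)) \<le> 1 / real (Suc q)" by (intro divide_left_mono) auto
      ultimately show "\<exists>i\<in>{..Suc q}. 1 / real (Suc (Suc q)) \<le> \<bar>Y (real_of_rat r) (int i) u\<bar>"
        by (intro bexI[of _ i]) auto
    qed
    show "AE u in M. \<exists>q. G q u"
      using field_nonzero_half_line[OF Y NZ disjI1[OF refl]] AE_space
    proof eventually_elim
      case (elim u)
      then have u: "u \<in> K n" by simp
      have hl: "\<exists>i :: nat. Y \<tau> (int i) u \<noteq> 0" if "\<tau> \<in> {0..1}" for \<tau>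
        using elim(1) that by (auto dest!: bspec[of _ _ \<tau>] spec[of _ 0])
      show ?case
      proof (rule ccontr)
        assume "\<not> ?thesis"
        then have bad: "\<exists>r. real_of_rat r \<in> {0..1} \<and> (\<forall>i\<in>{..q}. \<bar>Y (real_of_rat r) (int i) u\<bar> < 1 / real (Suc q))" for q
          unfolding G_def by (metis not_le)
        have "\<exists>\<tau>\<in>{0..1}. \<forall>N. \<forall>j\<in>{0..int N}. Y \<tau> j u = 0"
        proof (rule lipschitz_common_zero[where y = "\<lambda>\<tau> j. Y \<tau> j u"])
          show "\<bar>Y \<tau> j u - Y \<tau>' j u\<bar> \<le> C * \<bar>\<tau> - \<tau>'\<bar>" if "\<tau> \<in> {0..1}" "\<tau>' \<in> {0..1}" for \<tau> \<tau>' j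
            by (rule C(2)[OF that u])
          show "incseq (\<lambda>N. {0..int N})" by (auto simp: incseq_def)
          fix N
          obtain r where r: "real_of_rat r \<in> {0..1}" "\<And>i. i \<le> N \<Longrightarrow> \<bar>Y (real_of_rat r) (int i) u\<bar> < 1 / real (Suc N)"
            using bad[of N] by auto
          have "\<bar>Y (real_of_rat r) j u\<bar> \<le> 1 / real (Suc N)" if "j \<in> {0..int N}" for j
            using r(2)[of "nat j"] that by (simp add: nat_le_iff)
          then show "\<exists>\<tau>\<in>{0..1}. \<forall>j\<in>{0..int N}. \<bar>Y \<tau> j u\<bar> \<le> 1 / real (Suc N)" using r(1) by blast
        qed
        then obtain \<tau> where \<tau>: "\<tau> \<in> {0..1}" "\<And>N j. j \<in> {0..int N} \<Longrightarrow> Y \<tau> j u = 0" by blast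
        obtain i :: nat where "Y \<tau> (int i) u \<noteq> 0" using hl[OF \<tau>(1)] by blast
        then show False using \<tau>(2)[of "int i" i] by simp
      qed
    qed
    show "AE u in M. \<forall>q m. G q u \<longrightarrow> G q (Tshift_power (- int (m * l)) u) \<longrightarrow>
      (\<Sum>k<m. h (Tshift_power (- int (k * l)) u)) \<le> real_of_int (2 * int q * int (nat \<lceil>C * real (Suc q)\<rceil> + 1) + 2 * int q)"
      using mono AE_space
    proof eventually_elim
      case (elim u)
      then have u: "u \<in> K n" by simp
      show ?case
      proof (intro allI impI)
        fix q m assume G1: "G q u" and G2: "G q (Tshift_power (- int (m * l)) u)"
        let ?i = "\<lambda>\<tau> k. int (sign_changes (\<lambda>j. Y \<tau> j u) (int (k * l)) (int (k * l) + int l))"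
        let ?d = "\<lambda>k. drop_event Y (int (k * l)) (int (k * l) + int l) u"
        have "(\<Sum>k<m. ?i 1 k - ?i 0 k + of_bool (?d k)) \<le> 2 * int q * int (nat \<lceil>C * real (Suc q)\<rceil> + 1) + 2 * int q"
        proof (rule sign_changes_block_sum_bound[where y = "\<lambda>\<tau> j. Y \<tau> j u" and C = C, OF C(1) C(2)[OF _ _ u] _ l])
          show "sign_changes (\<lambda>j. Y \<tau>1 j u) a b \<le> sign_changes (\<lambda>j. Y \<tau>0 j u) a b"
            if "0 \<le> \<tau>0" "\<tau>0 \<le> \<tau>1" "\<tau>1 \<le> 1" "a \<le> b" "\<And>\<tau>. \<tau>0 \<le> \<tau> \<Longrightarrow> \<tau> \<le> \<tau>1 \<Longrightarrow> Y \<tau> a u \<noteq> 0 \<and> Y \<tau> b u \<noteq> 0" for a b \<tau>0 \<tau>1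
            using elim(1) that by (simp add: Ball_def)
          show "\<exists>r\<le>q. 1 / real (Suc q) \<le> \<bar>Y \<tau> (int r) u\<bar>" if "\<tau> \<in> {0..1} \<inter> \<rat>" for \<tau>
            using that G1 unfolding G_def by (auto elim!: Rats_cases)
          show "\<exists>r\<le>q. 1 / real (Suc q) \<le> \<bar>Y \<tau> (int (m * l) + int r) u\<bar>" if \<tau>: "\<tau> \<in> {0..1} \<inter> \<rat>" for \<tau>
          proof -
            have "\<tau> \<in> \<rat>" using \<tau> by simp
            then obtain r where r: "\<tau> = real_of_rat r" by (rule Rats_cases)
            then have "real_of_rat r \<in> {0..1}" using \<tau> by simp
            note r = r this
            then obtain i where "i \<le> q" "1 / real (Suc q) \<le> \<bar>Y \<tau> (int i) (Tshift_power (- int (m * l)) u)\<bar>"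
              using G2 unfolding G_def by auto
            moreover have "Y \<tau> (int i) (Tshift_power (- int (m * l)) u) = Y \<tau> (int (m * l) + int i) u"
              using Y u r unfolding stationary_field_def by (simp add: add.commute)
            ultimately show ?thesis by (intro exI[of _ i]) simp
          qed
          show "(\<forall>\<tau>\<in>{0..1}. Y \<tau> (int (k * l)) u \<noteq> 0 \<and> Y \<tau> (int (k * l) + int l) u \<noteq> 0) \<and>
             sign_changes (\<lambda>j. Y 1 j u) (int (k * l)) (int (k * l) + int l) < sign_changes (\<lambda>j. Y 0 j u) (int (k * l)) (int (k * l) + int l)"
            if "?d k" for k
            using that lower_event_iff[OF Y u] by (simp add: drop_event_def)
        qed
        then have "real_of_int (\<Sum>k<m. ?i 1 k - ?i 0 k + of_bool (?d k)) \<le> real_of_int (2 * int q * int (nat \<lceil>C * real (Suc q)\<rceil> + 1) + 2 * int q)"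
          by (rule of_int_le_iff[THEN iffD2])
        moreover have "(\<Sum>k<m. h (Tshift_power (- int (k * l)) u)) = real_of_int (\<Sum>k<m. ?i 1 k - ?i 0 k + of_bool (?d k))"
          by (simp add: h_shift[OF u] del: of_nat_mult)
        ultimately show "(\<Sum>k<m. h (Tshift_power (- int (k * l)) u)) \<le> real_of_int (2 * int q * int (nat \<lceil>C * real (Suc q)\<rceil> + 1) + 2 * int q)"
          by (simp only:)
      qed
    qed
  qed
  moreover have "(\<integral>u. h u \<partial>M) = real l * density Y 1 - real l * density Y 0 + prob {u \<in> K n. drop_event Y 0 (int l) u}"
  proof -
    have i: "integrable M (\<lambda>u. ?s \<tau> 0 (int l) u)" if "\<tau> \<in> {0..1}" for \<tau>
      by (rule integrable_const_bound[of _ "real l"])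
        (use sign_changes_measurable[OF Y that, of 0 "int l"] sign_changes_le[of _ 0 "int l"] in \<open>auto simp: inv_fun_def\<close>)
    have i2: "integrable M (\<lambda>u. indicator {u \<in> K n. drop_event Y 0 (int l) u} u :: real)"
      using inv_event_sets[OF inv_event_drop[OF Y]] by (intro integrable_real_indicator) (auto simp: emeasure_eq_measure)
    have "(\<integral>u. h u \<partial>M) = (\<integral>u. ?s 1 0 (int l) u \<partial>M) - (\<integral>u. ?s 0 0 (int l) u \<partial>M) + (\<integral>u. indicator {u \<in> K n. drop_event Y 0 (int l) u} u \<partial>M)"
      unfolding h_def using i[OF 01(1)] i[OF 01(2)] i2
      by (simp only: Bochner_Integration.integral_add Bochner_Integration.integral_diff Bochner_Integration.integrable_diff)
    then show ?thesis
      by (simp only: expectation_sign_changes[OF Y 01(1)] expectation_sign_changes[OF Y 01(2)] prob_eq_integral[OF inv_event_drop[OF Y]])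
  qed
  ultimately show ?thesis by simp
qed

end

section \<open>Crossings with the moved configurations\<close>

lemma no_sign_change_ordered:
  assumes "\<And>j. \<not> sign_change_at w j"
  shows "(\<forall>j. 0 \<le> w j) \<or> (\<forall>j. w j \<le> 0)"
proof (rule ccontr)
  assume "\<not> ?thesis"
  then obtain i j where "w i < 0" "0 < w j" by (meson not_le)
  then have "w (min i j) * w (max i j) < 0" "min i j < max i j"
    by (cases "i < j"; cases "i = j"; simp add: min_def max_def mult_neg_pos mult_pos_neg)+
  then have "1 \<le> sign_changes w (min i j) (max i j)" by (intro sign_changes_pos)
  then show False using assms by (simp add: sign_changes_def)
qed

lemma rat_dense_subinterval:
  fixes a b s d :: real
  assumes "a < b" "s \<in> {a..b}" "0 < d"
  obtains r where "r \<in> \<rat>" "r \<in> {a..b}" "r \<noteq> s" "dist r s < d"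
proof (cases "a < s")
  case True
  then obtain r where "r \<in> \<rat>" "max a (s - d) < r" "r < s"
    using Rats_dense_in_real[of "max a (s - d)" s] assms by auto
  then show ?thesis using that[of r] assms by (auto simp: dist_real_def)
next
  case False
  then have "s < min b (s + d)" using assms by auto
  then obtain r where "r \<in> \<rat>" "s < r" "r < min b (s + d)"
    using Rats_dense_in_real by blast
  then show ?thesis using that[of r] assms by (auto simp: dist_real_def)
qed

context fk_ergodic
begin

definition moved :: "int \<Rightarrow> int \<Rightarrow> real \<Rightarrow> config \<Rightarrow> config" where
  "moved k m s u = translate m (\<phi> s (Tshift_power k u))"

text \<open>Two times enter: \<open>s\<close> selects the configuration with which \<open>u\<close>
  is compared, and \<open>t\<close> is the time during which both are evolved.\<close>

definition moved_diff :: "int \<Rightarrow> int \<Rightarrow> real \<Rightarrow> real \<Rightarrow> config \<Rightarrow> config" where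
  "moved_diff k m s t u = (\<lambda>j. \<phi> t (moved k m s u) j - \<phi> t u j)"

definition comparable :: "int \<Rightarrow> int \<Rightarrow> real \<Rightarrow> config \<Rightarrow> bool" where
  "comparable k m s u \<longleftrightarrow> moved k m s u \<le> u \<or> u \<le> moved k m s u"

lemmas flow_K' = flow_K[where n = n] and flow_add' = flow_add[where n = n]
  and flow_translate' = flow_translate[where n = n] and flow_shift' = flow_shift[where n = n]

lemma moved_K: "u \<in> K n \<Longrightarrow> 0 \<le> s \<Longrightarrow> moved k m s u \<in> K n"
  by (simp add: moved_def K_translate flow_K K_shift)

lemma moved_translate: "u \<in> K n \<Longrightarrow> 0 \<le> s \<Longrightarrow> moved k m s (translate l u) = translate l (moved k m s u)"
  by (simp add: moved_def translate_shift[symmetric] flow_translate' K_shift translate_add add.commute)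

lemma moved_shift: "u \<in> K n \<Longrightarrow> 0 \<le> s \<Longrightarrow> moved k m s (Tshift_power i u) = Tshift_power i (moved k m s u)"
  by (simp add: moved_def Tshift_power_add flow_shift' translate_shift add.commute)

lemma moved_flow: "u \<in> K n \<Longrightarrow> 0 \<le> s \<Longrightarrow> 0 \<le> r \<Longrightarrow> moved k m s (\<phi> r u) = \<phi> r (moved k m s u)"
  by (simp add: moved_def flow_shift'[symmetric] flow_translate' flow_add'[symmetric] K_shift flow_K' add.commute)

lemma moved_diff_flow: "u \<in> K n \<Longrightarrow> 0 \<le> s \<Longrightarrow> 0 \<le> r \<Longrightarrow> 0 \<le> t \<Longrightarrow> moved_diff k m s t (\<phi> r u) = moved_diff k m s (r + t) u"
  by (simp add: moved_diff_def moved_flow flow_add' moved_K)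

lemma moved_diff_0: "u \<in> K n \<Longrightarrow> 0 \<le> s \<Longrightarrow> moved_diff k m s 0 u = (\<lambda>j. moved k m s u j - u j)"
  by (simp add: moved_diff_def flow_0[OF moved_K] flow_0)

lemma moved_diff_cooperative: "u \<in> K n \<Longrightarrow> 0 \<le> s \<Longrightarrow> cooperative \<delta> (field_lip n) (\<lambda>t. moved_diff k m s t u)"
  unfolding moved_diff_def by (rule cooperative_flow_diff[OF moved_K])

lemma moved_diff_shift: "u \<in> K n \<Longrightarrow> 0 \<le> s \<Longrightarrow> 0 \<le> t \<Longrightarrow> moved_diff k m s t (Tshift_power i u) j = moved_diff k m s t u (j - i)"
  by (simp add: moved_diff_def moved_shift flow_shift' moved_K) (simp add: Tshift_power_def)

lemma moved_measurable: "0 \<le> s \<Longrightarrow> moved k m s \<in> measurable M M"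
proof -
  assume s: "0 \<le> s"
  have "translate m \<in> measurable M M"
    by (rule measurable_into_M)
      (auto simp: translate_def[abs_def] K_translate[unfolded translate_def] intro!: continuous_on_coordinatewise_then_product continuous_intros continuous_coordinate)
  then show ?thesis
    unfolding moved_def[abs_def]
    by (rule measurable_compose[OF measurable_compose[OF shift_measurable flow_measurable[OF s]]])
qed

lemma inv_fun_moved_diff: "0 \<le> s \<Longrightarrow> 0 \<le> t \<Longrightarrow> inv_fun (\<lambda>u. moved_diff k m s t u j)"
proof -
  assume st: "0 \<le> s" "0 \<le> t"
  have "(\<lambda>u. \<phi> t u j) \<in> borel_measurable M"
    by (rule measurable_compose[OF flow_measurable[OF st(2)] coordinate_measurable])
  moreover have "(\<lambda>u. \<phi> t (moved k m s u) j) \<in> borel_measurable M"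
    by (rule measurable_compose[OF moved_measurable[OF st(1)] calculation])
  ultimately have "(\<lambda>u. moved_diff k m s t u j) \<in> borel_measurable M"
    unfolding moved_diff_def by measurable
  moreover have "moved_diff k m s t (translate l u) j = moved_diff k m s t u j" if "u \<in> K n" for u l
    using that st by (simp add: moved_diff_def moved_translate flow_translate' moved_K) (simp add: translate_def)
  ultimately show ?thesis by (simp add: inv_fun_def)
qed

lemma comparable_iff_moved_diff: "u \<in> K n \<Longrightarrow> 0 \<le> s \<Longrightarrow> comparable k m s u \<longleftrightarrow> (\<forall>j. 0 \<le> moved_diff k m s 0 u j) \<or> (\<forall>j. moved_diff k m s 0 u j \<le> 0)"
  by (auto simp: comparable_def moved_diff_0 le_fun_def)

lemma inv_event_comparable:
  assumes s: "0 \<le> s"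
  shows "inv_event (comparable k m s)"
proof -
  have [measurable]: "(\<lambda>u. moved_diff k m s 0 u j) \<in> borel_measurable M" for j
    using inv_fun_moved_diff[OF s order_refl] by (simp add: inv_fun_def)
  have "Measurable.pred M (\<lambda>u. (\<forall>j. 0 \<le> moved_diff k m s 0 u j) \<or> (\<forall>j. moved_diff k m s 0 u j \<le> 0))"
    by measurable
  moreover have "Measurable.pred M (comparable k m s) \<longleftrightarrow> Measurable.pred M (\<lambda>u. (\<forall>j. 0 \<le> moved_diff k m s 0 u j) \<or> (\<forall>j. moved_diff k m s 0 u j \<le> 0))"
    by (rule measurable_cong) (simp add: comparable_iff_moved_diff s)
  ultimately show ?thesis
    using s by (auto simp: inv_event_def comparable_def moved_translate)
qed

lemma comparable_zero_one:
  assumes s: "0 \<le> s"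
  shows "(AE u in M. comparable k m s u) \<or> (AE u in M. \<not> comparable k m s u)"
  by (rule zero_one[OF inv_event_comparable[OF s]])
    (use s in \<open>auto simp: comparable_def Tshift_eq_power moved_shift moved_flow moved_K intro!: flow_mono\<close>)

section \<open>Crossing densities along the flow and in the parameter\<close>

definition crossing_density :: "int \<Rightarrow> int \<Rightarrow> real \<Rightarrow> real" where
  "crossing_density k m s = prob {u \<in> K n. sign_change_at (moved_diff k m s 0 u) 0}"

lemma inv_event_sign_change_moved_diff:
  assumes "0 \<le> s" "0 \<le> t"
  shows "inv_event (\<lambda>u. sign_change_at (moved_diff k m s t u) j)"
proof -
  have [measurable]: "(\<lambda>u. moved_diff k m s t u j) \<in> borel_measurable M" for j
    using inv_fun_moved_diff[OF assms] by (simp add: inv_fun_def)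
  have "Measurable.pred M (\<lambda>u. sign_change_at (moved_diff k m s t u) j)"
    unfolding sign_change_at_def by measurable
  moreover have "moved_diff k m s t (translate l u) = moved_diff k m s t u" if "u \<in> K n" for u l
    using inv_fun_moved_diff[OF assms] that by (auto simp: inv_fun_def)
  ultimately show ?thesis by (simp add: inv_event_def)
qed

lemma crossing_density_flow:
  assumes "0 \<le> s" "0 \<le> t"
  shows "prob {u \<in> K n. sign_change_at (moved_diff k m s t u) 0} = crossing_density k m s"
proof -
  have "moved_diff k m s 0 (\<phi> t u) = moved_diff k m s t u" if "u \<in> K n" for u
    using moved_diff_flow[OF that assms(1,2) order_refl] by simp
  then show ?thesis
    using prob_flow[OF inv_event_sign_change_moved_diff[OF assms(1) order_refl] assms(2), of k m 0]
    by (simp add: crossing_density_def cong: conj_cong)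
qed

text \<open>If crossings at site 0 had probability 0, stationarity would exclude them at all sites
  simultaneously, and a sequence without sign changes has one sign.\<close>

lemma crossing_density_nonzero:
  assumes s: "0 \<le> s" and n: "AE u in M. \<not> comparable k m s u"
  shows "crossing_density k m s \<noteq> 0"
proof
  assume "crossing_density k m s = 0"
  then have "AE u in M. \<not> sign_change_at (moved_diff k m s 0 u) 0"
    using prob_Collect_eq_0[of "\<lambda>u. sign_change_at (moved_diff k m s 0 u) 0"]
      inv_event_sets[OF inv_event_sign_change_moved_diff[OF s order_refl, of k m 0]] by (simp add: crossing_density_def)
  moreover have inv: "inv_event (\<lambda>u. \<not> sign_change_at (moved_diff k m s 0 u) 0)"
    using inv_event_sign_change_moved_diff[OF s order_refl, of k m 0] by (auto simp: inv_event_def)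
  ultimately have "AE u in M. \<not> sign_change_at (moved_diff k m s 0 (Tshift_power j u)) 0" for j
    using AE_shift[OF inv] by blast
  then have "AE u in M. \<forall>j. \<not> sign_change_at (moved_diff k m s 0 (Tshift_power j u)) 0"
    unfolding AE_all_countable by blast
  then have "AE u in M. False"
    using n AE_space
  proof eventually_elim
    case (elim u)
    then have u: "u \<in> K n" by simp
    have "\<not> sign_change_at (moved_diff k m s 0 u) j" for j
    proof -
      have "moved_diff k m s 0 (Tshift_power (- j) u) = (\<lambda>i. moved_diff k m s 0 u (i + j))"
        using moved_diff_shift[OF u s order_refl, of k m "- j"] by auto
      then show ?thesis using elim(1) sign_change_at_shift[of "moved_diff k m s 0 u" j 0] by (metis add_0)
    qed
    then show False using no_sign_change_ordered[of "moved_diff k m s 0 u"] elim(2) comparable_iff_moved_diff[OF u s] by blast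
  qed
  then show False by simp
qed

lemma moved_diff_time_lipschitz:
  assumes "u \<in> K n" "0 \<le> s" "0 \<le> t" "0 \<le> t'"
  shows "\<bar>moved_diff k m s t u j - moved_diff k m s t' u j\<bar> \<le> 2 * field_bound n * \<bar>t - t'\<bar>"
proof -
  have "\<bar>\<phi> t (moved k m s u) j - \<phi> t' (moved k m s u) j\<bar> \<le> field_bound n * \<bar>t - t'\<bar>" "\<bar>\<phi> t u j - \<phi> t' u j\<bar> \<le> field_bound n * \<bar>t - t'\<bar>"
    using flow_lipschitz[OF moved_K[OF assms(1,2)] assms(4,3)] flow_lipschitz[OF assms(1,4,3)] by auto
  then show ?thesis unfolding moved_diff_def by linarith
qed

lemma moved_diff_param_lipschitz:
  assumes "u \<in> K n" "0 \<le> s" "0 \<le> s'" "0 \<le> t"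
  shows "\<bar>moved_diff k m s t u j - moved_diff k m s' t u j\<bar> \<le> field_bound n * \<bar>s - s'\<bar> * exp (5 * field_lip n * t)"
proof -
  have "\<bar>moved k m s u i - moved k m s' u i\<bar> \<le> field_bound n * \<bar>s - s'\<bar>" for i
    using flow_lipschitz[OF K_shift[OF assms(1)] assms(3,2)] by (simp add: moved_def translate_def)
  then show ?thesis
    using flow_sup_bound[OF moved_K[OF assms(1,2)] moved_K[OF assms(1,3)] _ assms(4)] by (simp add: moved_diff_def)
qed

lemma moved_diff_zero_imp:
  assumes "u \<in> K n" "0 \<le> s" "0 \<le> t" "\<And>j. moved_diff k m s t u j = 0"
  shows "moved k m s u = u"
  by (rule flow_inj[OF moved_K[OF assms(1,2)] assms(1,3)]) (use assms(4) in \<open>auto simp: moved_diff_def fun_eq_iff\<close>)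

text \<open>The inequality opposite to the Sturm property. Rational times and integer ends leave
  countably many conditions, each of which may fail on a null set.\<close>

definition no_drop :: "int \<Rightarrow> int \<Rightarrow> real \<Rightarrow> config \<Rightarrow> bool" where
  "no_drop k m s u \<longleftrightarrow> (\<forall>t0\<in>\<rat>. \<forall>t1\<in>\<rat>. \<forall>a b. 0 \<le> t0 \<and> t0 < t1 \<and> a < b \<and>
     (\<forall>t\<in>{t0..t1}. moved_diff k m s t u a \<noteq> 0 \<and> moved_diff k m s t u b \<noteq> 0) \<longrightarrow>
     sign_changes (moved_diff k m s t0 u) a b \<le> sign_changes (moved_diff k m s t1 u) a b)"

text \<open>With time as the parameter both densities in \<open>density_drop\<close> equal
  \<open>crossing_density k m s\<close>, so drops have probability 0 in the window from 0, and by a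
  shift in every window. Absence of comparability guarantees that the difference never vanishes
  identically: by injectivity of the flow this would already be a coincidence at time 0.\<close>

lemma AE_no_drop:
  assumes s: "0 \<le> s" and n: "AE u in M. \<not> comparable k m s u"
  shows "AE u in M. no_drop k m s u"
proof -
  have main: "AE u in M. (\<forall>t\<in>{t0..t1}. moved_diff k m s t u a \<noteq> 0 \<and> moved_diff k m s t u b \<noteq> 0) \<longrightarrow>
     sign_changes (moved_diff k m s t0 u) a b \<le> sign_changes (moved_diff k m s t1 u) a b"
    if t: "0 \<le> t0" "t0 < t1" and ab: "a < b" for t0 t1 a b
  proof -
    define T where "T \<tau> = t0 + \<tau> * (t1 - t0)" for \<tau> :: real
    define Y where "Y \<tau> j u = moved_diff k m s (T \<tau>) u j" for \<tau> j u
    have T: "0 \<le> T \<tau>" "T \<tau> \<in> {t0..t1}" if "\<tau> \<in> {0..1}" for \<tau>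
    proof -
      define p where "p = \<tau> * (t1 - t0)"
      have "p \<le> t1 - t0" unfolding p_def using mult_right_mono[of \<tau> 1 "t1 - t0"] that t by simp
      moreover have "0 \<le> p" using that t by (simp add: p_def)
      ultimately have "t0 \<le> T \<tau>" "T \<tau> \<le> t1" unfolding T_def p_def[symmetric] by simp_all
      then show "0 \<le> T \<tau>" "T \<tau> \<in> {t0..t1}" using t by auto
    qed
    have Y: "stationary_field Y"
      unfolding stationary_field_def
    proof (intro conjI ballI allI)
      show "inv_fun (Y \<tau> j)" if "\<tau> \<in> {0..1}" for \<tau> j
        unfolding Y_def by (rule inv_fun_moved_diff[OF s T(1)[OF that]])
      show "Y \<tau> j (Tshift_power i u) = Y \<tau> (j - i) u" if "\<tau> \<in> {0..1}" "u \<in> K n" for \<tau> j i u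
        unfolding Y_def by (rule moved_diff_shift[OF that(2) s T(1)[OF that(1)]])
      show "\<exists>C\<ge>0. \<forall>\<tau>\<in>{0..1}. \<forall>\<tau>'\<in>{0..1}. \<forall>j. \<forall>u\<in>K n. \<bar>Y \<tau> j u - Y \<tau>' j u\<bar> \<le> C * \<bar>\<tau> - \<tau>'\<bar>"
      proof (intro exI[of _ "2 * field_bound n * (t1 - t0)"] conjI ballI allI)
        fix \<tau> \<tau>' :: real and j u assume *: "\<tau> \<in> {0..1}" "\<tau>' \<in> {0..1}" "u \<in> K n"
        have "T \<tau> - T \<tau>' = (t1 - t0) * (\<tau> - \<tau>')" by (simp add: T_def algebra_simps)
        then have "\<bar>T \<tau> - T \<tau>'\<bar> = (t1 - t0) * \<bar>\<tau> - \<tau>'\<bar>" using t by (simp add: abs_mult)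
        then show "\<bar>Y \<tau> j u - Y \<tau>' j u\<bar> \<le> 2 * field_bound n * (t1 - t0) * \<bar>\<tau> - \<tau>'\<bar>"
          using moved_diff_time_lipschitz[OF *(3) s T(1)[OF *(1)] T(1)[OF *(2)], of k m j] by (simp add: Y_def mult.assoc)
      qed (use t field_bound_pos[of n] in auto)
    qed
    have NZ: "AE u in M. \<forall>\<tau>\<in>{0..1}. \<exists>j. Y \<tau> j u \<noteq> 0"
      using n AE_space
    proof eventually_elim
      case (elim u)
      show ?case
      proof (rule ccontr)
        assume "\<not> ?thesis"
        then obtain \<tau> where "\<tau> \<in> {0..1}" "\<And>j. Y \<tau> j u = 0" by blast
        then have "moved k m s u = u" using moved_diff_zero_imp[of u s "T \<tau>" k m] elim(2) s T(1)[of \<tau>] by (simp add: Y_def)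
        then show False using elim(1) by (simp add: comparable_def)
      qed
    qed
    have mono: "AE u in M. \<forall>a b \<tau>0 \<tau>1. 0 \<le> \<tau>0 \<longrightarrow> \<tau>0 \<le> \<tau>1 \<longrightarrow> \<tau>1 \<le> 1 \<longrightarrow> a \<le> b \<longrightarrow>
       (\<forall>\<tau>\<in>{\<tau>0..\<tau>1}. Y \<tau> a u \<noteq> 0 \<and> Y \<tau> b u \<noteq> 0) \<longrightarrow>
       sign_changes (\<lambda>j. Y \<tau>1 j u) a b \<le> sign_changes (\<lambda>j. Y \<tau>0 j u) a b"
    proof (rule AE_I2, intro allI impI)
      fix u a b and \<tau>0 \<tau>1 :: real
      assume u: "u \<in> space M" and \<tau>: "0 \<le> \<tau>0" "\<tau>0 \<le> \<tau>1" "\<tau>1 \<le> 1" and "a \<le> b"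
        and nz: "\<forall>\<tau>\<in>{\<tau>0..\<tau>1}. Y \<tau> a u \<noteq> 0 \<and> Y \<tau> b u \<noteq> 0"
      have "sign_changes (moved_diff k m s (T \<tau>1) u) a b \<le> sign_changes (moved_diff k m s (T \<tau>0) u) a b"
      proof (rule sign_changes_nonincreasing[OF moved_diff_cooperative[OF _ s] delta_pos])
        show "0 \<le> T \<tau>0" using T(1)[of \<tau>0] \<tau> by simp
        show "T \<tau>0 \<le> T \<tau>1" using \<tau> t by (auto simp: T_def intro!: mult_right_mono)
        fix r assume r: "T \<tau>0 \<le> r" "r \<le> T \<tau>1"
        define \<tau> where "\<tau> = (r - t0) / (t1 - t0)"
        have "r = T \<tau>" using t by (simp add: \<tau>_def T_def)
        moreover have "\<tau> \<in> {\<tau>0..\<tau>1}" using r t by (auto simp: \<tau>_def T_def field_simps)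
        ultimately show "moved_diff k m s r u a \<noteq> 0 \<and> moved_diff k m s r u b \<noteq> 0" using nz by (simp add: Y_def)
      qed (use u \<open>a \<le> b\<close> in auto)
      then show "sign_changes (\<lambda>j. Y \<tau>1 j u) a b \<le> sign_changes (\<lambda>j. Y \<tau>0 j u) a b" by (simp add: Y_def)
    qed
    define l where "l = nat (b - a)"
    have l: "1 \<le> l" "int l = b - a" using ab by (auto simp: l_def)
    have "density Y \<tau> = crossing_density k m s" if "\<tau> \<in> {0..1}" for \<tau>
      using crossing_density_flow[OF s T(1)[OF that], of k m] by (simp add: density_def Y_def)
    then have "prob {u \<in> K n. drop_event Y 0 (int l) u} \<le> 0"
      using density_drop[OF Y l(1) NZ mono] by simp
    then have "AE u in M. \<not> drop_event Y 0 (int l) u"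
      using prob_Collect_eq_0[of "drop_event Y 0 (int l)"] inv_event_sets[OF inv_event_drop[OF Y]]
      by (simp add: measure_le_0_iff)
    moreover have inv: "inv_event (\<lambda>u. \<not> drop_event Y 0 (int l) u)"
      using inv_event_drop[OF Y, of 0 "int l"] by (auto simp: inv_event_def)
    ultimately have "AE u in M. \<not> drop_event Y 0 (int l) (Tshift_power (- a) u)"
      using AE_shift[OF inv] by blast
    then show ?thesis
      using AE_space
    proof eventually_elim
      case (elim u)
      then have u: "u \<in> K n" by simp
      have sh: "(\<lambda>j. Y \<tau> j (Tshift_power (- a) u)) = (\<lambda>j. Y \<tau> (j + a) u)" if "\<tau> \<in> {0..1}" for \<tau>
        using shift_coordinates[OF u Y that, of "- a"] by simp
      show ?case
      proof (intro impI)
        assume nz: "\<forall>t\<in>{t0..t1}. moved_diff k m s t u a \<noteq> 0 \<and> moved_diff k m s t u b \<noteq> 0"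
        have "Y \<tau> a u \<noteq> 0 \<and> Y \<tau> b u \<noteq> 0" if "\<tau> \<in> {0..1}" for \<tau>
          using nz T(2)[OF that] by (simp add: Y_def)
        then have "Y \<tau> 0 (Tshift_power (- a) u) \<noteq> 0 \<and> Y \<tau> (int l) (Tshift_power (- a) u) \<noteq> 0" if "\<tau> \<in> {0..1}" for \<tau>
          using fun_cong[OF sh[OF that], of 0] fun_cong[OF sh[OF that], of "int l"] that l(2) by simp
        then have "lower_event Y 0 (int l) (Tshift_power (- a) u)"
          using lower_event_iff[OF Y K_shift[OF u]] by blast
        then have "sign_changes (\<lambda>j. Y 0 (j + a) u) 0 (int l) \<le> sign_changes (\<lambda>j. Y 1 (j + a) u) 0 (int l)"
          using elim(1) sh[of 0] sh[of 1] by (simp add: drop_event_def)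
        then show "sign_changes (moved_diff k m s t0 u) a b \<le> sign_changes (moved_diff k m s t1 u) a b"
          using sign_changes_shift[of "\<lambda>j. Y 0 j u" a 0 "int l"] sign_changes_shift[of "\<lambda>j. Y 1 j u" a 0 "int l"] l(2)
          by (simp add: Y_def T_def)
      qed
    qed
  qed
  have "AE u in M. \<forall>t0\<in>\<rat>. \<forall>t1\<in>\<rat>. \<forall>a b. 0 \<le> t0 \<and> t0 < t1 \<and> a < b \<longrightarrow> (\<forall>t\<in>{t0..t1}. moved_diff k m s t u a \<noteq> 0 \<and> moved_diff k m s t u b \<noteq> 0) \<longrightarrow>
     sign_changes (moved_diff k m s t0 u) a b \<le> sign_changes (moved_diff k m s t1 u) a b"
    by (intro AE_ball_countable' AE_all_countable[THEN iffD2] allI countable_rat AE_impI main) auto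
  then show ?thesis by (rule AE_mp) (rule AE_I2, simp add: no_drop_def)
qed

text \<open>A degenerate crossing at an exceptional parameter \<open>s\<close> would force a drop that persists
  for nearby rational parameters.\<close>

lemma nondegenerate_all_parameters:
  assumes u: "u \<in> K n" and s: "0 \<le> s1" "s1 < S" "s \<in> {s1..S}"
    and nd: "\<And>r. r \<in> \<rat> \<Longrightarrow> r \<in> {s1..S} \<Longrightarrow> no_drop k m r u"
    and ends: "moved_diff k m s 1 u a \<noteq> 0" "moved_diff k m s 1 u b \<noteq> 0" "a < b"
  shows "\<not> degenerate (moved_diff k m s 1 u) a b"
proof
  assume deg: "degenerate (moved_diff k m s 1 u) a b"
  have s0: "0 \<le> s" using s by simp
  note coop = moved_diff_cooperative[OF u s0, of k m]
  have "\<forall>\<^sub>F \<tau> in at_right 0. \<tau> < 1 \<and> (\<forall>t. \<bar>t - 1\<bar> \<le> \<tau> \<longrightarrow> moved_diff k m s t u a \<noteq> 0 \<and> moved_diff k m s t u b \<noteq> 0) \<and>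
     \<not> degenerate (moved_diff k m s (1 + \<tau>) u) a b \<and> sign_changes (moved_diff k m s (1 + \<tau>) u) a b < sign_changes (moved_diff k m s (1 - \<tau>) u) a b"
    by (rule degenerate_imp_drop[OF coop delta_pos _ ends(1,2) less_imp_le[OF ends(3)] deg]) simp
  then obtain e where e: "0 < e" "\<And>\<tau>. 0 < \<tau> \<Longrightarrow> \<tau> < e \<Longrightarrow> \<tau> < 1 \<and> (\<forall>t. \<bar>t - 1\<bar> \<le> \<tau> \<longrightarrow> moved_diff k m s t u a \<noteq> 0 \<and> moved_diff k m s t u b \<noteq> 0) \<and>
     \<not> degenerate (moved_diff k m s (1 + \<tau>) u) a b \<and> sign_changes (moved_diff k m s (1 + \<tau>) u) a b < sign_changes (moved_diff k m s (1 - \<tau>) u) a b"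
    by (auto simp: eventually_at_right_field)
  obtain \<tau> where \<tau>: "\<tau> \<in> \<rat>" "0 < \<tau>" "\<tau> < e" using Rats_dense_in_real[OF e(1)] by blast
  define t0 t1 where "t0 = 1 - \<tau>" and "t1 = 1 + \<tau>"
  have t: "t0 \<in> \<rat>" "t1 \<in> \<rat>" "0 \<le> t0" "t0 < t1" "0 \<le> t1" using \<tau> e(2)[OF \<tau>(2,3)] by (auto simp: t0_def t1_def)
  have nz: "moved_diff k m s t u a \<noteq> 0 \<and> moved_diff k m s t u b \<noteq> 0" if "t \<in> {t0..t1}" for t
    using e(2)[OF \<tau>(2,3)] that by (auto simp: t0_def t1_def abs_le_iff)
  have d: "\<not> degenerate (moved_diff k m s t1 u) a b" "sign_changes (moved_diff k m s t1 u) a b < sign_changes (moved_diff k m s t0 u) a b"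
    using e(2)[OF \<tau>(2,3)] by (auto simp: t0_def t1_def)
  let ?F = "at s within {s1..S}"
  have dist0: "((\<lambda>r. field_bound n * \<bar>r - s\<bar> * exp (5 * field_lip n * t)) \<longlongrightarrow> 0) ?F" for t
  proof -
    have "((\<lambda>r. field_bound n * \<bar>r - s\<bar> * exp (5 * field_lip n * t)) \<longlongrightarrow> field_bound n * \<bar>s - s\<bar> * exp (5 * field_lip n * t)) ?F"
      by (intro tendsto_intros)
    then show ?thesis by simp
  qed
  have inS: "\<forall>\<^sub>F r in ?F. r \<in> {s1..S}" by (simp add: eventually_at_filter)
  have conv: "((\<lambda>r. moved_diff k m r t u j) \<longlongrightarrow> moved_diff k m s t u j) ?F" if "0 \<le> t" for t j
  proof (rule tendsto_dist_iff[THEN iffD2], rule tendsto_sandwich[OF _ _ tendsto_const dist0[of t]])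
    show "\<forall>\<^sub>F r in ?F. dist (moved_diff k m r t u j) (moved_diff k m s t u j) \<le> field_bound n * \<bar>r - s\<bar> * exp (5 * field_lip n * t)"
      using inS by (rule eventually_mono) (use moved_diff_param_lipschitz[OF u _ s0 that] s in \<open>auto simp: dist_real_def\<close>)
  qed simp
  \<comment> \<open>On the compact time interval the value at \<open>j\<close> has a positive
    minimal modulus for the parameter \<open>s\<close>, and Lipschitz dependence on the parameter,
    uniform for times up to \<open>t1\<close>, preserves nonvanishing nearby.\<close>
  have nzF: "\<forall>\<^sub>F r in ?F. \<forall>t\<in>{t0..t1}. moved_diff k m r t u j \<noteq> 0" if j: "\<And>t. t \<in> {t0..t1} \<Longrightarrow> moved_diff k m s t u j \<noteq> 0" for j
  proof -
    have "continuous_on {t0..t1} (\<lambda>t. \<bar>moved_diff k m s t u j\<bar>)"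
      by (intro continuous_intros continuous_on_subset[OF cooperative_continuous_on[OF coop]]) (use t in auto)
    then obtain t' where t': "t' \<in> {t0..t1}" "\<And>t. t \<in> {t0..t1} \<Longrightarrow> \<bar>moved_diff k m s t' u j\<bar> \<le> \<bar>moved_diff k m s t u j\<bar>"
      using continuous_attains_inf[of "{t0..t1}"] t(4) by force
    have "\<forall>\<^sub>F r in ?F. field_bound n * \<bar>r - s\<bar> * exp (5 * field_lip n * t1) < \<bar>moved_diff k m s t' u j\<bar>"
      by (rule order_tendstoD[OF dist0]) (use j[OF t'(1)] in simp)
    then show ?thesis
      using inS
    proof eventually_elim
      case (elim r)
      show ?case
      proof
        fix t assume tt: "t \<in> {t0..t1}"
        have "\<bar>moved_diff k m r t u j - moved_diff k m s t u j\<bar> \<le> field_bound n * \<bar>r - s\<bar> * exp (5 * field_lip n * t)"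
          by (rule moved_diff_param_lipschitz[OF u _ s0]) (use elim tt t s in auto)
        also have "\<dots> \<le> field_bound n * \<bar>r - s\<bar> * exp (5 * field_lip n * t1)"
          using tt field_bound_pos[of n] field_lip_pos[of n] by (intro mult_left_mono) auto
        also note elim(1)
        also note t'(2)[OF tt]
        finally show "moved_diff k m r t u j \<noteq> 0" by auto
      qed
    qed
  qed
  have nza: "\<forall>\<^sub>F r in ?F. \<forall>t\<in>{t0..t1}. moved_diff k m r t u a \<noteq> 0" and nzb: "\<forall>\<^sub>F r in ?F. \<forall>t\<in>{t0..t1}. moved_diff k m r t u b \<noteq> 0"
    by (rule nzF, use nz in blast)+
  have "\<forall>\<^sub>F r in ?F. sign_extends (moved_diff k m s t0 u) (moved_diff k m r t0 u) a b"
    "\<forall>\<^sub>F r in ?F. sign_extends (moved_diff k m s t1 u) (moved_diff k m r t1 u) a b"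
    by (rule eventually_sign_extends, rule conv, use t in simp)+
  with inS nza nzb have "\<forall>\<^sub>F r in ?F. r \<notin> \<rat>"
  proof eventually_elim
    case (elim r)
    note * = elim
    show ?case
    proof
    assume rQ: "r \<in> \<rat>"
    \<comment> \<open>The count at \<open>t1\<close> is the same for \<open>r\<close> and
      \<open>s\<close> by nondegeneracy, and the count at \<open>t0\<close> for \<open>r\<close> is
      at least the one for \<open>s\<close> by semicontinuity. A drop for \<open>s\<close> thus
      becomes a drop for the rational \<open>r\<close>, which \<open>no_drop\<close>
      forbids.\<close>
    have "sign_changes (moved_diff k m r t0 u) a b \<le> sign_changes (moved_diff k m r t1 u) a b"
      using nd[OF rQ *(1)] t *(2,3) ends(3) unfolding no_drop_def by blast
    also have "\<dots> = sign_changes (moved_diff k m s t1 u) a b"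
      by (rule sign_changes_nondegenerate[OF _ _ _ *(5) d(1)]) (use nz[of t1] t ends(3) in auto)
    also note d(2)
    also have "sign_changes (moved_diff k m s t0 u) a b \<le> sign_changes (moved_diff k m r t0 u) a b"
      by (rule sign_changes_lower_semicontinuous[OF _ _ _ *(4)]) (use nz[of t0] t ends(3) in auto)
    finally show False by simp
    qed
  qed
  then obtain d where d: "0 < d" "\<And>r. r \<in> {s1..S} \<Longrightarrow> r \<noteq> s \<Longrightarrow> dist r s < d \<Longrightarrow> r \<notin> \<rat>"
    by (auto simp: eventually_at)
  obtain r where "r \<in> \<rat>" "r \<in> {s1..S}" "r \<noteq> s" "dist r s < d" by (rule rat_dense_subinterval[OF s(2,3) d(1)])
  then show False using d(2) by blast
qed

text \<open>The difference is inspected at time 1, so that each parameter has a past in which a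
  degenerate zero would have caused a drop. Since none is degenerate, the count in a window with
  nonzero ends does not depend on the parameter, and \<open>density_drop\<close> applies. The
  hypothesis \<open>ne\<close> prevents the field from vanishing identically.\<close>

lemma crossing_density_mono:
  assumes s: "0 \<le> s1" "s1 < S"
    and n: "\<And>s. s1 \<le> s \<Longrightarrow> s \<le> S \<Longrightarrow> AE u in M. \<not> comparable k m s u"
    and ne: "AE u in M. \<forall>s\<ge>s1. moved k m s u \<noteq> u"
  shows "crossing_density k m s1 \<le> crossing_density k m S"
proof -
  \<comment> \<open>The parameter runs backwards from \<open>S\<close> to \<open>s1\<close>, so that
    the inequality of \<open>density_drop\<close> points in the desired direction.\<close>
  define R where "R \<tau> = S - \<tau> * (S - s1)" for \<tau> :: real
  define Y where "Y \<tau> j u = moved_diff k m (R \<tau>) 1 u j" for \<tau> j u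
  have R: "0 \<le> R \<tau>" "R \<tau> \<in> {s1..S}" if "\<tau> \<in> {0..1}" for \<tau>
  proof -
    define p where "p = \<tau> * (S - s1)"
    have "p \<le> S - s1" unfolding p_def using mult_right_mono[of \<tau> 1 "S - s1"] that s by simp
    moreover have "0 \<le> p" using that s by (simp add: p_def)
    ultimately have "s1 \<le> R \<tau>" "R \<tau> \<le> S" unfolding R_def p_def[symmetric] by simp_all
    then show "0 \<le> R \<tau>" "R \<tau> \<in> {s1..S}" using s by auto
  qed
  have lip: "\<bar>Y \<tau> j u - Y \<tau>' j u\<bar> \<le> field_bound n * (S - s1) * exp (5 * field_lip n * 1) * \<bar>\<tau> - \<tau>'\<bar>"
    if *: "\<tau> \<in> {0..1}" "\<tau>' \<in> {0..1}" "u \<in> K n" for \<tau> \<tau>' j u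
  proof -
    have "R \<tau> - R \<tau>' = (S - s1) * (\<tau>' - \<tau>)" by (simp add: R_def algebra_simps)
    then have "\<bar>R \<tau> - R \<tau>'\<bar> = (S - s1) * \<bar>\<tau> - \<tau>'\<bar>" using s by (simp add: abs_mult abs_minus_commute)
    then show ?thesis
      using moved_diff_param_lipschitz[OF *(3) R(1)[OF *(1)] R(1)[OF *(2)], of 1 k m j] by (simp add: Y_def mult_ac)
  qed
  have Y: "stationary_field Y"
    unfolding stationary_field_def
  proof (intro conjI ballI allI)
    show "inv_fun (Y \<tau> j)" if "\<tau> \<in> {0..1}" for \<tau> j
      unfolding Y_def by (rule inv_fun_moved_diff[OF R(1)[OF that]]) simp
    show "Y \<tau> j (Tshift_power i u) = Y \<tau> (j - i) u" if "\<tau> \<in> {0..1}" "u \<in> K n" for \<tau> j i u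
      unfolding Y_def by (rule moved_diff_shift[OF that(2) R(1)[OF that(1)]]) simp
    show "\<exists>C\<ge>0. \<forall>\<tau>\<in>{0..1}. \<forall>\<tau>'\<in>{0..1}. \<forall>j. \<forall>u\<in>K n. \<bar>Y \<tau> j u - Y \<tau>' j u\<bar> \<le> C * \<bar>\<tau> - \<tau>'\<bar>"
      using lip s field_bound_pos[of n] by (intro exI[of _ "field_bound n * (S - s1) * exp (5 * field_lip n * 1)"]) auto
  qed
  have NZ: "AE u in M. \<forall>\<tau>\<in>{0..1}. \<exists>j. Y \<tau> j u \<noteq> 0"
    using ne AE_space
  proof eventually_elim
    case (elim u)
    show ?case
    proof (rule ccontr)
      assume "\<not> ?thesis"
      then obtain \<tau> where \<tau>: "\<tau> \<in> {0..1}" "\<And>j. Y \<tau> j u = 0" by blast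
      then have "moved k m (R \<tau>) u = u" using moved_diff_zero_imp[of u "R \<tau>" 1 k m] elim(2) R(1)[of \<tau>] by (simp add: Y_def)
      then show False using elim(1) R(2)[OF \<tau>(1)] by auto
    qed
  qed
  have "AE u in M. \<forall>r\<in>\<rat>. r \<in> {s1..S} \<longrightarrow> no_drop k m r u"
    using n s by (intro AE_ball_countable' AE_impI AE_no_drop countable_rat) auto
  then have mono: "AE u in M. \<forall>a b \<tau>0 \<tau>1. 0 \<le> \<tau>0 \<longrightarrow> \<tau>0 \<le> \<tau>1 \<longrightarrow> \<tau>1 \<le> 1 \<longrightarrow> a \<le> b \<longrightarrow>
       (\<forall>\<tau>\<in>{\<tau>0..\<tau>1}. Y \<tau> a u \<noteq> 0 \<and> Y \<tau> b u \<noteq> 0) \<longrightarrow>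
       sign_changes (\<lambda>j. Y \<tau>1 j u) a b \<le> sign_changes (\<lambda>j. Y \<tau>0 j u) a b"
    using AE_space
  proof eventually_elim
    case (elim u)
    then have u: "u \<in> K n" by simp
    show ?case
    proof (intro allI impI)
      fix a b and \<tau>0 \<tau>1 :: real
      assume \<tau>: "0 \<le> \<tau>0" "\<tau>0 \<le> \<tau>1" "\<tau>1 \<le> 1" and ab: "a \<le> b"
        and nz: "\<forall>\<tau>\<in>{\<tau>0..\<tau>1}. Y \<tau> a u \<noteq> 0 \<and> Y \<tau> b u \<noteq> 0"
      show "sign_changes (\<lambda>j. Y \<tau>1 j u) a b \<le> sign_changes (\<lambda>j. Y \<tau>0 j u) a b"
      proof (cases "a = b")
        case False
        then have ab': "a < b" using ab by simp
        have nd: "\<not> degenerate (\<lambda>j. Y \<tau> j u) a b" if "\<tau> \<in> {\<tau>0..\<tau>1}" for \<tau>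
        proof -
          have "\<tau> \<in> {0..1}" using that \<tau> by auto
          have "\<not> degenerate (moved_diff k m (R \<tau>) 1 u) a b"
            by (rule nondegenerate_all_parameters[OF u s R(2)[OF \<open>\<tau> \<in> {0..1}\<close>] _ _ _ ab'])
              (use elim(1) nz that in \<open>auto simp: Y_def\<close>)
          then show ?thesis by (simp add: Y_def)
        qed
        \<comment> \<open>In the absence of degenerate zeros the count is locally constant;
          \<open>c\<close> selects the side from which \<open>\<tau>\<close> is approached.\<close>
        have loc: "\<forall>\<^sub>F h in at_right 0. sign_changes (\<lambda>j. Y (\<tau> + c * h) j u) a b = sign_changes (\<lambda>j. Y \<tau> j u) a b"
          if t: "\<tau> \<in> {\<tau>0..\<tau>1}" and c: "(c = 1 \<and> \<tau> < \<tau>1) \<or> (c = -1 \<and> \<tau>0 < \<tau>)" for \<tau> c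
        proof -
          have t01: "\<tau> \<in> {0..1}" using t \<tau> by auto
          have conv: "((\<lambda>h. Y (\<tau> + c * h) j u) \<longlongrightarrow> Y \<tau> j u) (at_right 0)" for j
          proof (rule tendsto_dist_iff[THEN iffD2], rule tendsto_sandwich[OF _ _ tendsto_const])
            have "\<forall>\<^sub>F h in at_right 0. \<tau> + c * h \<in> {0..1}"
              using c t \<tau> by (intro eventually_at_right_0I[of "if c = 1 then \<tau>1 - \<tau> else \<tau> - \<tau>0"]) auto
            then show "\<forall>\<^sub>F h in at_right 0. dist (Y (\<tau> + c * h) j u) (Y \<tau> j u) \<le> field_bound n * (S - s1) * exp (5 * field_lip n * 1) * \<bar>\<tau> + c * h - \<tau>\<bar>"
              by (rule eventually_mono) (simp only: dist_real_def lip[OF _ t01 u])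
            have "((\<lambda>h. field_bound n * (S - s1) * exp (5 * field_lip n * 1) * \<bar>\<tau> + c * h - \<tau>\<bar>) \<longlongrightarrow> field_bound n * (S - s1) * exp (5 * field_lip n * 1) * \<bar>\<tau> + c * 0 - \<tau>\<bar>) (at_right 0)"
              by (intro tendsto_intros)
            then show "((\<lambda>h. field_bound n * (S - s1) * exp (5 * field_lip n * 1) * \<bar>\<tau> + c * h - \<tau>\<bar>) \<longlongrightarrow> 0) (at_right 0)" by simp
          qed simp
          have "\<forall>\<^sub>F h in at_right 0. sign_extends (\<lambda>j. Y \<tau> j u) (\<lambda>j. Y (\<tau> + c * h) j u) a b"
            by (rule eventually_sign_extends[OF conv])
          then show ?thesis
            by (rule eventually_mono) (rule sign_changes_nondegenerate[OF _ _ ab _ nd[OF t]], use nz t in auto)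
        qed
        show ?thesis
        proof (rule locally_nonincreasing_imp[OF \<tau>(2)])
          fix \<tau> assume "\<tau>0 \<le> \<tau>" "\<tau> < \<tau>1"
          then show "\<forall>\<^sub>F h in at_right 0. sign_changes (\<lambda>j. Y (\<tau> + h) j u) a b \<le> sign_changes (\<lambda>j. Y \<tau> j u) a b"
            using loc[of \<tau> 1] by (auto elim!: eventually_mono)
        next
          fix \<tau> assume "\<tau>0 < \<tau>" "\<tau> \<le> \<tau>1"
          then show "\<forall>\<^sub>F h in at_right 0. sign_changes (\<lambda>j. Y \<tau> j u) a b \<le> sign_changes (\<lambda>j. Y (\<tau> - h) j u) a b"
            using loc[of \<tau> "-1"] by (auto elim!: eventually_mono)
        qed
      qed simp
    qed
  qed
  have "density Y 0 = crossing_density k m S" "density Y 1 = crossing_density k m s1"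
    using crossing_density_flow[of S 1 k m] crossing_density_flow[of s1 1 k m] s by (auto simp: density_def Y_def R_def)
  then have "crossing_density k m s1 + prob {u \<in> K n. drop_event Y 0 1 u} \<le> crossing_density k m S"
    using density_drop[OF Y order_refl NZ mono] by simp
  then show ?thesis using measure_nonneg[of M "{u \<in> K n. drop_event Y 0 1 u}"] by linarith
qed

section \<open>Vanishing of the density and comparability\<close>

lemma prob_tendsto_0:
  assumes "\<And>N. inv_event (Q N)" "AE u in M. \<forall>\<^sub>F N in sequentially. \<not> Q N u"
  shows "(\<lambda>N. prob {u \<in> K n. Q N u}) \<longlonglongrightarrow> 0"
proof -
  have "(\<lambda>N. \<integral>u. indicator {u \<in> K n. Q N u} u \<partial>M) \<longlonglongrightarrow> (\<integral>u. (0 :: real) \<partial>M)"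
  proof (rule integral_dominated_convergence[where w = "\<lambda>_. 1"])
    show "AE u in M. (\<lambda>N. indicator {u \<in> K n. Q N u} u :: real) \<longlonglongrightarrow> 0"
      using assms(2)
    proof eventually_elim
      case (elim u)
      then have "\<forall>\<^sub>F N in sequentially. indicator {u \<in> K n. Q N u} u = (0 :: real)"
        by (rule eventually_mono) simp
      then show ?case by (rule tendsto_eventually)
    qed
    show "(\<lambda>u. indicator {u \<in> K n. Q N u} u :: real) \<in> borel_measurable M" for N
      using inv_event_indicator[OF assms(1)] by (simp add: inv_fun_def)
  qed (auto simp: indicator_def)
  then show ?thesis by (simp only: prob_eq_integral[OF assms(1)]) simp
qed

text \<open>Without comparability at \<open>s1\<close> the density there is positive, and it does
  not decrease as long as comparability fails. If it fails forever, escape contradicts this in the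
  limit. Otherwise the contradiction arises at the infimum of the parameters with comparability:
  approaching it from below, the density tends to 0.\<close>

theorem AE_comparable:
  assumes s1: "0 \<le> s1" and ne: "AE u in M. \<forall>s\<ge>s1. moved k m s u \<noteq> u"
    and escape: "AE u in M. \<forall>c. \<forall>\<^sub>F N in sequentially. c < \<bar>\<phi> (real N) u 0 - u 0\<bar>"
  shows "AE u in M. comparable k m s1 u"
proof (rule ccontr)
  assume "\<not> (AE u in M. comparable k m s1 u)"
  then have n1: "AE u in M. \<not> comparable k m s1 u" using comparable_zero_one[OF s1] by blast
  define A where "A = {s. s1 \<le> s \<and> (AE u in M. comparable k m s u)}"
  have notA: "AE u in M. \<not> comparable k m s u" if "s1 \<le> s" "s \<notin> A" for s
    using comparable_zero_one[of s k m] that s1 by (auto simp: A_def)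
  have pos: "0 < crossing_density k m s1" using crossing_density_nonzero[OF s1 n1] by (simp add: crossing_density_def less_le)
  show False
  proof (cases "A = {}")
    case True
    have le: "crossing_density k m s1 \<le> crossing_density k m S" if "s1 < S" for S
      by (rule crossing_density_mono[OF s1 that _ ne]) (use notA True in auto)
    have "(\<lambda>N. crossing_density k m (real N)) \<longlonglongrightarrow> 0"
      unfolding crossing_density_def
    proof (rule prob_tendsto_0)
      show "inv_event (\<lambda>u. sign_change_at (moved_diff k m (real N) 0 u) 0)" for N
        by (rule inv_event_sign_change_moved_diff) auto
      show "AE u in M. \<forall>\<^sub>F N in sequentially. \<not> sign_change_at (moved_diff k m (real N) 0 u) 0"
        using escape AE_space
      proof eventually_elim
        case (elim u)
        then have u: "u \<in> K n" by simp
        \<comment> \<open>The terms \<open>real n * \<bar>k\<bar>\<close> and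
          \<open>\<bar>m\<bar>\<close> account for the shift and the translation. What remains
          exceeds \<open>2 * n\<close>, the largest change of the difference from site 0 to site 1,
          so the two values have the same strict sign.\<close>
        have "\<forall>\<^sub>F N in sequentially. 2 * real n + real n * real_of_int \<bar>k\<bar> + \<bar>real_of_int m\<bar> < \<bar>\<phi> (real N) u 0 - u 0\<bar>"
          using elim(1) by blast
        then show ?case
        proof (rule eventually_mono)
          fix N assume big: "2 * real n + real n * real_of_int \<bar>k\<bar> + \<bar>real_of_int m\<bar> < \<bar>\<phi> (real N) u 0 - u 0\<bar>"
          define v where "v = \<phi> (real N) u"
          define x where "x = moved k m (real N) u"
          have vK: "v \<in> K n" and xK: "x \<in> K n" using u by (auto simp: v_def x_def flow_K moved_K)
          have "x 0 = v (- k) + real_of_int m"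
            using flow_shift[OF u, of "real N" k] by (simp add: x_def v_def moved_def translate_def Tshift_power_def)
          moreover have "\<bar>v (- k) - v 0\<bar> \<le> real n * real_of_int \<bar>k\<bar>"
            using K_diff[OF vK, of 0 "- k"] by simp
          ultimately have w0: "2 * real n < \<bar>x 0 - u 0\<bar>" using big unfolding v_def[symmetric] by linarith
          have w1: "\<bar>(x 1 - u 1) - (x 0 - u 0)\<bar> \<le> 2 * real n"
            using K_D[OF xK, of 0] K_D[OF u, of 0] by simp
          have "0 < (x 0 - u 0) * (x 1 - u 1)"
            using w0 w1 by (cases "0 < x 0 - u 0") (auto simp: zero_less_mult_iff abs_if split: if_splits)
          then have "x 1 - u 1 \<noteq> 0" "\<not> (x 0 - u 0) * (x 1 - u 1) < 0" by auto
          then show "\<not> sign_change_at (moved_diff k m (real N) 0 u) 0"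
            using sign_change_at_next[of "moved_diff k m (real N) 0 u" 0] moved_diff_0[OF u, of "real N" k m] by (auto simp: x_def)
        qed
      qed
    qed
    moreover have "\<forall>\<^sub>F N in sequentially. crossing_density k m s1 \<le> crossing_density k m (real N)"
      using eventually_gt_at_top[of "nat \<lceil>s1\<rceil>"] by (rule eventually_mono) (intro le, linarith)
    ultimately have "crossing_density k m s1 \<le> 0"
      using tendsto_lowerbound[of _ 0 sequentially] by auto
    then show False using pos by simp
  next
    case False
    define s2 where "s2 = Inf A"
    have bdd: "bdd_below A" by (auto simp: A_def intro!: bdd_belowI[of _ s1])
    have s2: "s1 \<le> s2" unfolding s2_def by (rule cInf_greatest[OF False]) (auto simp: A_def)
    have "s2 \<in> closure A" unfolding s2_def by (rule closure_contains_Inf[OF False bdd])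
    then obtain \<sigma> where \<sigma>: "\<And>i. \<sigma> i \<in> A" "\<sigma> \<longlonglongrightarrow> s2" unfolding closure_sequential by blast
    have "AE u in M. \<forall>i. comparable k m (\<sigma> i) u" unfolding AE_all_countable using \<sigma>(1) by (auto simp: A_def)
    \<comment> \<open>A strict crossing involves two sites only and would persist at the nearby
      parameters of \<open>A\<close>.\<close>
    then have O2: "AE u in M. comparable k m s2 u"
      using AE_space
    proof eventually_elim
      case (elim u)
      then have u: "u \<in> K n" by simp
      have s0: "0 \<le> \<sigma> i" "0 \<le> s2" for i using \<sigma>(1)[of i] s1 s2 by (auto simp: A_def)
      have conv: "(\<lambda>i. moved_diff k m (\<sigma> i) 0 u j) \<longlonglongrightarrow> moved_diff k m s2 0 u j" for j
      proof (rule tendsto_dist_iff[THEN iffD2], rule tendsto_sandwich[OF _ _ tendsto_const])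
        have "(\<lambda>i. field_bound n * \<bar>\<sigma> i - s2\<bar> * exp (5 * field_lip n * 0)) \<longlonglongrightarrow> field_bound n * \<bar>s2 - s2\<bar> * exp (5 * field_lip n * 0)"
          by (intro tendsto_intros \<sigma>(2))
        then show "(\<lambda>i. field_bound n * \<bar>\<sigma> i - s2\<bar> * exp (5 * field_lip n * 0)) \<longlonglongrightarrow> 0" by simp
        show "\<forall>\<^sub>F i in sequentially. dist (moved_diff k m (\<sigma> i) 0 u j) (moved_diff k m s2 0 u j) \<le> field_bound n * \<bar>\<sigma> i - s2\<bar> * exp (5 * field_lip n * 0)"
          using moved_diff_param_lipschitz[OF u s0(1) s0(2) order_refl] by (simp add: dist_real_def)
      qed simp
      show ?case
      proof (rule ccontr)
        assume "\<not> comparable k m s2 u"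
        then obtain i j where ij: "moved_diff k m s2 0 u i < 0" "0 < moved_diff k m s2 0 u j"
          using comparable_iff_moved_diff[OF u s0(2)] by (meson not_le)
        have "\<forall>\<^sub>F l in sequentially. moved_diff k m (\<sigma> l) 0 u i < 0" "\<forall>\<^sub>F l in sequentially. 0 < moved_diff k m (\<sigma> l) 0 u j"
          using order_tendstoD[OF conv] ij by auto
        then have "\<forall>\<^sub>F l in sequentially. \<not> comparable k m (\<sigma> l) u"
          by eventually_elim (use comparable_iff_moved_diff[OF u s0(1)] in \<open>meson not_le\<close>)
        then show False using elim(1) by (simp add: eventually_sequentially)
      qed
    qed
    have "s2 \<noteq> s1"
    proof
      assume "s2 = s1"
      with O2 have "AE u in M. comparable k m s1 u" by simp
      then have "AE u in M. False" using n1 by eventually_elim simp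
      then show False by simp
    qed
    then have s12: "s1 < s2" using s2 by simp
    define \<rho> where "\<rho> N = s2 - (s2 - s1) / real (N + 2)" for N
    have \<rho>: "s1 < \<rho> N" "\<rho> N < s2" for N
    proof -
      have "(s2 - s1) / real (N + 2) < (s2 - s1) / 1" by (rule divide_strict_left_mono) (use s12 in auto)
      then show "s1 < \<rho> N" by (simp add: \<rho>_def)
      show "\<rho> N < s2" using s12 by (simp add: \<rho>_def)
    qed
    have \<rho>lim: "\<rho> \<longlonglongrightarrow> s2" unfolding \<rho>_def by real_asymp
    have le: "crossing_density k m s1 \<le> crossing_density k m (\<rho> N)" for N
    proof (rule crossing_density_mono[OF s1 \<rho>(1) _ ne])
      fix s assume "s1 \<le> s" "s \<le> \<rho> N"
      then have "s \<notin> A" using \<rho>(2)[of N] cInf_lower[OF _ bdd, of s] by (auto simp: s2_def)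
      then show "AE u in M. \<not> comparable k m s u" using notA \<open>s1 \<le> s\<close> by blast
    qed
    \<comment> \<open>At \<open>s2\<close> the order is only weak at time 0 but strict at every site
      at time 1, hence stable at the sites 0 and 1 for nearby parameters. The crossing density is
      the same at both times.\<close>
    have "(\<lambda>N. prob {u \<in> K n. sign_change_at (moved_diff k m (\<rho> N) 1 u) 0}) \<longlonglongrightarrow> 0"
    proof (rule prob_tendsto_0)
      show "inv_event (\<lambda>u. sign_change_at (moved_diff k m (\<rho> N) 1 u) 0)" for N
        by (rule inv_event_sign_change_moved_diff) (use \<rho>(1)[of N] s1 in auto)
      show "AE u in M. \<forall>\<^sub>F N in sequentially. \<not> sign_change_at (moved_diff k m (\<rho> N) 1 u) 0"
        using O2 ne AE_space
      proof eventually_elim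
        case (elim u)
        then have u: "u \<in> K n" by simp
        have s0: "0 \<le> \<rho> i" "0 \<le> s2" for i using \<rho>(1)[of i] s1 s2 by auto
        have conv: "(\<lambda>i. moved_diff k m (\<rho> i) 1 u j) \<longlonglongrightarrow> moved_diff k m s2 1 u j" for j
        proof (rule tendsto_dist_iff[THEN iffD2], rule tendsto_sandwich[OF _ _ tendsto_const])
          have "(\<lambda>i. field_bound n * \<bar>\<rho> i - s2\<bar> * exp (5 * field_lip n * 1)) \<longlonglongrightarrow> field_bound n * \<bar>s2 - s2\<bar> * exp (5 * field_lip n * 1)"
            by (intro tendsto_intros \<rho>lim)
          then show "(\<lambda>i. field_bound n * \<bar>\<rho> i - s2\<bar> * exp (5 * field_lip n * 1)) \<longlonglongrightarrow> 0" by simp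
          show "\<forall>\<^sub>F i in sequentially. dist (moved_diff k m (\<rho> i) 1 u j) (moved_diff k m s2 1 u j) \<le> field_bound n * \<bar>\<rho> i - s2\<bar> * exp (5 * field_lip n * 1)"
            using moved_diff_param_lipschitz[OF u s0(1) s0(2) zero_le_one] by (simp add: dist_real_def)
        qed simp
        have ne2: "moved k m s2 u \<noteq> u" using elim(2) s2 by blast
        have "(\<forall>j. moved_diff k m s2 1 u j < 0) \<or> (\<forall>j. 0 < moved_diff k m s2 1 u j)"
          using elim(1) flow_strict_mono[OF moved_K[OF u s0(2)] u _ ne2 zero_less_one]
            flow_strict_mono[OF u moved_K[OF u s0(2)] _ ne2[symmetric] zero_less_one]
          unfolding comparable_def moved_diff_def by fastforce
        then show ?case
        proof
          assume neg: "\<forall>j. moved_diff k m s2 1 u j < 0"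
          have "\<forall>\<^sub>F N in sequentially. moved_diff k m (\<rho> N) 1 u 0 < 0" "\<forall>\<^sub>F N in sequentially. moved_diff k m (\<rho> N) 1 u 1 < 0"
            using order_tendstoD(2)[OF conv] neg by auto
          then show ?thesis
          proof eventually_elim
            case (elim N)
            then show ?case using sign_change_at_next[of "moved_diff k m (\<rho> N) 1 u" 0] by (auto simp: mult_less_0_iff)
          qed
        next
          assume pos: "\<forall>j. 0 < moved_diff k m s2 1 u j"
          have "\<forall>\<^sub>F N in sequentially. 0 < moved_diff k m (\<rho> N) 1 u 0" "\<forall>\<^sub>F N in sequentially. 0 < moved_diff k m (\<rho> N) 1 u 1"
            using order_tendstoD(1)[OF conv] pos by auto
          then show ?thesis
          proof eventually_elim
            case (elim N)
            then show ?case using sign_change_at_next[of "moved_diff k m (\<rho> N) 1 u" 0] by (auto simp: mult_less_0_iff)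
          qed
        qed
      qed
    qed
    moreover have "prob {u \<in> K n. sign_change_at (moved_diff k m (\<rho> N) 1 u) 0} = crossing_density k m (\<rho> N)" for N
      by (rule crossing_density_flow) (use \<rho>(1)[of N] s1 in auto)
    ultimately have "(\<lambda>N. crossing_density k m (\<rho> N)) \<longlonglongrightarrow> 0" by simp
    then have "crossing_density k m s1 \<le> 0" by (rule LIMSEQ_le_const) (use le in auto)
    then show False using pos by simp
  qed
qed

section \<open>Energy balance and drift\<close>

lemma f_inv_fun: "inv_fun (\<lambda>u. f u j)"
  unfolding inv_fun_def
  by (auto simp: f_translate intro!: measurable_continuous f_continuous_on continuous_coordinate)

lemma pair_continuous: "C1_plane g \<Longrightarrow> continuous_on (K n) (\<lambda>u :: config. g (u a) (u b))"
  using continuous_on_compose2[OF C1_plane_continuous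
      continuous_on_Pair[OF continuous_coordinate[where S = "K n" and j = a] continuous_coordinate[where S = "K n" and j = b]], of g]
  by simp

lemma V_shift: "V (u + real_of_int m) (v + real_of_int m) = V u v"
  "D1 V (u + real_of_int m) (v + real_of_int m) = D1 V u v"
  "D2 V (u + real_of_int m) (v + real_of_int m) = D2 V u v"
  by (rule shift_of_int, rule periodic_V) (rule shift_of_int, rule D1_shift D2_shift, rule periodic_V)+

lemma pair_inv_fun:
  "inv_fun (\<lambda>u. V (u a) (u b))" "inv_fun (\<lambda>u. D1 V (u a) (u b))" "inv_fun (\<lambda>u. D2 V (u a) (u b))"
  unfolding inv_fun_def
  by (auto simp: translate_def V_shift intro!: measurable_continuous pair_continuous C1s)

text \<open>The rate of change along the flow of the energy \<open>V (u 0) (u 1)\<close> of one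
  bond.\<close>

definition power_fun :: "config \<Rightarrow> real" where
  "power_fun u = D1 V (u 0) (u 1) * f u 0 + D2 V (u 0) (u 1) * f u 1"

lemma power_fun_inv: "inv_fun power_fun"
  using f_inv_fun[of 0] f_inv_fun[of 1] pair_inv_fun[of 0 1] by (auto simp: inv_fun_def power_fun_def[abs_def])

lemma energy_derivative:
  assumes "u \<in> K n" "0 \<le> t"
  shows "((\<lambda>t. V (\<phi> t u 0) (\<phi> t u 1)) has_real_derivative power_fun (\<phi> t u)) (at t within {0..})"
proof -
  have d: "((\<lambda>t. \<phi> t u j) has_derivative (\<lambda>h. f (\<phi> t u) j * h)) (at t within {0..})" for j
    using solK_deriv[OF flow_solK[OF assms(1)] assms(2) order_refl] by (simp add: has_field_derivative_def)
  have "((\<lambda>t. (\<lambda>(x, y). V x y) (\<phi> t u 0, \<phi> t u 1)) has_derivative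
     (\<lambda>h. (\<lambda>(h, k). D1 V (\<phi> t u 0) (\<phi> t u 1) * h + D2 V (\<phi> t u 0) (\<phi> t u 1) * k) (f (\<phi> t u) 0 * h, f (\<phi> t u) 1 * h))) (at t within {0..})"
    by (rule has_derivative_compose[where g = "\<lambda>(x, y). V x y" and f = "\<lambda>t. (\<phi> t u 0, \<phi> t u 1)", OF has_derivative_Pair[OF d d] C1_plane_has_derivative[OF C1s(1)]])
  then show ?thesis
    unfolding has_field_derivative_def prod.case
    by (rule has_derivative_eq_rhs) (auto simp: power_fun_def algebra_simps)
qed

lemma power_fun_bounded: "\<exists>C. \<forall>u\<in>K n. \<bar>power_fun u\<bar> \<le> C"
proof -
  obtain B1 where B1: "B1 > 0" "\<And>u v. \<bar>u - v\<bar> \<le> real n \<Longrightarrow> \<bar>D1 V u v\<bar> \<le> B1"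
    using shift_invariant_bounded_on_strip[OF D1_shift[of V, OF periodic_V] C1_plane_continuous[OF C1s(2)]] by blast
  obtain B2 where B2: "B2 > 0" "\<And>u v. \<bar>u - v\<bar> \<le> real n \<Longrightarrow> \<bar>D2 V u v\<bar> \<le> B2"
    using shift_invariant_bounded_on_strip[OF D2_shift[of V, OF periodic_V] C1_plane_continuous[OF C1s(3)]] by blast
  have "\<bar>power_fun u\<bar> \<le> B1 * field_bound n + B2 * field_bound n" if u: "u \<in> K n" for u
  proof -
    have "\<bar>u 0 - u 1\<bar> \<le> real n" using K_D[OF u, of 0] by simp
    then have "\<bar>D1 V (u 0) (u 1) * f u 0\<bar> \<le> B1 * field_bound n" "\<bar>D2 V (u 0) (u 1) * f u 1\<bar> \<le> B2 * field_bound n"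
      unfolding abs_mult using B1 B2 field_bounded[OF u] field_bound_pos[of n] by (auto intro!: mult_mono)
    then show ?thesis unfolding power_fun_def by linarith
  qed
  then show ?thesis by blast
qed

text \<open>Difference quotients at time 0 along \<open>1 / real (Suc N)\<close> are bounded by the
  bound \<open>C\<close> of the derivative, so dominated convergence applies. It serves for the bond
  energy and for the displacement.\<close>

lemma integral_derivative_quotient:
  fixes E g :: "config \<Rightarrow> real" and W :: "real \<Rightarrow> config \<Rightarrow> real"
  assumes W: "\<And>t. 0 \<le> t \<Longrightarrow> W t \<in> borel_measurable M" and W0: "\<And>u. u \<in> K n \<Longrightarrow> W 0 u = 0"
    and d: "\<And>u t. u \<in> K n \<Longrightarrow> 0 \<le> t \<Longrightarrow> ((\<lambda>t. W t u) has_real_derivative g (\<phi> t u)) (at t within {0..})"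
    and g: "inv_fun g" and C: "\<And>u. u \<in> K n \<Longrightarrow> \<bar>g u\<bar> \<le> C"
  shows "(\<lambda>N. real (Suc N) * (\<integral>u. W (1 / real (Suc N)) u \<partial>M)) \<longlonglongrightarrow> (\<integral>u. g u \<partial>M)"
proof -
  have C0: "0 \<le> C" using C[of "SOME u. u \<in> K n"] not_empty by (metis abs_ge_zero order_trans some_in_eq space_M)
  have lip: "\<bar>W t u\<bar> \<le> C * t" if u: "u \<in> K n" and t: "0 \<le> t" for u t
  proof -
    have d': "((\<lambda>t. W t u) has_real_derivative g (\<phi> s u)) (at s within {0..t})" if "0 \<le> s" for s
      by (rule DERIV_subset[OF d[OF u that]]) auto
    have b: "\<bar>g (\<phi> s u)\<bar> \<le> C" if "0 \<le> s" for s by (rule C[OF flow_K[OF u that]])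
    have lin: "((\<lambda>s. C * s) has_real_derivative C) (at s within {0..t})" for s
      using DERIV_cmult[OF DERIV_ident, of C s "{0..t}"] by simp
    have "C * 0 - W 0 u \<le> C * t - W t u"
    proof (rule nonneg_deriv_imp_le[where g = "\<lambda>s. C * s - W s u"])
      show "((\<lambda>s. C * s - W s u) has_real_derivative C - g (\<phi> s u)) (at s within {0..t})" if "0 \<le> s" "s \<le> t" for s
        by (rule DERIV_diff[OF lin d'[OF that(1)]])
      show "0 \<le> C - g (\<phi> s u)" if "0 < s" "s < t" for s using b[of s] that by linarith
    qed fact
    moreover have "C * 0 + W 0 u \<le> C * t + W t u"
    proof (rule nonneg_deriv_imp_le[where g = "\<lambda>s. C * s + W s u"])
      show "((\<lambda>s. C * s + W s u) has_real_derivative C + g (\<phi> s u)) (at s within {0..t})" if "0 \<le> s" "s \<le> t" for s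
        by (rule DERIV_add[OF lin d'[OF that(1)]])
      show "0 \<le> C + g (\<phi> s u)" if "0 < s" "s < t" for s using b[of s] that by linarith
    qed fact
    ultimately show ?thesis using W0[OF u] by (simp add: abs_le_iff)
  qed
  have lim0: "(\<lambda>N. 1 / real (Suc N)) \<longlonglongrightarrow> 0" by (rule LIMSEQ_inverse_real_of_nat[unfolded inverse_eq_divide])
  have "(\<lambda>N. \<integral>u. real (Suc N) * W (1 / real (Suc N)) u \<partial>M) \<longlonglongrightarrow> (\<integral>u. g u \<partial>M)"
  proof (rule integral_dominated_convergence[where w = "\<lambda>_. C"])
    show "g \<in> borel_measurable M" using g by (simp add: inv_fun_def)
    show "(\<lambda>u. real (Suc N) * W (1 / real (Suc N)) u) \<in> borel_measurable M" for N
      by (intro borel_measurable_times borel_measurable_const W) simp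
    show "AE u in M. norm (real (Suc N) * W (1 / real (Suc N)) u) \<le> C" for N
    proof (rule AE_I2)
      fix u assume "u \<in> space M"
      then have "real (Suc N) * \<bar>W (1 / real (Suc N)) u\<bar> \<le> real (Suc N) * (C * (1 / real (Suc N)))"
        by (intro mult_left_mono lip) auto
      also have "\<dots> = C" by (simp del: of_nat_Suc)
      finally show "norm (real (Suc N) * W (1 / real (Suc N)) u) \<le> C" by (simp add: abs_mult)
    qed
    show "AE u in M. (\<lambda>N. real (Suc N) * W (1 / real (Suc N)) u) \<longlonglongrightarrow> g u"
    proof (rule AE_I2)
      fix u assume "u \<in> space M"
      then have u: "u \<in> K n" by simp
      have "((\<lambda>t. (W t u - W 0 u) / (t - 0)) \<longlongrightarrow> g (\<phi> 0 u)) (at 0 within {0..})"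
        using d[OF u order_refl] unfolding has_field_derivative_iff .
      then have L: "((\<lambda>t. W t u / t) \<longlongrightarrow> g u) (at 0 within {0..})" by (simp add: W0[OF u] flow_0[OF u])
      have "filterlim (\<lambda>N. 1 / real (Suc N)) (at 0 within {0..}) sequentially"
        unfolding filterlim_at using lim0 by auto
      from filterlim_compose[OF L this] show "(\<lambda>N. real (Suc N) * W (1 / real (Suc N)) u) \<longlonglongrightarrow> g u"
        by (simp add: mult.commute)
    qed
  qed simp
  then show ?thesis by simp
qed

lemma bounded_integrable: "inv_fun g \<Longrightarrow> (\<And>u. u \<in> K n \<Longrightarrow> \<bar>g u\<bar> \<le> C) \<Longrightarrow> integrable M g"
  by (rule integrable_const_bound[of _ C]) (auto simp: inv_fun_def)

text \<open>The expected bond energy is constant in time, so the expected power vanishes.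
  Stationarity moves its second term back by one site, where the two forces of the neighbouring
  bonds add up to \<open>F - f u 0\<close>, and this factor multiplies the velocity
  \<open>f u 0\<close>.\<close>

lemma power_balance: "(\<integral>u. f u 0 * f u 0 \<partial>M) = F * (\<integral>u. f u 0 \<partial>M)"
proof -
  obtain C where C: "\<And>u. u \<in> K n \<Longrightarrow> \<bar>power_fun u\<bar> \<le> C" using power_fun_bounded by blast
  define W where "W t u = V (\<phi> t u 0) (\<phi> t u 1) - V (u 0) (u 1)" for t u
  note Vi = pair_inv_fun(1)[of 0 1]
  obtain B where B: "\<And>u v. \<bar>u - v\<bar> \<le> real n \<Longrightarrow> \<bar>V u v\<bar> \<le> B"
    using shift_invariant_bounded_on_strip[OF periodic_V C1_plane_continuous[OF C1s(1)]] by blast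
  have VB: "\<bar>V (u 0) (u 1)\<bar> \<le> B" if "u \<in> K n" for u using B K_D[OF that, of 0] by (simp add: abs_minus_commute)
  have zero: "(\<integral>u. W t u \<partial>M) = 0" if t: "0 \<le> t" for t
  proof -
    have "integrable M (\<lambda>u. V (\<phi> t u 0) (\<phi> t u 1))"
      by (rule bounded_integrable[OF inv_fun_flow[OF Vi t]]) (use VB flow_K t in auto)
    moreover have "integrable M (\<lambda>u. V (u 0) (u 1))" by (rule bounded_integrable[OF Vi VB])
    ultimately show ?thesis unfolding W_def using integral_flow[OF Vi t] by simp
  qed
  have "(\<lambda>N. real (Suc N) * (\<integral>u. W (1 / real (Suc N)) u \<partial>M)) \<longlonglongrightarrow> (\<integral>u. power_fun u \<partial>M)"
  proof (rule integral_derivative_quotient[OF _ _ _ power_fun_inv C])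
    show "W t \<in> borel_measurable M" if "0 \<le> t" for t
      unfolding W_def[abs_def]
      by (rule borel_measurable_diff) (use Vi inv_fun_flow[OF Vi that] in \<open>simp_all add: inv_fun_def\<close>)
    show "W 0 u = 0" if "u \<in> K n" for u using flow_0[OF that] by (simp add: W_def)
    show "((\<lambda>t. W t u) has_real_derivative power_fun (\<phi> t u)) (at t within {0..})" if "u \<in> K n" "0 \<le> t" for u t
      using DERIV_diff[OF energy_derivative[OF that] DERIV_const] by (simp add: W_def)
  qed
  then have p0: "(\<integral>u. power_fun u \<partial>M) = 0"
    using zero LIMSEQ_unique[OF _ tendsto_const] by simp
  define a where "a u = D1 V (u 0) (u 1) * f u 0" for u
  define b where "b u = D2 V (u 0) (u 1) * f u 1" for u
  have ai: "inv_fun a" and bi: "inv_fun b"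
    using f_inv_fun[of 0] f_inv_fun[of 1] pair_inv_fun[of 0 1] by (auto simp: inv_fun_def a_def[abs_def] b_def[abs_def])
  obtain B1 where B1: "B1 > 0" "\<And>u v. \<bar>u - v\<bar> \<le> real n \<Longrightarrow> \<bar>D1 V u v\<bar> \<le> B1"
    using shift_invariant_bounded_on_strip[OF D1_shift[of V, OF periodic_V] C1_plane_continuous[OF C1s(2)]] by blast
  obtain B2 where B2: "B2 > 0" "\<And>u v. \<bar>u - v\<bar> \<le> real n \<Longrightarrow> \<bar>D2 V u v\<bar> \<le> B2"
    using shift_invariant_bounded_on_strip[OF D2_shift[of V, OF periodic_V] C1_plane_continuous[OF C1s(3)]] by blast
  have ab: "\<bar>a u\<bar> \<le> B1 * field_bound n" "\<bar>b u\<bar> \<le> B2 * field_bound n" if u: "u \<in> K n" for u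
  proof -
    have "\<bar>u 0 - u 1\<bar> \<le> real n" using K_D[OF u, of 0] by simp
    then show "\<bar>a u\<bar> \<le> B1 * field_bound n" "\<bar>b u\<bar> \<le> B2 * field_bound n"
      unfolding abs_mult a_def b_def using B1 B2 field_bounded[OF u] field_bound_pos[of n] by (auto intro!: mult_mono)
  qed
  have ii: "integrable M a" "integrable M b" "integrable M (\<lambda>u. b (Tshift_power 1 u))"
    by (rule bounded_integrable[OF ai ab(1)], assumption, rule bounded_integrable[OF bi ab(2)], assumption,
        rule bounded_integrable[OF inv_fun_shift[OF bi], of 1 "B2 * field_bound n"], rule ab(2), rule K_shift)
  have "(\<integral>u. a u \<partial>M) + (\<integral>u. b u \<partial>M) = 0"
  proof -
    have "power_fun = (\<lambda>u. a u + b u)" by (simp add: fun_eq_iff power_fun_def a_def b_def)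
    then show ?thesis using p0 ii by simp
  qed
  then have "(\<integral>u. a u \<partial>M) + (\<integral>u. b (Tshift_power 1 u) \<partial>M) = 0" by (simp add: integral_shift[OF bi])
  then have "(\<integral>u. a u + b (Tshift_power 1 u) \<partial>M) = 0" using ii by simp
  moreover have "a u + b (Tshift_power 1 u) = F * f u 0 - f u 0 * f u 0" for u
  proof -
    have "b (Tshift_power 1 u) = D2 V (u (- 1)) (u 0) * f u 0"
      by (simp add: b_def f_shift) (simp add: Tshift_power_def)
    moreover have "D1 V (u 0) (u 1) + D2 V (u (- 1)) (u 0) = F - f u 0" by (simp add: vfield_def)
    then have "(D1 V (u 0) (u 1) + D2 V (u (- 1)) (u 0)) * f u 0 = (F - f u 0) * f u 0" by simp
    ultimately show ?thesis by (simp add: a_def algebra_simps)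
  qed
  ultimately have "(\<integral>u. F * f u 0 - f u 0 * f u 0 \<partial>M) = 0" by simp
  moreover have "integrable M (\<lambda>u. f u 0)" by (rule bounded_integrable[OF f_inv_fun field_bounded])
  moreover have "integrable M (\<lambda>u. f u 0 * f u 0)"
  proof (rule bounded_integrable[where C = "field_bound n * field_bound n"])
    show "inv_fun (\<lambda>u. f u 0 * f u 0)" using f_inv_fun[of 0] by (auto simp: inv_fun_def)
    show "\<bar>f u 0 * f u 0\<bar> \<le> field_bound n * field_bound n" if "u \<in> K n" for u
      unfolding abs_mult using field_bounded[OF that, of 0] field_bound_pos[of n] by (intro mult_mono) auto
  qed
  ultimately show ?thesis by simp
qed

lemma no_drift_imp_equilibria:
  assumes "(\<integral>u. f u 0 \<partial>M) = 0"
  shows "AE u in M. \<forall>j. f u j = 0"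
proof -
  have i: "inv_fun (\<lambda>u. f u 0 * f u 0)" using f_inv_fun[of 0] by (auto simp: inv_fun_def)
  have "integrable M (\<lambda>u. f u 0 * f u 0)"
  proof (rule bounded_integrable[OF i, where C = "field_bound n * field_bound n"])
    show "\<bar>f u 0 * f u 0\<bar> \<le> field_bound n * field_bound n" if "u \<in> K n" for u
      unfolding abs_mult using field_bounded[OF that, of 0] field_bound_pos[of n] by (intro mult_mono) auto
  qed
  then have "AE u in M. f u 0 = 0"
    using integral_nonneg_eq_0_iff_AE[of M "\<lambda>u. f u 0 * f u 0"] power_balance assms by simp
  moreover have "inv_event (\<lambda>u. f u 0 = 0)"
  proof -
    have [measurable]: "(\<lambda>u. f u 0) \<in> borel_measurable M" using f_inv_fun[of 0] by (simp add: inv_fun_def)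
    have "Measurable.pred M (\<lambda>u. f u 0 = 0)" by measurable
    then show ?thesis by (simp add: inv_event_def f_translate)
  qed
  ultimately have "AE u in M. f (Tshift_power k u) 0 = 0" for k by (subst AE_shift)
  then have "AE u in M. \<forall>k. f (Tshift_power k u) 0 = 0" unfolding AE_all_countable by blast
  then show ?thesis
  proof (rule AE_mp, intro AE_I2 impI allI)
    fix u j assume "\<forall>k. f (Tshift_power k u) 0 = 0"
    then have "f (Tshift_power (- j) u) 0 = 0" by blast
    then show "f u j = 0" by (simp add: f_shift) (simp add: Tshift_power_def)
  qed
qed

section \<open>Drift and escape\<close>

definition displacement :: "real \<Rightarrow> config \<Rightarrow> real" where
  "displacement t u = \<phi> t u 0 - u 0"

lemma displacement_inv_fun: "0 \<le> t \<Longrightarrow> inv_fun (displacement t)"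
proof -
  assume t: "0 \<le> t"
  have "displacement t \<in> borel_measurable M"
    unfolding displacement_def[abs_def]
    by (intro borel_measurable_diff coordinate_measurable measurable_compose[OF flow_measurable[OF t] coordinate_measurable])
  then show ?thesis using t by (auto simp: inv_fun_def displacement_def flow_translate') (simp add: translate_def)
qed

lemma displacement_bound: "u \<in> K n \<Longrightarrow> 0 \<le> t \<Longrightarrow> \<bar>displacement t u\<bar> \<le> field_bound n * t"
  using flow_lipschitz[of u n 0 t 0] by (simp add: displacement_def flow_0)

lemma displacement_add: "u \<in> K n \<Longrightarrow> 0 \<le> s \<Longrightarrow> 0 \<le> t \<Longrightarrow> displacement (s + t) u = displacement s u + displacement t (\<phi> s u)"
  by (simp add: displacement_def flow_add')

lemma displacement_integrable: "0 \<le> t \<Longrightarrow> integrable M (displacement t)"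
  by (rule bounded_integrable[OF displacement_inv_fun displacement_bound])

lemma integral_displacement_add: "0 \<le> s \<Longrightarrow> 0 \<le> t \<Longrightarrow> (\<integral>u. displacement (s + t) u \<partial>M) = (\<integral>u. displacement s u \<partial>M) + (\<integral>u. displacement t u \<partial>M)"
proof -
  assume st: "0 \<le> s" "0 \<le> t"
  have i: "integrable M (\<lambda>u. displacement t (\<phi> s u))"
    by (rule bounded_integrable[OF inv_fun_flow[OF displacement_inv_fun[OF st(2)] st(1)]]) (rule displacement_bound[OF flow_K[OF _ st(1)] st(2)])
  have "(\<integral>u. displacement (s + t) u \<partial>M) = (\<integral>u. displacement s u + displacement t (\<phi> s u) \<partial>M)"
    by (rule Bochner_Integration.integral_cong) (auto simp: displacement_add st)
  also have "\<dots> = (\<integral>u. displacement s u \<partial>M) + (\<integral>u. displacement t (\<phi> s u) \<partial>M)"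
    by (rule Bochner_Integration.integral_add[OF displacement_integrable[OF st(1)] i])
  finally show ?thesis by (simp add: integral_flow[OF displacement_inv_fun[OF st(2)] st(1)])
qed

lemma integral_displacement_multiple: "0 \<le> t \<Longrightarrow> (\<integral>u. displacement (real N * t) u \<partial>M) = real N * (\<integral>u. displacement t u \<partial>M)"
proof (induction N)
  case 0
  have "(\<integral>u. displacement 0 u \<partial>M) = (\<integral>u. 0 \<partial>M)"
    by (rule Bochner_Integration.integral_cong) (auto simp: displacement_def flow_0)
  then show ?case by simp
next
  case (Suc N)
  have "real (Suc N) * t = real N * t + t" by (simp add: algebra_simps)
  then show ?case using Suc integral_displacement_add[of "real N * t" t] by (simp add: algebra_simps)
qed

text \<open>The expected displacement is additive in time, so all its difference quotients along
  \<open>1 / real (Suc N)\<close> equal the value at time 1, and their limit is the expected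
  velocity.\<close>

lemma integral_displacement_1: "(\<integral>u. displacement 1 u \<partial>M) = (\<integral>u. f u 0 \<partial>M)"
proof -
  have "(\<lambda>N. real (Suc N) * (\<integral>u. displacement (1 / real (Suc N)) u \<partial>M)) \<longlonglongrightarrow> (\<integral>u. f u 0 \<partial>M)"
  proof (rule integral_derivative_quotient[OF _ _ _ f_inv_fun field_bounded])
    show "displacement t \<in> borel_measurable M" if "0 \<le> t" for t using displacement_inv_fun[OF that] by (simp add: inv_fun_def)
    show "displacement 0 u = 0" if "u \<in> K n" for u using flow_0[OF that] by (simp add: displacement_def)
    show "((\<lambda>t. displacement t u) has_real_derivative f (\<phi> t u) 0) (at t within {0..})" if "u \<in> K n" "0 \<le> t" for u t
      using DERIV_diff[OF solK_deriv[OF flow_solK[OF that(1)] that(2) order_refl] DERIV_const] by (simp add: displacement_def)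
  qed
  moreover have "real (Suc N) * (\<integral>u. displacement (1 / real (Suc N)) u \<partial>M) = (\<integral>u. displacement 1 u \<partial>M)" for N
    using integral_displacement_multiple[of "1 / real (Suc N)" "Suc N"] by (simp del: of_nat_Suc)
  ultimately show ?thesis using LIMSEQ_unique[OF tendsto_const] by simp
qed

text \<open>The covering argument of Katznelson and Weiss: cut \<open>[0, L)\<close> greedily into blocks of length at most
  \<open>R\<close> on which the mean displacement is at most \<open>c\<close>, and bad unit steps.\<close>

lemma block_cover:
  fixes \<sigma> c :: real and R :: nat
  assumes \<sigma>: "\<bar>\<sigma>\<bar> = 1"
  defines "bad \<equiv> \<lambda>u. \<forall>k. 1 \<le> k \<and> k \<le> R \<longrightarrow> \<not> \<sigma> * displacement (real k) u \<le> c * real k"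
  assumes "u \<in> K n"
  shows "\<sigma> * displacement (real L) u - c * real L \<le> (field_bound n + \<bar>c\<bar>) * ((\<Sum>i<L. of_bool (bad (\<phi> (real i) u))) + real R)"
  using assms(3)
proof (induction L arbitrary: u rule: less_induct)
  case (less L)
  let ?C = "field_bound n + \<bar>c\<bar>"
  note u = less.prems
  have C: "0 \<le> ?C" using field_bound_pos[of n] by simp
  \<comment> \<open>Per unit of time the signed displacement exceeds the slope \<open>c\<close> by
    at most \<open>?C\<close>. This price is paid for each bad unit step and for the last stretch,
    of length at most \<open>R\<close>.\<close>
  have crude: "\<sigma> * displacement (real k) u - c * real k \<le> ?C * real k" for k
  proof -
    have "\<bar>\<sigma> * displacement (real k) u\<bar> \<le> field_bound n * real k" using displacement_bound[OF u, of "real k"] \<sigma> by (simp add: abs_mult)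
    moreover have "- (c * real k) \<le> \<bar>c\<bar> * real k" by (metis abs_ge_minus_self abs_mult abs_of_nat)
    ultimately show ?thesis by (simp add: algebra_simps abs_le_iff)
  qed
  have step: "\<sigma> * displacement (real L) u - c * real L \<le> (\<sigma> * displacement (real k) u - c * real k) + ?C * ((\<Sum>i\<in>{k..<L}. of_bool (bad (\<phi> (real i) u))) + real R)"
    if k: "1 \<le> k" "k \<le> L" for k
  proof -
    have v: "\<phi> (real k) u \<in> K n" by (rule flow_K[OF u]) simp
    have "\<sigma> * displacement (real (L - k)) (\<phi> (real k) u) - c * real (L - k) \<le> ?C * ((\<Sum>i<L - k. of_bool (bad (\<phi> (real i) (\<phi> (real k) u)))) + real R)"
      by (rule less.IH[OF _ v]) (use k in simp)
    moreover have "(\<Sum>i<L - k. of_bool (bad (\<phi> (real i) (\<phi> (real k) u)))) = (\<Sum>i\<in>{k..<L}. of_bool (bad (\<phi> (real i) u)) :: real)"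
    proof -
      have "\<phi> (real i) (\<phi> (real k) u) = \<phi> (real (i + k)) u" for i
        using flow_add[OF u, of "real k" "real i"] by (simp add: add.commute)
      then have "(\<Sum>i<L - k. of_bool (bad (\<phi> (real i) (\<phi> (real k) u)))) = (\<Sum>i\<in>{0..<L - k}. of_bool (bad (\<phi> (real (i + k)) u)) :: real)"
        by (simp only: atLeast0LessThan)
      also have "\<dots> = (\<Sum>i\<in>{0 + k..<(L - k) + k}. of_bool (bad (\<phi> (real i) u)))"
        by (rule sum.shift_bounds_nat_ivl[symmetric])
      finally show ?thesis using k by simp
    qed
    moreover have "displacement (real L) u = displacement (real k) u + displacement (real (L - k)) (\<phi> (real k) u)"
      using displacement_add[OF u, of "real k" "real (L - k)"] k by (simp add: of_nat_diff)
    moreover have "c * real L = c * real k + c * real (L - k)" using k by (simp add: of_nat_diff algebra_simps)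
    ultimately show ?thesis by (simp add: algebra_simps)
  qed
  have nn: "0 \<le> (\<Sum>i\<in>A. of_bool (bad (\<phi> (real i) u)) :: real)" for A :: "nat set" by (rule sum_nonneg) simp
  show ?case
  proof (cases "L \<le> R")
    case True
    have "?C * real L \<le> ?C * ((\<Sum>i<L. of_bool (bad (\<phi> (real i) u))) + real R)"
      using True nn[of "{..<L}"] C by (intro mult_left_mono) auto
    then show ?thesis using crude[of L] by linarith
  next
    case False
    show ?thesis
    proof (cases "bad u")
      case True
      have "{..<L} = insert 0 {1..<L}" using False by auto
      then have "(\<Sum>i<L. of_bool (bad (\<phi> (real i) u)) :: real) = 1 + (\<Sum>i\<in>{1..<L}. of_bool (bad (\<phi> (real i) u)))"
        using True by (simp add: flow_0[OF u])
      then show ?thesis using step[of 1] crude[of 1] False by (simp add: algebra_simps)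
    next
      case good: False
      then obtain k where k: "1 \<le> k" "k \<le> R" "\<sigma> * displacement (real k) u \<le> c * real k" by (auto simp: bad_def)
      have "(\<Sum>i\<in>{k..<L}. of_bool (bad (\<phi> (real i) u)) :: real) \<le> (\<Sum>i<L. of_bool (bad (\<phi> (real i) u)))"
        by (rule sum_mono2) auto
      then have "?C * ((\<Sum>i\<in>{k..<L}. of_bool (bad (\<phi> (real i) u))) + real R) \<le> ?C * ((\<Sum>i<L. of_bool (bad (\<phi> (real i) u))) + real R)"
        using C by (intro mult_left_mono) auto
      then show ?thesis using step[of k] k False by linarith
    qed
  qed
qed

text \<open>The covering bound is integrated and divided by the length \<open>Suc L\<close>, which
  removes the unfinished stretch as \<open>L\<close> grows and leaves the probability of a bad
  point. That probability tends to 0 with growing \<open>R\<close> because almost every point has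
  some good block.\<close>

lemma mean_le_of_recurrent_blocks:
  fixes \<sigma> c :: real
  assumes \<sigma>: "\<bar>\<sigma>\<bar> = 1" and good: "AE u in M. \<exists>k\<ge>1. \<sigma> * displacement (real k) u \<le> c * real k"
  shows "\<sigma> * (\<integral>u. displacement 1 u \<partial>M) \<le> c"
proof -
  let ?C = "field_bound n + \<bar>c\<bar>" and ?\<rho> = "\<integral>u. displacement 1 u \<partial>M"
  define bad where "bad R u \<longleftrightarrow> (\<forall>k. 1 \<le> k \<and> k \<le> R \<longrightarrow> \<not> \<sigma> * displacement (real k) u \<le> c * real k)" for R u
  have bad_inv: "inv_event (bad R)" for R
  proof -
    have [measurable]: "displacement (real k) \<in> borel_measurable M" for k using displacement_inv_fun[of "real k"] by (simp add: inv_fun_def)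
    have "Measurable.pred M (bad R)" unfolding bad_def[abs_def] by measurable
    moreover have "displacement (real k) (translate m u) = displacement (real k) u" if "u \<in> K n" for k m u
      using displacement_inv_fun[of "real k"] that by (simp add: inv_fun_def)
    ultimately show ?thesis by (simp add: inv_event_def bad_def)
  qed
  have bnd: "\<sigma> * ?\<rho> - c \<le> ?C * (prob {u \<in> K n. bad R u} + real R / real (Suc L))" for R L
  proof -
    let ?L = "Suc L"
    have bi: "integrable M (\<lambda>u. indicator {u \<in> K n. bad R u} (\<phi> (real i) u) :: real)" for i
      by (rule bounded_integrable[OF inv_fun_flow[OF inv_event_indicator[OF bad_inv]], where C = 1]) (auto simp: indicator_def)
    have "real ?L * (\<sigma> * ?\<rho> - c) = (\<integral>u. \<sigma> * displacement (real ?L) u - c * real ?L \<partial>M)"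
      using integral_displacement_multiple[of 1 ?L] displacement_integrable[of "real ?L"] by (simp add: algebra_simps)
    also have "\<dots> \<le> (\<integral>u. ?C * ((\<Sum>i<?L. indicator {u \<in> K n. bad R u} (\<phi> (real i) u)) + real R) \<partial>M)"
    proof (rule integral_mono)
      show "integrable M (\<lambda>u. \<sigma> * displacement (real ?L) u - c * real ?L)" using displacement_integrable[of "real ?L"] by simp
      show "integrable M (\<lambda>u. ?C * ((\<Sum>i<?L. indicator {u \<in> K n. bad R u} (\<phi> (real i) u)) + real R))"
        by (intro integrable_mult_right Bochner_Integration.integrable_add Bochner_Integration.integrable_sum bi) simp
      fix u assume "u \<in> space M"
      then have u: "u \<in> K n" by simp
      have "(\<Sum>i<?L. of_bool (bad R (\<phi> (real i) u)) :: real) = (\<Sum>i<?L. indicator {u \<in> K n. bad R u} (\<phi> (real i) u))"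
        by (rule sum.cong) (auto simp: indicator_def flow_K[OF u])
      then show "\<sigma> * displacement (real ?L) u - c * real ?L \<le> ?C * ((\<Sum>i<?L. indicator {u \<in> K n. bad R u} (\<phi> (real i) u)) + real R)"
        using block_cover[OF \<sigma> u, of ?L c R] unfolding bad_def[symmetric] by (simp only:)
    qed
    also have "\<dots> = ?C * ((\<Sum>i<?L. \<integral>u. indicator {u \<in> K n. bad R u} (\<phi> (real i) u) \<partial>M) + real R)"
      using bi by (simp add: Bochner_Integration.integral_add Bochner_Integration.integral_sum Bochner_Integration.integrable_sum del: sum.lessThan_Suc)
    also have "\<dots> = ?C * (real ?L * prob {u \<in> K n. bad R u} + real R)"
      by (simp only: integral_flow[OF inv_event_indicator[OF bad_inv] of_nat_0_le_iff] prob_eq_integral[OF bad_inv, symmetric]) simp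
    also have "\<dots> = real ?L * (?C * (prob {u \<in> K n. bad R u} + real R / real ?L))" by (simp add: field_simps del: of_nat_Suc)
    finally show ?thesis by (simp del: of_nat_Suc)
  qed
  have "\<sigma> * ?\<rho> - c \<le> ?C * (prob {u \<in> K n. bad R u} + 0)" for R
  proof (rule LIMSEQ_le_const)
    show "(\<lambda>L. ?C * (prob {u \<in> K n. bad R u} + real R / real (Suc L))) \<longlonglongrightarrow> ?C * (prob {u \<in> K n. bad R u} + 0)"
    proof (intro tendsto_intros)
      show "(\<lambda>L. real R / real (Suc L)) \<longlonglongrightarrow> 0" by real_asymp
    qed
  qed (use bnd in auto)
  moreover have "(\<lambda>R. prob {u \<in> K n. bad R u}) \<longlonglongrightarrow> 0"
  proof (rule prob_tendsto_0[OF bad_inv])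
    show "AE u in M. \<forall>\<^sub>F R in sequentially. \<not> bad R u"
      using good
    proof eventually_elim
      case (elim u)
      then obtain k where k: "1 \<le> k" "\<sigma> * displacement (real k) u \<le> c * real k" by blast
      show ?case using eventually_ge_at_top[of k] by (rule eventually_mono) (use k in \<open>auto simp: bad_def\<close>)
    qed
  qed
  then have "(\<lambda>R. ?C * (prob {u \<in> K n. bad R u} + 0)) \<longlonglongrightarrow> ?C * (0 + 0)" by (intro tendsto_intros)
  ultimately have "\<sigma> * ?\<rho> - c \<le> ?C * (0 + 0)" by (intro LIMSEQ_le_const) auto
  then show ?thesis by simp
qed

text \<open>The event \<open>E\<close> says that the signed displacement returns infinitely often
  below a line of slope \<open>c\<close>, half the mean drift, up to some additive constant. The
  constant absorbs the bounded changes caused by the shift and the flow, so \<open>E\<close> is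
  invariant and has probability 0 or 1. Full probability would push the mean drift below itself;
  outside \<open>E\<close> the displacement eventually stays above \<open>c * N\<close>.\<close>

lemma AE_escape:
  assumes ne: "(\<integral>u. f u 0 \<partial>M) \<noteq> 0"
  shows "AE u in M. \<forall>c. \<forall>\<^sub>F N in sequentially. c < \<bar>\<phi> (real N) u 0 - u 0\<bar>"
proof -
  let ?\<rho> = "\<integral>u. displacement 1 u \<partial>M"
  have \<rho>: "?\<rho> \<noteq> 0" using ne by (simp add: integral_displacement_1)
  define \<sigma> where "\<sigma> = sgn ?\<rho>"
  have \<sigma>: "\<bar>\<sigma>\<bar> = 1" "0 < \<sigma> * ?\<rho>" using \<rho> by (auto simp: \<sigma>_def sgn_if)
  define c where "c = \<sigma> * ?\<rho> / 2"
  have c: "0 < c" "c < \<sigma> * ?\<rho>" using \<sigma> by (auto simp: c_def)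
  define E where "E u \<longleftrightarrow> (\<exists>C :: nat. \<forall>N0. \<exists>N\<ge>N0. \<sigma> * displacement (real N) u \<le> c * real N + real C)" for u
  have E_mono: "E v" if E: "E u" and close: "\<And>N. \<bar>displacement (real N) v - displacement (real N) u\<bar> \<le> B" for u v B
  proof -
    obtain C :: nat where C: "\<And>N0. \<exists>N\<ge>N0. \<sigma> * displacement (real N) u \<le> c * real N + real C" using E unfolding E_def by blast
    show ?thesis unfolding E_def
    proof (rule exI[of _ "C + nat \<lceil>B\<rceil>"], rule allI)
      fix N0
      obtain N where N: "N \<ge> N0" "\<sigma> * displacement (real N) u \<le> c * real N + real C" using C by blast
      have "\<bar>\<sigma> * displacement (real N) v - \<sigma> * displacement (real N) u\<bar> \<le> B"
        using close[of N] \<sigma>(1) by (simp add: right_diff_distrib[symmetric] abs_mult)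
      moreover have "B \<le> real (nat \<lceil>B\<rceil>)" by linarith
      ultimately have "\<sigma> * displacement (real N) v \<le> c * real N + real (C + nat \<lceil>B\<rceil>)"
        using N(2) unfolding of_nat_add by linarith
      then show "\<exists>N\<ge>N0. \<sigma> * displacement (real N) v \<le> c * real N + real (C + nat \<lceil>B\<rceil>)"
        using N(1) by blast
    qed
  qed
  have E_inv: "inv_event E"
  proof -
    have [measurable]: "displacement (real k) \<in> borel_measurable M" for k using displacement_inv_fun[of "real k"] by (simp add: inv_fun_def)
    have "Measurable.pred M E" unfolding E_def[abs_def] by measurable
    moreover have "displacement (real k) (translate m u) = displacement (real k) u" if "u \<in> K n" for k m u
      using displacement_inv_fun[of "real k"] that by (simp add: inv_fun_def)
    ultimately show ?thesis by (simp add: inv_event_def E_def)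
  qed
  have "(AE u in M. E u) \<or> (AE u in M. \<not> E u)"
  proof (rule zero_one[OF E_inv])
    fix u assume u: "u \<in> K n"
    have close: "\<bar>displacement (real N) (Tshift u) - displacement (real N) u\<bar> \<le> 2 * real n" for N
    proof -
      have "displacement (real N) (Tshift u) = \<phi> (real N) u (- 1) - u (- 1)"
        using flow_shift[OF u, of "real N" 1] by (simp add: displacement_def Tshift_eq_power) (simp add: Tshift_power_def)
      then show ?thesis
        using K_D[OF u, of "- 1"] K_D[OF flow_K[OF u], of "real N" "- 1"] by (simp add: displacement_def)
    qed
    show "E (Tshift u) = E u"
      using E_mono[of u "Tshift u"] E_mono[of "Tshift u" u] close by (metis abs_minus_commute)
  next
    fix u and t :: real assume u: "u \<in> K n" and t: "0 \<le> t" and "E u"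
    have "\<bar>displacement (real N) (\<phi> t u) - displacement (real N) u\<bar> \<le> 2 * (field_bound n * t)" for N
    proof -
      have "displacement (real N) u + displacement t (\<phi> (real N) u) = displacement t u + displacement (real N) (\<phi> t u)"
        using displacement_add[OF u, of "real N" t] displacement_add[OF u t, of "real N"] t by (simp add: add.commute)
      moreover have "\<bar>displacement t u\<bar> \<le> field_bound n * t" "\<bar>displacement t (\<phi> (real N) u)\<bar> \<le> field_bound n * t"
        using displacement_bound[OF u t] displacement_bound[OF flow_K[OF u] t] by auto
      ultimately show ?thesis by linarith
    qed
    then show "E (\<phi> t u)" using E_mono \<open>E u\<close> by blast
  qed
  moreover have "\<not> (AE u in M. E u)"
  proof
    assume "AE u in M. E u"
    \<comment> \<open>A slope strictly between \<open>c\<close> and the mean drift: for large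
      \<open>N\<close> the term \<open>(c1 - c) * N\<close> swallows the additive constant.\<close>
    define c1 where "c1 = (c + \<sigma> * ?\<rho>) / 2"
    have c1: "c < c1" "c1 < \<sigma> * ?\<rho>" using c by (auto simp: c1_def)
    have "AE u in M. \<exists>k\<ge>1. \<sigma> * displacement (real k) u \<le> c1 * real k"
      using \<open>AE u in M. E u\<close>
    proof eventually_elim
      case (elim u)
      then obtain C :: nat where C: "\<And>N0. \<exists>N\<ge>N0. \<sigma> * displacement (real N) u \<le> c * real N + real C" unfolding E_def by blast
      obtain N where N: "N \<ge> max 1 (nat \<lceil>real C / (c1 - c)\<rceil>)" "\<sigma> * displacement (real N) u \<le> c * real N + real C" using C by blast
      have "real C / (c1 - c) \<le> real N" using N(1) by linarith
      then have "real C \<le> real N * (c1 - c)" using c1 by (simp add: pos_divide_le_eq)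
      then show ?case using N by (intro exI[of _ N]) (auto simp: algebra_simps)
    qed
    from mean_le_of_recurrent_blocks[OF \<sigma>(1) this] show False using c1 by simp
  qed
  ultimately have "AE u in M. \<not> E u" by blast
  then show ?thesis
  proof eventually_elim
    case (elim u)
    show ?case
    proof
      fix b :: real
      obtain N0 where N0: "\<And>N. N \<ge> N0 \<Longrightarrow> c * real N < \<sigma> * displacement (real N) u"
        using elim unfolding E_def by (metis add_0_right not_le of_nat_0)
      have "b < \<bar>displacement (real N) u\<bar>" if N: "N \<ge> max N0 (nat \<lceil>b / c\<rceil>)" for N
      proof -
        have "b / c \<le> real N" using N by linarith
        then have "b \<le> c * real N" using c(1) by (simp add: pos_divide_le_eq mult.commute)
        also have "\<dots> < \<sigma> * displacement (real N) u" using N0 N by simp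
        also have "\<dots> \<le> \<bar>\<sigma> * displacement (real N) u\<bar>" by simp
        finally show ?thesis using \<sigma>(1) by (simp add: abs_mult)
      qed
      then show "\<forall>\<^sub>F N in sequentially. b < \<bar>\<phi> (real N) u 0 - u 0\<bar>"
        unfolding displacement_def eventually_sequentially by blast
    qed
  qed
qed

section \<open>Totally ordered orbits\<close>

lemma moved_0_0: "u \<in> K n \<Longrightarrow> moved 0 0 s u = \<phi> s u"
  by (simp add: moved_def)

lemma moved_flow_add: "u \<in> K n \<Longrightarrow> 0 \<le> t \<Longrightarrow> 0 \<le> s \<Longrightarrow> moved k m s (\<phi> t u) = moved k m (t + s) u"
  by (simp add: moved_def flow_shift'[symmetric] flow_add' K_shift)

text \<open>Failure of comparability is witnessed by strict signs at two sites, and these persist at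
  nearby parameters by Lipschitz dependence.\<close>

lemma comparable_of_rational:
  assumes u: "u \<in> K n" and s: "0 \<le> s" and r: "\<And>r. r \<in> \<rat> \<Longrightarrow> 0 \<le> r \<Longrightarrow> comparable k m r u"
  shows "comparable k m s u"
proof (rule ccontr)
  assume "\<not> ?thesis"
  then obtain i j where ij: "moved_diff k m s 0 u i < 0" "0 < moved_diff k m s 0 u j"
    using comparable_iff_moved_diff[OF u s] by (meson not_le)
  define d where "d = min (- moved_diff k m s 0 u i) (moved_diff k m s 0 u j) / field_bound n"
  have d: "0 < d" using ij field_bound_pos[of n] by (simp add: d_def)
  then obtain q where q: "q \<in> \<rat>" "s < q" "q < s + d" using Rats_dense_in_real[of s "s + d"] by auto
  have q0: "0 \<le> q" using q s by simp
  have "field_bound n * \<bar>s - q\<bar> < field_bound n * d" using q field_bound_pos[of n] by (intro mult_strict_left_mono) auto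
  also have "field_bound n * d = min (- moved_diff k m s 0 u i) (moved_diff k m s 0 u j)" using field_bound_pos[of n] by (simp add: d_def)
  finally have "moved_diff k m q 0 u i < 0" "0 < moved_diff k m q 0 u j"
    using moved_diff_param_lipschitz[OF u s q0 order_refl, of k m i] moved_diff_param_lipschitz[OF u s q0 order_refl, of k m j] by auto
  then show False using r[OF q(1) q0] comparable_iff_moved_diff[OF u q0, of k m] by (meson not_le)
qed

text \<open>Reducing the time modulo \<open>s\<close> bounds every displacement of a periodic
  configuration by \<open>field_bound n * s\<close>.\<close>

lemma escape_imp_not_fixed:
  assumes u: "u \<in> K n" and s: "0 < s" and fixed: "\<phi> s u = u"
    and escape: "\<forall>c. \<forall>\<^sub>F N in sequentially. c < \<bar>\<phi> (real N) u 0 - u 0\<bar>"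
  shows False
proof -
  have iter: "\<phi> (real k * s) u = u" for k
  proof (induction k)
    case (Suc k)
    have "real (Suc k) * s = real k * s + s" by (simp add: algebra_simps)
    then show ?case using flow_add[OF u, of "real k * s" s] Suc s fixed by simp
  qed (simp add: flow_0[OF u])
  have "\<bar>\<phi> (real N) u 0 - u 0\<bar> \<le> field_bound n * s" for N
  proof -
    define k where "k = nat \<lfloor>real N / s\<rfloor>"
    have "0 \<le> real N / s" using s by simp
    then have k: "real k \<le> real N / s" "real N / s < real k + 1" unfolding k_def by linarith+
    define r where "r = real N - real k * s"
    have r: "0 \<le> r" "r \<le> s" "real N = real k * s + r"
      using k s by (auto simp: r_def field_simps)
    have "\<phi> (real N) u = \<phi> r u"
      using flow_add[OF u, of "real k * s" r] r s iter[of k] by simp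
    then have "\<bar>\<phi> (real N) u 0 - u 0\<bar> \<le> field_bound n * r" using displacement_bound[OF u r(1)] by (simp add: displacement_def)
    also have "\<dots> \<le> field_bound n * s" using r field_bound_pos[of n] by simp
    finally show ?thesis .
  qed
  moreover have "\<forall>\<^sub>F N in sequentially. field_bound n * s < \<bar>\<phi> (real N) u 0 - u 0\<bar>" using escape by blast
  ultimately show False by (auto simp: eventually_sequentially not_less[symmetric])
qed

text \<open>For \<open>k = m = 0\<close> a coincidence is a return in time, which escape excludes.
  For general \<open>k\<close> and \<open>m\<close> a coincidence at \<open>s' \<ge> s\<close> is
  turned around: \<open>u\<close> is comparable with \<open>\<phi> (s' - s) u\<close>, and the
  monotone map \<open>moved k m s\<close> transports this to a comparison of
  \<open>moved k m s u\<close> with \<open>u\<close>, contrary to the assumption.\<close>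

lemma AE_all_ordered:
  assumes ne: "(\<integral>u. f u 0 \<partial>M) \<noteq> 0"
  shows "AE u in M. \<forall>k m. \<forall>s\<ge>0. comparable k m s u"
proof -
  note escape = AE_escape[OF ne]
  have base: "AE u in M. comparable 0 0 s u" if s: "0 \<le> s" for s
  proof (cases "s = 0")
    case True
    then show ?thesis by (intro AE_I2) (simp add: comparable_def moved_0_0 flow_0)
  next
    case False
    show ?thesis
    proof (rule AE_comparable[OF s _ escape])
      show "AE u in M. \<forall>s'\<ge>s. moved 0 0 s' u \<noteq> u"
        using escape AE_space
      proof eventually_elim
        case (elim u)
        then have u: "u \<in> K n" by simp
        show ?case
        proof (intro allI impI notI)
          fix s' assume "s \<le> s'" "moved 0 0 s' u = u"
          then show False using escape_imp_not_fixed[OF u, of s'] elim(1) s False moved_0_0[OF u, of s'] by simp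
        qed
      qed
    qed
  qed
  have "AE u in M. \<forall>r\<in>\<rat>. 0 \<le> r \<longrightarrow> comparable 0 0 r u"
    by (intro AE_ball_countable' AE_impI base countable_rat)
  then have mono: "AE u in M. \<forall>s\<ge>0. comparable 0 0 s u"
    using AE_space by eventually_elim (use comparable_of_rational in auto)
  have gen: "AE u in M. comparable k m s u" if s: "0 \<le> s" for k m s
  proof (rule ccontr)
    assume "\<not> ?thesis"
    then have n: "AE u in M. \<not> comparable k m s u" using comparable_zero_one[OF s] by blast
    have "AE u in M. \<forall>s'\<ge>s. moved k m s' u \<noteq> u"
      using n mono AE_space
    proof eventually_elim
      case (elim u)
      then have u: "u \<in> K n" by simp
      show ?case
      proof (intro allI impI notI)
        fix s' assume s': "s \<le> s'" "moved k m s' u = u"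
        have "comparable 0 0 (s' - s) u" using elim(2) s' by simp
        then have o: "\<phi> (s' - s) u \<le> u \<or> u \<le> \<phi> (s' - s) u" by (simp add: comparable_def moved_0_0[OF u])
        have "moved k m s (\<phi> (s' - s) u) = u"
          using moved_flow_add[OF u, of "s' - s" s k m] s s' by simp
        have "moved k m s (\<phi> (s' - s) u) \<le> moved k m s u \<or> moved k m s u \<le> moved k m s (\<phi> (s' - s) u)"
          using o flow_mono[OF K_shift[OF flow_K[OF u]] K_shift[OF u] _ s] flow_mono[OF K_shift[OF u] K_shift[OF flow_K[OF u]] _ s] s'
          by (auto simp: moved_def)
        with \<open>moved k m s (\<phi> (s' - s) u) = u\<close> show False using elim(1) by (auto simp: comparable_def)
      qed
    qed
    from AE_comparable[OF s this escape] n have "AE u in M. False" by eventually_elim simp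
    then show False by simp
  qed
  have "AE u in M. \<forall>k m. \<forall>r\<in>\<rat>. 0 \<le> r \<longrightarrow> comparable k m r u"
    by (intro AE_all_countable[THEN iffD2] allI AE_ball_countable' AE_impI gen countable_rat)
  then show ?thesis
    using AE_space by eventually_elim (use comparable_of_rational in auto)
qed

section \<open>Density of orbits\<close>

definition hits :: "config set \<Rightarrow> config \<Rightarrow> bool" where
  "hits O' u \<longleftrightarrow> (\<exists>k m. \<exists>t\<ge>0. moved k m t u \<in> O')"

lemma moved_continuous_time:
  assumes "u \<in> K n"
  shows "continuous_on {0..} (\<lambda>t. moved k m t u)"
  unfolding moved_def translate_def
  by (intro continuous_on_coordinatewise_then_product continuous_intros flow_continuous_time[OF K_shift[OF assms]])

lemma hits_rational:
  assumes O: "open O'" and u: "u \<in> K n"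
  shows "hits O' u \<longleftrightarrow> (\<exists>k m. \<exists>r :: rat. 0 \<le> r \<and> moved k m (real_of_rat r) u \<in> O')"
proof
  assume "hits O' u"
  then obtain k m t where t: "0 \<le> t" "moved k m t u \<in> O'" by (auto simp: hits_def)
  have "((\<lambda>t. moved k m t u) \<longlongrightarrow> moved k m t u) (at t within {0..})"
    using moved_continuous_time[OF u] t(1) by (auto simp: continuous_on)
  then have "\<forall>\<^sub>F s in at t within {0..}. moved k m s u \<in> O'" by (rule topological_tendstoD[OF _ O t(2)])
  then obtain d where d: "0 < d" "\<And>s. 0 \<le> s \<Longrightarrow> s \<noteq> t \<Longrightarrow> dist s t < d \<Longrightarrow> moved k m s u \<in> O'"
    by (auto simp: eventually_at)
  obtain r where r: "r \<in> \<rat>" "r \<in> {t..t + 1}" "r \<noteq> t" "dist r t < d"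
    by (rule rat_dense_subinterval[of t "t + 1" t d]) (use d in auto)
  then obtain q where "r = real_of_rat q" by (auto elim: Rats_cases)
  then show "\<exists>k m. \<exists>r :: rat. 0 \<le> r \<and> moved k m (real_of_rat r) u \<in> O'"
  proof (intro exI conjI)
    have "0 \<le> r" using r t(1) by auto
    then show "moved k m (real_of_rat q) u \<in> O'" using d(2)[of r] r \<open>r = real_of_rat q\<close> by simp
    show "0 \<le> q" using \<open>0 \<le> r\<close> \<open>r = real_of_rat q\<close> by simp
  qed
next
  assume "\<exists>k m. \<exists>r :: rat. 0 \<le> r \<and> moved k m (real_of_rat r) u \<in> O'"
  then show "hits O' u" unfolding hits_def by (metis zero_le_of_rat_iff)
qed

lemma inv_event_hits:
  assumes O: "open O'"
  shows "inv_event (hits O')"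
proof -
  have [measurable]: "Measurable.pred M (\<lambda>u. 0 \<le> r \<and> moved k m (real_of_rat r) u \<in> O')" for k m r
  proof (cases "0 \<le> r")
    case True
    have "(\<lambda>u. moved k m (real_of_rat r) u) \<in> borel_measurable M"
      by (rule measurable_compose[OF moved_measurable measurable_continuous[OF continuous_on_id]]) (use True in simp)
    then have "Measurable.pred M (\<lambda>u. moved k m (real_of_rat r) u \<in> O')"
      by (rule pred_sets2[OF borel_open[OF O]])
    then show ?thesis using True by simp
  qed simp
  have "Measurable.pred M (\<lambda>u. \<exists>k m. \<exists>r :: rat. 0 \<le> r \<and> moved k m (real_of_rat r) u \<in> O')" by measurable
  moreover have "Measurable.pred M (hits O') \<longleftrightarrow> Measurable.pred M (\<lambda>u. \<exists>k m. \<exists>r :: rat. 0 \<le> r \<and> moved k m (real_of_rat r) u \<in> O')"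
    by (rule measurable_cong) (simp add: hits_rational[OF O])
  moreover have "hits O' (translate l u) = hits O' u" if u: "u \<in> K n" for l u
  proof -
    have eq: "moved k m t (translate l u) = moved k (m + l) t u" if "0 \<le> t" for k m t
      using moved_translate[OF u that] by (simp add: moved_def translate_add add.commute)
    show ?thesis unfolding hits_def using eq by (metis diff_add_cancel)
  qed
  ultimately show ?thesis by (simp add: inv_event_def)
qed

text \<open>Almost every orbit is dense in the support of the measure.\<close>

lemma AE_hits:
  assumes O: "open O'"
  shows "(AE u in M. u \<notin> O') \<or> (AE u in M. hits O' u)"
proof -
  \<comment> \<open>The complement is the forward invariant event required by
    \<open>zero_one\<close>: an orbit missing \<open>O'\<close> keeps missing it, whereas an orbit
    that has hit it may not do so again.\<close>
  have inv: "inv_event (\<lambda>u. \<not> hits O' u)" using inv_event_hits[OF O] by (auto simp: inv_event_def)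
  have "(AE u in M. \<not> hits O' u) \<or> (AE u in M. \<not> \<not> hits O' u)"
  proof (rule zero_one[OF inv])
    fix u assume u: "u \<in> K n"
    have "moved k m t (Tshift u) = moved (k + 1) m t u" for k m t
      by (simp add: moved_def Tshift_eq_power Tshift_power_add)
    then show "(\<not> hits O' (Tshift u)) = (\<not> hits O' u)" unfolding hits_def by (metis diff_add_cancel)
  next
    fix u and t :: real assume u: "u \<in> K n" and t: "0 \<le> t" and n: "\<not> hits O' u"
    have "moved k m s (\<phi> t u) = moved k m (t + s) u" if "0 \<le> s" for k m s
      using u t that by (rule moved_flow_add)
    then show "\<not> hits O' (\<phi> t u)" using n t unfolding hits_def by (metis add_nonneg_nonneg)
  qed
  moreover have "AE u in M. u \<notin> O'" if "AE u in M. \<not> hits O' u"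
    using that AE_space
  proof eventually_elim
    case (elim u)
    then show ?case using flow_0[of u n] by (auto simp: hits_def moved_def dest!: spec[of _ 0])
  qed
  ultimately show ?thesis unfolding not_not by blast
qed

section \<open>Periodicity and total order\<close>

lemma flow_period_multiple:
  assumes v: "v \<in> K n" and t0: "0 < t0" "\<phi> t0 v = translate e v" and r: "0 \<le> r"
  shows "\<phi> (real p * t0 + r) v = translate (int p * e) (\<phi> r v)"
proof (induction p)
  case (Suc p)
  have nn: "0 \<le> real p * t0 + r" using t0 r by simp
  have "real (Suc p) * t0 + r = t0 + (real p * t0 + r)" by (simp add: algebra_simps)
  then have "\<phi> (real (Suc p) * t0 + r) v = \<phi> (real p * t0 + r) (translate e v)"
    using flow_add[OF v _ nn, of t0] t0 by (simp only: add.assoc less_imp_le)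
  also have "\<dots> = translate e (\<phi> (real p * t0 + r) v)" by (rule flow_translate[OF v nn])
  also have "\<dots> = translate (int (Suc p) * e) (\<phi> r v)" unfolding Suc translate_add by (simp add: algebra_simps)
  finally show ?case .
qed simp

text \<open>Both points are, up to a common translation, images under the flow at the smaller time
  of \<open>v\<close> and of a configuration already known to be comparable with \<open>v\<close>.
  Monotonicity carries the order forward.\<close>

lemma orbit_comparable:
  assumes v: "v \<in> K n" and cmp: "\<And>m s. 0 \<le> s \<Longrightarrow> translate m (\<phi> s v) \<le> v \<or> v \<le> translate m (\<phi> s v)"
    and st: "0 \<le> s" "0 \<le> t"
  shows "translate m (\<phi> s v) \<le> translate l (\<phi> t v) \<or> translate l (\<phi> t v) \<le> translate m (\<phi> s v)"
proof -
  have *: "translate m (\<phi> s v) \<le> translate l (\<phi> t v) \<or> translate l (\<phi> t v) \<le> translate m (\<phi> s v)"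
    if st: "0 \<le> t" "t \<le> s" for s t m l
  proof -
    define x where "x = translate (m - l) (\<phi> (s - t) v)"
    have x: "x \<in> K n" unfolding x_def K_translate by (rule flow_K[OF v]) (use st in simp)
    have "\<phi> t x = translate (m - l) (\<phi> s v)"
      unfolding x_def using st v by (simp add: flow_translate' flow_K' flow_add'[symmetric])
    then have eq: "translate m (\<phi> s v) = translate l (\<phi> t x)" by (simp add: translate_add)
    have "x \<le> v \<or> v \<le> x" unfolding x_def by (rule cmp) (use st in simp)
    then show ?thesis unfolding eq using flow_mono[OF x v _ st(1)] flow_mono[OF v x _ st(1)] by auto
  qed
  show ?thesis using *[of t s m l] *[of s t l m] st by (cases "t \<le> s") auto
qed

text \<open>A point in the past of \<open>T\<^sup>k v\<close> is recovered by going forward around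
  the periodic orbit: after enough periods there is an orbit point that reaches the same
  configuration in the same time, and injectivity of the flow identifies the two.\<close>

lemma Upsilon_subset_orbit:
  assumes v: "v \<in> K n" and t0: "0 < t0" "\<phi> t0 v = translate e v"
    and shift: "\<And>k. \<exists>m. \<exists>s\<ge>0. Tshift_power k v = translate m (\<phi> s v)"
  shows "Upsilon V F v \<subseteq> {translate m (\<phi> t v) | m t. 0 \<le> t}"
proof
  fix w assume "w \<in> Upsilon V F v"
  then obtain k t where w: "w \<in> X" "0 \<le> t" "w = \<phi> t (Tshift_power k v) \<or> \<phi> t w = Tshift_power k v"
    by (auto simp: Upsilon_def)
  obtain m s where s: "0 \<le> s" "Tshift_power k v = translate m (\<phi> s v)" using shift by blast
  from w(3) show "w \<in> {translate m (\<phi> t v) | m t. 0 \<le> t}"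
  proof
    assume "w = \<phi> t (Tshift_power k v)"
    then have "w = translate m (\<phi> (s + t) v)" using s w(2) v by (simp add: flow_translate' flow_K' flow_add')
    then show ?thesis using s w(2) by (intro CollectI exI[of _ m] exI[of _ "s + t"]) auto
  next
    assume tw: "\<phi> t w = Tshift_power k v"
    obtain n' where "w \<in> K n'" using w(1) by (auto simp: X_def)
    \<comment> \<open>A backward point is only known to lie in \<open>X\<close>, possibly with
      larger spacing than \<open>v\<close>; injectivity is applied in a set that contains
      both.\<close>
    define N where "N = max n n'"
    have wN: "w \<in> K N" and vN: "v \<in> K N"
      using K_mono[of n N] K_mono[of n' N] v \<open>w \<in> K n'\<close> by (auto simp: N_def)
    define p where "p = nat \<lceil>t / t0\<rceil>"
    have "t / t0 \<le> real p" unfolding p_def by linarith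
    then have p: "t \<le> real p * t0" using t0(1) by (simp add: pos_divide_le_eq)
    define r where "r = real p * t0 + s - t"
    have r: "0 \<le> r" "r + t = real p * t0 + s" using p s by (auto simp: r_def)
    define x where "x = translate (m - int p * e) (\<phi> r v)"
    have xN: "x \<in> K N" unfolding x_def K_translate by (rule flow_K[OF vN r(1)])
    have "\<phi> t x = translate (m - int p * e) (\<phi> (r + t) v)"
      unfolding x_def using r w(2) flow_translate[OF flow_K[OF vN r(1)] w(2)] flow_add[OF vN r(1) w(2)] by simp
    also have "\<dots> = translate m (\<phi> s v)"
      unfolding r(2) using flow_period_multiple[OF v t0 s(1), of p] by (simp add: translate_add)
    also have "\<dots> = \<phi> t w" using tw s(2) by simp
    finally have "x = w" by (rule flow_inj[OF xN wN w(2)])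
    then show ?thesis unfolding x_def using r(1) by blast
  qed
qed

text \<open>Passing from \<open>u\<close> to \<open>\<phi> 1 u\<close> turns weak order into strict
  order, so that a contact at a single site already means equality. Contacts at site 0 and at the
  shifted sites are produced by the intermediate value theorem along the drifting orbit.\<close>

lemma ordered_orbit_periodic:
  assumes u: "u \<in> K n" and ord: "\<And>k m s. 0 \<le> s \<Longrightarrow> comparable k m s u"
    and esc: "\<forall>c. \<forall>\<^sub>F N in sequentially. c < \<bar>\<phi> (real N) u 0 - u 0\<bar>"
  shows "\<exists>t0 e. 0 < t0 \<and> \<phi> t0 (\<phi> 1 u) = translate e (\<phi> 1 u) \<and> (e = 1 \<or> e = -1) \<and>
    (\<forall>k. \<exists>m. \<exists>s\<ge>0. Tshift_power k (\<phi> 1 u) = translate m (\<phi> s (\<phi> 1 u))) \<and>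
    (\<forall>m s. 0 \<le> s \<longrightarrow> translate m (\<phi> s (\<phi> 1 u)) \<le> \<phi> 1 u \<or> \<phi> 1 u \<le> translate m (\<phi> s (\<phi> 1 u)))"
proof -
  define v where "v = \<phi> 1 u"
  have v: "v \<in> K n" unfolding v_def by (rule flow_K[OF u]) simp
  have mv: "moved k m s v = \<phi> 1 (moved k m s u)" if "0 \<le> s" for k m s
    unfolding v_def using moved_flow[OF u that, of 1] by simp
  have ordv: "moved k m s v \<le> v \<or> v \<le> moved k m s v" if "0 \<le> s" for k m s
    using ord[OF that, of k m] flow_mono[OF moved_K[OF u that] u _ zero_le_one] flow_mono[OF u moved_K[OF u that] _ zero_le_one]
    unfolding mv[OF that] comparable_def by (auto simp: v_def)
  \<comment> \<open>If the configurations were distinct, so would be their predecessors one time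
    unit earlier, which are comparable; strict monotonicity would then separate them at every
    site.\<close>
  have touch: "moved k m s v = v" if s: "0 \<le> s" and eq: "moved k m s v i = v i" for k m s i
  proof (rule ccontr)
    assume "moved k m s v \<noteq> v"
    then have ne: "moved k m s u \<noteq> u" using mv[OF s, of k m] by (auto simp: v_def)
    from ord[OF s, of k m] show False
      unfolding comparable_def
    proof
      assume "moved k m s u \<le> u"
      from flow_strict_mono[OF moved_K[OF u s] u this ne zero_less_one, of i] show False using eq mv[OF s, of k m] by (simp add: v_def)
    next
      assume "u \<le> moved k m s u"
      from flow_strict_mono[OF u moved_K[OF u s] this ne[symmetric] zero_less_one, of i] show False using eq mv[OF s, of k m] by (simp add: v_def)
    qed
  qed
  have cont: "continuous_on {0..b} (\<lambda>s. \<phi> s v 0)" for b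
    by (rule continuous_on_subset[OF flow_continuous_time[OF v]]) auto
  have ivt: "\<exists>s. 0 \<le> s \<and> s \<le> b \<and> \<phi> s v 0 = y"
    if "0 \<le> b" "v 0 \<le> y \<and> y \<le> \<phi> b v 0 \<or> \<phi> b v 0 \<le> y \<and> y \<le> v 0" for b y
    using that(2)
  proof
    assume "v 0 \<le> y \<and> y \<le> \<phi> b v 0"
    then show ?thesis using IVT'[OF _ _ that(1) cont, of y] flow_0[OF v] by auto
  next
    assume "\<phi> b v 0 \<le> y \<and> y \<le> v 0"
    then show ?thesis using IVT2'[OF _ _ that(1) cont, of y] flow_0[OF v] by auto
  qed
  have "\<forall>\<^sub>F N in sequentially. 1 + 2 * field_bound n < \<bar>\<phi> (real N) u 0 - u 0\<bar>" using esc by blast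
  \<comment> \<open>The displacements of \<open>u\<close> and of \<open>\<phi> 1 u\<close> over the
    same time differ by two displacements over unit time. The margin
    \<open>2 * field_bound n\<close> leaves more than 1 for \<open>v\<close>.\<close>
  then obtain N where N: "1 + 2 * field_bound n < \<bar>\<phi> (real N) u 0 - u 0\<bar>" by (auto simp: eventually_sequentially)
  have "displacement (real N) u + displacement 1 (\<phi> (real N) u) = displacement 1 u + displacement (real N) v"
    using displacement_add[OF u, of "real N" 1] displacement_add[OF u, of 1 "real N"] by (simp add: add.commute v_def)
  moreover have "\<bar>displacement 1 u\<bar> \<le> field_bound n" "\<bar>displacement 1 (\<phi> (real N) u)\<bar> \<le> field_bound n"
    using displacement_bound[OF u, of 1] displacement_bound[OF flow_K[OF u], of "real N" 1] by auto
  ultimately have big: "1 < \<bar>\<phi> (real N) v 0 - v 0\<bar>" using N unfolding displacement_def by linarith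
  define e :: int where "e = (if v 0 < \<phi> (real N) v 0 then 1 else -1)"
  have "\<exists>s. 0 \<le> s \<and> s \<le> real N \<and> \<phi> s v 0 = v 0 + real_of_int e"
    by (rule ivt) (use big in \<open>auto simp: e_def\<close>)
  then obtain t0 where t0: "0 \<le> t0" "\<phi> t0 v 0 = v 0 + real_of_int e" by blast
  have "t0 \<noteq> 0" using t0(2) flow_0[OF v] by (auto simp: e_def split: if_splits)
  then have t0': "0 < t0" using t0(1) by simp
  have "moved 0 (- e) t0 v 0 = v 0" using t0(2) by (simp add: moved_def translate_def)
  from touch[OF t0(1) this] have "translate (- e) (\<phi> t0 v) = v" by (simp add: moved_def)
  then have per: "\<phi> t0 v = translate e v" by (metis translate_add add.right_inverse translate_0)
  have shift: "\<exists>m. \<exists>s\<ge>0. Tshift_power k v = translate m (\<phi> s v)" for k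
  proof -
    \<comment> \<open>During the time \<open>t0\<close> the value at site 0 sweeps an interval of
      length 1 from \<open>lo\<close> upwards. Subtracting the integer \<open>m\<close> brings
      \<open>v (- k)\<close> into that interval, so it is attained.\<close>
    define lo where "lo = min (v 0) (v 0 + real_of_int e)"
    define m where "m = \<lfloor>v (- k) - lo\<rfloor>"
    define y where "y = v (- k) - real_of_int m"
    have y: "lo \<le> y" "y \<le> lo + 1" unfolding y_def m_def by linarith+
    have "\<exists>s. 0 \<le> s \<and> s \<le> t0 \<and> \<phi> s v 0 = y"
      by (rule ivt[OF t0(1)]) (use y t0(2) in \<open>auto simp: lo_def e_def min_def split: if_splits\<close>)
    then obtain s where s: "0 \<le> s" "\<phi> s v 0 = y" by blast
    have "moved (- k) m s v (- k) = v (- k)"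
      using s flow_shift[OF v s(1), of "- k"] by (simp add: moved_def translate_def Tshift_power_def y_def)
    from touch[OF s(1) this] have "Tshift_power (- k) (translate m (\<phi> s v)) = v"
      by (simp add: moved_def flow_shift[OF v s(1)] translate_shift)
    then have "Tshift_power k v = translate m (\<phi> s v)" by (metis Tshift_power_add add.right_inverse Tshift_power_0)
    then show ?thesis using s(1) by blast
  qed
  have cmp: "translate m (\<phi> s v) \<le> v \<or> v \<le> translate m (\<phi> s v)" if "0 \<le> s" for m s
    using ordv[OF that, of 0 m] by (simp add: moved_def)
  show ?thesis
    unfolding v_def[symmetric]
    using t0' per shift cmp by (intro exI[of _ t0] exI[of _ e]) (auto simp: e_def)
qed

text \<open>In the drifting case a single configuration with all the almost sure properties is
  chosen. The resulting orbit with its translates is closed, its complement is a countable union of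
  basic open sets, and each of these is null because the dense orbit never enters it.\<close>

theorem dichotomy:
  "(AE u in M. \<forall>j. f u j = 0) \<or>
   (\<exists>v\<in>K n. periodic V F v \<and> totally_ordered (Upsilon V F v) \<and>
      {translate m (\<phi> t v) | m t. 0 \<le> t} \<in> sets borel \<and>
      (AE u in M. u \<in> {translate m (\<phi> t v) | m t. 0 \<le> t}))"
proof (cases "(\<integral>u. f u 0 \<partial>M) = 0")
  case True
  then show ?thesis using no_drift_imp_equilibria by blast
next
  case False
  obtain \<B> :: "config set set" where \<B>: "countable \<B>" "\<And>S. S \<in> \<B> \<Longrightarrow> open S" "\<And>S. open S \<Longrightarrow> \<exists>U. U \<subseteq> \<B> \<and> S = \<Union>U"
    by (rule univ_second_countable[where 'a = config]) blast
  \<comment> \<open>The orbit is started at \<open>\<phi> 1 u\<close>; invariance of the measure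
    transfers the hitting property to it.\<close>
  have "AE u in M. (AE w in M. w \<notin> S) \<or> hits S (\<phi> 1 u)" if "S \<in> \<B>" for S
  proof (cases "AE w in M. w \<notin> S")
    case False
    then have "AE u in M. hits S u" using AE_hits[OF \<B>(2)[OF that]] by blast
    then have "AE u in M. hits S (\<phi> 1 u)" using AE_flow[OF inv_event_hits[OF \<B>(2)[OF that]], of 1] by simp
    then show ?thesis by eventually_elim simp
  qed simp
  then have dense: "AE u in M. \<forall>S\<in>\<B>. (AE w in M. w \<notin> S) \<or> hits S (\<phi> 1 u)"
    by (intro AE_ball_countable' \<B>(1))
  have "AE u in M. (\<forall>k m. \<forall>s\<ge>0. comparable k m s u) \<and> (\<forall>S\<in>\<B>. (AE w in M. w \<notin> S) \<or> hits S (\<phi> 1 u)) \<and>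
      (\<forall>c. \<forall>\<^sub>F N in sequentially. c < \<bar>\<phi> (real N) u 0 - u 0\<bar>) \<and> u \<in> K n"
    using AE_all_ordered[OF False] dense AE_escape[OF False] AE_space by eventually_elim simp
  then have "\<exists>u. (\<forall>k m. \<forall>s\<ge>0. comparable k m s u) \<and> (\<forall>S\<in>\<B>. (AE w in M. w \<notin> S) \<or> hits S (\<phi> 1 u)) \<and>
      (\<forall>c. \<forall>\<^sub>F N in sequentially. c < \<bar>\<phi> (real N) u 0 - u 0\<bar>) \<and> u \<in> K n"
    by (rule eventually_happens'[OF ae_filter_bot])
  then obtain u where ord: "\<And>k m s. 0 \<le> s \<Longrightarrow> comparable k m s u"
    and hit: "\<And>S. S \<in> \<B> \<Longrightarrow> (AE w in M. w \<notin> S) \<or> hits S (\<phi> 1 u)"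
    and esc: "\<forall>c. \<forall>\<^sub>F N in sequentially. c < \<bar>\<phi> (real N) u 0 - u 0\<bar>" and u: "u \<in> K n"
    by metis
  define v where "v = \<phi> 1 u"
  have v: "v \<in> K n" unfolding v_def by (rule flow_K[OF u]) simp
  obtain t0 e where t0: "0 < t0" "\<phi> t0 v = translate e v" "e = 1 \<or> e = -1"
    and shift: "\<And>k. \<exists>m. \<exists>s\<ge>0. Tshift_power k v = translate m (\<phi> s v)"
    and cmp: "\<And>m s. 0 \<le> s \<Longrightarrow> translate m (\<phi> s v) \<le> v \<or> v \<le> translate m (\<phi> s v)"
    using ordered_orbit_periodic[OF u ord esc] unfolding v_def by blast
  define Orb where "Orb = {translate m (\<phi> t v) | m t. 0 \<le> t}"
  have per: "\<phi> (real p * t0 + r) v = translate (int p * e) (\<phi> r v)" if "0 \<le> r" for p r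
    by (rule flow_period_multiple[OF v t0(1,2) that])
  have "periodic V F v"
    unfolding periodic_def using K_imp_X[OF v] t0 by blast
  moreover have "totally_ordered (Upsilon V F v)"
  proof -
    have "Upsilon V F v \<subseteq> Orb"
      unfolding Orb_def by (rule Upsilon_subset_orbit[OF v t0(1,2) shift])
    moreover have "w \<le> x \<or> x \<le> w" if "w \<in> Orb" "x \<in> Orb" for w x
      using that orbit_comparable[OF v cmp] unfolding Orb_def by blast
    ultimately show ?thesis unfolding totally_ordered_def by blast
  qed
  moreover have "Orb \<in> sets borel" "AE x in M. x \<in> Orb"
  proof -
    \<comment> \<open>Finitely many translates of the compact arc over one period. They exhaust
      \<open>Orb\<close>, which makes it a Borel set.\<close>
    define Z where "Z P = (\<Union>m\<in>{- int P..int P}. (\<lambda>t. translate m (\<phi> t v)) ` {0..t0})" for P :: nat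
    have Zc: "closed (Z P)" for P
    proof -
      have "compact ((\<lambda>t. translate m (\<phi> t v)) ` {0..t0})" for m
        unfolding translate_def
        by (intro compact_continuous_image continuous_on_coordinatewise_then_product continuous_intros
            continuous_on_subset[OF flow_continuous_time[OF v]] compact_Icc) auto
      then have "compact (Z P)" unfolding Z_def by (intro compact_UN) auto
      then show ?thesis by (rule compact_imp_closed)
    qed
    have red: "\<exists>m r. 0 \<le> r \<and> r \<le> t0 \<and> x = translate m (\<phi> r v)" if x: "x \<in> Orb" for x
    proof -
      obtain m t where mt: "x = translate m (\<phi> t v)" "0 \<le> t" using x unfolding Orb_def by blast
      define p where "p = nat \<lfloor>t / t0\<rfloor>"
      have "0 \<le> t / t0" using t0(1) mt(2) by simp
      then have p: "real p \<le> t / t0" "t / t0 < real p + 1" unfolding p_def by linarith+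
      define r where "r = t - real p * t0"
      have r: "0 \<le> r" "r \<le> t0" using p t0(1) by (auto simp: r_def field_simps)
      have "x = translate (m + int p * e) (\<phi> r v)"
        using per[OF r(1), of p] mt(1) by (simp add: r_def translate_add)
      then show ?thesis using r by blast
    qed
    have Orb_eq: "Orb = (\<Union>P. Z P)"
    proof
      show "Orb \<subseteq> (\<Union>P. Z P)"
      proof
        fix x assume "x \<in> Orb"
        then obtain m r where "0 \<le> r" "r \<le> t0" "x = translate m (\<phi> r v)" using red by blast
        then have "x \<in> Z (nat \<bar>m\<bar>)" unfolding Z_def by (intro UN_I[of m] image_eqI[of _ _ r]) auto
        then show "x \<in> (\<Union>P. Z P)" by blast
      qed
      show "(\<Union>P. Z P) \<subseteq> Orb" unfolding Z_def Orb_def by fastforce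
    qed
    show "Orb \<in> sets borel" unfolding Orb_eq by (intro sets.countable_UN) (auto intro: borel_closed Zc)
    have sep: "\<exists>S\<in>\<B>. x \<in> S \<and> S \<inter> Orb = {}" if x: "x \<notin> Orb" for x
    proof -
      \<comment> \<open>Large enough that every orbit point within distance 1 of \<open>x\<close> at
        site 0 lies in \<open>Z P\<close>: the arc itself moves by at most
        \<open>field_bound n * t0\<close>, which limits the translation \<open>m\<close>. Near
        \<open>x\<close> the orbit thus reduces to a closed set.\<close>
      define P where "P = nat \<lceil>\<bar>x 0\<bar> + 1 + \<bar>v 0\<bar> + field_bound n * t0\<rceil>"
      define U where "U = - Z P \<inter> {w. \<bar>w 0 - x 0\<bar> < 1}"
      have "continuous_on UNIV (\<lambda>w :: config. \<bar>w 0 - x 0\<bar>)"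
        by (intro continuous_intros continuous_coordinate)
      then have "open {w :: config. \<bar>w 0 - x 0\<bar> < 1}" by (rule open_Collect_less[OF _ continuous_on_const])
      then have "open U" unfolding U_def using Zc by (intro open_Int) (auto simp: open_Compl)
      moreover have "x \<in> U" using x unfolding U_def Orb_eq by auto
      moreover have "U \<inter> Orb = {}"
      proof (rule ccontr)
        assume "U \<inter> Orb \<noteq> {}"
        then obtain w where w: "w \<in> U" "w \<in> Orb" by blast
        obtain m r where r: "0 \<le> r" "r \<le> t0" "w = translate m (\<phi> r v)" using red[OF w(2)] by blast
        have "\<bar>\<phi> r v 0 - v 0\<bar> \<le> field_bound n * r" using displacement_bound[OF v r(1)] by (simp add: displacement_def)
        also have "\<dots> \<le> field_bound n * t0" using r field_bound_pos[of n] by simp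
        finally have "\<bar>\<phi> r v 0 - v 0\<bar> \<le> field_bound n * t0" .
        moreover have "\<bar>\<phi> r v 0 + real_of_int m - x 0\<bar> < 1" using w(1) r(3) by (simp add: U_def translate_def)
        ultimately have "\<bar>real_of_int m\<bar> \<le> \<bar>x 0\<bar> + 1 + \<bar>v 0\<bar> + field_bound n * t0" by linarith
        then have "\<bar>m\<bar> \<le> int P" unfolding P_def by linarith
        then have "w \<in> Z P" unfolding Z_def r(3) using r by (intro UN_I[of m] image_eqI[of _ _ r]) auto
        then show False using w(1) by (simp add: U_def)
      qed
      moreover from \<open>open U\<close> obtain \<U> where "\<U> \<subseteq> \<B>" "U = \<Union>\<U>" using \<B>(3) by metis
      ultimately show ?thesis by blast
    qed
    have off: "AE x in M. x \<notin> S" if S: "S \<in> \<B>" "S \<inter> Orb = {}" for S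
    proof -
      have "\<not> hits S v"
      proof
        assume "hits S v"
        then obtain k m t where t: "0 \<le> t" "moved k m t v \<in> S" by (auto simp: hits_def)
        obtain m' s where s: "0 \<le> s" "Tshift_power k v = translate m' (\<phi> s v)" using shift by blast
        have "moved k m t v = translate (m + m') (\<phi> (s + t) v)"
          using t s v by (simp add: moved_def flow_translate' flow_add' flow_K' translate_add)
        then have "moved k m t v \<in> Orb" unfolding Orb_def using t(1) s(1) by (intro CollectI exI[of _ "m + m'"] exI[of _ "s + t"]) auto
        then show False using t(2) S(2) by blast
      qed
      then show ?thesis using hit[OF S(1)] by (simp add: v_def)
    qed
    have "AE x in M. \<forall>S\<in>\<B>. S \<inter> Orb = {} \<longrightarrow> x \<notin> S"
      by (intro AE_ball_countable' \<B>(1) AE_impI off)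
    then show "AE x in M. x \<in> Orb"
      by (rule AE_mp) (use sep in \<open>auto intro!: AE_I2\<close>)
  qed
  ultimately show ?thesis using v unfolding Orb_def by blast
qed

end

section \<open>Representatives of classes\<close>

text \<open>Each class has a unique representative \<open>u\<close> with \<open>0 \<le> u 0 < 1\<close>; it depends measurably, though
  not continuously, on the class.\<close>

definition reduce :: "config \<Rightarrow> config" where
  "reduce u = translate (- \<lfloor>u 0\<rfloor>) u"

definition rep :: "config set \<Rightarrow> config" where
  "rep c = reduce (SOME u. u \<in> c)"

lemma reduce_translate: "reduce (translate m u) = reduce u"
  by (simp add: reduce_def translate_def fun_eq_iff)

lemma rep_cls:
  assumes "u \<in> X"
  shows "rep (cls u) = reduce u"
proof -
  have "u \<in> cls u" using cls_eq[OF assms] translate_0[of u] by (metis rangeI)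
  then have "(SOME w. w \<in> cls u) \<in> cls u" by (rule someI[of "\<lambda>w. w \<in> cls u"])
  then show ?thesis using cls_eq[OF assms] by (auto simp: rep_def reduce_translate)
qed

lemma cls_translate:
  assumes "u \<in> X"
  shows "cls (translate m u) = cls u"
proof -
  have "translate k u \<in> range (\<lambda>k. translate (k + m) u)" for k
    using rangeI[of "\<lambda>k. translate (k + m) u" "k - m"] by simp
  then show ?thesis using assms by (auto simp: cls_eq translate_in_X translate_add)
qed

lemma cls_rep:
  assumes "c \<in> QX"
  shows "rep c \<in> X" "cls (rep c) = c"
proof -
  obtain u where u: "u \<in> X" "c = cls u" using assms by (auto simp: QX_def cls_def quotient_def)
  then show "rep c \<in> X" "cls (rep c) = c"
    by (simp_all add: rep_cls reduce_def translate_in_X cls_translate)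
qed

lemma rep_zero: "0 \<le> rep c 0" "rep c 0 < 1"
  by (auto simp: rep_def reduce_def translate_def) linarith+

lemma sets_QX_borel: "sets QX_borel = sigma_sets QX {U. openin QX_topology U}"
  and space_QX_borel: "space QX_borel = QX"
proof -
  have "{U. openin QX_topology U} \<subseteq> Pow QX" by (auto simp: openin_QX_topology)
  then show "sets QX_borel = sigma_sets QX {U. openin QX_topology U}" "space QX_borel = QX"
    by (simp_all add: QX_borel_def sets_measure_of space_measure_of)
qed

text \<open>For a translation invariant \<open>W\<close> the choice of the representative is
  irrelevant, so the preimage of this set under \<open>cls\<close> is the relatively open set
  \<open>X \<inter> W\<close>.\<close>

lemma rep_open_invariant:
  assumes W: "open W" and inv: "\<And>u m. translate m u \<in> W \<longleftrightarrow> u \<in> W"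
  shows "{c \<in> QX. rep c \<in> W} \<in> sets QX_borel"
proof -
  have "{u \<in> X. cls u \<in> {c \<in> QX. rep c \<in> W}} = X \<inter> W"
    using inv by (auto simp: cls_in_QX rep_cls reduce_def)
  then have "openin QX_topology {c \<in> QX. rep c \<in> W}"
    using W by (auto simp: openin_QX_topology openin_open)
  then show ?thesis unfolding sets_QX_borel by (intro sigma_sets.Basic) simp
qed

text \<open>Differences \<open>u j - u 0\<close> are continuous and translation invariant, hence
  descend to the quotient. The remaining coordinate is the fractional part of \<open>u 0\<close>; it
  jumps downwards at integers, so for \<open>a \<ge> 0\<close> the set where it exceeds
  \<open>a\<close> is open, being a union of the intervals from \<open>a + m\<close> to
  \<open>m + 1\<close>.\<close>

lemma rep_measurable: "rep \<in> borel_measurable QX_borel"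
proof (rule measurable_coordinatewise_then_product)
  fix j
  have diff: "(\<lambda>c. rep c j - rep c 0) \<in> borel_measurable QX_borel"
    unfolding borel_measurable_iff_greater space_QX_borel
  proof
    fix a :: real
    have "open {u :: config. a < u j - u 0}"
      by (intro open_Collect_less continuous_on_const continuous_on_diff continuous_coordinate)
    from rep_open_invariant[OF this] show "{c \<in> QX. a < rep c j - rep c 0} \<in> sets QX_borel"
      by (simp add: translate_def)
  qed
  have zero: "(\<lambda>c. rep c 0) \<in> borel_measurable QX_borel"
    unfolding borel_measurable_iff_greater space_QX_borel
  proof
    fix a :: real
    show "{c \<in> QX. a < rep c 0} \<in> sets QX_borel"
    proof (cases "a < 0")
      case True
      then have "{c \<in> QX. a < rep c 0} = QX" using rep_zero by (auto intro: less_le_trans)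
      then show ?thesis using sets.top[of QX_borel] by (simp add: space_QX_borel)
    next
      case False
      define W where "W = {u :: config. \<exists>m :: int. a + of_int m < u 0 \<and> u 0 < of_int m + 1}"
      have "W = (\<Union>m :: int. {u. a + of_int m < u 0} \<inter> {u. u 0 < of_int m + 1})" by (auto simp: W_def)
      then have "open W"
        by (auto intro!: open_Int open_Collect_less continuous_on_const continuous_coordinate)
      moreover have "translate m u \<in> W \<longleftrightarrow> u \<in> W" for m u
      proof
        assume "translate m u \<in> W"
        then obtain l :: int where "a + of_int l < u 0 + of_int m" "u 0 + of_int m < of_int l + 1"
          by (auto simp: W_def translate_def)
        then show "u \<in> W" unfolding W_def by (intro CollectI exI[of _ "l - m"]) auto
      next
        assume "u \<in> W"
        then obtain l :: int where "a + of_int l < u 0" "u 0 < of_int l + 1" by (auto simp: W_def)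
        then show "translate m u \<in> W" unfolding W_def by (intro CollectI exI[of _ "l + m"]) (auto simp: translate_def)
      qed
      moreover have "rep c \<in> W \<longleftrightarrow> a < rep c 0" for c
      proof
        assume "rep c \<in> W"
        then obtain l :: int where l: "a + of_int l < rep c 0" "rep c 0 < of_int l + 1" by (auto simp: W_def)
        then have "(-1 :: real) < of_int l" using rep_zero[of c] by linarith
        moreover have "real_of_int l < 1" using l False rep_zero[of c] by linarith
        ultimately have "l = 0" by linarith
        then show "a < rep c 0" using l by simp
      qed (use rep_zero[of c] in \<open>auto simp: W_def intro!: exI[of _ 0]\<close>)
      ultimately show ?thesis using rep_open_invariant[of W] by simp
    qed
  qed
  show "(\<lambda>c. rep c j) \<in> borel_measurable QX_borel"
    using borel_measurable_add[OF diff zero] by simp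
qed

section \<open>The law of the representatives\<close>

lemma closed_K: "closed (K n)"
proof -
  have "K n = (\<Inter>i. {u. \<bar>u (i + 1) - u i\<bar> \<le> real n})" by (auto simp: K_def)
  then show ?thesis
    by (auto intro!: closed_INT closed_Collect_le continuous_on_rabs continuous_on_diff continuous_coordinate continuous_on_const)
qed

lemma X_eq: "X = (\<Union>n. K n)"
  using K_imp_X by (auto simp: X_def)

context
  fixes \<mu> M :: "_ measure" and n :: nat
  assumes prob_\<mu>: "prob_space \<mu>" and sets_\<mu>: "sets \<mu> = sets QX_borel"
    and full: "measure \<mu> {c \<in> QX. rep c \<in> K n} = 1"
  defines "M \<equiv> restrict_space (distr \<mu> borel rep) (K n)"
begin

lemma space_\<mu>: "space \<mu> = QX"
  using sets_eq_imp_space_eq[OF sets_\<mu>] space_QX_borel by simp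

lemma rep_measurable_\<mu>: "rep \<in> borel_measurable \<mu>"
  using rep_measurable measurable_cong_sets[OF sets_\<mu> refl] by blast

lemma sets_restricted: "sets M = sets (restrict_space borel (K n))"
  unfolding M_def by (rule sets_restrict_space_cong) simp

lemma K_borel: "K n \<inter> space (distr \<mu> borel rep) \<in> sets (distr \<mu> borel rep)"
  unfolding sets_distr space_distr space_borel Int_UNIV_right by (rule borel_closed[OF closed_K])

lemma measure_restricted:
  assumes "S \<in> sets borel" "S \<subseteq> K n"
  shows "measure M S = measure \<mu> {c \<in> QX. rep c \<in> S}"
proof -
  have "measure M S = measure \<mu> (rep -` S \<inter> space \<mu>)"
    unfolding M_def using assms K_borel rep_measurable_\<mu> by (simp add: measure_restrict_space measure_distr)
  moreover have "rep -` S \<inter> space \<mu> = {c \<in> QX. rep c \<in> S}" by (auto simp: space_\<mu>)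
  ultimately show ?thesis by simp
qed

lemma prob_restricted: "prob_space M"
proof -
  have "measure M (K n) = 1"
    using measure_restricted[OF _ order_refl] closed_K full by (auto intro: borel_closed)
  moreover have "space M = K n" by (simp add: M_def space_restrict_space)
  moreover have "finite_measure M"
    unfolding M_def using borel_closed[OF closed_K]
    by (intro finite_measure_restrict_space prob_space.finite_measure[OF prob_space.prob_space_distr[OF prob_\<mu> rep_measurable_\<mu>]]) simp
  ultimately show ?thesis by (intro prob_spaceI) (simp add: finite_measure.emeasure_eq_measure)
qed

lemma AE_rep_K: "AE c in \<mu>. rep c \<in> K n"
proof -
  have "{c \<in> QX. rep c \<in> K n} = {c \<in> space \<mu>. rep c \<in> K n}" by (simp add: space_\<mu>)
  moreover have "{c \<in> space \<mu>. rep c \<in> K n} \<in> sets \<mu>"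
    using measurable_sets[OF rep_measurable_\<mu> borel_closed[OF closed_K[of n]]]
    by (simp add: vimage_def Int_def conj_commute)
  ultimately show ?thesis using prob_space.prob_Collect_eq_1[OF prob_\<mu>] full by simp
qed

lemma restricted_measurable:
  fixes h :: "config \<Rightarrow> real"
  assumes "h \<in> borel_measurable M"
  shows "(\<lambda>u. indicator (K n) u * h u) \<in> borel_measurable borel"
  using assms borel_measurable_restrict_space_iff[OF K_borel, of h] by (simp add: M_def)

lemma integral_restricted:
  fixes h :: "config \<Rightarrow> real"
  assumes "h \<in> borel_measurable M"
  shows "(\<integral>u. h u \<partial>M) = (\<integral>c. indicator (K n) (rep c) * h (rep c) \<partial>\<mu>)"
  using integral_distr[OF rep_measurable_\<mu> restricted_measurable[OF assms]]
    integral_restrict_space[OF K_borel, of h] by (simp add: M_def)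

text \<open>The representative of the image class and the image of the representative differ by an
  integer translation, which \<open>h\<close> does not see.\<close>

lemma integral_restricted_preserved:
  fixes h :: "config \<Rightarrow> real"
  assumes pres: "preserves \<mu> ((`) g)" and g: "continuous_on (K n) g" "\<And>u. u \<in> K n \<Longrightarrow> g u \<in> K n"
    and rep: "\<And>c. c \<in> QX \<Longrightarrow> rep (g ` c) = reduce (g (rep c))"
    and h: "h \<in> borel_measurable M" "\<And>u m. u \<in> K n \<Longrightarrow> h (translate m u) = h u"
  shows "(\<integral>u. h (g u) \<partial>M) = (\<integral>u. h u \<partial>M)"
proof -
  define G where "G c = indicator (K n) (rep c) * h (rep c)" for c
  have G: "G \<in> borel_measurable \<mu>"
    unfolding G_def using measurable_compose[OF rep_measurable_\<mu> restricted_measurable[OF h(1)]] .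
  have gM: "g \<in> measurable M M"
  proof -
    have "g \<in> measurable (restrict_space borel (K n)) (restrict_space borel (K n))"
      using g by (intro measurable_restrict_space2 borel_measurable_continuous_on_restrict) (auto simp: space_restrict_space)
    then show ?thesis using measurable_cong_sets[OF sets_restricted sets_restricted] by blast
  qed
  have hg: "(\<lambda>u. h (g u)) \<in> borel_measurable M" by (rule measurable_compose[OF gM h(1)])
  have p: "(`) g \<in> measurable \<mu> \<mu>" "distr \<mu> \<mu> ((`) g) = \<mu>" using pres by (auto simp: preserves_def)
  have "(\<integral>u. h (g u) \<partial>M) = (\<integral>c. indicator (K n) (rep c) * h (g (rep c)) \<partial>\<mu>)"
    by (rule integral_restricted[OF hg])
  also have "\<dots> = (\<integral>c. G (g ` c) \<partial>\<mu>)"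
  proof (rule integral_cong_AE)
    show "(\<lambda>c. indicator (K n) (rep c) * h (g (rep c))) \<in> borel_measurable \<mu>"
      using measurable_compose[OF rep_measurable_\<mu> restricted_measurable[OF hg]] .
    show "(\<lambda>c. G (g ` c)) \<in> borel_measurable \<mu>" by (rule measurable_compose[OF p(1) G])
    show "AE c in \<mu>. indicator (K n) (rep c) * h (g (rep c)) = G (g ` c)"
      using AE_rep_K AE_space
    proof eventually_elim
      case (elim c)
      then have "rep (g ` c) = translate (- \<lfloor>g (rep c) 0\<rfloor>) (g (rep c))"
        using rep[of c] by (simp add: space_\<mu> reduce_def)
      then show ?case using elim(1) g(2)[OF elim(1)] h(2) by (simp add: G_def K_translate)
    qed
  qed
  also have "\<dots> = (\<integral>c. G c \<partial>\<mu>)" using integral_distr[OF p(1) G] p(2) by simp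
  also have "\<dots> = (\<integral>u. h u \<partial>M)" unfolding G_def by (rule integral_restricted[OF h(1), symmetric])
  finally show ?thesis .
qed

lemma AE_restricted_imp_supported:
  assumes S: "S \<in> sets borel" and AE: "AE u in M. u \<in> S"
  shows "supported_on \<mu> {c \<in> QX. rep c \<in> S}"
proof -
  have sub: "{c \<in> QX. rep c \<in> B} \<in> sets \<mu>" if "B \<in> sets borel" for B
    using measurable_sets[OF rep_measurable_\<mu> that] by (simp add: vimage_def Int_def conj_commute space_\<mu>)
  interpret M: prob_space M by (rule prob_restricted)
  interpret \<mu>: prob_space \<mu> by (rule prob_\<mu>)
  have SK: "S \<inter> K n \<in> sets borel" using S borel_closed[OF closed_K] by (rule sets.Int)
  have "S \<inter> K n \<in> sets M"
    unfolding sets_restricted using SK by (subst sets_restrict_space_iff) (auto intro: borel_closed closed_K)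
  moreover have "AE u in M. u \<in> S \<inter> K n"
    using AE AE_space by eventually_elim (simp add: M_def space_restrict_space)
  ultimately have "measure M (S \<inter> K n) = 1" by (intro M.prob_eq_1[THEN iffD2])
  then have "measure \<mu> {c \<in> QX. rep c \<in> S \<inter> K n} = 1" using measure_restricted[OF SK] by simp
  moreover have "measure \<mu> {c \<in> QX. rep c \<in> S \<inter> K n} \<le> measure \<mu> {c \<in> QX. rep c \<in> S}"
    by (intro \<mu>.finite_measure_mono sub S) auto
  ultimately show ?thesis using sub[OF S] \<mu>.prob_le_1[of "{c \<in> QX. rep c \<in> S}"] by (simp add: supported_on_def)
qed

end

section \<open>From ergodic measures on classes to laws on configurations\<close>

context fk_chain
begin

lemma shift_rep:
  assumes "c \<in> QX"
  shows "Tshift ` c = cls (Tshift (rep c))" "Tshift (rep c) \<in> X"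
proof -
  show "Tshift ` c = cls (Tshift (rep c))"
    using shift_cls[OF cls_rep(1)[OF assms], of 1] cls_rep(2)[OF assms] by (simp add: Tshift_eq_power)
  show "Tshift (rep c) \<in> X"
    using cls_rep(1)[OF assms] K_shift by (auto simp: X_eq Tshift_eq_power)
qed

lemma flow_rep:
  assumes "c \<in> QX" "0 \<le> t"
  shows "\<phi> t ` c = cls (\<phi> t (rep c))" "\<phi> t (rep c) \<in> X"
proof -
  obtain k where k: "rep c \<in> K k" using cls_rep(1)[OF assms(1)] by (auto simp: X_eq)
  show "\<phi> t ` c = cls (\<phi> t (rep c))" using flow_cls[OF k assms(2)] cls_rep(2)[OF assms(1)] by simp
  show "\<phi> t (rep c) \<in> X" by (rule K_imp_X[OF flow_K[OF k assms(2)]])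
qed

lemma invariant_set_rep:
  assumes tr: "\<And>u m. u \<in> X \<Longrightarrow> P (translate m u) = P u"
    and sh: "\<And>u. u \<in> X \<Longrightarrow> P (Tshift u) = P u"
    and fl: "\<And>u t. u \<in> X \<Longrightarrow> 0 \<le> t \<Longrightarrow> P u \<Longrightarrow> P (\<phi> t u)"
  shows "invariant_set V F {c \<in> QX. P (rep c)}"
proof -
  have P_cls: "P (rep (cls u)) = P u" if "u \<in> X" for u
    using tr[OF that] by (simp add: rep_cls[OF that] reduce_def)
  have "(`) Tshift ` {c \<in> QX. P (rep c)} = {c \<in> QX. P (rep c)}"
  proof
    show "(`) Tshift ` {c \<in> QX. P (rep c)} \<subseteq> {c \<in> QX. P (rep c)}"
      using shift_rep cls_rep sh P_cls by (auto simp: cls_in_QX)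
    show "{c \<in> QX. P (rep c)} \<subseteq> (`) Tshift ` {c \<in> QX. P (rep c)}"
    proof
      fix c assume c: "c \<in> {c \<in> QX. P (rep c)}"
      \<comment> \<open>Invariance under the shift is an equality of sets, so a preimage of each
        class is exhibited, given by the inverse shift.\<close>
      define w where "w = Tshift_power (- 1) (rep c)"
      have w: "w \<in> X" using c cls_rep(1)[of c] K_shift by (auto simp: X_eq w_def)
      have Tw: "Tshift w = rep c" by (simp add: w_def Tshift_eq_power Tshift_power_def)
      have "Tshift ` cls w = c" using shift_cls[OF w, of 1] Tw cls_rep(2)[of c] c by (simp add: Tshift_eq_power)
      moreover have "P (rep (cls w))" using P_cls[OF w] sh[OF w] Tw c by simp
      ultimately show "c \<in> (`) Tshift ` {c \<in> QX. P (rep c)}" using cls_in_QX[OF w] by blast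
    qed
  qed
  moreover have "(`) (\<phi> t) ` {c \<in> QX. P (rep c)} \<subseteq> {c \<in> QX. P (rep c)}" if t: "0 \<le> t" for t
    using flow_rep[OF _ t] cls_rep fl[OF _ t] P_cls by (auto simp: cls_in_QX)
  ultimately show ?thesis by (simp add: invariant_set_def)
qed

text \<open>Each set of classes with spacing at most \<open>n\<close> is invariant, so it has
  probability 0 or 1. These countably many sets exhaust the quotient and cannot all be null.\<close>

lemma ergodic_bounded_spacing:
  assumes E: "ergodic_measure V F \<mu>"
  shows "\<exists>n. measure \<mu> {c \<in> QX. rep c \<in> K n} = 1"
proof (rule ccontr)
  assume neg: "\<not> ?thesis"
  have pr: "prob_space \<mu>" and s: "sets \<mu> = sets QX_borel"
    using E by (auto simp: ergodic_measure_def invariant_measure_def)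
  interpret prob_space \<mu> by (rule pr)
  have sp: "space \<mu> = QX" using sets_eq_imp_space_eq[OF s] space_QX_borel by simp
  have rm: "rep \<in> borel_measurable \<mu>" using rep_measurable measurable_cong_sets[OF s refl] by blast
  have m: "{c \<in> QX. rep c \<in> K n} \<in> sets \<mu>" for n
    using measurable_sets[OF rm borel_closed[OF closed_K[of n]]] by (simp add: vimage_def Int_def conj_commute sp)
  have "invariant_set V F {c \<in> QX. rep c \<in> K n}" for n
    by (rule invariant_set_rep) (auto simp: K_translate K_Tshift_iff intro: flow_K)
  then have "measure \<mu> {c \<in> QX. rep c \<in> K n} = 0" for n
    using E m[of n] neg unfolding ergodic_measure_def by blast
  then have "AE c in \<mu>. c \<notin> {c \<in> QX. rep c \<in> K n}" for n
    using m[of n] prob_eq_0 by blast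
  then have "AE c in \<mu>. \<forall>n. c \<notin> {c \<in> QX. rep c \<in> K n}" by (simp only: AE_all_countable) blast
  then have "AE c in \<mu>. False"
    using AE_space by eventually_elim (use cls_rep(1) in \<open>auto simp: sp X_eq\<close>)
  then show False by simp
qed

theorem ergodic_restricted:
  assumes E: "ergodic_measure V F \<mu>" and full: "measure \<mu> {c \<in> QX. rep c \<in> K n} = 1"
  shows "fk_ergodic V F \<delta> (restrict_space (distr \<mu> borel rep) (K n)) n"
proof -
  let ?M = "restrict_space (distr \<mu> borel rep) (K n)"
  have pr: "prob_space \<mu>" and s: "sets \<mu> = sets QX_borel"
    and pT: "preserves \<mu> ((`) Tshift)" and pF: "\<And>t. 0 \<le> t \<Longrightarrow> preserves \<mu> ((`) (\<phi> t))"
    using E by (auto simp: ergodic_measure_def invariant_measure_def)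
  have sp: "space \<mu> = QX" using sets_eq_imp_space_eq[OF s] space_QX_borel by simp
  have rm: "rep \<in> borel_measurable \<mu>" using rep_measurable measurable_cong_sets[OF s refl] by blast
  note rs = measure_restricted[OF pr s full] sets_restricted[OF pr s full]
    integral_restricted_preserved[OF pr s full]
  interpret prob_space ?M by (rule prob_restricted[OF pr s full])
  show ?thesis
  proof unfold_locales
    show "sets ?M = sets (restrict_space borel (K n))" by (rule rs)
  next
    fix h :: "config \<Rightarrow> real"
    assume h: "h \<in> borel_measurable ?M" "\<And>u m. u \<in> K n \<Longrightarrow> h (translate m u) = h u"
    show "(\<integral>u. h (Tshift u) \<partial>?M) = (\<integral>u. h u \<partial>?M)"
    proof (rule rs(3)[OF pT _ _ _ h])
      show "continuous_on (K n) Tshift"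
        unfolding Tshift_def by (intro continuous_on_coordinatewise_then_product continuous_coordinate)
      show "Tshift u \<in> K n" if "u \<in> K n" for u using K_shift[OF that] by (simp add: Tshift_eq_power)
      show "rep (Tshift ` c) = reduce (Tshift (rep c))" if "c \<in> QX" for c
        using shift_rep[OF that] by (simp add: rep_cls)
    qed
  next
    fix h :: "config \<Rightarrow> real" and t :: real
    assume t: "0 \<le> t" and h: "h \<in> borel_measurable ?M" "\<And>u m. u \<in> K n \<Longrightarrow> h (translate m u) = h u"
    show "(\<integral>u. h (\<phi> t u) \<partial>?M) = (\<integral>u. h u \<partial>?M)"
    proof (rule rs(3)[OF pF[OF t] _ _ _ h])
      show "continuous_on (K n) (\<phi> t)"
        by (intro continuous_on_coordinatewise_then_product flow_continuous t)
      show "\<phi> t u \<in> K n" if "u \<in> K n" for u by (rule flow_K[OF that t])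
      show "rep (\<phi> t ` c) = reduce (\<phi> t (rep c))" if "c \<in> QX" for c
        using flow_rep[OF that t] by (simp add: rep_cls)
    qed
  next
    fix Q
    assume Q: "{u \<in> K n. Q u} \<in> sets ?M" and tr: "\<And>u m. u \<in> K n \<Longrightarrow> Q (translate m u) = Q u"
      and sh: "\<And>u. u \<in> K n \<Longrightarrow> Q (Tshift u) = Q u"
      and fl: "\<And>u t. u \<in> K n \<Longrightarrow> 0 \<le> t \<Longrightarrow> Q u \<Longrightarrow> Q (\<phi> t u)"
    let ?S = "{u \<in> K n. Q u}"
    have S: "?S \<in> sets borel"
      using Q unfolding rs(2) by (subst (asm) sets_restrict_space_iff) (auto intro: borel_closed closed_K)
    have "{c \<in> QX. rep c \<in> ?S} \<in> sets \<mu>"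
      using measurable_sets[OF rm S] by (simp add: vimage_def Int_def conj_commute sp)
    moreover have "invariant_set V F {c \<in> QX. rep c \<in> ?S}"
      by (rule invariant_set_rep) (use tr sh fl in \<open>auto simp: K_translate K_Tshift_iff intro: flow_K\<close>)
    moreover have "prob ?S = measure \<mu> {c \<in> QX. rep c \<in> ?S}" by (rule rs(1)[OF S]) auto
    ultimately show "prob ?S = 0 \<or> prob ?S = 1" using E by (simp add: ergodic_measure_def)
  qed
qed

text \<open>Being an equilibrium depends only on the class, so the set can be described through
  representatives. In this form, as a preimage of a Borel set under \<open>rep\<close>, the support
  statement for configurations carries over to the quotient.\<close>

lemma cls_equilibria: "cls ` equilibria V F = {c \<in> QX. rep c \<in> X \<inter> {u. \<forall>j. f u j = 0}}"
proof -
  have "rep (cls u) \<in> {u. \<forall>j. f u j = 0} \<longleftrightarrow> (\<forall>j. f u j = 0)" if "u \<in> X" for u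
    by (simp add: rep_cls[OF that] reduce_def f_translate)
  then have iff: "(\<forall>j. f (rep (cls u)) j = 0) \<longleftrightarrow> (\<forall>j. f u j = 0)" if "u \<in> X" for u
    using that by simp
  show ?thesis
  proof (intro subset_antisym subsetI)
    fix c assume "c \<in> cls ` equilibria V F"
    then obtain u where u: "u \<in> X" "\<forall>j. f u j = 0" "c = cls u" by (auto simp: equilibria_def)
    then have "c \<in> QX" "\<forall>j. f (rep c) j = 0" using iff[OF u(1)] cls_in_QX[OF u(1)] by simp_all
    then show "c \<in> {c \<in> QX. rep c \<in> X \<inter> {u. \<forall>j. f u j = 0}}" using cls_rep(1) by simp
  next
    fix c assume "c \<in> {c \<in> QX. rep c \<in> X \<inter> {u. \<forall>j. f u j = 0}}"
    then have c: "c \<in> QX" "rep c \<in> equilibria V F" by (simp_all add: equilibria_def)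
    show "c \<in> cls ` equilibria V F" using imageI[OF c(2), of cls] cls_rep(2)[OF c(1)] by simp
  qed
qed

lemma orbit_eq:
  assumes "v \<in> K n"
  shows "orbit V F v = {c \<in> QX. rep c \<in> {translate m (\<phi> t v) | m t. 0 \<le> t}}"
proof -
  have X: "\<phi> t v \<in> X" if "0 \<le> t" for t by (rule K_imp_X[OF flow_K[OF assms that]])
  show ?thesis
  proof (intro subset_antisym subsetI)
    fix c assume "c \<in> orbit V F v"
    then obtain t where "0 \<le> t" "c = cls (\<phi> t v)" by (auto simp: orbit_def)
    then show "c \<in> {c \<in> QX. rep c \<in> {translate m (\<phi> t v) | m t. 0 \<le> t}}"
      using X[of t] by (auto simp: cls_in_QX rep_cls reduce_def)
  next
    fix c assume "c \<in> {c \<in> QX. rep c \<in> {translate m (\<phi> t v) | m t. 0 \<le> t}}"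
    then obtain m t where c: "c \<in> QX" "rep c = translate m (\<phi> t v)" "0 \<le> t" by auto
    then have "c = cls (\<phi> t v)" using cls_rep(2)[OF c(1)] cls_translate[OF X[OF c(3)], of m] by simp
    then show "c \<in> orbit V F v" using c(3) by (auto simp: orbit_def)
  qed
qed

end

theorem theorem4:
  fixes V :: "real \<Rightarrow> real \<Rightarrow> real" and F \<delta> :: real and \<mu> :: "config set measure"
  assumes C2: "C2_plane V"
    and periodic_V: "\<And>u v. V (u + 1) (v + 1) = V u v"
    and delta_pos: "\<delta> > 0"
    and twist: "\<And>u v. D2 (D1 V) u v \<le> - \<delta>"
    and ergodic: "ergodic_measure V F \<mu>"
  shows "supported_on \<mu> (cls ` equilibria V F) \<or>
    (\<exists>u. periodic V F u \<and> totally_ordered (Upsilon V F u) \<and> supported_on \<mu> (orbit V F u))"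
proof -
  interpret fk_chain V F \<delta> by unfold_locales (fact C2 periodic_V delta_pos twist)+
  obtain n where full: "measure \<mu> {c \<in> QX. rep c \<in> K n} = 1"
    using ergodic_bounded_spacing[OF ergodic] by blast
  have pr: "prob_space \<mu>" and s: "sets \<mu> = sets QX_borel"
    using ergodic by (auto simp: ergodic_measure_def invariant_measure_def)
  note supp = AE_restricted_imp_supported[OF pr s full]
  interpret E: fk_ergodic V F \<delta> "restrict_space (distr \<mu> borel rep) (K n)" n
    by (rule ergodic_restricted[OF ergodic full])
  from E.dichotomy show ?thesis
  proof
    assume A: "AE u in restrict_space (distr \<mu> borel rep) (K n). \<forall>j. vfield V F u j = 0"
    have "closed {u. vfield V F u j = 0}" for j
      by (intro closed_Collect_eq continuous_on_const f_continuous_on continuous_coordinate)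
    then have "{u. \<forall>j. vfield V F u j = 0} \<in> sets borel"
      by (intro borel_closed closed_Collect_all)
    moreover have "X \<in> sets borel"
      unfolding X_eq by (intro sets.countable_UN) (auto intro: borel_closed closed_K)
    ultimately have "X \<inter> {u. \<forall>j. vfield V F u j = 0} \<in> sets borel" by (rule sets.Int[rotated])
    moreover have "AE u in restrict_space (distr \<mu> borel rep) (K n). u \<in> X \<inter> {u. \<forall>j. vfield V F u j = 0}"
      using A AE_space by eventually_elim (auto intro: K_imp_X)
    ultimately show ?thesis unfolding cls_equilibria by (intro disjI1 supp)
  next
    assume "\<exists>v\<in>K n. periodic V F v \<and> totally_ordered (Upsilon V F v) \<and>
      {translate m (flow V F t v) | m t. 0 \<le> t} \<in> sets borel \<and>
      (AE u in restrict_space (distr \<mu> borel rep) (K n). u \<in> {translate m (flow V F t v) | m t. 0 \<le> t})"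
    then obtain v where v: "v \<in> K n" "periodic V F v" "totally_ordered (Upsilon V F v)"
      "{translate m (flow V F t v) | m t. 0 \<le> t} \<in> sets borel"
      "AE u in restrict_space (distr \<mu> borel rep) (K n). u \<in> {translate m (flow V F t v) | m t. 0 \<le> t}"
      by blast
    have "supported_on \<mu> (orbit V F v)" unfolding orbit_eq[OF v(1)] by (rule supp[OF v(4,5)])
    then show ?thesis using v(2,3) by blast
  qed
qed

end
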